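(* Let $0 < \epsilon < 1$, let $\varrho$ be either the uniform or the Chebyshev measure on $\mathcal{U} = [-1,1]^{\mathbb{N}}$, let $\boldsymbol{b} \in [0,\infty)^{\mathbb{N}}$ with $\boldsymbol{b} \in \ell^p(\mathbb{N})$ for some $0 < p < 1$, let $\varepsilon > 0$, $m \geq 3$, and let $\boldsymbol{y}_1,\ldots,\boldsymbol{y}_m$ be drawn independently and identically from $\varrho$. Then there exists a set $S \subset \mathcal{F}$ (depending on $\boldsymbol{b}$ and $\varepsilon$ only) of cardinality $|S| \leq \lceil m / \log(m/\epsilon) \rceil$ such that the following holds with probability at least $1-\epsilon$ for each fixed $f \in \mathcal{H}(\boldsymbol{b},\varepsilon)$. For any $\boldsymbol{e} = (e_i)_{i=1}^m \in \mathbb{C}^m$, the least-squares approximation $$\hat{f} = \operatorname*{argmin}_{q \in \mathcal{P}_S} \frac1m \sum_{i=1}^m | f(\boldsymbol{y}_i) + e_i - q(\boldsymbol{y}_i) |^2$$ is unique and satisfies $$\| f - \hat{f} \|_{L^2_\varrho(\mathcal{U})} \leq C(\boldsymbol{b},\varepsilon,p) \cdot \left( \frac{m}{\log(m/\epsilon)} \right)^{\frac12-\frac1p} + 2 \cdot \|\boldsymbol{e}\|_\infty ,$$ where the constant $C(\boldsymbol{b},\varepsilon,p)$ depends on $\boldsymbol{b}$, $\varepsilon$ and $p$ only. Moreover, the condition number of the least-squares matrix $\boldsymbol{A}$ satisfies $\mathrm{cond}(\boldsymbol{A}) \leq 2$.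
   Context: Notation: $\mathbb{N} = \{1,2,\ldots\}$, $\mathbb{N}_0 = \mathbb{N}\cup\{0\}$; $\log$ is the natural logarithm. The symbols $\epsilon$ (failure probability) and $\varepsilon$ (holomorphy parameter) are different. Measure and basis. The univariate uniform and Chebyshev (arcsine) measures on $[-1,1]$ are $\mathrm{d}\varrho(y) = 2^{-1}\,\mathrm{d}y$ and $\mathrm{d}\varrho(y) = (\pi\sqrt{1-y^2})^{-1}\,\mathrm{d}y$. Let $\{\psi_\nu\}_{\nu\in\mathbb{N}_0}$ be the corresponding orthonormal polynomials in $L^2_\varrho([-1,1])$ with $\deg\psi_\nu=\nu$ (orthonormal Legendre, respectively first-kind Chebyshev, polynomials). By abuse of notation $\varrho=\varrho\times\varrho\times\cdots$ also denotes the infinite tensor-product probability measure on $\mathcal{U}=[-1,1]^{\mathbb{N}}$. Let $\mathcal{F} = \{ \boldsymbol{\nu} = (\nu_i)_{i=1}^\infty \in \mathbb{N}_0^{\mathbb{N}} : |\{i : \nu_i\neq 0\}| < \infty\}$ and, for $\boldsymbol{\nu}\in\mathcal{F}$, $\Psi_{\boldsymbol{\nu}}(\boldsymbol{y}) = \prod_{i : \nu_i \neq 0} \psi_{\nu_i}(y_i)$; these form an orthonormal basis of $L^2_\varrho(\mathcal{U})$, the space of square-integrable functions $\mathcal{U}\to\mathbb{C}$. For $S\subset\mathcal{F}$ finite, $\mathcal{P}_S = \mathrm{span}\{\Psi_{\boldsymbol{\nu}} : \boldsymbol{\nu}\in S\}$. Least-squares matrix. If $\boldsymbol{\nu}_1,\ldots,\boldsymbol{\nu}_{n}$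 is an enumeration of $S$, $n=|S|$, then $\boldsymbol{A} = \left( \Psi_{\boldsymbol{\nu}_j}(\boldsymbol{y}_i)/\sqrt{m}\right)_{i,j=1}^{m,n}\in\mathbb{C}^{m\times n}$, and $\mathrm{cond}(\boldsymbol{A}) = \sigma_{\max}(\boldsymbol{A})/\sigma_{\min}(\boldsymbol{A})$ is its 2-norm condition number. Holomorphic functions. For $\rho>1$ the Bernstein ellipse is $\mathcal{E}_\rho = \{ (z+z^{-1})/2 : z\in\mathbb{C},\ 1\leq |z|\leq\rho\}\subset\mathbb{C}$, and $\mathcal{E}_1 = [-1,1]$. For $\boldsymbol{\rho}\in[1,\infty)^{\mathbb{N}}$, $\mathcal{E}_{\boldsymbol{\rho}} = \mathcal{E}_{\rho_1}\times\mathcal{E}_{\rho_2}\times\cdots\subset\mathbb{C}^{\mathbb{N}}$. Given $\boldsymbol{b}\in[0,\infty)^{\mathbb{N}}$ and $\varepsilon>0$, let $\mathcal{R}_{\boldsymbol{b},\varepsilon}$ be the union of all $\mathcal{E}_{\boldsymbol{\rho}}$ with $\boldsymbol{\rho}\in[1,\infty)^{\mathbb{N}}$ satisfying $\sum_{i=1}^\infty \left(\frac{\rho_i+\rho_i^{-1}}{2}-1\right)b_i\leq\varepsilon$. A function $f:\mathcal{U}\to\mathbb{C}$ is $(\boldsymbol{b},\varepsilon)$-holomorphic if it (extends to a function that) is holomorphic in every $\mathcal{E}_{\boldsymbol{\rho}}$ with $\boldsymbol{\rho}$ satisfying this inequality. Holomorphy is understood with respect to each variable: at every point $\boldsymbol{z}$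 of the region and for every $i$, the limit of $(f(\boldsymbol{z}+h\boldsymbol{e}_i)-f(\boldsymbol{z}))/h$ as $h\to0$, $h\in\mathbb{C}$, exists (as usual for closed sets, $f$ being defined in a neighbourhood of the point in the variable concerned; here $\boldsymbol{e}_i$ is the $i$th canonical unit sequence). $\mathcal{H}(\boldsymbol{b},\varepsilon)\subset L^2_\varrho(\mathcal{U})$ is the set of $(\boldsymbol{b},\varepsilon)$-holomorphic functions $f$ with $\|f\|_{L^\infty(\mathcal{R}_{\boldsymbol{b},\varepsilon})}\leq 1$. *)

theory Defs
  imports
    "HOL-Probability.Probability"
    "HOL-Computational_Algebra.Polynomial"
    "Jordan_Normal_Form.Schur_Decomposition"
begin

text \<open>Sequences indexed by the positive integers are functions on \<^typ>\<open>nat\<close>, starting at 0.\<close>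

section \<open>Measures, orthonormal polynomials, multi-indices\<close>

text \<open>The underlying space of the univariate measures is \<open>[-1,1]\<close>, not the real line, so that the
  space of their infinite product is exactly the cube \<open>[-1,1]\<^sup>\<nat>\<close>.\<close>

definition uniform1 :: "real measure" where
  "uniform1 = density (restrict_space lborel {-1..1}) (\<lambda>y. ennreal (1 / 2))"

definition chebyshev1 :: "real measure" where
  "chebyshev1 = density (restrict_space lborel {-1..1}) (\<lambda>y. ennreal (1 / (pi * sqrt (1 - y\<^sup>2))))"

definition tensor_measure :: "real measure \<Rightarrow> (nat \<Rightarrow> real) measure" where
  "tensor_measure \<mu> = (\<Pi>\<^sub>M i\<in>UNIV. \<mu>)"

definition cube :: "(nat \<Rightarrow> real) set" where
  "cube = {y. \<forall>i. y i \<in> {-1..1}}"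

text \<open>This determines each \<open>\<psi> n\<close> up to its sign: for \<^const>\<open>uniform1\<close> the normalized Legendre
  polynomials, for \<^const>\<open>chebyshev1\<close> the normalized Chebyshev polynomials of the first kind.\<close>

definition orthonormal_polys :: "real measure \<Rightarrow> (nat \<Rightarrow> real poly) \<Rightarrow> bool" where
  "orthonormal_polys \<mu> \<psi> \<longleftrightarrow>
     (\<forall>n. degree (\<psi> n) = n) \<and>
     (\<forall>k n. (\<integral>y. poly (\<psi> k) y * poly (\<psi> n) y \<partial>\<mu>) = (if k = n then 1 else 0))"

definition multi_indices :: "(nat \<Rightarrow> nat) set" where
  "multi_indices = {\<nu>. finite {i. \<nu> i \<noteq> 0}}"

definition Psi :: "(nat \<Rightarrow> real poly) \<Rightarrow> (nat \<Rightarrow> nat) \<Rightarrow> (nat \<Rightarrow> real) \<Rightarrow> real" where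
  "Psi \<psi> \<nu> y = (\<Prod>i\<in>{i. \<nu> i \<noteq> 0}. poly (\<psi> (\<nu> i)) (y i))"

text \<open>The complex span of the \<open>Psi \<psi> \<nu>\<close> with \<open>\<nu> \<in> S\<close>, for finite \<open>S\<close>.\<close>

definition poly_space :: "(nat \<Rightarrow> real poly) \<Rightarrow> (nat \<Rightarrow> nat) set \<Rightarrow> ((nat \<Rightarrow> real) \<Rightarrow> complex) set" where
  "poly_space \<psi> S = {q. \<exists>c. q = (\<lambda>y. \<Sum>\<nu>\<in>S. c \<nu> * complex_of_real (Psi \<psi> \<nu> y))}"

definition L2_norm :: "'a measure \<Rightarrow> ('a \<Rightarrow> complex) \<Rightarrow> real" where
  "L2_norm M g = sqrt (\<integral>y. (cmod (g y))\<^sup>2 \<partial>M)"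

section \<open>Holomorphic functions of infinitely many variables\<close>

text \<open>For \<open>r = 1\<close> this is the segment \<open>[-1,1]\<close>.\<close>

definition bernstein_ellipse :: "real \<Rightarrow> complex set" where
  "bernstein_ellipse r = {(z + inverse z) / 2 | z. 1 \<le> cmod z \<and> cmod z \<le> r}"

definition bernstein_polyellipse :: "(nat \<Rightarrow> real) \<Rightarrow> (nat \<Rightarrow> complex) set" where
  "bernstein_polyellipse \<rho> = {z. \<forall>i. z i \<in> bernstein_ellipse (\<rho> i)}"

text \<open>The series has nonnegative terms; an infinite sum violates the bound, which is why summability
  is required separately.\<close>

definition admissible :: "(nat \<Rightarrow> real) \<Rightarrow> real \<Rightarrow> (nat \<Rightarrow> real) \<Rightarrow> bool" where
  "admissible b \<eta> \<rho> \<longleftrightarrow>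
     (\<forall>i. 1 \<le> \<rho> i) \<and>
     summable (\<lambda>i. ((\<rho> i + inverse (\<rho> i)) / 2 - 1) * b i) \<and>
     (\<Sum>i. ((\<rho> i + inverse (\<rho> i)) / 2 - 1) * b i) \<le> \<eta>"

definition holo_region :: "(nat \<Rightarrow> real) \<Rightarrow> real \<Rightarrow> (nat \<Rightarrow> complex) set" where
  "holo_region b \<eta> = (\<Union>\<rho>\<in>{\<rho>. admissible b \<eta> \<rho>}. bernstein_polyellipse \<rho>)"

text \<open>The derivative is the full complex one, also at boundary points of the (closed) set \<open>D\<close>; it sees
  the values of \<open>F\<close> near the point, possibly outside \<open>D\<close>.\<close>

definition separately_holomorphic_on ::
  "((nat \<Rightarrow> complex) \<Rightarrow> complex) \<Rightarrow> (nat \<Rightarrow> complex) set \<Rightarrow> bool" where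
  "separately_holomorphic_on F D \<longleftrightarrow>
     (\<forall>z\<in>D. \<forall>i. (\<lambda>w. F (z(i := w))) field_differentiable (at (z i)))"

text \<open>The unit ball \<open>H(b,\<eta>)\<close>, as a set of square-integrable functions on the cube, where
  \<open>F\<close> is the holomorphic extension of \<open>f\<close>.\<close>

definition holo_class :: "real measure \<Rightarrow> (nat \<Rightarrow> real) \<Rightarrow> real \<Rightarrow> ((nat \<Rightarrow> real) \<Rightarrow> complex) set" where
  "holo_class \<mu> b \<eta> =
     {f. f \<in> borel_measurable (tensor_measure \<mu>) \<and>
         integrable (tensor_measure \<mu>) (\<lambda>y. (cmod (f y))\<^sup>2) \<and>
         (\<exists>F. (\<forall>y\<in>cube. F (\<lambda>i. complex_of_real (y i)) = f y) \<and>
              (\<forall>\<rho>. admissible b \<eta> \<rho> \<longrightarrow> separately_holomorphic_on F (bernstein_polyellipse \<rho>)) \<and>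
              (\<forall>z\<in>holo_region b \<eta>. cmod (F z) \<le> 1))}"

section \<open>Least squares\<close>

text \<open>\<open>q\<close> is a minimizer of the least-squares problem for the sample points \<open>y 0, \<dots>, y (m - 1)\<close>
  and the noise \<open>e 0, \<dots>, e (m - 1)\<close>.\<close>

definition is_least_squares ::
  "(nat \<Rightarrow> real poly) \<Rightarrow> (nat \<Rightarrow> nat) set \<Rightarrow> nat \<Rightarrow> (nat \<Rightarrow> nat \<Rightarrow> real) \<Rightarrow>
   ((nat \<Rightarrow> real) \<Rightarrow> complex) \<Rightarrow> (nat \<Rightarrow> complex) \<Rightarrow> ((nat \<Rightarrow> real) \<Rightarrow> complex) \<Rightarrow> bool" where
  "is_least_squares \<psi> S m y f e q \<longleftrightarrow>
     is_arg_min (\<lambda>q. 1 / real m * (\<Sum>i<m. (cmod (f (y i) + e i - q (y i)))\<^sup>2))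
       (\<lambda>q. q \<in> poly_space \<psi> S) q"

text \<open>Here \<open>\<nu> 0, \<dots>, \<nu> (n - 1)\<close> enumerates the index set.\<close>

definition ls_matrix ::
  "(nat \<Rightarrow> real poly) \<Rightarrow> nat \<Rightarrow> nat \<Rightarrow> (nat \<Rightarrow> nat \<Rightarrow> nat) \<Rightarrow> (nat \<Rightarrow> nat \<Rightarrow> real) \<Rightarrow> complex mat" where
  "ls_matrix \<psi> m n \<nu> y = mat m n (\<lambda>(i, j). complex_of_real (Psi \<psi> (\<nu> j) (y i) / sqrt (real m)))"

text \<open>Singular values of a matrix with at least as many rows as columns.\<close>

definition singular_values :: "complex mat \<Rightarrow> real set" where
  "singular_values A = {s. 0 \<le> s \<and> eigenvalue (mat_adjoint A * A) (complex_of_real (s\<^sup>2))}"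

definition cond :: "complex mat \<Rightarrow> ereal" where
  "cond A = (if Min (singular_values A) = 0 then \<infinity>
             else ereal (Max (singular_values A) / Min (singular_values A)))"

end

theory Submission
  imports Defs "HOL-Complex_Analysis.Complex_Analysis" "Jordan_Normal_Form.Spectral_Radius"
begin

text \<open>
  On a Bernstein polyellipse each variable is projected by a discrete Chebyshev projection, and a Cauchy
  formula on the ellipse bounds the resulting remainder. This gives \<open>|c \<nu>| \<le> \<Prod>i. C (1 + 2 \<nu> i) / \<rho> i ^ \<nu> i\<close> for
  every admissible \<open>\<rho>\<close>. Let \<open>B \<nu>\<close> be the infimum of these bounds and \<open>u \<nu>\<close> a polynomial bound on the sup norm of \<open>\<Psi> \<nu>\<close>.
  Choosing \<open>\<rho> i = \<kappa>\<close> for small \<open>i\<close> and \<open>\<rho> i = \<kappa> + \<eta> \<nu> i / (|\<nu>| b i)\<close> for large \<open>i\<close>, with \<open>|\<nu>|\<close> the degree in the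
  latter variables, and summing with the multinomial theorem, one finds that \<open>\<Sum>\<nu>. (u \<nu>)\<^sup>2 (B \<nu>) powr p\<close> is finite.
  The set \<open>S\<close> consists of the indices with \<open>B \<nu> > t u \<nu>\<close>, where \<open>t\<close> is the smallest threshold such that the sum of \<open>(u \<nu>)\<^sup>2\<close> over
  \<open>S\<close> is at most a small multiple of \<open>n\<close>. Stechkin's argument then bounds the tails of the expansion in \<open>L\<^sup>2\<close> and, weighted by \<open>u\<close>, in the sup norm.

  The sum of \<open>(u \<nu>)\<^sup>2\<close> also controls the Gram matrix of the samples: a matrix Chernoff bound, proved by expanding
  the trace of the exponential under rank-one updates, shows that with high probability its spectrum lies in \<open>[1/2, 3/2]\<close>, whence
  uniqueness, stability and a condition number of at most \<open>sqrt 3\<close>. A scalar Chernoff bound controls the discrete norm of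
  the remainder \<open>f - \<Sum>\<nu>\<in>S. c \<nu> \<Psi> \<nu>\<close> for the fixed function \<open>f\<close>. If \<open>n\<close> is small, \<open>S = {0}\<close> and the Gram matrix is the identity.
\<close>

section \<open>Moments of matrix powers and concentration of Gram matrices\<close>

text \<open>One family of index sets has to serve both measures, every exponent p and every function
  of the class. All selections are therefore made with quantities that know none of these: the
  sup-norm bound \<open>sup_psi\<close> is valid for both measures, and \<open>coef_bd\<close>
  dominates the coefficients of every f. The error is measured in L2, whereas the samples see the
  remainder pointwise, so tails in two norms are needed. Put L = ln (m / \<epsilon>) and R = m / L.
  The available bound on the sup norm of the remainder exceeds the one on its L2 norm by a factor
  sqrt R. In a scalar tail bound of failure probability about \<epsilon> the squared sup norm is
  multiplied by L, and R * L = m; the deviation is then of the size that m samples contribute on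
  average anyway, and the rate is not spoiled. This balance is why weighted l1 tails are carried
  beside l2 tails, and why f is fixed before the samples. Infinitely many variables are met by an
  argument in one variable, iterated over the finite support of the multi-index. In the same spirit
  no matrix exponential is formed: traces of powers are estimated and summed as a scalar
  series.\<close>

lemma sum_choose_triangle:
  fixes x :: "nat \<Rightarrow> real"
  shows "(\<Sum>i<k. \<Sum>l\<le>i. real (i choose l) * x l) = (\<Sum>l<k. real (k choose Suc l) * x l)"
proof (induction k)
  case (Suc k)
  have "(\<Sum>l<Suc k. real (Suc k choose Suc l) * x l)
      = (\<Sum>l\<le>k. real (k choose l) * x l) + (\<Sum>l\<le>k. real (k choose Suc l) * x l)"
    by (simp add: lessThan_Suc_atMost algebra_simps sum.distrib)
  also have "(\<Sum>l\<le>k. real (k choose Suc l) * x l) = (\<Sum>l<k. real (k choose Suc l) * x l)"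
    by (simp add: lessThan_Suc_atMost[symmetric])
  finally show ?case using Suc by simp
qed simp

text \<open>With \<open>sum_choose_triangle\<close> this is the hockey-stick identity summed against
  a sequence. In the k-th power of A + s w w^T, k choose l counts the words with l rank-one factors;
  the two identities build up that count one factor at a time.\<close>

lemma sum_choose_triangle2:
  fixes x :: "nat \<Rightarrow> real"
  shows "(\<Sum>i<k. \<Sum>l<i. real (i choose Suc l) * x l) = (\<Sum>l<k. real (k choose Suc (Suc l)) * x l)"
proof (induction k)
  case (Suc k)
  have "(\<Sum>l<Suc k. real (Suc k choose Suc (Suc l)) * x l)
      = (\<Sum>l<Suc k. real (k choose Suc l) * x l) + (\<Sum>l<Suc k. real (k choose Suc (Suc l)) * x l)"
    by (simp add: algebra_simps sum.distrib del: sum.lessThan_Suc)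
  also have "\<dots> = (\<Sum>l<k. real (k choose Suc l) * x l) + (\<Sum>l<k. real (k choose Suc (Suc l)) * x l)"
    by (simp add: binomial_eq_0)
  finally show ?case using Suc by simp
qed simp

text \<open>Log-convexity makes successive ratios of d increase, so weight can be moved from the
  smaller index to the larger one until the smaller is 0. The ratio inequality is kept in product
  form since d may vanish; a zero at one index forces a zero at the next.\<close>

lemma log_convex_mult_le:
  fixes d :: "nat \<Rightarrow> real"
  assumes nn: "\<And>a. 0 \<le> d a" and lc: "\<And>a. (d (Suc a))\<^sup>2 \<le> d a * d (Suc (Suc a))"
  shows "d i * d j \<le> d 0 * d (i + j)"
proof -
  have ratio: "d (Suc i) * d (i + e) \<le> d i * d (Suc (i + e))" for i e
  proof (induction e)
    case (Suc e)
    show ?case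
    proof (cases "d (i + e) = 0")
      case True
      then have "d (Suc (i + e)) = 0" using lc[of "i + e"] by simp
      then show ?thesis using nn by simp
    next
      case False
      then have pos: "0 < d (i + e)" using nn[of "i + e"] by simp
      have "d (i + e) * (d (Suc i) * d (Suc (i + e))) = (d (Suc i) * d (i + e)) * d (Suc (i + e))"
        by simp
      also have "\<dots> \<le> (d i * d (Suc (i + e))) * d (Suc (i + e))"
        by (rule mult_right_mono[OF Suc nn])
      also have "\<dots> = d i * (d (Suc (i + e)))\<^sup>2" by (simp add: power2_eq_square)
      also have "\<dots> \<le> d i * (d (i + e) * d (Suc (Suc (i + e))))"
        by (rule mult_left_mono[OF lc nn])
      finally have "d (i + e) * (d (Suc i) * d (Suc (i + e))) \<le> d (i + e) * (d i * d (Suc (Suc (i + e))))"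
        by (simp add: algebra_simps)
      then show ?thesis using pos by simp
    qed
  qed simp
  have le: "i \<le> j \<Longrightarrow> d i * d j \<le> d 0 * d (i + j)" for i j
  proof (induction i arbitrary: j)
    case (Suc i)
    have "d (Suc i) * d j \<le> d i * d (Suc j)" using ratio[of i "j - i"] Suc.prems by simp
    also have "\<dots> \<le> d 0 * d (i + Suc j)" using Suc.IH[of "Suc j"] Suc.prems by simp
    finally show ?case by simp
  qed simp
  show ?thesis
  proof (cases "i \<le> j")
    case False
    then show ?thesis using le[of j i] by (simp add: mult.commute add.commute)
  qed (rule le)
qed

section \<open>Quadratic forms and moments of matrix powers over a finite index set\<close>

definition ip :: "'i set \<Rightarrow> ('i \<Rightarrow> real) \<Rightarrow> ('i \<Rightarrow> real) \<Rightarrow> real" where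
  "ip I x y = (\<Sum>i\<in>I. x i * y i)"

definition mv :: "'i set \<Rightarrow> ('i \<Rightarrow> 'i \<Rightarrow> real) \<Rightarrow> ('i \<Rightarrow> real) \<Rightarrow> 'i \<Rightarrow> real" where
  "mv I A x = (\<lambda>i. \<Sum>j\<in>I. A i j * x j)"

text \<open>The trace of the k-th power, read off from the images of the unit vectors. Vectors and
  matrices are plain functions of which only the values on \<open>I\<close> count, so that
  multi-indices can serve as indices directly.\<close>

definition tr_pow :: "'i set \<Rightarrow> ('i \<Rightarrow> 'i \<Rightarrow> real) \<Rightarrow> nat \<Rightarrow> real" where
  "tr_pow I A k = (\<Sum>i\<in>I. (mv I A ^^ k) (\<lambda>j. of_bool (j = i)) i)"

definition sym_on :: "'i set \<Rightarrow> ('i \<Rightarrow> 'i \<Rightarrow> real) \<Rightarrow> bool" where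
  "sym_on I A \<longleftrightarrow> (\<forall>i\<in>I. \<forall>j\<in>I. A i j = A j i)"

definition psd_on :: "'i set \<Rightarrow> ('i \<Rightarrow> 'i \<Rightarrow> real) \<Rightarrow> bool" where
  "psd_on I A \<longleftrightarrow> sym_on I A \<and> (\<forall>x. 0 \<le> ip I x (mv I A x))"

lemma ip_comm: "ip I x y = ip I y x"
  by (simp add: ip_def mult.commute)

lemma ip_lin: "ip I z (\<lambda>i. x i + c * y i) = ip I z x + c * ip I z y"
  by (simp add: ip_def algebra_simps sum.distrib sum_distrib_left)

lemma mv_lin: "mv I A (\<lambda>i. x i + c * y i) = (\<lambda>i. mv I A x i + c * mv I A y i)"
  by (simp add: mv_def algebra_simps sum.distrib sum_distrib_left)

lemma mv_pow_lin: "(mv I A ^^ k) (\<lambda>i. x i + c * y i) = (\<lambda>i. (mv I A ^^ k) x i + c * (mv I A ^^ k) y i)"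
  by (induction k) (simp_all add: mv_lin)

lemma ip_mv_sym: "sym_on I A \<Longrightarrow> ip I (mv I A x) y = ip I x (mv I A y)"
  unfolding ip_def mv_def sum_distrib_left sum_distrib_right
  by (subst sum.swap) (auto intro!: sum.cong simp: sym_on_def)

lemma ip_mv_pow_sym: "sym_on I A \<Longrightarrow> ip I ((mv I A ^^ k) x) y = ip I x ((mv I A ^^ k) y)"
  by (induction k arbitrary: x y) (simp_all add: ip_mv_sym funpow_swap1)

lemma ip_indicator: "finite I \<Longrightarrow> i \<in> I \<Longrightarrow> ip I x (\<lambda>j. of_bool (j = i)) = x i"
  unfolding ip_def by (subst sum.remove[of _ i]) auto

lemma mv_pow_entry:
  assumes "finite I" "sym_on I A" "i \<in> I"
  shows "(mv I A ^^ k) x i = (\<Sum>j\<in>I. x j * (mv I A ^^ k) (\<lambda>l. of_bool (l = i)) j)"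
proof -
  have "(mv I A ^^ k) x i = ip I ((mv I A ^^ k) x) (\<lambda>l. of_bool (l = i))"
    using assms by (simp add: ip_indicator)
  also have "\<dots> = ip I x ((mv I A ^^ k) (\<lambda>l. of_bool (l = i)))"
    using assms by (simp add: ip_mv_pow_sym)
  finally show ?thesis by (simp add: ip_def)
qed

text \<open>Definiteness is not assumed, so that B may be the inner product or the form of a
  positive semidefinite matrix. If B y y = 0, the polynomial in c is affine and nonnegative, hence
  constant.\<close>

lemma cauchy_schwarz_form:
  fixes B :: "('i \<Rightarrow> real) \<Rightarrow> ('i \<Rightarrow> real) \<Rightarrow> real"
  assumes lin: "\<And>x y z c. B z (\<lambda>i. x i + c * y i) = B z x + c * B z y"
    and sym: "\<And>x y. B x y = B y x" and pos: "\<And>x. 0 \<le> B x x"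
  shows "(B x y)\<^sup>2 \<le> B x x * B y y"
proof -
  have q: "0 \<le> B x x + 2 * c * B x y + c\<^sup>2 * B y y" for c
  proof -
    have "B (\<lambda>i. x i + c * y i) (\<lambda>i. x i + c * y i) = B x x + 2 * c * B x y + c\<^sup>2 * B y y"
      unfolding lin sym[of "\<lambda>i. x i + c * y i" x] sym[of "\<lambda>i. x i + c * y i" y] sym[of y x]
      by (simp add: power2_eq_square algebra_simps)
    then show ?thesis using pos by metis
  qed
  show ?thesis
  proof (cases "B y y = 0")
    case True
    have "B x y = 0"
    proof (rule ccontr)
      assume "B x y \<noteq> 0"
      then show False using q[of "- (B x x + 1) / (2 * B x y)"] True by (simp add: field_simps)
    qed
    then show ?thesis using True by simp
  next
    case False
    then have "0 < B y y" using pos[of y] by simp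
    then show ?thesis using q[of "- B x y / B y y"] by (simp add: field_simps power2_eq_square)
  qed
qed

lemma ip_cauchy_schwarz: "(ip I x y)\<^sup>2 \<le> ip I x x * ip I y y"
  by (rule cauchy_schwarz_form[of "ip I"]) (simp_all add: ip_lin, simp_all add: ip_def sum_nonneg mult.commute)

text \<open>These are the moments of the spectral measure of A at x, handled without a spectral
  theorem. Distributing the power evenly over both arguments leaves no factor A or a single one in
  the middle, so Cauchy-Schwarz applies to the inner product or to the form of A, according to
  parity.\<close>

lemma power_moments:
  fixes x :: "'i \<Rightarrow> real"
  assumes psd: "psd_on I A"
  defines "d \<equiv> \<lambda>k. ip I x ((mv I A ^^ k) x)"
  shows moment_nonneg: "0 \<le> d k" and moment_log_convex: "(d (Suc k))\<^sup>2 \<le> d k * d (Suc (Suc k))"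
proof -
  have sym: "sym_on I A" and pos: "\<And>x. 0 \<le> ip I x (mv I A x)" using psd by (auto simp: psd_on_def)
  have even: "d (b + c) = ip I ((mv I A ^^ b) x) ((mv I A ^^ c) x)" for b c
    by (simp add: d_def ip_mv_pow_sym[OF sym] funpow_add)
  have odd: "d (Suc (b + c)) = ip I ((mv I A ^^ b) x) (mv I A ((mv I A ^^ c) x))" for b c
    using even[of b "Suc c"] by simp
  have nn: "0 \<le> ip I z z" for z by (simp add: ip_def sum_nonneg)
  show "0 \<le> d k"
  proof (cases "even k")
    case True
    then obtain b where "k = b + b" by (auto elim!: evenE simp: mult_2)
    then show ?thesis using even[of b b] nn by simp
  next
    case False
    then obtain b where "k = Suc (b + b)" by (auto elim!: oddE simp: mult_2)
    then show ?thesis using odd[of b b] pos by simp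
  qed
  show "(d (Suc k))\<^sup>2 \<le> d k * d (Suc (Suc k))"
  proof (cases "even k")
    case True
    then obtain b where k: "k = b + b" by (auto elim!: evenE simp: mult_2)
    then show ?thesis using even[of b b] even[of b "Suc b"] even[of "Suc b" "Suc b"]
      ip_cauchy_schwarz[of I "(mv I A ^^ b) x" "(mv I A ^^ Suc b) x"] by simp
  next
    case False
    then obtain b where k: "k = Suc (b + b)" by (auto elim!: oddE simp: mult_2)
    have "(ip I x (mv I A y))\<^sup>2 \<le> ip I x (mv I A x) * ip I y (mv I A y)" for x y
      by (rule cauchy_schwarz_form[where B = "\<lambda>x y. ip I x (mv I A y)"])
         (simp_all add: mv_lin ip_lin pos, metis ip_comm ip_mv_sym sym)
    from this[of "(mv I A ^^ b) x" "(mv I A ^^ Suc b) x"] show ?thesis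
      using k odd[of b b] odd[of b "Suc b"] odd[of "Suc b" "Suc b"] by simp
  qed
qed

text \<open>This replaces the Golden--Thompson or Lieb inequality in the usual matrix Chernoff bound. In the expansion
  of the power, each word with several factors \<open>w w\<^sup>T\<close> contributes a product of moments \<open>d k\<close>, and
  log-convexity merges such a product into a single moment.\<close>

lemma tr_pow_rank_one_update:
  fixes w :: "'i \<Rightarrow> real" and s :: real
  assumes psd: "psd_on I A" and fin: "finite I" and \<kappa>: "ip I w w \<le> \<kappa>" "0 < \<kappa>"
  defines "d \<equiv> \<lambda>k. ip I w ((mv I A ^^ k) w)" and "h \<equiv> \<bar>s :: real\<bar> * \<kappa>"
  shows "tr_pow I (\<lambda>i j. A i j + s * w i * w j) k
    \<le> tr_pow I A k + s * real k * d (k - 1)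
       + (1 / \<kappa>) * (\<Sum>l\<in>{2..k}. real (k choose l) * h ^ l * d (k - l))"
proof -
  define H where "H = (\<lambda>i j. A i j + s * w i * w j)"
  have symA: "sym_on I A" using psd by (simp add: psd_on_def)
  then have symH: "sym_on I H" by (simp add: sym_on_def H_def)
  have Hx: "mv I H x = (\<lambda>i. mv I A x i + (s * ip I w x) * w i)" for x
    by (simp add: mv_def H_def ip_def algebra_simps sum.distrib sum_distrib_left)
  \<comment> \<open>\<open>g k j\<close> is the moment at w of the mixed word H^k A^j, and
    \<open>t k j\<close> below is the trace of that word. The H next to A^j is replaced by A or by s
    w w^T; the second choice cuts the word into two shorter pieces.\<close>
  define g where "g = (\<lambda>k j. ip I w ((mv I H ^^ k) ((mv I A ^^ j) w)))"
  have dm: "d i * d j \<le> \<kappa> * d (i + j)" for i j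
  proof -
    have "d i * d j \<le> d 0 * d (i + j)" unfolding d_def
      by (rule log_convex_mult_le) (use power_moments[OF psd] in auto)
    also have "\<dots> \<le> \<kappa> * d (i + j)"
      using moment_nonneg[OF psd] \<kappa>(1) unfolding d_def by (intro mult_right_mono) auto
    finally show ?thesis .
  qed
  have d0: "0 \<le> d k" for k using moment_nonneg[OF psd] by (simp add: d_def)
  have h0: "0 \<le> h" using \<kappa> by (simp add: h_def)
  have g0: "g 0 j = d j" for j by (simp add: g_def d_def)
  have gS: "g (Suc k) j = g k (Suc j) + s * g k 0 * d j" for k j
  proof -
    have e: "(mv I H ^^ Suc k) x = (\<lambda>i. (mv I H ^^ k) (mv I A x) i + (s * ip I w x) * (mv I H ^^ k) w i)" for x
      by (simp add: funpow_Suc_right Hx mv_pow_lin del: funpow.simps)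
    show ?thesis unfolding g_def d_def e ip_lin by simp
  qed
  have gk: "g k j = d (k + j) + s * (\<Sum>i<k. g i 0 * d (k - 1 - i + j))" for k j
  proof (induction k arbitrary: j)
    case (Suc k)
    have "(\<Sum>i<k. g i 0 * d (k - 1 - i + Suc j)) = (\<Sum>i<k. g i 0 * d (Suc k - 1 - i + j))"
      by (intro sum.cong) (auto simp: Suc_diff_Suc)
    then show ?case using gS[of k j] Suc[of "Suc j"] by (simp add: algebra_simps)
  qed (simp add: g0)
  define t where "t = (\<lambda>k j. \<Sum>i\<in>I. (mv I H ^^ k) ((mv I A ^^ j) (\<lambda>j. of_bool (j = i))) i)"
  have tS: "t (Suc k) j = t k (Suc j) + s * g k j" for k j
  proof -
    have e: "(mv I H ^^ Suc k) x = (\<lambda>i. (mv I H ^^ k) (mv I A x) i + (s * ip I w x) * (mv I H ^^ k) w i)" for x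
      by (simp add: funpow_Suc_right Hx mv_pow_lin del: funpow.simps)
    have "(\<Sum>i\<in>I. ip I w ((mv I A ^^ j) (\<lambda>j. of_bool (j = i))) * (mv I H ^^ k) w i)
        = (\<Sum>i\<in>I. (mv I A ^^ j) w i * (mv I H ^^ k) w i)"
      by (intro sum.cong) (auto simp: ip_mv_pow_sym[OF symA, symmetric] ip_indicator fin)
    also have "\<dots> = g k j"
      unfolding g_def ip_mv_pow_sym[OF symH, symmetric] by (simp add: ip_def mult.commute)
    finally show ?thesis unfolding t_def e
      by (simp add: sum.distrib mult.assoc sum_distrib_left[symmetric])
  qed
  have tk: "t k j = t 0 (k + j) + s * (\<Sum>i<k. g i (k - 1 - i + j))" for k j
  proof (induction k arbitrary: j)
    case (Suc k)
    have "(\<Sum>i<k. g i (k - 1 - i + Suc j)) = (\<Sum>i<k. g i (Suc k - 1 - i + j))"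
      by (intro sum.cong) (auto simp: Suc_diff_Suc)
    then show ?case using tS[of k j] Suc[of "Suc j"] by (simp add: algebra_simps)
  qed simp
  \<comment> \<open>Common to both estimates below: inserting a binomial bound for
    \<open>g i 0\<close> into the recursion raises the number of rank-one factors by one.\<close>
  have mid: "\<bar>s\<bar> * (\<Sum>i<k. (\<Sum>l\<le>i. real (i choose l) * h ^ l * d (i - l)) * d (k - 1 - i + j))
      \<le> (\<Sum>l<k. real (k choose Suc l) * h ^ Suc l * d (k + j - Suc l))" for k j
  proof -
    have "\<bar>s\<bar> * (\<Sum>i<k. (\<Sum>l\<le>i. real (i choose l) * h ^ l * d (i - l)) * d (k - 1 - i + j))
        = \<bar>s\<bar> * (\<Sum>i<k. \<Sum>l\<le>i. real (i choose l) * h ^ l * (d (i - l) * d (k - 1 - i + j)))"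
      by (simp add: sum_distrib_right mult.assoc)
    also have "\<dots> \<le> \<bar>s\<bar> * (\<Sum>i<k. \<Sum>l\<le>i. real (i choose l) * h ^ l * (\<kappa> * d (k + j - Suc l)))"
    proof (intro mult_left_mono sum_mono)
      fix i l assume "i \<in> {..<k}" "l \<in> {..i}"
      then have "i - l + (k - 1 - i + j) = k + j - Suc l" by auto
      then show "d (i - l) * d (k - 1 - i + j) \<le> \<kappa> * d (k + j - Suc l)"
        using dm[of "i - l" "k - 1 - i + j"] by simp
    qed (use h0 in auto)
    also have "\<dots> = \<bar>s\<bar> * (\<Sum>i<k. \<Sum>l\<le>i. real (i choose l) * (h ^ l * \<kappa> * d (k + j - Suc l)))"
      by (simp add: mult.assoc)
    also have "\<dots> = \<bar>s\<bar> * (\<Sum>l<k. real (k choose Suc l) * (h ^ l * \<kappa> * d (k + j - Suc l)))"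
      by (simp only: sum_choose_triangle)
    also have "\<dots> = (\<Sum>l<k. real (k choose Suc l) * h ^ Suc l * d (k + j - Suc l))"
      unfolding sum_distrib_left by (intro sum.cong) (auto simp: h_def algebra_simps)
    finally show ?thesis by simp
  qed
  have gb: "\<bar>g k 0\<bar> \<le> (\<Sum>l\<le>k. real (k choose l) * h ^ l * d (k - l))" for k
  proof (induction k rule: less_induct)
    case (less k)
    have "\<bar>g k 0\<bar> \<le> d k + \<bar>s * (\<Sum>i<k. g i 0 * d (k - 1 - i + 0))\<bar>"
      using gk[of k 0] d0[of k] by simp
    also have "\<bar>s * (\<Sum>i<k. g i 0 * d (k - 1 - i + 0))\<bar> \<le> \<bar>s\<bar> * (\<Sum>i<k. \<bar>g i 0\<bar> * d (k - 1 - i + 0))"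
      unfolding abs_mult using d0
      by (intro mult_left_mono order.trans[OF sum_abs]) (auto simp: abs_mult intro!: sum_mono)
    also have "\<dots> \<le> \<bar>s\<bar> * (\<Sum>i<k. (\<Sum>l\<le>i. real (i choose l) * h ^ l * d (i - l)) * d (k - 1 - i + 0))"
      using less d0 by (intro mult_left_mono sum_mono mult_right_mono) auto
    also have "\<dots> \<le> (\<Sum>l<k. real (k choose Suc l) * h ^ Suc l * d (k - Suc l))"
      using mid[of k 0] by simp
    also have "d k + \<dots> = (\<Sum>l<Suc k. real (k choose l) * h ^ l * d (k - l))"
      by (subst sum.lessThan_Suc_shift) simp
    finally show ?case by (simp only: lessThan_Suc_atMost)
  qed
  have gd: "\<bar>g i j - d (i + j)\<bar> \<le> (\<Sum>l<i. real (i choose Suc l) * h ^ Suc l * d (i + j - Suc l))" for i j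
  proof -
    have "\<bar>g i j - d (i + j)\<bar> \<le> \<bar>s\<bar> * (\<Sum>r<i. \<bar>g r 0\<bar> * d (i - 1 - r + j))"
      unfolding gk[of i j] using d0
      by (auto simp: abs_mult intro!: mult_left_mono sum_mono order.trans[OF sum_abs])
    also have "\<dots> \<le> \<bar>s\<bar> * (\<Sum>r<i. (\<Sum>l\<le>r. real (r choose l) * h ^ l * d (r - l)) * d (i - 1 - r + j))"
      using gb d0 by (intro mult_left_mono sum_mono mult_right_mono) auto
    also have "\<dots> \<le> (\<Sum>l<i. real (i choose Suc l) * h ^ Suc l * d (i + j - Suc l))"
      by (rule mid)
    finally show ?thesis .
  qed
  \<comment> \<open>The term linear in s is split off with its sign, because its mean becomes the
    drift. Only words with at least two rank-one factors are estimated in absolute value.\<close>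
  have "s * (\<Sum>i<k. g i (k - 1 - i)) = s * (\<Sum>i<k. d (k - 1)) + s * (\<Sum>i<k. g i (k - 1 - i) - d (k - 1))"
    by (simp add: sum_subtractf algebra_simps)
  also have "s * (\<Sum>i<k. g i (k - 1 - i) - d (k - 1))
     \<le> \<bar>s\<bar> * (\<Sum>i<k. \<bar>g i (k - 1 - i) - d (i + (k - 1 - i))\<bar>)"
  proof -
    have "s * (\<Sum>i<k. g i (k - 1 - i) - d (k - 1)) \<le> \<bar>s * (\<Sum>i<k. g i (k - 1 - i) - d (k - 1))\<bar>" by simp
    also have "\<dots> \<le> \<bar>s\<bar> * (\<Sum>i<k. \<bar>g i (k - 1 - i) - d (k - 1)\<bar>)"
      by (auto simp: abs_mult intro!: mult_left_mono)
    finally show ?thesis by simp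
  qed
  also have "\<dots> \<le> \<bar>s\<bar> * (\<Sum>i<k. \<Sum>l<i. real (i choose Suc l) * h ^ Suc l * d (i + (k - 1 - i) - Suc l))"
    by (intro mult_left_mono sum_mono gd) auto
  also have "\<dots> = \<bar>s\<bar> * (\<Sum>i<k. \<Sum>l<i. real (i choose Suc l) * (h ^ Suc l * d (k - Suc (Suc l))))"
    by (auto intro!: sum.cong simp: mult.assoc)
  also have "\<dots> = \<bar>s\<bar> * (\<Sum>l<k. real (k choose Suc (Suc l)) * (h ^ Suc l * d (k - Suc (Suc l))))"
    by (simp only: sum_choose_triangle2)
  also have "\<dots> = (1 / \<kappa>) * (\<Sum>l<k. real (k choose Suc (Suc l)) * h ^ Suc (Suc l) * d (k - Suc (Suc l)))"
    unfolding sum_distrib_left using \<kappa>(2) by (intro sum.cong) (auto simp: h_def)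
  also have "(\<Sum>l<k. real (k choose Suc (Suc l)) * h ^ Suc (Suc l) * d (k - Suc (Suc l)))
     = (\<Sum>l\<in>{2..<k+2}. real (k choose l) * h ^ l * d (k - l))"
    by (rule sum.reindex_bij_witness[of _ "\<lambda>l. l - 2" "\<lambda>l. Suc (Suc l)"])
       (auto simp: numeral_2_eq_2)
  also have "\<dots> = (\<Sum>l\<in>{2..k}. real (k choose l) * h ^ l * d (k - l))"
    by (rule sum.mono_neutral_right) auto
  finally have "s * (\<Sum>i<k. g i (k - 1 - i)) \<le> s * (\<Sum>i<k. d (k - 1))
     + (1 / \<kappa>) * (\<Sum>l\<in>{2..k}. real (k choose l) * h ^ l * d (k - l))" by simp
  moreover have "tr_pow I H k = tr_pow I A k + s * (\<Sum>i<k. g i (k - 1 - i))"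
    using tk[of k 0] by (simp add: t_def tr_pow_def)
  ultimately show ?thesis by (simp add: H_def)
qed

lemma tr_pow_nonneg:
  assumes "psd_on I A" shows "0 \<le> tr_pow I A k"
proof (cases "finite I")
  case True
  have "tr_pow I A k = (\<Sum>i\<in>I. ip I (\<lambda>j. of_bool (j = i)) ((mv I A ^^ k) (\<lambda>j. of_bool (j = i))))"
    unfolding tr_pow_def by (intro sum.cong) (auto simp: ip_comm[of _ "\<lambda>j. of_bool (j = _)"] ip_indicator True)
  then show ?thesis using moment_nonneg[OF assms] by (simp add: sum_nonneg)
qed (simp add: tr_pow_def)

text \<open>For a unit vector log-convexity gives (d 1)^k \<le> d k. For even k = 2 b, d k is the
  squared norm of A^b v, hence at most the squared Hilbert-Schmidt norm of A^b, which is the trace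
  of A^k.\<close>

lemma tr_pow_ge_power:
  assumes psd: "psd_on I A" and fin: "finite I" and v: "ip I v v = 1" and k: "even k"
  shows "(ip I v (mv I A v)) ^ k \<le> tr_pow I A k"
proof -
  have sym: "sym_on I A" using psd by (simp add: psd_on_def)
  obtain b where b: "k = b + b" using k by (auto elim!: evenE simp: mult_2)
  define d where "d = (\<lambda>k. ip I v ((mv I A ^^ k) v))"
  have d0: "d 0 = 1" by (simp add: d_def v)
  have dd: "d i * d j \<le> d (i + j)" for i j
    using log_convex_mult_le[of d i j] power_moments[OF psd] d0 by (simp add: d_def)
  have dnn: "0 \<le> d k" for k using moment_nonneg[OF psd] by (simp add: d_def)
  have "(d 1) ^ k \<le> d k" for k
  proof (induction k)
    case (Suc k)
    have "(d 1) ^ Suc k \<le> d 1 * d k" using Suc dnn by (simp add: mult_left_mono)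
    also have "\<dots> \<le> d (Suc k)" using dd[of 1 k] by simp
    finally show ?case .
  qed (simp add: d0)
  then have "(ip I v (mv I A v)) ^ k \<le> d k" by (simp add: d_def)
  also have "d k = ip I ((mv I A ^^ b) v) ((mv I A ^^ b) v)"
    by (simp add: d_def b ip_mv_pow_sym[OF sym] funpow_add)
  also have "\<dots> = (\<Sum>i\<in>I. (ip I ((mv I A ^^ b) (\<lambda>j. of_bool (j = i))) v)\<^sup>2)"
  proof -
    have "(mv I A ^^ b) v i = ip I ((mv I A ^^ b) (\<lambda>j. of_bool (j = i))) v" if "i \<in> I" for i
    proof -
      have "(mv I A ^^ b) v i = ip I ((mv I A ^^ b) v) (\<lambda>j. of_bool (j = i))"
        by (rule ip_indicator[OF fin that, symmetric])
      also have "\<dots> = ip I v ((mv I A ^^ b) (\<lambda>j. of_bool (j = i)))" by (rule ip_mv_pow_sym[OF sym])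
      finally show ?thesis by (simp only: ip_comm[of I v])
    qed
    then show ?thesis by (simp add: ip_def[of I "(mv I A ^^ b) v" "(mv I A ^^ b) v"] power2_eq_square)
  qed
  also have "\<dots> \<le> (\<Sum>i\<in>I. ip I ((mv I A ^^ b) (\<lambda>j. of_bool (j = i))) ((mv I A ^^ b) (\<lambda>j. of_bool (j = i))))"
    using ip_cauchy_schwarz[of I _ v] v by (intro sum_mono) auto
  also have "\<dots> = tr_pow I A k"
    unfolding tr_pow_def
  proof (intro sum.cong refl)
    fix i assume i: "i \<in> I"
    let ?e = "\<lambda>j. of_bool (j = i) :: real"
    have "ip I ((mv I A ^^ b) ?e) ((mv I A ^^ b) ?e) = ip I ((mv I A ^^ k) ?e) ?e"
      unfolding ip_mv_pow_sym[OF sym, symmetric] by (simp add: b funpow_add)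
    then show "ip I ((mv I A ^^ b) ?e) ((mv I A ^^ b) ?e) = (mv I A ^^ k) ?e i"
      by (simp add: ip_indicator[OF fin i])
  qed
  finally show ?thesis .
qed

section \<open>Exponential series of power traces and random Gram matrices\<close>

lemma summable_exp_bounded:
  fixes t :: "nat \<Rightarrow> real"
  assumes "\<And>k. \<bar>t k\<bar> \<le> B * a ^ k" "0 \<le> a"
  shows "summable (\<lambda>k. norm (t k / fact k))"
proof (rule summable_comparison_test')
  show "summable (\<lambda>k. B * (inverse (fact k) * a ^ k))"
    using summable_exp[of a] by (rule summable_mult)
  fix n
  have "\<bar>t n\<bar> * inverse (fact n) \<le> (B * a ^ n) * inverse (fact n)"
    by (rule mult_right_mono[OF assms(1)]) simp
  then show "norm (norm (t n / fact n)) \<le> B * (inverse (fact n) * a ^ n)"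
    by (simp add: divide_inverse abs_mult mult_ac)
qed

text \<open>The first hypothesis bounds t' by a binomial convolution, so its exponential series is
  at most a Cauchy product. The second factor sums to 1 + s + (exp h - 1 - h) / \<kappa>, and exp h
  \<le> 1 + h + h^2 on the unit interval gives the stated exponent. In the application t and t' are
  mean traces of powers before and after one more sample.\<close>

lemma exp_series_step:
  fixes t t' :: "nat \<Rightarrow> real"
  assumes le: "\<And>k. t' k \<le> t k + s * real k * t (k - 1)
       + (1 / \<kappa>) * (\<Sum>l\<in>{2..k}. real (k choose l) * h ^ l * t (k - l))"
    and t: "\<And>k. \<bar>t k\<bar> \<le> B * a ^ k" and t': "\<And>k. \<bar>t' k\<bar> \<le> B' * a ^ k" and a: "0 \<le> a"
    and h: "0 \<le> h" "h \<le> 1" and \<kappa>: "0 < \<kappa>" and t0: "\<And>k. 0 \<le> t k"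
  shows "(\<Sum>k. t' k / fact k) \<le> (\<Sum>k. t k / fact k) * exp (s + h\<^sup>2 / \<kappa>)"
proof -
  \<comment> \<open>Weights of the words with l rank-one factors: exact for l = 0 and l = 1, upper
    bounds from l = 2 on.\<close>
  define c where "c = (\<lambda>l::nat. if l = 0 then 1 else if l = 1 then s else h ^ l / \<kappa>)"
  have le': "t' k / fact k \<le> (\<Sum>l\<le>k. (c l / fact l) * (t (k - l) / fact (k - l)))" for k
  proof -
    have "t k + s * real k * t (k - 1) + (1 / \<kappa>) * (\<Sum>l\<in>{2..k}. real (k choose l) * h ^ l * t (k - l))
        = (\<Sum>l\<le>k. real (k choose l) * c l * t (k - l))"
    proof (cases k)
      case (Suc k')
      have "{..k} = {0, 1} \<union> {2..k}" using Suc by auto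
      then have "(\<Sum>l\<le>k. real (k choose l) * c l * t (k - l))
         = (\<Sum>l\<in>{0,1}. real (k choose l) * c l * t (k - l)) + (\<Sum>l\<in>{2..k}. real (k choose l) * c l * t (k - l))"
        by (simp only:) (rule sum.union_disjoint, auto)
      also have "(\<Sum>l\<in>{2..k}. real (k choose l) * c l * t (k - l))
          = (1 / \<kappa>) * (\<Sum>l\<in>{2..k}. real (k choose l) * h ^ l * t (k - l))"
        unfolding sum_distrib_left by (intro sum.cong) (auto simp: c_def)
      finally show ?thesis by (simp add: c_def)
    qed (simp add: c_def)
    then have "t' k / fact k \<le> (\<Sum>l\<le>k. real (k choose l) * c l * t (k - l)) / fact k"
      using le[of k] by (simp add: divide_right_mono)
    also have "\<dots> = (\<Sum>l\<le>k. (c l / fact l) * (t (k - l) / fact (k - l)))"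
      unfolding sum_divide_distrib by (intro sum.cong) (auto simp: binomial_fact field_simps)
    finally show ?thesis .
  qed
  have sc: "summable (\<lambda>k. norm (c k / fact k))"
  proof (rule summable_exp_bounded[where B = "1 + \<bar>s\<bar> + 1 / \<kappa>" and a = 1])
    fix k have "h ^ k / \<kappa> \<le> 1 / \<kappa>" using h \<kappa> by (simp add: divide_right_mono power_le_one)
    moreover have "0 \<le> h ^ k / \<kappa>" "0 \<le> 1 / \<kappa>" using h \<kappa> by simp_all
    ultimately show "\<bar>c k\<bar> \<le> (1 + \<bar>s\<bar> + 1 / \<kappa>) * 1 ^ k" by (auto simp: c_def)
  qed simp
  have st: "summable (\<lambda>k. norm (t k / fact k))" by (rule summable_exp_bounded[OF t a])
  have st': "summable (\<lambda>k. norm (t' k / fact k))" by (rule summable_exp_bounded[OF t' a])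
  have "(\<Sum>k. t' k / fact k) \<le> (\<Sum>k. \<Sum>l\<le>k. (c l / fact l) * (t (k - l) / fact (k - l)))"
    by (rule suminf_le[OF le' summable_norm_cancel[OF st'] summable_Cauchy_product[OF sc st]])
  also have "\<dots> = (\<Sum>k. c k / fact k) * (\<Sum>k. t k / fact k)"
    using Cauchy_product_sums[OF sc st] by (simp add: sums_iff)
  also have "\<dots> \<le> exp (s + h\<^sup>2 / \<kappa>) * (\<Sum>k. t k / fact k)"
  proof (rule mult_right_mono)
    show "0 \<le> (\<Sum>k. t k / fact k)" using t0 by (intro suminf_nonneg summable_norm_cancel[OF st]) simp
    have "(\<lambda>k. h ^ k / fact k) sums exp h" using exp_converges[of h] by (simp add: divide_inverse mult.commute)
    then have "(\<lambda>k. (1 / \<kappa>) * (h ^ k / fact k)) sums ((1 / \<kappa>) * exp h)" by (rule sums_mult)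
    moreover have "(\<lambda>k. if k = 0 then 1 - 1 / \<kappa> else 0) sums (1 - 1 / \<kappa>)"
      using sums_single[of 0 "\<lambda>_. 1 - 1 / \<kappa>"] by simp
    moreover have "(\<lambda>k::nat. if k = 1 then s - h / \<kappa> else 0) sums (s - h / \<kappa>)"
      using sums_single[of 1 "\<lambda>_. s - h / \<kappa>"] by simp
    ultimately have "(\<lambda>k. (1 / \<kappa>) * (h ^ k / fact k) + (if k = 0 then 1 - 1 / \<kappa> else 0) + (if k = 1 then s - h / \<kappa> else 0))
       sums ((1 / \<kappa>) * exp h + (1 - 1 / \<kappa>) + (s - h / \<kappa>))" by (intro sums_add)
    also have "(\<lambda>k. (1 / \<kappa>) * (h ^ k / fact k) + (if k = 0 then 1 - 1 / \<kappa> else 0) + (if k = 1 then s - h / \<kappa> else 0))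
       = (\<lambda>k. c k / fact k)" by (auto simp: c_def fun_eq_iff)
    finally have "(\<Sum>k. c k / fact k) = 1 + s + (exp h - 1 - h) / \<kappa>" by (simp add: sums_iff field_simps add_divide_distrib diff_divide_distrib)
    also have "(exp h - 1 - h) / \<kappa> \<le> h\<^sup>2 / \<kappa>" using exp_bound[OF h] \<kappa> by (intro divide_right_mono) auto
    also have "1 + s + h\<^sup>2 / \<kappa> \<le> exp (s + h\<^sup>2 / \<kappa>)" unfolding add.assoc by (rule exp_ge_add_one_self)
    finally show "(\<Sum>k. c k / fact k) \<le> exp (s + h\<^sup>2 / \<kappa>)" by simp
  qed
  finally show ?thesis by (simp add: mult.commute)
qed

lemma mv_pow_bound:
  assumes A: "\<And>i j. i \<in> I \<Longrightarrow> j \<in> I \<Longrightarrow> \<bar>A i j\<bar> \<le> c" and x: "\<And>i. i \<in> I \<Longrightarrow> \<bar>x i\<bar> \<le> 1" and i: "i \<in> I" and c: "0 \<le> c"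
  shows "\<bar>(mv I A ^^ k) x i\<bar> \<le> (real (card I) * c) ^ k"
  using i
proof (induction k arbitrary: i)
  case (Suc k)
  have "\<bar>(mv I A ^^ Suc k) x i\<bar> \<le> (\<Sum>j\<in>I. \<bar>A i j\<bar> * \<bar>(mv I A ^^ k) x j\<bar>)"
    by (auto simp: mv_def abs_mult[symmetric] intro!: sum_abs)
  also have "\<dots> \<le> (\<Sum>j\<in>I. c * (real (card I) * c) ^ k)"
    using Suc A c by (intro sum_mono mult_mono) auto
  also have "\<dots> = (real (card I) * c) ^ Suc k" by simp
  finally show ?case .
qed (use x in simp)

lemma tr_pow_bound:
  assumes "\<And>i j. i \<in> I \<Longrightarrow> j \<in> I \<Longrightarrow> \<bar>A i j\<bar> \<le> c" "0 \<le> c"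
  shows "\<bar>tr_pow I A k\<bar> \<le> real (card I) * (real (card I) * c) ^ k"
proof -
  have "\<bar>tr_pow I A k\<bar> \<le> (\<Sum>i\<in>I. (real (card I) * c) ^ k)"
    unfolding tr_pow_def using assms by (intro order.trans[OF sum_abs] sum_mono mv_pow_bound) auto
  then show ?thesis by simp
qed

lemma tr_pow_measurable:
  assumes "\<And>i j. i \<in> I \<Longrightarrow> j \<in> I \<Longrightarrow> (\<lambda>y. A y i j) \<in> borel_measurable M"
  shows "(\<lambda>y. tr_pow I (A y) k) \<in> borel_measurable M"
proof -
  have "i \<in> I \<Longrightarrow> (\<lambda>y. (mv I (A y) ^^ k) x i) \<in> borel_measurable M" for i x
    by (induction k arbitrary: i) (auto simp: mv_def intro!: borel_measurable_sum borel_measurable_times assms)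
  then show ?thesis unfolding tr_pow_def by (intro borel_measurable_sum) auto
qed

lemma tr_pow_scaled_identity: "tr_pow I (\<lambda>i j. c * of_bool (i = j)) k = real (card I) * c ^ k"
proof (cases "finite I")
  case True
  have "i \<in> I \<Longrightarrow> (mv I (\<lambda>i j. c * of_bool (i = j)) ^^ k) x i = c ^ k * x i" for x i
  proof (induction k arbitrary: i)
    case (Suc k)
    have "(mv I (\<lambda>i j. c * of_bool (i = j)) ^^ Suc k) x i = c * (mv I (\<lambda>i j. c * of_bool (i = j)) ^^ k) x i"
      using Suc.prems True unfolding mv_def funpow.simps o_def
      by (subst sum.remove[of _ i]) (auto intro!: sum.neutral)
    then show ?case using Suc by simp
  qed simp
  then show ?thesis by (simp add: tr_pow_def)
qed (simp add: tr_pow_def)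

text \<open>Models one row of the least-squares matrix before scaling: a random vector with identity
  second-moment matrix and squared norm at most \<kappa>. In the application \<kappa> bounds the sum
  of the squared sup norms of the basis functions.\<close>

locale isotropic = prob_space N for N :: "'a measure" +
  fixes I :: "'i set" and \<phi> :: "'a \<Rightarrow> 'i \<Rightarrow> real" and \<kappa> :: real
  assumes fin: "finite I" and \<kappa>: "0 < \<kappa>"
    and meas: "\<And>i. i \<in> I \<Longrightarrow> (\<lambda>y. \<phi> y i) \<in> borel_measurable N"
    and bound: "\<And>y. y \<in> space N \<Longrightarrow> ip I (\<phi> y) (\<phi> y) \<le> \<kappa>"
    and ortho: "\<And>i j. i \<in> I \<Longrightarrow> j \<in> I \<Longrightarrow> (\<integral>y. \<phi> y i * \<phi> y j \<partial>N) = of_bool (i = j)"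
begin

abbreviation "P (j :: nat) \<equiv> (\<Pi>\<^sub>M i\<in>{..<j}. N)"

text \<open>For negative s the shift c keeps the matrix positive semidefinite, as the moment
  inequalities require. It moves every eigenvalue by c and cancels in the final tail bound.\<close>

definition shifted_gram :: "real \<Rightarrow> real \<Rightarrow> nat \<Rightarrow> (nat \<Rightarrow> 'a) \<Rightarrow> 'i \<Rightarrow> 'i \<Rightarrow> real" where
  "shifted_gram c s j y = (\<lambda>i l. c * of_bool (i = l) + s * (\<Sum>r<j. \<phi> (y r) i * \<phi> (y r) l))"

lemma prob_P: "prob_space (P j)"
  by (intro prob_space_PiM prob_space_axioms)

lemma entry_bound: "y \<in> space N \<Longrightarrow> i \<in> I \<Longrightarrow> l \<in> I \<Longrightarrow> \<bar>\<phi> y i * \<phi> y l\<bar> \<le> \<kappa>"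
proof -
  assume y: "y \<in> space N" and i: "i \<in> I" and l: "l \<in> I"
  have sq: "(\<phi> y i)\<^sup>2 \<le> \<kappa>" if "i \<in> I" for i
  proof -
    have "(\<phi> y i)\<^sup>2 \<le> (\<Sum>i\<in>I. (\<phi> y i)\<^sup>2)" by (rule member_le_sum[OF that]) (auto simp: fin)
    then show ?thesis using bound[OF y] by (simp add: ip_def power2_eq_square)
  qed
  have "\<bar>\<phi> y i * \<phi> y l\<bar> \<le> ((\<phi> y i)\<^sup>2 + (\<phi> y l)\<^sup>2) / 2"
    using sum_squares_bound[of "\<phi> y i" "\<phi> y l"] sum_squares_bound[of "\<phi> y i" "- \<phi> y l"] by (auto simp: abs_le_iff)
  then show ?thesis using sq[OF i] sq[OF l] by simp
qed

lemma integrable_entry: "i \<in> I \<Longrightarrow> l \<in> I \<Longrightarrow> integrable N (\<lambda>y. \<phi> y i * \<phi> y l)"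
  by (intro integrable_const_bound[where B = \<kappa>] borel_measurable_times meas AE_I2) (auto simp: entry_bound)

lemma form_shifted_gram: "ip I x (mv I (shifted_gram c s j y) x) = c * ip I x x + s * (\<Sum>r<j. (ip I (\<phi> (y r)) x)\<^sup>2)"
proof -
  have "mv I (shifted_gram c s j y) x i = c * x i + s * (\<Sum>r<j. \<phi> (y r) i * ip I (\<phi> (y r)) x)" if "i \<in> I" for i
  proof -
    have "mv I (shifted_gram c s j y) x i = (\<Sum>l\<in>I. c * of_bool (i = l) * x l) + s * (\<Sum>l\<in>I. \<Sum>r<j. \<phi> (y r) i * \<phi> (y r) l * x l)"
      by (simp add: mv_def shifted_gram_def algebra_simps sum.distrib sum_distrib_left sum_distrib_right)
    also have "(\<Sum>l\<in>I. c * of_bool (i = l) * x l) = c * x i"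
      using fin that by (subst sum.remove[of _ i]) (auto intro!: sum.neutral)
    also have "(\<Sum>l\<in>I. \<Sum>r<j. \<phi> (y r) i * \<phi> (y r) l * x l) = (\<Sum>r<j. \<phi> (y r) i * ip I (\<phi> (y r)) x)"
      by (subst sum.swap) (simp add: ip_def sum_distrib_left mult.assoc)
    finally show ?thesis .
  qed
  then have "ip I x (mv I (shifted_gram c s j y) x) = (\<Sum>i\<in>I. x i * (c * x i + s * (\<Sum>r<j. \<phi> (y r) i * ip I (\<phi> (y r)) x)))"
    by (simp add: ip_def)
  also have "\<dots> = c * ip I x x + s * (\<Sum>r<j. \<Sum>i\<in>I. x i * (\<phi> (y r) i * ip I (\<phi> (y r)) x))"
    by (subst sum.swap) (simp add: ip_def algebra_simps sum.distrib sum_distrib_left)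
  also have "(\<Sum>r<j. \<Sum>i\<in>I. x i * (\<phi> (y r) i * ip I (\<phi> (y r)) x)) = (\<Sum>r<j. (ip I (\<phi> (y r)) x)\<^sup>2)"
  proof (intro sum.cong refl)
    fix r
    have "(\<Sum>i\<in>I. x i * (\<phi> (y r) i * ip I (\<phi> (y r)) x)) = (\<Sum>i\<in>I. \<phi> (y r) i * x i) * ip I (\<phi> (y r)) x"
      unfolding sum_distrib_right by (intro sum.cong) auto
    then show "(\<Sum>i\<in>I. x i * (\<phi> (y r) i * ip I (\<phi> (y r)) x)) = (ip I (\<phi> (y r)) x)\<^sup>2"
      by (simp add: ip_def[symmetric] power2_eq_square)
  qed
  finally show ?thesis .
qed

lemma psd_shifted_gram:
  assumes y: "\<And>r. r < j \<Longrightarrow> y r \<in> space N" and cs: "0 \<le> c" "0 \<le> c + s * real j * \<kappa>"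
  shows "psd_on I (shifted_gram c s j y)"
proof -
  have "0 \<le> ip I x (mv I (shifted_gram c s j y) x)" for x
  proof (cases "0 \<le> s")
    case True
    then show ?thesis unfolding form_shifted_gram using cs by (simp add: ip_def sum_nonneg)
  next
    case False
    have nn: "0 \<le> ip I x x" by (simp add: ip_def sum_nonneg)
    have "(\<Sum>r<j. (ip I (\<phi> (y r)) x)\<^sup>2) \<le> (\<Sum>r<j. \<kappa> * ip I x x)"
    proof (intro sum_mono)
      fix r assume "r \<in> {..<j}"
      then have "ip I (\<phi> (y r)) (\<phi> (y r)) \<le> \<kappa>" using y bound by simp
      then show "(ip I (\<phi> (y r)) x)\<^sup>2 \<le> \<kappa> * ip I x x"
        using ip_cauchy_schwarz[of I "\<phi> (y r)" x] nn by (meson mult_right_mono order.trans)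
    qed
    then have "s * (real j * \<kappa> * ip I x x) \<le> s * (\<Sum>r<j. (ip I (\<phi> (y r)) x)\<^sup>2)"
      using False by (intro mult_left_mono_neg) auto
    moreover have "0 \<le> (c + s * real j * \<kappa>) * ip I x x" using cs nn by simp
    ultimately show ?thesis unfolding form_shifted_gram by (simp add: algebra_simps)
  qed
  moreover have "sym_on I (shifted_gram c s j y)" by (auto simp: sym_on_def shifted_gram_def mult.commute)
  ultimately show ?thesis by (simp add: psd_on_def)
qed

lemma shifted_gram_bound: "y \<in> space (P j) \<Longrightarrow> i \<in> I \<Longrightarrow> l \<in> I \<Longrightarrow> j \<le> m \<Longrightarrow> \<bar>shifted_gram c s j y i l\<bar> \<le> \<bar>c\<bar> + \<bar>s\<bar> * real m * \<kappa>"
proof -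
  assume y: "y \<in> space (P j)" and i: "i \<in> I" and l: "l \<in> I" and j: "j \<le> m"
  have "\<bar>\<Sum>r<j. \<phi> (y r) i * \<phi> (y r) l\<bar> \<le> (\<Sum>r<j. \<kappa>)"
    using y i l by (intro order.trans[OF sum_abs] sum_mono entry_bound) (auto simp: space_PiM)
  also have "\<dots> \<le> real m * \<kappa>" using j \<kappa> by simp
  finally have "\<bar>s\<bar> * \<bar>\<Sum>r<j. \<phi> (y r) i * \<phi> (y r) l\<bar> \<le> \<bar>s\<bar> * (real m * \<kappa>)" by (rule mult_left_mono) simp
  moreover have "\<bar>c * of_bool (i = l)\<bar> \<le> \<bar>c\<bar>" by simp
  ultimately show ?thesis unfolding shifted_gram_def abs_mult[symmetric] mult.assoc by (intro order.trans[OF abs_triangle_ineq] add_mono)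
qed

lemma shifted_gram_measurable: "i \<in> I \<Longrightarrow> l \<in> I \<Longrightarrow> (\<lambda>y. shifted_gram c s j y i l) \<in> borel_measurable (P j)"
proof -
  assume il: "i \<in> I" "l \<in> I"
  have "(\<lambda>y. \<phi> (y r) i) \<in> borel_measurable (P j)" if "r < j" "i \<in> I" for r i
    using that by (intro measurable_compose[where f = "\<lambda>y. y r" and g = "\<lambda>x. \<phi> x i", OF _ meas] measurable_component_singleton) auto
  then show ?thesis unfolding shifted_gram_def
    by (intro borel_measurable_add borel_measurable_times borel_measurable_const borel_measurable_sum) (use il in auto)
qed

lemma integrable_tr_pow: "integrable (P j) (\<lambda>y. tr_pow I (shifted_gram c s j y) k)"
proof -
  interpret P: prob_space "P j" by (rule prob_P)
  show ?thesis
    by (intro P.integrable_const_bound[where B = "real (card I) * (real (card I) * (\<bar>c\<bar> + \<bar>s\<bar> * real j * \<kappa>)) ^ k"]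
         tr_pow_measurable shifted_gram_measurable AE_I2)
       (auto intro!: tr_pow_bound shifted_gram_bound simp: \<kappa> less_imp_le)
qed

text \<open>Isotropy turns the mean of a quadratic form into a trace. Averaging the rank-one
  estimate over a sample thus produces traces of lower powers again, and the recursion
  closes.\<close>

lemma integral_moment:
  assumes "sym_on I A"
  shows "integrable N (\<lambda>y. ip I (\<phi> y) ((mv I A ^^ k) (\<phi> y)))"
    and "(\<integral>y. ip I (\<phi> y) ((mv I A ^^ k) (\<phi> y)) \<partial>N) = tr_pow I A k"
proof -
  have e: "ip I (\<phi> y) ((mv I A ^^ k) (\<phi> y))
     = (\<Sum>i\<in>I. \<Sum>j\<in>I. (mv I A ^^ k) (\<lambda>l. of_bool (l = i)) j * (\<phi> y i * \<phi> y j))" for y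
    unfolding ip_def sum_distrib_left
    by (intro sum.cong) (auto simp: mv_pow_entry[OF fin assms, of _ k "\<phi> y"] sum_distrib_left mult_ac)
  show "integrable N (\<lambda>y. ip I (\<phi> y) ((mv I A ^^ k) (\<phi> y)))"
    unfolding e by (intro Bochner_Integration.integrable_sum integrable_mult_right integrable_entry) auto
  have "(\<integral>y. ip I (\<phi> y) ((mv I A ^^ k) (\<phi> y)) \<partial>N)
     = (\<Sum>i\<in>I. \<Sum>j\<in>I. (mv I A ^^ k) (\<lambda>l. of_bool (l = i)) j * of_bool (i = j))"
    unfolding e by (simp add: integrable_entry ortho)
  also have "\<dots> = (\<Sum>i\<in>I. (mv I A ^^ k) (\<lambda>l. of_bool (l = i)) i)"
    by (intro sum.cong refl) (subst sum.remove[OF fin], auto intro!: sum.neutral)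
  finally show "(\<integral>y. ip I (\<phi> y) ((mv I A ^^ k) (\<phi> y)) \<partial>N) = tr_pow I A k"
    by (simp add: tr_pow_def)
qed

definition mean_tr_pow :: "real \<Rightarrow> real \<Rightarrow> nat \<Rightarrow> nat \<Rightarrow> real" where
  "mean_tr_pow c s j k = (\<integral>y. tr_pow I (shifted_gram c s j y) k \<partial>P j)"

lemma psd_shifted_gram_le: "y \<in> space (P j) \<Longrightarrow> j \<le> m \<Longrightarrow> 0 \<le> c \<Longrightarrow> 0 \<le> c + s * real m * \<kappa> \<Longrightarrow> psd_on I (shifted_gram c s j y)"
proof (rule psd_shifted_gram)
  assume a: "j \<le> m" "0 \<le> c" "0 \<le> c + s * real m * \<kappa>"
  show "0 \<le> c + s * real j * \<kappa>"
  proof (cases "0 \<le> s")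
    case False
    have "s * (real m * \<kappa>) \<le> s * (real j * \<kappa>)" using a False \<kappa> by (intro mult_left_mono_neg) auto
    then show ?thesis using a by simp
  qed (use a \<kappa> in simp)
qed (auto simp: space_PiM)

text \<open>The last sample is split off by Fubini. For fixed earlier samples the shifted Gram
  matrix is a fixed positive semidefinite matrix, so the rank-one estimate applies pointwise and is
  then averaged.\<close>

lemma mean_tr_pow_step:
  assumes "Suc j \<le> m" "0 \<le> c" "0 \<le> c + s * real m * \<kappa>"
  shows "mean_tr_pow c s (Suc j) k \<le> mean_tr_pow c s j k + s * real k * mean_tr_pow c s j (k - 1)
       + (1 / \<kappa>) * (\<Sum>l\<in>{2..k}. real (k choose l) * (\<bar>s\<bar> * \<kappa>) ^ l * mean_tr_pow c s j (k - l))"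
proof -
  interpret P: prob_space "P j" by (rule prob_P)
  interpret pf: product_sigma_finite "\<lambda>_::nat. N" by standard
  define U where "U = (\<lambda>y. tr_pow I (shifted_gram c s j y) k + s * real k * tr_pow I (shifted_gram c s j y) (k - 1)
       + (1 / \<kappa>) * (\<Sum>l\<in>{2..k}. real (k choose l) * (\<bar>s\<bar> * \<kappa>) ^ l * tr_pow I (shifted_gram c s j y) (k - l)))"
  have ins: "{..<Suc j} = insert j {..<j}" by auto
  have upd: "shifted_gram c s (Suc j) (y(j := x)) = (\<lambda>i l. shifted_gram c s j y i l + s * \<phi> x i * \<phi> x l)" for y x
    by (auto simp: shifted_gram_def fun_eq_iff algebra_simps)
  have "mean_tr_pow c s (Suc j) k = (\<integral>y. (\<integral>x. tr_pow I (shifted_gram c s (Suc j) (y(j := x))) k \<partial>N) \<partial>P j)"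
    unfolding mean_tr_pow_def ins by (rule pf.product_integral_insert) (use integrable_tr_pow[of "Suc j" c s k] ins in auto)
  also have "\<dots> \<le> (\<integral>y. U y \<partial>P j)"
  proof (rule integral_mono_AE')
    show "integrable (P j) U" unfolding U_def
      by (intro Bochner_Integration.integrable_add integrable_mult_right Bochner_Integration.integrable_sum integrable_tr_pow)
    have main: "(\<integral>x. tr_pow I (shifted_gram c s (Suc j) (y(j := x))) k \<partial>N) \<le> U y" if y: "y \<in> space (P j)" for y
    proof -
      have psd: "psd_on I (shifted_gram c s j y)" using y assms by (intro psd_shifted_gram_le[of y j m]) auto
      then have sym: "sym_on I (shifted_gram c s j y)" by (simp add: psd_on_def)
      have psd2: "psd_on I (shifted_gram c s (Suc j) (y(j := x)))" if "x \<in> space N" for x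
        using y assms that by (intro psd_shifted_gram_le[of _ _ m]) (auto simp: space_PiM PiE_def Pi_def extensional_def)
      let ?d = "\<lambda>k x. ip I (\<phi> x) ((mv I (shifted_gram c s j y) ^^ k) (\<phi> x))"
      let ?U = "\<lambda>x. tr_pow I (shifted_gram c s j y) k + s * real k * ?d (k - 1) x
       + (1 / \<kappa>) * (\<Sum>l\<in>{2..k}. real (k choose l) * (\<bar>s\<bar> * \<kappa>) ^ l * ?d (k - l) x)"
      note im = integral_moment[OF sym]
      have "(\<integral>x. tr_pow I (shifted_gram c s (Suc j) (y(j := x))) k \<partial>N) \<le> (\<integral>x. ?U x \<partial>N)"
      proof (rule integral_mono_AE')
        show "integrable N ?U"
          by (intro Bochner_Integration.integrable_add integrable_mult_right Bochner_Integration.integrable_sum im(1) integrable_const)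
        have le: "tr_pow I (shifted_gram c s (Suc j) (y(j := x))) k \<le> ?U x" if "x \<in> space N" for x
          unfolding upd by (intro tr_pow_rank_one_update psd fin bound \<kappa> that)
        then show "AE x in N. tr_pow I (shifted_gram c s (Suc j) (y(j := x))) k \<le> ?U x" by (rule AE_I2)
        \<comment> \<open>The majorant inherits nonnegativity from the trace below it; then only the
          majorant has to be integrable for the comparison of integrals.\<close>
        show "AE x in N. 0 \<le> ?U x"
          by (intro AE_I2 order.trans[OF tr_pow_nonneg le] psd2)
      qed
      also have "\<dots> = U y"
        unfolding U_def by (simp add: im prob_space Bochner_Integration.integrable_add)
      finally show ?thesis .
    qed
    then show "AE y in P j. (\<integral>x. tr_pow I (shifted_gram c s (Suc j) (y(j := x))) k \<partial>N) \<le> U y" by (rule AE_I2)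
    have "0 \<le> (\<integral>x. tr_pow I (shifted_gram c s (Suc j) (y(j := x))) k \<partial>N)" if "y \<in> space (P j)" for y
      using assms that by (intro integral_nonneg_AE AE_I2 tr_pow_nonneg psd_shifted_gram_le[of _ _ m])
        (auto simp: space_PiM PiE_def Pi_def extensional_def)
    then show "AE y in P j. 0 \<le> U y" using main by (intro AE_I2) (meson order.trans)
  qed
  also have "\<dots> = mean_tr_pow c s j k + s * real k * mean_tr_pow c s j (k - 1)
       + (1 / \<kappa>) * (\<Sum>l\<in>{2..k}. real (k choose l) * (\<bar>s\<bar> * \<kappa>) ^ l * mean_tr_pow c s j (k - l))"
    unfolding U_def mean_tr_pow_def by (simp add: integrable_tr_pow Bochner_Integration.integrable_add)
  finally show ?thesis .
qed

lemma mean_tr_pow_bound: "j \<le> m \<Longrightarrow> \<bar>mean_tr_pow c s j k\<bar> \<le> real (card I) * (real (card I) * (\<bar>c\<bar> + \<bar>s\<bar> * real m * \<kappa>)) ^ k"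
proof -
  assume j: "j \<le> m"
  interpret P: prob_space "P j" by (rule prob_P)
  have "\<bar>mean_tr_pow c s j k\<bar> \<le> (\<integral>y. \<bar>tr_pow I (shifted_gram c s j y) k\<bar> \<partial>P j)" unfolding mean_tr_pow_def by (rule integral_abs_bound)
  also have "\<dots> \<le> (\<integral>y. real (card I) * (real (card I) * (\<bar>c\<bar> + \<bar>s\<bar> * real m * \<kappa>)) ^ k \<partial>P j)"
    using j \<kappa> by (intro integral_mono integrable_abs integrable_tr_pow) (auto intro!: tr_pow_bound shifted_gram_bound)
  finally show ?thesis by (simp add: P.prob_space)
qed

lemma mean_tr_pow_nonneg: "j \<le> m \<Longrightarrow> 0 \<le> c \<Longrightarrow> 0 \<le> c + s * real m * \<kappa> \<Longrightarrow> 0 \<le> mean_tr_pow c s j k"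
  unfolding mean_tr_pow_def by (intro integral_nonneg_AE AE_I2 tr_pow_nonneg psd_shifted_gram_le[of _ _ m])

text \<open>The series stands for the mean trace of the exponential of the shifted Gram matrix. Each
  sample contributes a factor exp (s + s^2 \<kappa>), just as for independent nonnegative scalars
  with mean 1 and bound \<kappa>.\<close>

lemma exp_moment:
  assumes c: "0 \<le> c" "0 \<le> c + s * real m * \<kappa>" and s: "\<bar>s\<bar> * \<kappa> \<le> 1" and j: "j \<le> m"
  shows "(\<Sum>k. mean_tr_pow c s j k / fact k) \<le> real (card I) * exp c * exp (real j * (s + s\<^sup>2 * \<kappa>))"
  using j
proof (induction j)
  case 0
  have "mean_tr_pow c s 0 k = real (card I) * c ^ k" for k
    using prob_space.prob_space[OF prob_P[of 0]] by (simp add: mean_tr_pow_def shifted_gram_def tr_pow_scaled_identity)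
  moreover have "(\<lambda>k. real (card I) * (c ^ k / fact k)) sums (real (card I) * exp c)"
    using exp_converges[of c] by (intro sums_mult) (simp add: divide_inverse mult.commute)
  ultimately show ?case by (simp add: sums_iff)
next
  case (Suc j)
  have "(\<Sum>k. mean_tr_pow c s (Suc j) k / fact k) \<le> (\<Sum>k. mean_tr_pow c s j k / fact k) * exp (s + (\<bar>s\<bar> * \<kappa>)\<^sup>2 / \<kappa>)"
    by (rule exp_series_step[OF mean_tr_pow_step[OF Suc.prems c] mean_tr_pow_bound mean_tr_pow_bound])
       (use Suc.prems \<kappa> s c mean_tr_pow_nonneg[of j m c s] in \<open>auto intro!: mult_nonneg_nonneg add_nonneg_nonneg\<close>)
  also have "(\<bar>s\<bar> * \<kappa>)\<^sup>2 / \<kappa> = s\<^sup>2 * \<kappa>" using \<kappa> by (simp add: power2_eq_square field_simps)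
  also have "(\<Sum>k. mean_tr_pow c s j k / fact k) * exp (s + s\<^sup>2 * \<kappa>)
      \<le> real (card I) * exp c * exp (real j * (s + s\<^sup>2 * \<kappa>)) * exp (s + s\<^sup>2 * \<kappa>)"
    using Suc by (intro mult_right_mono) auto
  also have "\<dots> = real (card I) * exp c * exp (real (Suc j) * (s + s\<^sup>2 * \<kappa>))"
    by (simp add: mult.assoc exp_add[symmetric] algebra_simps)
  finally show ?case .
qed

text \<open>One event serves all unit vectors because the trace dominates every quadratic form. That
  comparison is available for even powers only, so exp q is estimated by 2 cosh q, whence the factor
  2. Markov's inequality is applied to the random series g.\<close>

lemma form_tail:
  assumes c: "0 \<le> c" "0 \<le> c + s * real m * \<kappa>" and s: "\<bar>s\<bar> * \<kappa> \<le> 1"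
  shows "\<exists>E\<in>sets (P m). measure (P m) (space (P m) - E) \<le> 2 * real (card I) * exp (c + real m * (s + s\<^sup>2 * \<kappa>) - b)
     \<and> (\<forall>y\<in>E. \<forall>v. ip I v v = 1 \<longrightarrow> c + s * (\<Sum>r<m. (ip I (\<phi> (y r)) v)\<^sup>2) < b)"
proof -
  interpret P: prob_space "P m" by (rule prob_P)
  let ?K = "real (card I) * (\<bar>c\<bar> + \<bar>s\<bar> * real m * \<kappa>)"
  let ?f = "\<lambda>k y. tr_pow I (shifted_gram c s m y) k / fact k"
  define g where "g = (\<lambda>y. \<Sum>k. ?f k y)"
  have K0: "0 \<le> ?K" using \<kappa> by simp
  have tb: "\<bar>tr_pow I (shifted_gram c s m y) k\<bar> \<le> real (card I) * ?K ^ k" if "y \<in> space (P m)" for y k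
    using that \<kappa> by (intro tr_pow_bound shifted_gram_bound) auto
  have sm: "summable (\<lambda>k. norm (?f k y))" if "y \<in> space (P m)" for y
    by (rule summable_exp_bounded[OF tb[OF that] K0])
  have int: "integrable (P m) (?f k)" for k by (intro integrable_divide integrable_tr_pow)
  have sI: "summable (\<lambda>k. \<integral>y. norm (?f k y) \<partial>P m)"
  proof -
    have "(\<integral>y. norm (?f k y) \<partial>P m) = mean_tr_pow c s m k / fact k" for k
    proof -
      have "(\<integral>y. norm (?f k y) \<partial>P m) = (\<integral>y. ?f k y \<partial>P m)"
        by (intro Bochner_Integration.integral_cong) (auto simp: tr_pow_nonneg psd_shifted_gram_le[of _ _ m] c)
      then show ?thesis by (simp add: mean_tr_pow_def)
    qed
    then show ?thesis using summable_norm_cancel[OF summable_exp_bounded[OF mean_tr_pow_bound K0]] by simp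
  qed
  have gi: "integrable (P m) g" unfolding g_def
    by (rule Bochner_Integration.integrable_suminf[OF int AE_I2[OF sm] sI])
  have "(\<integral>y. g y \<partial>P m) = (\<Sum>k. \<integral>y. ?f k y \<partial>P m)" unfolding g_def
    by (rule integral_suminf[OF int AE_I2[OF sm] sI])
  also have "\<dots> = (\<Sum>k. mean_tr_pow c s m k / fact k)" by (simp add: mean_tr_pow_def)
  also have "\<dots> \<le> real (card I) * exp c * exp (real m * (s + s\<^sup>2 * \<kappa>))"
    by (rule exp_moment[OF c s order_refl])
  finally have gI: "(\<integral>y. g y \<partial>P m) \<le> real (card I) * exp (c + real m * (s + s\<^sup>2 * \<kappa>))"
    by (simp add: exp_add)
  have nn: "0 \<le> ?f k y" if "y \<in> space (P m)" for k y
    using psd_shifted_gram_le[OF that order_refl c] by (simp add: tr_pow_nonneg)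
  have low: "exp (ip I v (mv I (shifted_gram c s m y) v)) / 2 \<le> g y" if y: "y \<in> space (P m)" and v: "ip I v v = 1" for y v
  proof -
    let ?q = "ip I v (mv I (shifted_gram c s m y) v)"
    have psd: "psd_on I (shifted_gram c s m y)" using psd_shifted_gram_le[OF y order_refl c] .
    have "exp ?q / 2 \<le> cosh ?q" by (simp add: cosh_field_def)
    also have "cosh ?q = (\<Sum>k. if even k then ?q ^ k /\<^sub>R fact k else 0)"
      using cosh_converges[of ?q] by (simp add: sums_iff)
    also have "\<dots> \<le> g y" unfolding g_def
    proof (rule suminf_le)
      fix k show "(if even k then ?q ^ k /\<^sub>R fact k else 0) \<le> ?f k y"
        using tr_pow_ge_power[OF psd fin v, of k] nn[OF y, of k] by (auto simp: divide_inverse mult.commute)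
    qed (use cosh_converges[of ?q] summable_norm_cancel[OF sm[OF y]] in \<open>auto simp: sums_iff\<close>)
    finally show ?thesis .
  qed
  define E where "E = {y \<in> space (P m). \<not> exp b / 2 \<le> g y}"
  have gm: "g \<in> borel_measurable (P m)" using gi by auto
  have E: "E \<in> sets (P m)" unfolding E_def using gm by measurable
  have "measure (P m) (space (P m) - E) = measure (P m) {y\<in>space (P m). g y \<ge> exp b / 2}"
    by (intro arg_cong[where f = "measure _"]) (auto simp: E_def)
  also have "\<dots> \<le> (\<integral>y. g y \<partial>P m) / (exp b / 2)"
    by (rule integral_Markov_inequality_measure[OF gi sets.empty_sets])
       (use nn in \<open>auto intro!: AE_I2 suminf_nonneg summable_norm_cancel[OF sm] simp: g_def\<close>)
  also have "\<dots> \<le> (real (card I) * exp (c + real m * (s + s\<^sup>2 * \<kappa>))) / (exp b / 2)"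
    using gI by (intro divide_right_mono) auto
  also have "\<dots> = 2 * real (card I) * exp (c + real m * (s + s\<^sup>2 * \<kappa>) - b)"
    by (simp add: exp_diff)
  finally have "measure (P m) (space (P m) - E) \<le> 2 * real (card I) * exp (c + real m * (s + s\<^sup>2 * \<kappa>) - b)" .
  moreover have "c + s * (\<Sum>r<m. (ip I (\<phi> (y r)) v)\<^sup>2) < b" if "y \<in> E" "ip I v v = 1" for y v
  proof -
    have "g y < exp b / 2" "exp (ip I v (mv I (shifted_gram c s m y) v)) / 2 \<le> g y"
      using low[of y v] that by (auto simp: E_def)
    then have "exp (ip I v (mv I (shifted_gram c s m y) v)) < exp b" by linarith
    then have "ip I v (mv I (shifted_gram c s m y) v) < b" by simp
    then show ?thesis using that by (simp add: form_shifted_gram)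
  qed
  ultimately show ?thesis using E by blast
qed

lemma sum_form_scale:
  assumes "\<And>v. ip I v v = 1 \<Longrightarrow> a \<le> (\<Sum>r<m. (ip I (\<phi> (y r)) v)\<^sup>2) \<and> (\<Sum>r<m. (ip I (\<phi> (y r)) v)\<^sup>2) \<le> b"
  shows "a * ip I v v \<le> (\<Sum>r<m. (ip I (\<phi> (y r)) v)\<^sup>2) \<and> (\<Sum>r<m. (ip I (\<phi> (y r)) v)\<^sup>2) \<le> b * ip I v v"
proof (cases "ip I v v = 0")
  case True
  then have "ip I w v = 0" for w using ip_cauchy_schwarz[of I w v] by simp
  then show ?thesis using True by simp
next
  case False
  then have pos: "0 < ip I v v" by (simp add: ip_def sum_nonneg order.not_eq_order_implies_strict)
  define u where "u = (\<lambda>i. v i / sqrt (ip I v v))"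
  have "ip I u u = ip I v v / (sqrt (ip I v v))\<^sup>2"
    by (simp add: ip_def u_def sum_divide_distrib[symmetric] power2_eq_square)
  then have sup_Psi: "ip I u u = 1" using pos by simp
  have "(ip I w u)\<^sup>2 = (ip I w v)\<^sup>2 / ip I v v" for w
  proof -
    have "ip I w u = ip I w v / sqrt (ip I v v)" by (simp add: ip_def u_def sum_divide_distrib)
    then show ?thesis using pos by (simp add: power_divide)
  qed
  then have "(\<Sum>r<m. (ip I (\<phi> (y r)) u)\<^sup>2) = (\<Sum>r<m. (ip I (\<phi> (y r)) v)\<^sup>2) / ip I v v"
    by (simp add: sum_divide_distrib)
  then show ?thesis using assms[OF sup_Psi] pos by (simp add: pos_le_divide_eq pos_divide_le_eq)
qed

text \<open>The upper bound uses s = 1 / (4 \<kappa>) without shift, the lower one -s with shift m /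
  4 = s m \<kappa>, the least that guarantees semidefiniteness. Both exponents come to -m / (16
  \<kappa>), since 1/4 + 1/16 - 3/8 = -1/4 + 1/16 + 1/8 = -1/16.\<close>

lemma concentration:
  "\<exists>E\<in>sets (P m). measure (P m) (space (P m) - E) \<le> 4 * real (card I) * exp (- (real m / (16 * \<kappa>)))
     \<and> (\<forall>y\<in>E. \<forall>v. real m / 2 * ip I v v \<le> (\<Sum>r<m. (ip I (\<phi> (y r)) v)\<^sup>2)
          \<and> (\<Sum>r<m. (ip I (\<phi> (y r)) v)\<^sup>2) \<le> 3 / 2 * real m * ip I v v)"
proof -
  interpret P: prob_space "P m" by (rule prob_P)
  define s where "s = 1 / (4 * \<kappa>)"
  have s0: "0 < s" "s * \<kappa> = 1 / 4" using \<kappa> by (simp_all add: s_def)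
  have e: "0 + real m * (s + s\<^sup>2 * \<kappa>) - s * (3 / 2 * real m) = - (real m / (16 * \<kappa>))"
    "real m / 4 + real m * (- s + (- s)\<^sup>2 * \<kappa>) - (real m / 4 - s * (real m / 2)) = - (real m / (16 * \<kappa>))"
    using \<kappa> by (simp_all add: s_def field_simps power2_eq_square)
  obtain E1 where E1: "E1 \<in> sets (P m)" "measure (P m) (space (P m) - E1) \<le> 2 * real (card I) * exp (- (real m / (16 * \<kappa>)))"
      "\<And>y v. y \<in> E1 \<Longrightarrow> ip I v v = 1 \<Longrightarrow> s * (\<Sum>r<m. (ip I (\<phi> (y r)) v)\<^sup>2) < s * (3 / 2 * real m)"
    using form_tail[of 0 s m "s * (3 / 2 * real m)"] s0 \<kappa> unfolding e(1) by auto
  obtain E2 where E2: "E2 \<in> sets (P m)" "measure (P m) (space (P m) - E2) \<le> 2 * real (card I) * exp (- (real m / (16 * \<kappa>)))"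
      "\<And>y v. y \<in> E2 \<Longrightarrow> ip I v v = 1 \<Longrightarrow> real m / 4 + - s * (\<Sum>r<m. (ip I (\<phi> (y r)) v)\<^sup>2) < real m / 4 - s * (real m / 2)"
  proof -
    have "0 \<le> real m / 4 + - s * real m * \<kappa>"
      using s0(2) by (simp add: mult.assoc mult.left_commute[of s])
    moreover have "\<bar>- s\<bar> * \<kappa> \<le> 1" using s0 by simp
    ultimately show ?thesis using form_tail[of "real m / 4" "- s" m "real m / 4 - s * (real m / 2)"] that unfolding e(2) by fastforce
  qed
  have "measure (P m) (space (P m) - (E1 \<inter> E2)) \<le> measure (P m) ((space (P m) - E1) \<union> (space (P m) - E2))"
    using E1(1) E2(1) by (intro P.finite_measure_mono) auto
  also have "\<dots> \<le> measure (P m) (space (P m) - E1) + measure (P m) (space (P m) - E2)"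
    using E1(1) E2(1) by (intro measure_Un_le) auto
  also have "\<dots> \<le> 4 * real (card I) * exp (- (real m / (16 * \<kappa>)))" using E1(2) E2(2) by simp
  finally have ms: "measure (P m) (space (P m) - (E1 \<inter> E2)) \<le> 4 * real (card I) * exp (- (real m / (16 * \<kappa>)))" .
  have "real m / 2 * ip I v v \<le> (\<Sum>r<m. (ip I (\<phi> (y r)) v)\<^sup>2) \<and> (\<Sum>r<m. (ip I (\<phi> (y r)) v)\<^sup>2) \<le> 3 / 2 * real m * ip I v v"
    if "y \<in> E1 \<inter> E2" for y v
  proof (rule sum_form_scale)
    fix v :: "'i \<Rightarrow> real" assume v: "ip I v v = 1"
    show "real m / 2 \<le> (\<Sum>r<m. (ip I (\<phi> (y r)) v)\<^sup>2) \<and> (\<Sum>r<m. (ip I (\<phi> (y r)) v)\<^sup>2) \<le> 3 / 2 * real m"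
      using E1(3)[of y v] E2(3)[of y v] that v s0(1) by simp
  qed
  then show ?thesis using ms E1(1) E2(1) by (intro bexI[of _ "E1 \<inter> E2"]) auto
qed

end

section \<open>Chebyshev polynomials and Bernstein ellipses\<close>

text \<open>Triangularity: the leading term is removed by the basis polynomial of top degree. This
  is applied to Chebyshev polynomials and to the orthonormal ones.\<close>

lemma poly_basis_degree:
  fixes p :: "nat \<Rightarrow> 'a :: field poly"
  assumes p: "\<And>k. k \<le> n \<Longrightarrow> degree (p k) = k" "\<And>k. k \<le> n \<Longrightarrow> p k \<noteq> 0"
    and Q: "degree Q \<le> n"
  shows "\<exists>a. Q = (\<Sum>k\<le>n. Polynomial.smult (a k) (p k))"
  using assms
proof (induction n arbitrary: Q)
  case 0
  obtain c d where "Q = [:c:]" "p 0 = [:d:]" using 0 by (metis degree_eq_zeroE le_zero_eq order_refl)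
  moreover from this have "d \<noteq> 0" using 0(2)[of 0] by auto
  ultimately show ?case by (intro exI[of _ "\<lambda>_. c / d"]) simp
next
  case (Suc n)
  let ?c = "Polynomial.coeff Q (Suc n) / Polynomial.coeff (p (Suc n)) (Suc n)"
  let ?R = "Q - Polynomial.smult ?c (p (Suc n))"
  have lc: "Polynomial.coeff (p (Suc n)) (Suc n) \<noteq> 0" using Suc.prems(1,2)[of "Suc n"] by (metis leading_coeff_0_iff order_refl)
  have "degree ?R \<le> n"
  proof (rule degree_le, intro allI impI)
    fix i assume "n < i"
    then consider "i = Suc n" | "Suc n < i" by linarith
    then show "Polynomial.coeff ?R i = 0"
    proof cases
      case 1
      then show ?thesis using lc Suc.prems(1)[of "Suc n"] by simp
    next
      case 2
      then show ?thesis using Suc.prems(1)[of "Suc n"] Suc.prems(3) by (simp add: coeff_eq_0)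
    qed
  qed
  then obtain a where a: "?R = (\<Sum>k\<le>n. Polynomial.smult (a k) (p k))" using Suc.IH[of ?R] Suc.prems(1,2) by auto
  have "(\<Sum>k\<le>Suc n. Polynomial.smult ((a(Suc n := ?c)) k) (p k)) = ?R + Polynomial.smult ?c (p (Suc n))"
    unfolding a by (simp cong: sum.cong_simp)
  then show ?case by (intro exI[of _ "a(Suc n := ?c)"]) simp
qed

fun chebT :: "nat \<Rightarrow> real poly" where
  "chebT 0 = 1"
| "chebT (Suc 0) = [:0, 1:]"
| "chebT (Suc (Suc n)) = [:0, 2:] * chebT (Suc n) - chebT n"

lemma poly_chebT_cos: "poly (chebT n) (cos t) = cos (real n * t)"
proof (induction n rule: chebT.induct)
  case (3 n)
  have "2 * cos t * cos (real (Suc n) * t) = cos (real (Suc (Suc n)) * t) + cos (real n * t)"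
  proof -
    have "real (Suc (Suc n)) * t = real (Suc n) * t + t" "real n * t = real (Suc n) * t - t" by (simp_all add: algebra_simps)
    then show ?thesis by (simp only: cos_add cos_diff) simp
  qed
  then show ?case using 3 by simp
qed simp_all

lemma degree_chebT: "degree (chebT n) = n"
proof -
  have "degree (chebT n) = n \<and> chebT n \<noteq> 0 \<and> degree (chebT (Suc n)) = Suc n \<and> chebT (Suc n) \<noteq> 0" for n
  proof (induction n)
    case (Suc n)
    have d: "degree ([:0, 2:] * chebT (Suc n)) = Suc (Suc n)" using Suc by (subst degree_mult_eq) auto
    have "degree (chebT (Suc (Suc n))) = Suc (Suc n)"
      using Suc d degree_add_eq_left[of "- chebT n" "[:0, 2:] * chebT (Suc n)"] by simp
    then show ?case using Suc by auto
  qed simp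
  then show ?thesis by blast
qed

lemma chebT_nonzero: "chebT n \<noteq> 0"
  using poly_chebT_cos[of n 0] by auto

lemma chebT_le_1: "\<bar>x\<bar> \<le> 1 \<Longrightarrow> \<bar>poly (chebT n) x\<bar> \<le> 1"
  using poly_chebT_cos[of n "arccos x"] by (simp add: cos_arccos_abs)

lemma sum_cos_roots_of_unity:
  assumes "0 < k" "k < N"
  shows "(\<Sum>j<N. cos (real k * (2 * pi * real j / real N))) = 0"
proof -
  let ?z = "cis (2 * pi * real k / real N)"
  have "?z \<noteq> 1"
  proof
    assume "?z = 1"
    then have "cos (2 * pi * real k / real N) = 1" by (simp add: cis.code complex_eq_iff)
    then obtain n :: int where "2 * pi * real k / real N = of_int n * 2 * pi" by (auto simp: cos_one_2pi_int)
    then have "real k = of_int n * real N" using assms by (simp add: field_simps)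
    then have "int k = n * int N" by (metis of_int_eq_iff of_int_mult of_int_of_nat_eq)
    then show False using assms by (metis nat_dvd_not_less dvd_triv_right int_dvd_int_iff)
  qed
  moreover have "?z ^ N = 1"
  proof -
    have "real N * (2 * pi * real k / real N) = 2 * pi * real k" using assms by simp
    then show ?thesis by (simp only: Complex.DeMoivre) simp
  qed
  ultimately have "(\<Sum>j<N. ?z ^ j) = 0" by (simp add: geometric_sum)
  then have "Re (\<Sum>j<N. ?z ^ j) = 0" by simp
  moreover have "Re (\<Sum>j<N. ?z ^ j) = (\<Sum>j<N. cos (real k * (2 * pi * real j / real N)))"
    by (simp add: Complex.DeMoivre mult.commute mult.left_commute)
  ultimately show ?thesis by simp
qed

text \<open>Real parts of all N-th roots of unity, so that sums over the nodes are sums over a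
  cyclic group. Indices j and N - j give the same node, so most values occur twice.\<close>

definition cheb_node :: "nat \<Rightarrow> nat \<Rightarrow> real" where
  "cheb_node N j = cos (2 * pi * real j / real N)"

definition cheb_scale :: "nat \<Rightarrow> nat \<Rightarrow> real" where
  "cheb_scale N k = (if k = 0 then 1 else 2) / real N"

lemma abs_cheb_node: "\<bar>cheb_node N j\<bar> \<le> 1"
  by (simp add: cheb_node_def)

text \<open>At the nodes the product is half the sum of the cosines of frequencies |k - l| and k +
  l. Both frequencies are below N, and a nonzero frequency below N sums to zero over the roots of
  unity.\<close>

lemma chebT_discrete_ortho:
  assumes "k + l < N"
  shows "cheb_scale N k * (\<Sum>j<N. poly (chebT k) (cheb_node N j) * poly (chebT l) (cheb_node N j)) = of_bool (k = l)"
proof -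
  have s: "(\<Sum>j<N. cos (real i * (2 * pi * real j / real N))) = (if i = 0 then real N else 0)" if "i < N" for i
    using that sum_cos_roots_of_unity[of i N] by auto
  have "(\<Sum>j<N. poly (chebT k) (cheb_node N j) * poly (chebT l) (cheb_node N j))
      = (\<Sum>j<N. (cos (real (nat \<bar>int k - int l\<bar>) * (2 * pi * real j / real N)) + cos (real (k + l) * (2 * pi * real j / real N))) / 2)"
  proof (intro sum.cong refl)
    fix j let ?t = "2 * pi * real j / real N"
    have "cos (real k * ?t - real l * ?t) = cos (real (nat \<bar>int k - int l\<bar>) * ?t)"
    proof (cases "l \<le> k")
      case True
      then have e: "nat \<bar>int k - int l\<bar> = k - l" by auto
      show ?thesis by (simp only: e of_nat_diff[OF True] left_diff_distrib)
    next
      case False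
      then have e: "nat \<bar>int k - int l\<bar> = l - k" by auto
      have "cos (real k * ?t - real l * ?t) = cos (- (real k * ?t - real l * ?t))" by (simp only: cos_minus)
      also have "- (real k * ?t - real l * ?t) = real (l - k) * ?t"
        using False by (simp only: of_nat_diff[of k l] left_diff_distrib)
      finally show ?thesis unfolding e .
    qed
    then show "poly (chebT k) (cheb_node N j) * poly (chebT l) (cheb_node N j)
       = (cos (real (nat \<bar>int k - int l\<bar>) * ?t) + cos (real (k + l) * ?t)) / 2"
      unfolding cheb_node_def poly_chebT_cos cos_times_cos by (simp add: distrib_right add_divide_distrib)
  qed
  also have "\<dots> = ((if nat \<bar>int k - int l\<bar> = 0 then real N else 0) + (if k + l = 0 then real N else 0)) / 2"
    using assms s[of "nat \<bar>int k - int l\<bar>"] s[of "k + l"]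
    by (subst sum_divide_distrib[symmetric], subst sum.distrib) simp
  finally show ?thesis using assms by (auto simp: cheb_scale_def)
qed

text \<open>Projecting through values at finitely many real nodes, instead of integrating over one variable,
  keeps separate holomorphy in the other variables and needs no measurability of the extension off the cube.\<close>

definition cheb_lagrange :: "nat \<Rightarrow> nat \<Rightarrow> real poly" where
  "cheb_lagrange n j = (\<Sum>k<n. Polynomial.smult (cheb_scale (2 * n) k * poly (chebT k) (cheb_node (2 * n) j)) (chebT k))"

lemma degree_cheb_lagrange: "0 < n \<Longrightarrow> degree (cheb_lagrange n j) < n"
  unfolding cheb_lagrange_def
  by (intro degree_sum_less) (auto intro: le_less_trans[OF degree_smult_le] simp: degree_chebT)

lemma cheb_lagrange_reproduce:
  assumes "l < n"
  shows "(\<Sum>j<2*n. poly (cheb_lagrange n j) x * poly (chebT l) (cheb_node (2 * n) j)) = poly (chebT l) x"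
proof -
  have "(\<Sum>j<2*n. poly (cheb_lagrange n j) x * poly (chebT l) (cheb_node (2 * n) j))
     = (\<Sum>k<n. poly (chebT k) x * (cheb_scale (2*n) k * (\<Sum>j<2*n. poly (chebT k) (cheb_node (2*n) j) * poly (chebT l) (cheb_node (2*n) j))))"
    unfolding cheb_lagrange_def poly_sum sum_distrib_right sum_distrib_left
    by (subst sum.swap) (simp add: mult_ac)
  also have "\<dots> = (\<Sum>k<n. poly (chebT k) x * of_bool (k = l))"
    using assms by (intro sum.cong refl) (simp add: chebT_discrete_ortho)
  also have "\<dots> = poly (chebT l) x" using assms by (simp add: sum.remove[of _ l] of_bool_def if_distrib cong: if_cong)
  finally show ?thesis .
qed

text \<open>Each of the n summands is at most 2 / (2 n). With 2 n nodes the projection has norm at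
  most 2 n, a polynomial loss which the geometric decay absorbs.\<close>

lemma cheb_lagrange_le_1:
  assumes "\<bar>x\<bar> \<le> 1" "0 < n" shows "\<bar>poly (cheb_lagrange n j) x\<bar> \<le> 1"
proof -
  have "\<bar>poly (cheb_lagrange n j) x\<bar> \<le> (\<Sum>k<n. cheb_scale (2*n) k * \<bar>poly (chebT k) (cheb_node (2 * n) j)\<bar> * \<bar>poly (chebT k) x\<bar>)"
    unfolding cheb_lagrange_def poly_sum
    by (rule order.trans[OF sum_abs]) (simp add: abs_mult cheb_scale_def)
  also have "\<dots> \<le> (\<Sum>k<n. (1 / real n) * 1 * 1)"
    using assms(2) by (intro sum_mono mult_mono chebT_le_1 abs_cheb_node assms) (auto simp: cheb_scale_def field_simps)
  also have "\<dots> = 1" using assms by simp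
  finally show ?thesis .
qed

section \<open>Confocal ellipses and Cauchy's formula in the Joukowski coordinate\<close>

definition joukowski :: "complex \<Rightarrow> complex" where
  "joukowski w = (w + inverse w) / 2"

text \<open>The image of w differs from the foci 1 and -1 by (w - 1)^2 / (2 w) and (w + 1)^2 / (2
  w), and the parallelogram law evaluates the sum of the distances as |w| + 1 / |w|. The implicit
  description exhibits convexity and interior points, on which Cauchy's formula relies.\<close>

lemma bernstein_ellipse_iff:
  assumes "1 \<le> \<rho>"
  shows "z \<in> bernstein_ellipse \<rho> \<longleftrightarrow> cmod (z - 1) + cmod (z + 1) \<le> \<rho> + 1 / \<rho>"
proof -
  have sum: "cmod (joukowski w - 1) + cmod (joukowski w + 1) = cmod w + 1 / cmod w" if "w \<noteq> 0" for w
  proof -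
    have "joukowski w - 1 = (w - 1)\<^sup>2 / (2 * w)" "joukowski w + 1 = (w + 1)\<^sup>2 / (2 * w)"
      using that by (simp_all add: joukowski_def field_simps power2_eq_square)
    then have "cmod (joukowski w - 1) + cmod (joukowski w + 1) = ((cmod (w - 1))\<^sup>2 + (cmod (w + 1))\<^sup>2) / (2 * cmod w)"
      by (simp add: norm_divide norm_power norm_mult add_divide_distrib)
    also have "(cmod (w - 1))\<^sup>2 + (cmod (w + 1))\<^sup>2 = 2 * (cmod w)\<^sup>2 + 2"
      by (simp add: cmod_power2) (simp add: power2_eq_square algebra_simps)
    finally show ?thesis using that by (simp add: field_simps power2_eq_square)
  qed
  have mono: "r + 1 / r \<le> \<rho> + 1 / \<rho> \<longleftrightarrow> r \<le> \<rho>" if "1 \<le> r" for r :: real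
  proof -
    have "(\<rho> + 1 / \<rho>) - (r + 1 / r) = (\<rho> - r) * (1 - 1 / (r * \<rho>))" using that assms by (simp add: field_simps)
    moreover have "1 / (r * \<rho>) \<le> 1" using that assms by (simp add: divide_le_eq_1 mult_ge1_I)
    moreover have "1 / (r * \<rho>) < 1" if "\<rho> < r"
    proof -
      have "1 < r * \<rho>" using that assms by (metis dual_order.strict_trans2 less_1_mult linorder_not_le mult.right_neutral order_antisym_conv)
      then show ?thesis by simp
    qed
    ultimately show ?thesis
      by (smt (verit, best) mult_nonneg_nonneg mult_neg_pos)
  qed
  show ?thesis
  proof
    assume "z \<in> bernstein_ellipse \<rho>"
    then obtain w where w: "z = joukowski w" "1 \<le> cmod w" "cmod w \<le> \<rho>" by (auto simp: bernstein_ellipse_def joukowski_def)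
    then have "w \<noteq> 0" by auto
    then show "cmod (z - 1) + cmod (z + 1) \<le> \<rho> + 1 / \<rho>" using sum w mono by auto
  next
    assume z: "cmod (z - 1) + cmod (z + 1) \<le> \<rho> + 1 / \<rho>"
    define w0 where "w0 = z + csqrt (z\<^sup>2 - 1)"
    have prod: "w0 * (z - csqrt (z\<^sup>2 - 1)) = 1"
    proof -
      have "w0 * (z - csqrt (z\<^sup>2 - 1)) = z\<^sup>2 - (csqrt (z\<^sup>2 - 1))\<^sup>2" by (simp add: w0_def power2_eq_square algebra_simps)
      then show ?thesis by simp
    qed
    then have w0: "w0 \<noteq> 0" "inverse w0 = z - csqrt (z\<^sup>2 - 1)" by (auto simp: inverse_unique)
    \<comment> \<open>The points w0 and 1 / w0 have the same image z; the one outside the open unit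
      disc is taken.\<close>
    define w where "w = (if 1 \<le> cmod w0 then w0 else inverse w0)"
    have "joukowski w0 = z" unfolding joukowski_def w0(2) by (simp add: w0_def)
    moreover have "joukowski (inverse w0) = joukowski w0" by (simp add: joukowski_def add.commute)
    ultimately have w: "w \<noteq> 0" "joukowski w = z" using w0(1) by (auto simp: w_def)
    have "1 \<le> cmod w" using w0(1) by (auto simp: w_def norm_inverse intro!: one_le_inverse)
    moreover have "cmod w \<le> \<rho>" using sum[OF w(1)] z mono[OF \<open>1 \<le> cmod w\<close>] w(2) by simp
    ultimately show "z \<in> bernstein_ellipse \<rho>" using w(2) by (force simp: bernstein_ellipse_def joukowski_def)
  qed
qed

lemma convex_bernstein_ellipse: "1 \<le> \<rho> \<Longrightarrow> convex (bernstein_ellipse \<rho>)"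
proof -
  assume \<rho>: "1 \<le> \<rho>"
  show ?thesis
  proof (rule convexI)
    fix x y and u v :: real
    assume x: "x \<in> bernstein_ellipse \<rho>" and y: "y \<in> bernstein_ellipse \<rho>" and uv: "0 \<le> u" "0 \<le> v" "u + v = 1"
    have tri: "cmod (u *\<^sub>R x + v *\<^sub>R y - c) \<le> u * cmod (x - c) + v * cmod (y - c)" for c
    proof -
      have "u *\<^sub>R x + v *\<^sub>R y - c = u *\<^sub>R (x - c) + v *\<^sub>R (y - c)"
        using uv(3) by (simp add: scaleR_diff_right algebra_simps scaleR_add_left[symmetric])
      then show ?thesis using norm_triangle_ineq[of "u *\<^sub>R (x - c)" "v *\<^sub>R (y - c)"] uv by simp
    qed
    have "cmod (u *\<^sub>R x + v *\<^sub>R y - 1) + cmod (u *\<^sub>R x + v *\<^sub>R y + 1)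
        \<le> u * (cmod (x - 1) + cmod (x + 1)) + v * (cmod (y - 1) + cmod (y + 1))"
      using tri[of 1] tri[of "-1"] by (simp add: algebra_simps)
    also have "\<dots> \<le> u * (\<rho> + 1 / \<rho>) + v * (\<rho> + 1 / \<rho>)"
      using x y uv by (intro add_mono[OF mult_left_mono mult_left_mono]) (auto simp: bernstein_ellipse_iff[OF \<rho>])
    also have "\<dots> = \<rho> + 1 / \<rho>" using uv(3) by (simp add: distrib_right[symmetric])
    finally show "u *\<^sub>R x + v *\<^sub>R y \<in> bernstein_ellipse \<rho>" by (simp add: bernstein_ellipse_iff[OF \<rho>])
  qed
qed

lemma real_in_bernstein_ellipse: "1 \<le> \<rho> \<Longrightarrow> \<bar>x\<bar> \<le> 1 \<Longrightarrow> complex_of_real x \<in> bernstein_ellipse \<rho>"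
proof -
  assume \<rho>: "1 \<le> \<rho>" and x: "\<bar>x\<bar> \<le> 1"
  have "cmod (complex_of_real x - 1) = 1 - x" "cmod (complex_of_real x + 1) = 1 + x"
    using x norm_of_real[of "x - 1", where ?'a = complex] norm_of_real[of "x + 1", where ?'a = complex] by (auto simp del: norm_of_real)
  moreover have "2 \<le> \<rho> + 1 / \<rho>"
  proof -
    have "0 \<le> (\<rho> - 1)\<^sup>2 / \<rho>" using \<rho> by simp
    also have "\<dots> = \<rho> + 1 / \<rho> - 2" using \<rho> by (simp add: field_simps power2_eq_square)
    finally show ?thesis by simp
  qed
  ultimately show ?thesis by (simp add: bernstein_ellipse_iff[OF \<rho>])
qed

lemma real_in_interior_bernstein_ellipse:
  assumes "1 < \<rho>" "\<bar>x\<bar> \<le> 1" shows "complex_of_real x \<in> interior (bernstein_ellipse \<rho>)"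
proof (rule interiorI)
  let ?U = "{z. cmod (z - 1) + cmod (z + 1) < \<rho> + 1 / \<rho>}"
  show "open ?U" by (intro open_Collect_less continuous_intros)
  show "?U \<subseteq> bernstein_ellipse \<rho>" using assms by (auto simp: bernstein_ellipse_iff)
  have "cmod (complex_of_real x - 1) = 1 - x" "cmod (complex_of_real x + 1) = 1 + x"
    using assms norm_of_real[of "x - 1", where ?'a = complex] norm_of_real[of "x + 1", where ?'a = complex] by (auto simp del: norm_of_real)
  moreover have "2 < \<rho> + 1 / \<rho>"
  proof -
    have "0 < (\<rho> - 1)\<^sup>2 / \<rho>" using assms by simp
    also have "\<dots> = \<rho> + 1 / \<rho> - 2" using assms by (simp add: field_simps power2_eq_square)
    finally show ?thesis by simp
  qed
  ultimately show "complex_of_real x \<in> ?U" by simp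
qed

lemma joukowski_deriv: "w \<noteq> 0 \<Longrightarrow> deriv joukowski w = (1 - 1 / w\<^sup>2) / 2"
proof -
  assume w: "w \<noteq> 0"
  have "(joukowski has_field_derivative (1 + - (inverse w ^ Suc (Suc 0))) / 2) (at w)"
    unfolding joukowski_def[abs_def] by (intro DERIV_cdivide DERIV_add DERIV_ident DERIV_inverse w)
  then have "deriv joukowski w = (1 + - (inverse w ^ Suc (Suc 0))) / 2" by (rule DERIV_imp_deriv)
  also have "\<dots> = (1 - 1 / w\<^sup>2) / 2" using w by (simp add: field_simps power2_eq_square)
  finally show ?thesis .
qed

lemma joukowski_analytic: "joukowski analytic_on - {0}"
proof -
  have "(\<lambda>w. (w + inverse w) / 2) holomorphic_on (- {0} :: complex set)"
    by (intro holomorphic_on_divide holomorphic_on_add holomorphic_on_ident holomorphic_on_inverse holomorphic_on_const) auto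
  moreover have "open (- {0 :: complex})" by (intro open_Compl closed_singleton)
  ultimately show ?thesis unfolding joukowski_def[abs_def] by (simp only: analytic_on_open)
qed

text \<open>In the coordinate w the Cauchy kernel at cos t has simple poles at the two preimages cis
  t and cis (-t) of cos t and at 0, with residues 1, 1 and -1.\<close>

lemma joukowski_kernel:
  assumes w: "1 < cmod w"
  shows "joukowski w \<noteq> complex_of_real (cos t)"
    and "deriv joukowski w / (joukowski w - complex_of_real (cos t)) = 1 / (w - cis t) + 1 / (w - cis (- t)) - 1 / w"
proof -
  have w0: "w \<noteq> 0" using w by auto
  have ne: "w - cis t \<noteq> 0" "w - cis (- t) \<noteq> 0" using w by auto
  have cc: "cis t * cis (- t) = 1" by (simp add: cis_mult)
  have c2: "complex_of_real (cos t) = (cis t + cis (- t)) / 2" by (simp add: complex_eq_iff)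
  have e: "joukowski w - complex_of_real (cos t) = (w - cis t) * (w - cis (- t)) / (2 * w)"
  proof -
    have "(w - cis t) * (w - cis (- t)) = w * w - w * (cis t + cis (- t)) + 1" using cc by (simp add: algebra_simps)
    then show ?thesis unfolding c2 joukowski_def using w0 by (simp add: field_simps)
  qed
  show "joukowski w \<noteq> complex_of_real (cos t)" using e ne w0 by auto
  have "1 / (w - cis t) + 1 / (w - cis (- t)) - 1 / w
      = (w * (w - cis (- t)) + w * (w - cis t) - (w - cis t) * (w - cis (- t))) / (w * ((w - cis t) * (w - cis (- t))))"
  proof -
    have "1 / a + 1 / b - 1 / w = (w * b + w * a - a * b) / (w * (a * b))" if "a \<noteq> 0" "b \<noteq> 0" for a b
      using that w0 by (simp add: field_simps)
    then show ?thesis using ne by blast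
  qed
  also have "w * (w - cis (- t)) + w * (w - cis t) - (w - cis t) * (w - cis (- t)) = w * w - 1"
    using cc by (simp add: algebra_simps)
  also have "(w * w - 1) / (w * ((w - cis t) * (w - cis (- t)))) = deriv joukowski w / (joukowski w - complex_of_real (cos t))"
  proof -
    have k: "(w * w - 1) / (w * P) = ((1 - 1 / w\<^sup>2) / 2) / (P / (2 * w))" if "P \<noteq> 0" for P
      using that w0 by (simp add: field_simps power2_eq_square)
    show ?thesis unfolding e joukowski_deriv[OF w0] by (rule k) (use ne in simp)
  qed
  finally show "deriv joukowski w / (joukowski w - complex_of_real (cos t)) = 1 / (w - cis t) + 1 / (w - cis (- t)) - 1 / w" ..
qed

text \<open>Cauchy's formula along the boundary of the convex ellipse, pulled back to a circle. The
  winding number is found analytically: for f = 1 the pulled-back integral consists of three circle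
  integrals with signs 1, 1 and -1.\<close>

lemma cauchy_bernstein_ellipse:
  assumes \<rho>: "1 < \<rho>" and f: "f holomorphic_on bernstein_ellipse \<rho>"
  shows "((\<lambda>w. f (joukowski w) * (1 / (w - cis t) + 1 / (w - cis (- t)) - 1 / w))
    has_contour_integral 2 * of_real pi * \<i> * f (complex_of_real (cos t))) (circlepath 0 \<rho>)"
proof -
  define C where "C = circlepath (0::complex) \<rho>"
  define \<gamma> where "\<gamma> = joukowski \<circ> C"
  let ?p = "complex_of_real (cos t)"
  let ?k = "\<lambda>w. 1 / (w - cis t) + 1 / (w - cis (- t)) - 1 / w"
  have imC: "path_image C = {w. cmod w = \<rho>}" using \<rho> by (auto simp: C_def sphere_def dist_norm)
  have vC: "valid_path C" by (simp add: C_def)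
  have subC: "path_image C \<subseteq> - {0}" using \<rho> by (auto simp: imC)
  have v: "valid_path \<gamma>" unfolding \<gamma>_def
    by (rule valid_path_compose_analytic[OF vC joukowski_analytic subC])
  have im: "path_image \<gamma> = joukowski ` {w. cmod w = \<rho>}" by (simp add: \<gamma>_def path_image_compose imC)
  have imE: "path_image \<gamma> \<subseteq> bernstein_ellipse \<rho>" unfolding im bernstein_ellipse_def joukowski_def using \<rho> by force
  have pn: "?p \<notin> path_image \<gamma>"
  proof
    assume "?p \<in> path_image \<gamma>"
    then obtain w where "cmod w = \<rho>" "joukowski w = ?p" unfolding im by (metis (mono_tags) image_iff mem_Collect_eq)
    then show False using joukowski_kernel(1)[of w t] \<rho> by simp
  qed
  have closed: "pathfinish \<gamma> = pathstart \<gamma>" by (simp add: \<gamma>_def C_def pathfinish_compose pathstart_compose)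
  have pull: "contour_integral \<gamma> (\<lambda>z. g z / (z - ?p)) = contour_integral C (\<lambda>w. g (joukowski w) * ?k w)" for g
  proof -
    have "contour_integral \<gamma> (\<lambda>z. g z / (z - ?p)) = contour_integral C (\<lambda>w. deriv joukowski w * (g (joukowski w) / (joukowski w - ?p)))"
      unfolding \<gamma>_def by (rule contour_integral_comp_analyticW[OF joukowski_analytic vC subC])
    also have "\<dots> = contour_integral C (\<lambda>w. g (joukowski w) * ?k w)"
    proof (rule contour_integral_eq)
      fix w assume "w \<in> path_image C"
      then have w: "1 < cmod w" using \<rho> by (simp add: imC)
      have "deriv joukowski w * (g (joukowski w) / (joukowski w - ?p)) = g (joukowski w) * (deriv joukowski w / (joukowski w - ?p))" by simp
      then show "deriv joukowski w * (g (joukowski w) / (joukowski w - ?p)) = g (joukowski w) * ?k w"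
        by (simp only: joukowski_kernel(2)[OF w])
    qed
    finally show ?thesis .
  qed
  have c1: "((\<lambda>w. 1 / (w - a)) has_contour_integral 2 * of_real pi * \<i> * 1) C" if "cmod a < \<rho>" for a
    unfolding C_def by (rule Cauchy_integral_circlepath) (use that in \<open>auto intro: continuous_intros holomorphic_intros\<close>)
  have "(?k has_contour_integral (2 * of_real pi * \<i> * 1 + 2 * of_real pi * \<i> * 1 - 2 * of_real pi * \<i> * 1)) C"
    using c1[of "cis t"] c1[of "cis (- t)"] c1[of 0] \<rho> by (intro has_contour_integral_diff has_contour_integral_add) auto
  then have "contour_integral C ?k = 2 * of_real pi * \<i>" by (simp add: contour_integral_unique)
  then have "contour_integral \<gamma> (\<lambda>z. 1 / (z - ?p)) = 2 * of_real pi * \<i>" using pull[of "\<lambda>_. 1"] by simp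
  then have wn: "winding_number \<gamma> ?p = 1" using winding_number_valid_path[OF v pn] by simp
  have "((\<lambda>z. f z / (z - ?p)) has_contour_integral (2 * pi * \<i> * winding_number \<gamma> ?p * f ?p)) \<gamma>"
    using \<rho> pn imE by (intro Cauchy_integral_formula_convex_simple[OF convex_bernstein_ellipse f _ v _ closed]
        real_in_interior_bernstein_ellipse) auto
  then have val: "contour_integral C (\<lambda>w. f (joukowski w) * ?k w) = 2 * of_real pi * \<i> * f ?p"
    unfolding pull[symmetric] wn by (simp add: contour_integral_unique)
  have "(\<lambda>w. f (joukowski w) * ?k w) contour_integrable_on C" unfolding C_def
  proof (rule contour_integrable_continuous_circlepath)
    have "joukowski ` path_image C \<subseteq> bernstein_ellipse \<rho>" using imE by (simp add: im imC)
    moreover have "continuous_on (path_image C) joukowski"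
      using subC unfolding joukowski_def by (intro continuous_intros) auto
    ultimately have "continuous_on (path_image C) (\<lambda>w. f (joukowski w))"
      by (rule continuous_on_compose2[OF holomorphic_on_imp_continuous_on[OF f], rotated])
    moreover have "w - cis s \<noteq> 0" "w \<noteq> 0" if "w \<in> path_image C" for w s
      using that \<rho> by (auto simp: imC)
    ultimately show "continuous_on (path_image (circlepath 0 \<rho>)) (\<lambda>w. f (joukowski w) * ?k w)"
      unfolding C_def by (intro continuous_intros) auto
  qed
  then have "((\<lambda>w. f (joukowski w) * ?k w) has_contour_integral contour_integral C (\<lambda>w. f (joukowski w) * ?k w)) C"
    by (rule has_contour_integral_integral)
  then show ?thesis unfolding val unfolding C_def .
qed

text \<open>The kernel is expanded in powers of 1 / w. As cis (k t) + cis (-k t) is twice the k-th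
  Chebyshev polynomial at cos t, the functional annihilates all powers covered by the first n terms.
  On the circle of radius \<rho> only the geometric remainder is left, of order \<rho>^(-n).\<close>

lemma functional_bound_bernstein:
  fixes \<alpha> :: "'j \<Rightarrow> real" and x :: "'j \<Rightarrow> real"
  assumes \<rho>: "1 < \<rho>" and f: "f holomorphic_on bernstein_ellipse \<rho>"
    and B: "\<And>z. z \<in> bernstein_ellipse \<rho> \<Longrightarrow> cmod (f z) \<le> B"
    and x: "\<And>j. j \<in> A \<Longrightarrow> \<bar>x j\<bar> \<le> 1" and fin: "finite A" and n: "0 < n"
    and kill: "\<And>k. k < n \<Longrightarrow> (\<Sum>j\<in>A. \<alpha> j * poly (chebT k) (x j)) = 0"
  shows "cmod (\<Sum>j\<in>A. complex_of_real (\<alpha> j) * f (complex_of_real (x j))) \<le> (\<Sum>j\<in>A. \<bar>\<alpha> j\<bar>) * B * (2 / (1 - 1 / \<rho>)) / \<rho> ^ n"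
proof -
  define t where "t = (\<lambda>j. arccos (x j))"
  define R where "R = (\<lambda>s w. (cis s / w) ^ n / (1 - cis s / w))"
  have ct: "cos (t j) = x j" if "j \<in> A" for j using x[OF that] by (simp add: t_def cos_arccos_abs)
  let ?k = "\<lambda>t w. 1 / (w - cis t) + 1 / (w - cis (- t)) - 1 / w"
  have geo: "1 / (w - cis s) = (1 / w) * ((\<Sum>k<n. (cis s / w) ^ k) + R s w)" if "1 < cmod w" for w s
  proof -
    have w: "w \<noteq> 0" and ne: "cis s / w \<noteq> 1" using that by (auto simp: divide_eq_1_iff)
    have "(\<Sum>k<n. q ^ k) + q ^ n / (1 - q) = 1 / (1 - q)" if "q \<noteq> 1" for q :: complex
      by (simp add: sum_gp_strict that add_divide_distrib[symmetric])
    then have "(\<Sum>k<n. (cis s / w) ^ k) + R s w = 1 / (1 - cis s / w)" unfolding R_def using ne by blast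
    moreover have "1 - cis s / w = (w - cis s) / w" using w by (simp add: diff_divide_distrib)
    ultimately show ?thesis using w by simp
  qed
  have ker: "?k (t j) w = (1 / w) * (-1 + (\<Sum>k<n. 2 * complex_of_real (poly (chebT k) (x j)) * inverse w ^ k) + (R (t j) w + R (- t j) w))"
    if w: "1 < cmod w" and j: "j \<in> A" for w j
  proof -
    have "(cis (t j) / w) ^ k + (cis (- t j) / w) ^ k = 2 * complex_of_real (poly (chebT k) (x j)) * inverse w ^ k" for k
    proof -
      have "poly (chebT k) (x j) = cos (real k * t j)" using poly_chebT_cos[of k "t j"] ct[OF j] by simp
      moreover have "cis (real k * t j) + cis (- (real k * t j)) = 2 * complex_of_real (cos (real k * t j))" by (simp add: complex_eq_iff)
      moreover have "(cis (t j) / w) ^ k + (cis (- t j) / w) ^ k = (cis (real k * t j) + cis (- (real k * t j))) * inverse w ^ k"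
        by (simp only: divide_inverse power_mult_distrib Complex.DeMoivre) (simp add: distrib_right)
      ultimately show ?thesis by simp
    qed
    then have "(\<Sum>k<n. 2 * complex_of_real (poly (chebT k) (x j)) * inverse w ^ k) = (\<Sum>k<n. (cis (t j) / w) ^ k) + (\<Sum>k<n. (cis (- t j) / w) ^ k)"
      by (simp add: sum.distrib[symmetric])
    then show ?thesis unfolding geo[OF w] by (simp add: algebra_simps)
  qed
  have hi: "((\<lambda>w. \<Sum>j\<in>A. complex_of_real (\<alpha> j) * (f (joukowski w) * ?k (t j) w)) has_contour_integral
      (\<Sum>j\<in>A. complex_of_real (\<alpha> j) * (2 * of_real pi * \<i> * f (complex_of_real (cos (t j)))))) (circlepath 0 \<rho>)"
    by (intro has_contour_integral_sum[OF fin] has_contour_integral_lmul cauchy_bernstein_ellipse \<rho> f)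
  have hb: "cmod (\<Sum>j\<in>A. complex_of_real (\<alpha> j) * (f (joukowski w) * ?k (t j) w))
      \<le> (\<Sum>j\<in>A. \<bar>\<alpha> j\<bar>) * B * (2 / (1 - 1 / \<rho>)) / \<rho> ^ n / \<rho>" if w: "cmod (w - 0) = \<rho>" for w
  proof -
    have w1: "1 < cmod w" and w0: "w \<noteq> 0" using w \<rho> by auto
    \<comment> \<open>The pole at 0 contributes the -1, a multiple of the Chebyshev polynomial of
      degree 0; it is annihilated as well because 0 < n.\<close>
    have z: "(\<Sum>j\<in>A. complex_of_real (\<alpha> j) * (-1 + (\<Sum>k<n. 2 * complex_of_real (poly (chebT k) (x j)) * inverse w ^ k))) = 0"
    proof -
      have kc: "(\<Sum>j\<in>A. complex_of_real (\<alpha> j) * complex_of_real (poly (chebT k) (x j))) = 0" if "k < n" for k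
        using arg_cong[OF kill[OF that], of complex_of_real] by simp
      have "(\<Sum>j\<in>A. complex_of_real (\<alpha> j) * (-1 + (\<Sum>k<n. 2 * complex_of_real (poly (chebT k) (x j)) * inverse w ^ k)))
         = - (\<Sum>j\<in>A. complex_of_real (\<alpha> j)) + (\<Sum>j\<in>A. \<Sum>k<n. complex_of_real (\<alpha> j) * (2 * complex_of_real (poly (chebT k) (x j)) * inverse w ^ k))"
        by (simp add: right_diff_distrib sum_subtractf sum_distrib_left)
      also have "(\<Sum>j\<in>A. \<Sum>k<n. complex_of_real (\<alpha> j) * (2 * complex_of_real (poly (chebT k) (x j)) * inverse w ^ k))
         = (\<Sum>k<n. (2 * inverse w ^ k) * (\<Sum>j\<in>A. complex_of_real (\<alpha> j) * complex_of_real (poly (chebT k) (x j))))"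
        unfolding sum_distrib_left by (subst sum.swap) (simp add: mult_ac)
      also have "\<dots> = 0" using kc by simp
      finally show ?thesis using kc[OF n] by simp
    qed
    have R: "cmod (R s w) \<le> (1 / (1 - 1 / \<rho>)) / \<rho> ^ n" for s
    proof -
      have "1 - 1 / \<rho> \<le> cmod (1 - cis s / w)"
        using norm_triangle_ineq2[of 1 "cis s / w"] w by (simp add: norm_divide)
      moreover have "0 < 1 - 1 / \<rho>" using \<rho> by simp
      ultimately have "1 / cmod (1 - cis s / w) \<le> 1 / (1 - 1 / \<rho>)" by (intro divide_left_mono mult_pos_pos) auto
      moreover have "cmod (R s w) = (1 / cmod (1 - cis s / w)) / \<rho> ^ n"
        using w by (simp add: R_def norm_divide norm_power power_divide norm_mult)
      ultimately show ?thesis using \<rho> by (simp only:) (intro divide_right_mono zero_le_power, auto)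
    qed
    have "(\<Sum>j\<in>A. complex_of_real (\<alpha> j) * (f (joukowski w) * ?k (t j) w))
       = (f (joukowski w) / w) * (\<Sum>j\<in>A. complex_of_real (\<alpha> j) * (-1 + (\<Sum>k<n. 2 * complex_of_real (poly (chebT k) (x j)) * inverse w ^ k))
           + complex_of_real (\<alpha> j) * (R (t j) w + R (- t j) w))"
      unfolding sum_distrib_left by (intro sum.cong refl) (simp add: ker[OF w1] algebra_simps)
    also have "\<dots> = (f (joukowski w) / w) * (\<Sum>j\<in>A. complex_of_real (\<alpha> j) * (R (t j) w + R (- t j) w))"
      unfolding sum.distrib z by simp
    also have "cmod \<dots> \<le> (B / \<rho>) * (\<Sum>j\<in>A. \<bar>\<alpha> j\<bar> * ((2 / (1 - 1 / \<rho>)) / \<rho> ^ n))"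
      unfolding norm_mult norm_divide
    proof (intro mult_mono)
      have "joukowski w \<in> bernstein_ellipse \<rho>" using w \<rho> by (force simp: bernstein_ellipse_def joukowski_def)
      then show "cmod (f (joukowski w)) / cmod w \<le> B / \<rho>" using B w \<rho> by (simp add: divide_right_mono)
      then show "0 \<le> B / \<rho>" using norm_ge_zero[of "f (joukowski w)"] \<rho> by (meson divide_nonneg_nonneg norm_ge_zero order.trans)
      show "cmod (\<Sum>j\<in>A. complex_of_real (\<alpha> j) * (R (t j) w + R (- t j) w)) \<le> (\<Sum>j\<in>A. \<bar>\<alpha> j\<bar> * ((2 / (1 - 1 / \<rho>)) / \<rho> ^ n))"
      proof (rule sum_norm_le)
        fix j
        have "cmod (R (t j) w + R (- t j) w) \<le> (2 / (1 - 1 / \<rho>)) / \<rho> ^ n"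
          using norm_triangle_ineq[of "R (t j) w" "R (- t j) w"] R[of "t j"] R[of "- t j"] by (simp add: field_simps)
        then show "cmod (complex_of_real (\<alpha> j) * (R (t j) w + R (- t j) w)) \<le> \<bar>\<alpha> j\<bar> * ((2 / (1 - 1 / \<rho>)) / \<rho> ^ n)"
          unfolding norm_mult norm_of_real by (rule mult_left_mono) simp
      qed
    qed auto
    also have "\<dots> = (\<Sum>j\<in>A. \<bar>\<alpha> j\<bar>) * B * (2 / (1 - 1 / \<rho>)) / \<rho> ^ n / \<rho>"
      unfolding sum_distrib_right[symmetric] by (simp add: mult_ac)
    finally show ?thesis .
  qed
  define K where "K = (\<Sum>j\<in>A. \<bar>\<alpha> j\<bar>) * B * (2 / (1 - 1 / \<rho>)) / \<rho> ^ n"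
  have le: "cmod (\<Sum>j\<in>A. complex_of_real (\<alpha> j) * (2 * of_real pi * \<i> * f (complex_of_real (cos (t j)))))
      \<le> K / \<rho> * (2 * pi * \<rho>)"
    unfolding K_def
  proof (rule has_contour_integral_bound_circlepath[OF hi _ _ hb])
    have "0 \<le> B" using B[of 0] real_in_bernstein_ellipse[of \<rho> 0] \<rho> norm_ge_zero[of "f 0"] by (metis abs_zero less_imp_le of_real_0 order.trans zero_le_one)
    then show "0 \<le> (\<Sum>j\<in>A. \<bar>\<alpha> j\<bar>) * B * (2 / (1 - 1 / \<rho>)) / \<rho> ^ n / \<rho>"
      using \<rho> by (intro divide_nonneg_nonneg mult_nonneg_nonneg sum_nonneg) auto
  qed (use \<rho> in auto)
  have "(\<Sum>j\<in>A. complex_of_real (\<alpha> j) * (2 * of_real pi * \<i> * f (complex_of_real (cos (t j)))))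
      = 2 * of_real pi * \<i> * (\<Sum>j\<in>A. complex_of_real (\<alpha> j) * f (complex_of_real (x j)))"
    unfolding sum_distrib_left by (intro sum.cong refl) (simp add: ct)
  then have "2 * pi * cmod (\<Sum>j\<in>A. complex_of_real (\<alpha> j) * f (complex_of_real (x j))) \<le> 2 * pi * K"
    using le \<rho> by (simp add: norm_mult)
  then have "cmod (\<Sum>j\<in>A. complex_of_real (\<alpha> j) * f (complex_of_real (x j))) \<le> K" by simp
  then show ?thesis unfolding K_def .
qed

lemma cheb_projection_error:
  assumes \<rho>: "1 < \<rho>" and f: "f holomorphic_on bernstein_ellipse \<rho>"
    and B: "\<And>z. z \<in> bernstein_ellipse \<rho> \<Longrightarrow> cmod (f z) \<le> B" and x: "\<bar>x\<bar> \<le> 1" and n: "0 < n"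
  shows "cmod (f (complex_of_real x) - (\<Sum>j<2*n. complex_of_real (poly (cheb_lagrange n j) x) * f (complex_of_real (cheb_node (2*n) j))))
    \<le> real (1 + 2 * n) * B * (2 / (1 - 1 / \<rho>)) / \<rho> ^ n"
proof -
  \<comment> \<open>The error functional of the projection: the evaluation point x is placed at
    index 2 n behind the nodes, with weight 1.\<close>
  define \<alpha> where "\<alpha> = (\<lambda>j. if j = 2 * n then 1 else - poly (cheb_lagrange n j) x)"
  define X where "X = (\<lambda>j. if j = 2 * n then x else cheb_node (2 * n) j)"
  have S: "(\<Sum>j<Suc (2*n). g j) = (\<Sum>j<2*n. g j) + g (2*n)" for g :: "nat \<Rightarrow> 'b::comm_monoid_add" by simp
  have "cmod (\<Sum>j<Suc (2*n). complex_of_real (\<alpha> j) * f (complex_of_real (X j)))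
     \<le> (\<Sum>j<Suc (2*n). \<bar>\<alpha> j\<bar>) * B * (2 / (1 - 1 / \<rho>)) / \<rho> ^ n"
  proof (rule functional_bound_bernstein[OF \<rho> f B _ _ n])
    fix k assume k: "k < n"
    have "(\<Sum>j<2*n. \<alpha> j * poly (chebT k) (X j)) = - (\<Sum>j<2*n. poly (cheb_lagrange n j) x * poly (chebT k) (cheb_node (2*n) j))"
      unfolding sum_negf[symmetric] by (intro sum.cong) (auto simp: \<alpha>_def X_def)
    then show "(\<Sum>j<Suc (2*n). \<alpha> j * poly (chebT k) (X j)) = 0"
      unfolding S cheb_lagrange_reproduce[OF k] by (simp add: \<alpha>_def X_def)
  qed (use x abs_cheb_node in \<open>auto simp: X_def\<close>)
  moreover have "(\<Sum>j<2*n. complex_of_real (\<alpha> j) * f (complex_of_real (X j))) = - (\<Sum>j<2*n. complex_of_real (poly (cheb_lagrange n j) x) * f (complex_of_real (cheb_node (2*n) j)))"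
    unfolding sum_negf[symmetric] by (intro sum.cong) (auto simp: \<alpha>_def X_def)
  then have "(\<Sum>j<Suc (2*n). complex_of_real (\<alpha> j) * f (complex_of_real (X j)))
     = f (complex_of_real x) - (\<Sum>j<2*n. complex_of_real (poly (cheb_lagrange n j) x) * f (complex_of_real (cheb_node (2*n) j)))"
    unfolding S by (simp add: \<alpha>_def X_def)
  moreover have "(\<Sum>j<Suc (2*n). \<bar>\<alpha> j\<bar>) \<le> real (1 + 2 * n)"
  proof -
    have "(\<Sum>j<Suc (2*n). \<bar>\<alpha> j\<bar>) \<le> (\<Sum>j<Suc (2*n). 1)"
      using x n by (intro sum_mono) (auto simp: \<alpha>_def cheb_lagrange_le_1)
    then show ?thesis by simp
  qed
  moreover have "0 \<le> B" using B[of 0] real_in_bernstein_ellipse[of \<rho> 0] \<rho> norm_ge_zero[of "f 0"] by (metis abs_zero less_imp_le of_real_0 order.trans zero_le_one)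
  ultimately show ?thesis using \<rho>
    by (smt (verit, ccfv_SIG) divide_right_mono mult_right_mono zero_le_power divide_nonneg_nonneg less_divide_eq_1_pos)
qed

section \<open>Sup norms of orthonormal polynomials\<close>

lemma abs_sin_multiple: "\<bar>sin (real n * t)\<bar> \<le> real n * \<bar>sin t\<bar>"
proof (induction n)
  case (Suc n)
  have "\<bar>sin (real (Suc n) * t)\<bar> = \<bar>sin (real n * t) * cos t + cos (real n * t) * sin t\<bar>"
  proof -
    have "real (Suc n) * t = real n * t + t" by (simp add: distrib_right)
    then show ?thesis by (simp only: sin_add)
  qed
  also have "\<dots> \<le> \<bar>sin (real n * t)\<bar> * 1 + 1 * \<bar>sin t\<bar>"
    by (intro order.trans[OF abs_triangle_ineq] add_mono)
       (simp_all only: abs_mult mult_left_mono mult_right_mono abs_ge_zero abs_cos_le_one)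
  finally show ?case using Suc by (simp add: distrib_right)
qed simp

text \<open>Differentiating the identity that expresses cos (n t) through cos t leaves n times the
  quotient of sin (n t) by sin t, and the quotient is at most n in modulus. Division by sin t
  restricts x to the open interval.\<close>

lemma chebT_deriv_bound:
  assumes "\<bar>x\<bar> < 1"
  shows "\<bar>poly (pderiv (chebT n)) x\<bar> \<le> (real n)\<^sup>2"
proof -
  define t where "t = arccos x"
  have x: "cos t = x" using assms by (simp add: t_def cos_arccos_abs)
  have "x\<^sup>2 < 1" using assms by (simp add: abs_square_less_1)
  moreover from this have "\<bar>sin t\<bar> = sqrt (1 - x\<^sup>2)" using assms sin_arccos_abs[of x] by (simp add: t_def)
  ultimately have s: "0 < \<bar>sin t\<bar>" by simp
  have "((\<lambda>t. poly (chebT n) (cos t)) has_field_derivative poly (pderiv (chebT n)) (cos t) * - sin t) (at t)"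
    by (rule DERIV_chain2[OF poly_DERIV]) (auto intro!: derivative_eq_intros)
  moreover have "((\<lambda>t. cos (real n * t)) has_field_derivative - sin (real n * t) * real n) (at t)"
    by (auto intro!: derivative_eq_intros)
  ultimately have "poly (pderiv (chebT n)) x * - sin t = - sin (real n * t) * real n"
    unfolding poly_chebT_cos x by (rule DERIV_unique)
  then have "\<bar>poly (pderiv (chebT n)) x\<bar> * \<bar>sin t\<bar> = \<bar>sin (real n * t)\<bar> * real n"
    by (metis abs_minus_cancel abs_mult abs_of_nat)
  also have "\<dots> \<le> (real n)\<^sup>2 * \<bar>sin t\<bar>"
    using mult_left_mono[OF abs_sin_multiple[of n t], of "real n"] by (simp add: power2_eq_square mult_ac)
  finally show ?thesis using s by simp
qed

text \<open>Any polynomial bound in the degree suffices for the summability below, so the sharp Markov inequality is not needed.\<close>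

lemma weak_markov:
  fixes Q :: "real poly"
  assumes Q: "degree Q \<le> n" and M: "\<And>x. \<bar>x\<bar> \<le> 1 \<Longrightarrow> \<bar>poly Q x\<bar> \<le> M" and x: "\<bar>x\<bar> < 1"
  shows "\<bar>poly (pderiv Q) x\<bar> \<le> 2 * M * real (n + 1) ^ 3"
proof -
  obtain a where a: "Q = (\<Sum>k\<le>n. Polynomial.smult (a k) (chebT k))"
    using poly_basis_degree[of n chebT Q] Q degree_chebT chebT_nonzero by blast
  \<comment> \<open>With 2 n + 1 nodes discrete orthogonality covers all pairs of degrees up to n,
    so the Chebyshev coefficients of Q are weighted averages of its node values.\<close>
  let ?N = "2 * n + 1"
  have M0: "0 \<le> M" using M[of 0] by simp
  have ak: "\<bar>a k\<bar> \<le> 2 * M" if k: "k \<le> n" for k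
  proof -
    have "cheb_scale ?N k * (\<Sum>j<?N. poly (chebT k) (cheb_node ?N j) * poly Q (cheb_node ?N j))
       = (\<Sum>l\<le>n. a l * (cheb_scale ?N k * (\<Sum>j<?N. poly (chebT k) (cheb_node ?N j) * poly (chebT l) (cheb_node ?N j))))"
      unfolding a poly_sum sum_distrib_left by (subst sum.swap) (simp add: mult_ac del: sum.lessThan_Suc)
    also have "\<dots> = (\<Sum>l\<le>n. a l * of_bool (k = l))"
      using k by (intro sum.cong refl) (simp add: chebT_discrete_ortho del: sum.lessThan_Suc)
    also have "\<dots> = a k" using k by (simp add: sum.remove[of _ k] of_bool_def if_distrib cong: if_cong)
    finally have ak: "a k = cheb_scale ?N k * (\<Sum>j<?N. poly (chebT k) (cheb_node ?N j) * poly Q (cheb_node ?N j))" ..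
    have "0 \<le> cheb_scale ?N k" by (simp add: cheb_scale_def)
    then have "\<bar>a k\<bar> = cheb_scale ?N k * \<bar>\<Sum>j<?N. poly (chebT k) (cheb_node ?N j) * poly Q (cheb_node ?N j)\<bar>"
      unfolding ak abs_mult by (simp del: sum.lessThan_Suc)
    also have "\<dots> \<le> (2 / real ?N) * (\<Sum>j<?N. 1 * M)"
    proof (intro mult_mono order.trans[OF sum_abs] sum_mono)
      fix j show "\<bar>poly (chebT k) (cheb_node ?N j) * poly Q (cheb_node ?N j)\<bar> \<le> 1 * M"
        unfolding abs_mult by (intro mult_mono chebT_le_1 M abs_cheb_node) auto
    qed (auto simp: cheb_scale_def divide_right_mono)
    also have "\<dots> = 2 * M" by (simp del: sum.lessThan_Suc)
    finally show ?thesis .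
  qed
  have "pderiv Q = (\<Sum>k\<le>n. Polynomial.smult (a k) (pderiv (chebT k)))"
    unfolding a by (simp add: pderiv_sum pderiv_smult)
  then have "\<bar>poly (pderiv Q) x\<bar> \<le> (\<Sum>k\<le>n. \<bar>a k\<bar> * \<bar>poly (pderiv (chebT k)) x\<bar>)"
    by (simp add: poly_sum) (rule order.trans[OF sum_abs], simp add: abs_mult)
  also have "\<dots> \<le> (\<Sum>k\<le>n. (2 * M) * (real (n + 1))\<^sup>2)"
  proof (intro sum_mono mult_mono)
    fix k assume "k \<in> {..n}"
    then show "\<bar>a k\<bar> \<le> 2 * M" by (simp add: ak)
    have "\<bar>poly (pderiv (chebT k)) x\<bar> \<le> (real k)\<^sup>2" by (rule chebT_deriv_bound[OF x])
    also have "\<dots> \<le> (real (n + 1))\<^sup>2" using \<open>k \<in> {..n}\<close> by (intro power_mono) auto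
    finally show "\<bar>poly (pderiv (chebT k)) x\<bar> \<le> (real (n + 1))\<^sup>2" .
  qed (use M0 in auto)
  also have "\<dots> = 2 * M * real (n + 1) ^ 3" by (simp add: power3_eq_cube power2_eq_square algebra_simps)
  finally show ?thesis .
qed

text \<open>Within distance d of a maximum point the polynomial loses at most M / 2, as 2 M (n +
  1)^3 d = M / 2. The interval runs from the maximum point towards the origin and therefore stays
  inside [-1,1].\<close>

lemma poly_large_on_interval:
  fixes Q :: "real poly"
  assumes Q: "degree Q \<le> n"
  obtains M a d where "\<And>x. \<bar>x\<bar> \<le> 1 \<Longrightarrow> \<bar>poly Q x\<bar> \<le> M" "-1 \<le> a" "a + d \<le> 1" "d = 1 / (4 * real (n + 1) ^ 3)"
    "\<And>y. a < y \<Longrightarrow> y < a + d \<Longrightarrow> M / 2 \<le> \<bar>poly Q y\<bar>"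
proof -
  have "\<exists>x\<in>{-1..1::real}. \<forall>y\<in>{-1..1}. \<bar>poly Q y\<bar> \<le> \<bar>poly Q x\<bar>"
    by (rule continuous_attains_sup) (auto intro!: continuous_intros)
  then obtain x0 where x0: "x0 \<in> {-1..1}" and sup: "\<And>x. x \<in> {-1..1} \<Longrightarrow> \<bar>poly Q x\<bar> \<le> \<bar>poly Q x0\<bar>"
    by blast
  define M where "M = \<bar>poly Q x0\<bar>"
  define d where "d = 1 / (4 * real (n + 1) ^ 3)"
  have M: "\<bar>poly Q x\<bar> \<le> M" if "\<bar>x\<bar> \<le> 1" for x using sup[of x] that by (auto simp: M_def abs_le_iff)
  have "1 \<le> (1 + real n) ^ 3" by (rule one_le_power) simp
  then have "1 \<le> 4 * (1 + real n) ^ 3" by linarith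
  then have d: "0 < d" "d \<le> 1" by (simp_all add: d_def)
  have key: "M / 2 \<le> \<bar>poly Q y\<bar>" if y: "\<bar>y\<bar> < 1" "\<bar>y - x0\<bar> \<le> d" for y
  proof -
    have "\<bar>poly Q y - poly Q x0\<bar> \<le> (2 * M * real (n + 1) ^ 3) * \<bar>y - x0\<bar>"
    proof (cases "y = x0")
      case False
      define l u where "l = min y x0" and "u = max y x0"
      have lu: "l < u" using False by (auto simp: l_def u_def)
      obtain z where z: "l < z" "z < u" "poly Q u - poly Q l = (u - l) * poly (pderiv Q) z"
        using poly_MVT[OF lu] by blast
      have "\<bar>z\<bar> < 1" using z y x0 by (auto simp: l_def u_def)
      have "\<bar>poly Q y - poly Q x0\<bar> = \<bar>poly Q u - poly Q l\<bar>" by (auto simp: l_def u_def min_def max_def)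
      also have "\<dots> = \<bar>poly (pderiv Q) z\<bar> * \<bar>y - x0\<bar>" unfolding z(3) by (auto simp: l_def u_def abs_mult min_def max_def)
      also have "\<dots> \<le> (2 * M * real (n + 1) ^ 3) * \<bar>y - x0\<bar>"
        by (intro mult_right_mono weak_markov[OF Q M \<open>\<bar>z\<bar> < 1\<close>]) auto
      finally show ?thesis .
    qed simp
    also have "\<dots> \<le> (2 * M * real (n + 1) ^ 3) * d" using y(2) by (intro mult_left_mono) (auto simp: M_def)
    also have "\<dots> = M / 2" by (simp add: d_def field_simps)
    finally have "\<bar>poly Q y - poly Q x0\<bar> \<le> M / 2" .
    then show ?thesis using abs_triangle_ineq2_sym[of "poly Q x0" "poly Q y"] unfolding M_def by linarith
  qed
  show thesis
  proof (cases "x0 \<le> 0")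
    case True
    show thesis
    proof (rule that[OF M _ _ d_def, of "x0"])
      show "M / 2 \<le> \<bar>poly Q y\<bar>" if "x0 < y" "y < x0 + d" for y
        by (rule key) (use that x0 True d in auto)
    qed (use x0 True d in auto)
  next
    case False
    show thesis
    proof (rule that[OF M _ _ d_def, of "x0 - d"])
      show "M / 2 \<le> \<bar>poly Q y\<bar>" if "x0 - d < y" "y < x0 - d + d" for y
        by (rule key) (use that x0 False d in auto)
    qed (use x0 False d in auto)
  qed
qed

lemma has_integral_arcsine: "((\<lambda>y. 1 / (pi * sqrt (1 - y\<^sup>2))) has_integral 1) {-1..1::real}"
proof -
  have "((\<lambda>y. 1 / (pi * sqrt (1 - y\<^sup>2))) has_integral (arcsin 1 / pi - arcsin (-1) / pi)) {-1..1::real}"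
  proof (rule fundamental_theorem_of_calculus_interior)
    show "continuous_on {-1..1} (\<lambda>x. arcsin x / pi)" by (auto intro!: continuous_intros)
    fix x :: real assume x: "x \<in> {-1<..<1}"
    have "((\<lambda>x. arcsin x / pi) has_field_derivative inverse (sqrt (1 - x\<^sup>2)) / pi) (at x)"
      using x by (intro DERIV_cdivide DERIV_arcsin) auto
    then show "((\<lambda>x. arcsin x / pi) has_vector_derivative 1 / (pi * sqrt (1 - x\<^sup>2))) (at x)"
      by (simp add: has_real_derivative_iff_has_vector_derivative[symmetric] divide_inverse mult.commute)
  qed simp
  then show ?thesis by (simp add: arcsin_minus)
qed

locale ref_measure =
  fixes \<mu> :: "real measure"
  assumes ref: "\<mu> \<in> {uniform1, chebyshev1}"
begin

lemma space_mu: "space \<mu> = {-1..1}" and sets_mu: "sets \<mu> = sets (restrict_space borel {-1..1})"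
  using ref by (auto simp: uniform1_def chebyshev1_def space_restrict_space sets_restrict_space)

lemma measurable_mu: "f \<in> borel_measurable borel \<Longrightarrow> f \<in> borel_measurable \<mu>"
  unfolding measurable_cong_sets[OF sets_mu refl] by (rule measurable_restrict_space1)

text \<open>The common ground of the two measures for the sup-norm estimate: on the open interval
  the density is at least 1/4, being 1/2 in the uniform case and at least 1 / pi in the arcsine
  case.\<close>

lemma emeasure_mu:
  "\<exists>w. w \<in> borel_measurable borel \<and> (\<forall>y. \<bar>y\<bar> < 1 \<longrightarrow> 1 / 4 \<le> w y) \<and>
    (\<forall>A\<in>sets \<mu>. emeasure \<mu> A = (\<integral>\<^sup>+y. ennreal (w y) * indicator A y \<partial>lborel)) \<and>
    (\<integral>\<^sup>+y. ennreal (w y) * indicator {-1..1} y \<partial>lborel) = 1"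
proof -
  have em: "emeasure (density (restrict_space lborel {-1..1}) (\<lambda>y. ennreal (w y))) A = (\<integral>\<^sup>+y. ennreal (w y) * indicator A y \<partial>lborel)"
    if w: "w \<in> borel_measurable borel" and A: "A \<in> sets (restrict_space borel {-1..1})" for w :: "real \<Rightarrow> real" and A
  proof -
    have AR: "A \<in> sets (restrict_space lborel {-1..1::real})" "\<And>y. y \<in> A \<Longrightarrow> -1 \<le> y \<and> y \<le> 1" using A by (auto simp: sets_restrict_space)
    have wm: "(\<lambda>y. ennreal (w y)) \<in> borel_measurable (restrict_space lborel {-1..1::real})"
      using w by (intro measurable_restrict_space1) simp
    show ?thesis unfolding emeasure_density[OF wm AR(1)]
      by (subst nn_integral_restrict_space) (auto intro!: nn_integral_cong simp: indicator_def dest: AR(2))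
  qed
  consider "\<mu> = uniform1" | "\<mu> = chebyshev1" using ref by auto
  then show ?thesis
  proof cases
    case 1
    have "(\<integral>\<^sup>+y. ennreal (1 / 2) * indicator {-1..1::real} y \<partial>lborel) = 1"
    proof (subst nn_integral_cmult_indicator)
      have "emeasure lborel {-1..1::real} = ennreal 2" by simp
      then have "ennreal (1 / 2) * emeasure lborel {-1..1::real} = ennreal (1 / 2 * 2)"
        by (simp only:) (rule ennreal_mult[symmetric], auto)
      then show "ennreal (1 / 2) * emeasure lborel {-1..1::real} = 1" by simp
    qed simp
    then show ?thesis using em[of "\<lambda>_. 1 / 2"] sets_mu unfolding 1
      by (intro exI[of _ "\<lambda>_. 1 / 2"]) (auto simp: uniform1_def)
  next
    case 2
    let ?w = "\<lambda>y::real. 1 / (pi * sqrt (1 - y\<^sup>2))"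
    have "0 \<le> ?w y" if "y \<in> {-1..1}" for y
    proof -
      have "y\<^sup>2 \<le> 1" using that by (simp add: abs_square_le_1 abs_le_iff)
      then show ?thesis by simp
    qed
    from nn_integral_has_integral_lebesgue'[OF this has_integral_arcsine]
    have i: "(\<integral>\<^sup>+y. ennreal (?w y) * indicator {-1..1::real} y \<partial>lborel) = 1" by simp
    have l: "1 / 4 \<le> ?w y" if "\<bar>y\<bar> < 1" for y
    proof -
      have y2: "y\<^sup>2 < 1" using that by (simp add: abs_square_less_1)
      then have "pi * sqrt (1 - y\<^sup>2) \<le> 4 * 1" using pi_less_4 by (intro mult_mono) auto
      moreover have "0 < pi * sqrt (1 - y\<^sup>2)" using y2 by simp
      ultimately show ?thesis by (simp add: field_simps)
    qed
    have m: "?w \<in> borel_measurable borel" by measurable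
    show ?thesis using em[OF m] sets_mu i l m unfolding 2
      by (intro exI[of _ ?w]) (auto simp: chebyshev1_def)
  qed
qed

lemma prob_mu: "prob_space \<mu>"
proof
  have "{-1..1} \<in> sets \<mu>" using sets.top[of \<mu>] by (simp add: space_mu)
  then show "emeasure \<mu> (space \<mu>) = 1" using emeasure_mu unfolding space_mu by auto
qed

sublocale prob_space \<mu> by (rule prob_mu)

lemma measure_interval_ge:
  assumes "-1 \<le> a" "a \<le> b" "b \<le> 1"
  shows "(b - a) / 4 \<le> measure \<mu> {a<..<b}"
proof -
  have A: "{a<..<b} \<in> sets \<mu>" unfolding sets_mu using assms by (auto simp: sets_restrict_space intro!: image_eqI[of _ _ "{a<..<b}"])
  obtain w where w: "w \<in> borel_measurable borel" "\<And>y. \<bar>y\<bar> < 1 \<Longrightarrow> 1 / 4 \<le> w y"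
    and e: "emeasure \<mu> {a<..<b} = (\<integral>\<^sup>+y. ennreal (w y) * indicator {a<..<b} y \<partial>lborel)" using emeasure_mu A by blast
  have "ennreal ((b - a) / 4) = ennreal (1 / 4) * emeasure lborel {a<..<b}"
    using assms by (simp add: ennreal_mult[symmetric])
  also have "\<dots> = (\<integral>\<^sup>+y. ennreal (1 / 4) * indicator {a<..<b} y \<partial>lborel)" by (simp add: nn_integral_cmult_indicator)
  also have "\<dots> \<le> emeasure \<mu> {a<..<b}" unfolding e
    using assms w(2) by (intro nn_integral_mono) (auto simp: indicator_def intro!: ennreal_leI)
  finally show ?thesis using assms by (simp add: emeasure_eq_measure)
qed

lemma integrable_bounded:
  fixes f :: "real \<Rightarrow> 'b :: {banach, second_countable_topology}"
  assumes "f \<in> borel_measurable \<mu>" "\<And>y. \<bar>y\<bar> \<le> 1 \<Longrightarrow> norm (f y) \<le> B"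
  shows "integrable \<mu> f"
  using assms by (intro integrable_const_bound[of _ B] AE_I2) (auto simp: space_mu)

lemma poly_bounded: "\<exists>B\<ge>0. \<forall>y. \<bar>y\<bar> \<le> 1 \<longrightarrow> \<bar>poly (q :: real poly) y\<bar> \<le> B"
proof -
  have "compact ((\<lambda>y. poly q y) ` {-1..1})" by (intro compact_continuous_image continuous_intros) auto
  then obtain B where "0 < B" "\<And>x. x \<in> (\<lambda>y. poly q y) ` {-1..1} \<Longrightarrow> norm x \<le> B"
    using compact_imp_bounded bounded_pos by metis
  then show ?thesis by (intro exI[of _ B]) (auto simp: abs_le_iff)
qed

lemma integrable_poly: "integrable \<mu> (\<lambda>y. poly (q :: real poly) y)"
proof -
  have "(\<lambda>y. poly q y) \<in> borel_measurable borel" by (intro borel_measurable_continuous_onI continuous_intros)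
  then show ?thesis using poly_bounded[of q] by (metis integrable_bounded measurable_mu real_norm_def)
qed

end

text \<open>The unit L2 norm forces (M / 2)^2 * d / 4 \<le> 1 with d = 1 / (4 (n + 1)^3), that is
  M^2 \<le> 64 (n + 1)^3, which is rounded up to the square of 8 (n + 1)^2. No measure enters, so
  index sets built from this bound suit both.\<close>

definition sup_psi :: "nat \<Rightarrow> real" where
  "sup_psi n = (if n = 0 then 1 else 8 * (real (n + 1))\<^sup>2)"

locale ortho_polys = ref_measure +
  fixes \<psi> :: "nat \<Rightarrow> real poly"
  assumes orthonormal: "orthonormal_polys \<mu> \<psi>"
begin

lemma degree_psi: "degree (\<psi> n) = n" and psi_ortho: "(\<integral>y. poly (\<psi> k) y * poly (\<psi> n) y \<partial>\<mu>) = of_bool (k = n)"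
  using orthonormal by (auto simp: orthonormal_polys_def)

lemma psi_orth_lower:
  assumes "degree q < n"
  shows "(\<integral>y. poly q y * poly (\<psi> n) y \<partial>\<mu>) = 0"
proof -
  have "\<psi> k \<noteq> 0" for k using psi_ortho[of k k] by auto
  then obtain a where a: "q = (\<Sum>k\<le>degree q. Polynomial.smult (a k) (\<psi> k))"
    using poly_basis_degree[of "degree q" \<psi> q] degree_psi by blast
  have int: "integrable \<mu> (\<lambda>y. poly (\<psi> k) y * poly (\<psi> n) y)" for k
    using integrable_poly[of "\<psi> k * \<psi> n"] by simp
  have "(\<integral>y. poly q y * poly (\<psi> n) y \<partial>\<mu>) = (\<integral>y. (\<Sum>k\<le>degree q. a k * (poly (\<psi> k) y * poly (\<psi> n) y)) \<partial>\<mu>)"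
    by (subst a) (simp add: poly_sum sum_distrib_right mult.assoc)
  also have "\<dots> = (\<Sum>k\<le>degree q. a k * of_bool (k = n))"
    using int by (simp add: psi_ortho)
  also have "\<dots> = 0" using assms by (intro sum.neutral) auto
  finally show ?thesis .
qed

lemma psi_0_abs: "\<bar>poly (\<psi> 0) y\<bar> = 1"
proof -
  obtain c where c: "\<psi> 0 = [:c:]" using degree_psi[of 0] by (metis degree_eq_zeroE)
  then have "c * c = 1" using psi_ortho[of 0 0] prob_space by simp
  then show ?thesis using c by (simp add: abs_square_eq_1 power2_eq_square[symmetric])
qed

lemma psi_bound:
  assumes "\<bar>y\<bar> \<le> 1" shows "\<bar>poly (\<psi> n) y\<bar> \<le> sup_psi n"
proof (cases "n = 0")
  case True
  then show ?thesis using psi_0_abs by (simp add: sup_psi_def)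
next
  case False
  obtain M a d where M: "\<And>x. \<bar>x\<bar> \<le> 1 \<Longrightarrow> \<bar>poly (\<psi> n) x\<bar> \<le> M" and ad: "-1 \<le> a" "a + d \<le> 1" "d = 1 / (4 * real (n + 1) ^ 3)"
    and low: "\<And>y. a < y \<Longrightarrow> y < a + d \<Longrightarrow> M / 2 \<le> \<bar>poly (\<psi> n) y\<bar>"
    using poly_large_on_interval[of "\<psi> n" n] degree_psi by (metis order_refl)
  have M0: "0 \<le> M" using M[of 0] by simp
  have d0: "0 < d" by (simp add: ad)
  have A: "{a<..<a+d} \<in> sets \<mu>" unfolding sets_mu using ad by (auto simp: sets_restrict_space intro!: image_eqI[of _ _ "{a<..<a+d}"])
  have "(M / 2)\<^sup>2 * (d / 4) \<le> (M / 2)\<^sup>2 * measure \<mu> {a<..<a+d}"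
    using measure_interval_ge[of a "a + d"] ad d0 by (intro mult_left_mono) auto
  also have "\<dots> = (\<integral>y. (M / 2)\<^sup>2 * indicator {a<..<a+d} y \<partial>\<mu>)" using A by simp
  also have "\<dots> \<le> (\<integral>y. poly (\<psi> n) y * poly (\<psi> n) y \<partial>\<mu>)"
  proof (rule integral_mono)
    show "integrable \<mu> (\<lambda>y. (M / 2)\<^sup>2 * indicator {a<..<a+d} y)" using A
      by (intro integrable_mult_right integrable_real_indicator) (auto simp: emeasure_eq_measure)
    show "integrable \<mu> (\<lambda>y. poly (\<psi> n) y * poly (\<psi> n) y)" using integrable_poly[of "\<psi> n * \<psi> n"] by simp
    fix y
    show "(M / 2)\<^sup>2 * indicator {a<..<a+d} y \<le> poly (\<psi> n) y * poly (\<psi> n) y"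
    proof (cases "y \<in> {a<..<a+d}")
      case True
      then have "(M / 2)\<^sup>2 \<le> \<bar>poly (\<psi> n) y\<bar>\<^sup>2" using low[of y] M0 by (intro power_mono) auto
      then show ?thesis using True by (simp add: power2_eq_square)
    qed simp
  qed
  also have "\<dots> = 1" by (simp add: psi_ortho)
  finally have "M\<^sup>2 * d \<le> 16" by (simp add: power_divide)
  then have "M\<^sup>2 \<le> 64 * real (n + 1) ^ 3" unfolding ad(3) by (simp add: field_simps)
  also have "\<dots> \<le> 64 * real (n + 1) ^ 4" by (intro mult_left_mono power_increasing) auto
  also have "\<dots> = (8 * (real (n + 1))\<^sup>2)\<^sup>2" by (simp add: power_mult_distrib power_mult[symmetric])
  finally have "M \<le> 8 * (real (n + 1))\<^sup>2" by (rule power2_le_imp_le) auto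
  then show ?thesis using M[OF assms] False by (simp add: sup_psi_def)
qed

end

section \<open>Tensor products and coefficient bounds\<close>

definition msupp :: "(nat \<Rightarrow> nat) \<Rightarrow> nat set" where
  "msupp \<nu> = {i. \<nu> i \<noteq> 0}"

definition sup_Psi :: "(nat \<Rightarrow> nat) \<Rightarrow> real" where
  "sup_Psi \<nu> = (\<Prod>i\<in>msupp \<nu>. sup_psi (\<nu> i))"

lemma sup_psi_ge_1: "1 \<le> sup_psi n"
proof -
  have "1 * 1 \<le> (1 + real n) * (1 + real n)" by (rule mult_mono) auto
  then have "1 \<le> 8 * ((1 + real n) * (1 + real n))" by linarith
  then show ?thesis by (simp add: sup_psi_def power2_eq_square)
qed

lemma sup_Psi_ge_1: "1 \<le> sup_Psi \<nu>"
  unfolding sup_Psi_def by (rule prod_ge_1) (rule sup_psi_ge_1)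

lemma finite_msupp: "\<nu> \<in> multi_indices \<Longrightarrow> finite (msupp \<nu>)"
  by (simp add: multi_indices_def msupp_def)

context ref_measure
begin

abbreviation "ten \<equiv> tensor_measure \<mu>"

lemma prob_ten: "prob_space ten"
  unfolding tensor_measure_def by (intro prob_space_PiM prob_mu)

sublocale ten: prob_space ten by (rule prob_ten)

lemma space_ten: "space ten = cube"
  by (auto simp: tensor_measure_def space_PiM space_mu cube_def)

lemma coord_measurable: "(\<lambda>y. y i) \<in> ten \<rightarrow>\<^sub>M \<mu>"
  unfolding tensor_measure_def by (rule measurable_component_singleton) simp

lemma poly_coord_measurable: "(\<lambda>y. poly (q :: real poly) (y i)) \<in> borel_measurable ten"
  using measurable_compose[OF coord_measurable borel_measurable_integrable[OF integrable_poly[of q]]] .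

lemma upd_measurable: "(\<lambda>(x, y). y(i := x)) \<in> \<mu> \<Otimes>\<^sub>M ten \<rightarrow>\<^sub>M ten"
proof -
  have "(\<lambda>p. (snd p)(i := fst p)) \<in> \<mu> \<Otimes>\<^sub>M (\<Pi>\<^sub>M i\<in>UNIV. \<mu>) \<rightarrow>\<^sub>M (\<Pi>\<^sub>M i\<in>UNIV. \<mu>)"
    by (rule measurable_fun_upd[where J = UNIV]) auto
  then show ?thesis by (simp add: tensor_measure_def split_beta)
qed

lemma upd_const_measurable: "x \<in> {-1..1} \<Longrightarrow> (\<lambda>y. y(i := x)) \<in> ten \<rightarrow>\<^sub>M ten"
  using measurable_compose[OF measurable_Pair1'[of x \<mu> ten] upd_measurable[of i]] by (simp add: space_mu)

lemma ten_integrable_bounded: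
  fixes f :: "(nat \<Rightarrow> real) \<Rightarrow> 'b :: {banach, second_countable_topology}"
  assumes "f \<in> borel_measurable ten" "\<And>y. y \<in> cube \<Longrightarrow> norm (f y) \<le> B"
  shows "integrable ten f"
  using assms by (intro ten.integrable_const_bound[of _ B] AE_I2) (auto simp: space_ten)

text \<open>Replacing one coordinate by an independent copy preserves the product measure. This acts
  as Fubini in a single variable without splitting the infinite product.\<close>

lemma resample:
  fixes f :: "(nat \<Rightarrow> real) \<Rightarrow> 'b :: {banach, second_countable_topology}"
  assumes f: "f \<in> borel_measurable ten" "\<And>y. y \<in> cube \<Longrightarrow> norm (f y) \<le> B"
  shows "(\<integral>y. f y \<partial>ten) = (\<integral>y. (\<integral>x. f (y(i := x)) \<partial>\<mu>) \<partial>ten)"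
proof -
  interpret pair_sigma_finite \<mu> ten by standard
  interpret P: prob_space "\<mu> \<Otimes>\<^sub>M ten" by (rule prob_space_pair) (rule prob_mu prob_ten)+
  let ?R = "\<lambda>(x, y). y(i := x)"
  have d: "distr (\<mu> \<Otimes>\<^sub>M ten) ten ?R = ten"
    using distr_pair_PiM_eq_PiM[of UNIV "\<lambda>_. \<mu>" i] prob_mu by (simp add: tensor_measure_def)
  have m: "(\<lambda>p. f (?R p)) \<in> borel_measurable (\<mu> \<Otimes>\<^sub>M ten)"
    by (rule measurable_compose[OF upd_measurable f(1)])
  have int: "integrable (\<mu> \<Otimes>\<^sub>M ten) (\<lambda>(x, y). f (y(i := x)))"
    using m by (intro P.integrable_const_bound[of _ B] AE_I2)
      (auto intro!: f(2) simp: space_pair_measure space_mu space_ten cube_def split_beta)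
  have "(\<integral>y. f y \<partial>ten) = (\<integral>y. f y \<partial>distr (\<mu> \<Otimes>\<^sub>M ten) ten ?R)" by (simp only: d)
  also have "\<dots> = (\<integral>p. f (?R p) \<partial>(\<mu> \<Otimes>\<^sub>M ten))" by (rule integral_distr[OF upd_measurable f(1)])
  also have "\<dots> = (\<integral>(x, y). f (y(i := x)) \<partial>(\<mu> \<Otimes>\<^sub>M ten))"
    by (intro Bochner_Integration.integral_cong) auto
  also have "\<dots> = (\<integral>y. (\<integral>x. f (y(i := x)) \<partial>\<mu>) \<partial>ten)" by (rule integral_snd[OF int, symmetric])
  finally show ?thesis .
qed

lemma prod_poly_measurable: "(\<lambda>y. \<Prod>i\<in>I. poly (q i :: real poly) (y i)) \<in> borel_measurable ten"
  by (intro borel_measurable_prod poly_coord_measurable)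

lemma prod_poly_bounded: "finite I \<Longrightarrow> \<exists>B\<ge>0. \<forall>y\<in>cube. \<bar>\<Prod>i\<in>I. poly (q i :: real poly) (y i)\<bar> \<le> B"
proof -
  assume "finite I"
  have "\<forall>i. \<exists>B\<ge>0. \<forall>y. \<bar>y\<bar> \<le> 1 \<longrightarrow> \<bar>poly (q i) y\<bar> \<le> B" using poly_bounded by blast
  then obtain B where B: "\<And>i. 0 \<le> B i" "\<And>i y. \<bar>y\<bar> \<le> 1 \<Longrightarrow> \<bar>poly (q i) y\<bar> \<le> B i" by metis
  have "\<bar>\<Prod>i\<in>I. poly (q i) (y i)\<bar> \<le> (\<Prod>i\<in>I. B i)" if "y \<in> cube" for y
    unfolding abs_prod using that B by (intro prod_mono) (auto simp: cube_def abs_le_iff)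
  then show ?thesis using B by (intro exI[of _ "\<Prod>i\<in>I. B i"]) (auto intro: prod_nonneg)
qed

lemma integral_prod_poly:
  assumes "finite I"
  shows "(\<integral>y. (\<Prod>i\<in>I. poly (q i :: real poly) (y i)) \<partial>ten) = (\<Prod>i\<in>I. \<integral>x. poly (q i) x \<partial>\<mu>)"
  using assms
proof (induction I)
  case empty
  then show ?case by (simp add: ten.prob_space)
next
  case (insert i I)
  obtain B where B: "\<And>y. y \<in> cube \<Longrightarrow> norm (\<Prod>i\<in>insert i I. poly (q i) (y i)) \<le> B"
    using prod_poly_bounded[of "insert i I" q] insert.hyps(1) by auto
  have "(\<Prod>j\<in>insert i I. poly (q j) ((y(i := x)) j)) = poly (q i) x * (\<Prod>j\<in>I. poly (q j) (y j))" for x y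
    using insert.hyps by (subst prod.insert) (auto intro!: prod.cong)
  then have "(\<integral>y. (\<Prod>i\<in>insert i I. poly (q i) (y i)) \<partial>ten) = (\<integral>y. (\<integral>x. poly (q i) x * (\<Prod>j\<in>I. poly (q j) (y j)) \<partial>\<mu>) \<partial>ten)"
    by (subst resample[OF prod_poly_measurable B, of i]) simp_all
  then show ?case using insert by simp
qed

end

context ortho_polys
begin

text \<open>The constant polynomial \<open>\<psi> 0\<close> is only determined up to sign, and \<open>Psi\<close> leaves it out.\<close>

definition unit_psi :: "nat \<Rightarrow> real poly" where
  "unit_psi n = (if n = 0 then 1 else \<psi> n)"

lemma unit_psi_ortho: "(\<integral>x. poly (unit_psi k * unit_psi n) x \<partial>\<mu>) = of_bool (k = n)"
  using psi_ortho[of k n] psi_orth_lower[of 1 n] psi_orth_lower[of 1 k] prob_space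
  by (auto simp: unit_psi_def)

lemma Psi_unit_psi: "finite I \<Longrightarrow> msupp \<nu> \<subseteq> I \<Longrightarrow> Psi \<psi> \<nu> y = (\<Prod>i\<in>I. poly (unit_psi (\<nu> i)) (y i))"
  unfolding Psi_def msupp_def by (intro prod.mono_neutral_cong_left) (auto simp: unit_psi_def)

lemma Psi_measurable: "\<nu> \<in> multi_indices \<Longrightarrow> Psi \<psi> \<nu> \<in> borel_measurable ten"
  unfolding Psi_def[abs_def] by (rule prod_poly_measurable)

lemma of_real_measurable: "g \<in> borel_measurable M \<Longrightarrow> (\<lambda>x. complex_of_real (g x)) \<in> borel_measurable M"
  by measurable

lemma Psi_bound: "y \<in> cube \<Longrightarrow> \<bar>Psi \<psi> \<nu> y\<bar> \<le> sup_Psi \<nu>"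
proof -
  assume "y \<in> cube"
  then have "\<bar>y i\<bar> \<le> 1" for i by (auto simp: cube_def abs_le_iff)
  then show ?thesis unfolding Psi_def sup_Psi_def abs_prod msupp_def by (intro prod_mono conjI psi_bound) auto
qed

lemma Psi_ortho:
  assumes "\<nu> \<in> multi_indices" "\<nu>' \<in> multi_indices"
  shows "(\<integral>y. Psi \<psi> \<nu> y * Psi \<psi> \<nu>' y \<partial>ten) = of_bool (\<nu> = \<nu>')"
proof -
  define I where "I = msupp \<nu> \<union> msupp \<nu>'"
  have I: "finite I" using assms finite_msupp by (simp add: I_def)
  have "Psi \<psi> \<nu> y * Psi \<psi> \<nu>' y = (\<Prod>i\<in>I. poly (unit_psi (\<nu> i) * unit_psi (\<nu>' i)) (y i))" for y
    using Psi_unit_psi[OF I, of \<nu> y] Psi_unit_psi[OF I, of \<nu>' y] by (simp add: I_def prod.distrib)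
  then have "(\<integral>y. Psi \<psi> \<nu> y * Psi \<psi> \<nu>' y \<partial>ten) = (\<Prod>i\<in>I. of_bool (\<nu> i = \<nu>' i))"
    by (simp only: integral_prod_poly[OF I] unit_psi_ortho)
  also have "\<dots> = of_bool (\<nu> = \<nu>')"
  proof (cases "\<nu> = \<nu>'")
    case False
    then obtain i where i: "\<nu> i \<noteq> \<nu>' i" by blast
    then have "i \<in> I" by (auto simp: I_def msupp_def)
    then show ?thesis using i I False by (auto intro!: prod_zero)
  qed simp
  finally show ?thesis .
qed

lemma integrable_Psi_Psi:
  assumes "\<nu> \<in> multi_indices" "\<nu>' \<in> multi_indices"
  shows "integrable ten (\<lambda>y. Psi \<psi> \<nu> y * Psi \<psi> \<nu>' y)"
proof (rule ten_integrable_bounded)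
  show "(\<lambda>y. Psi \<psi> \<nu> y * Psi \<psi> \<nu>' y) \<in> borel_measurable ten"
    using Psi_measurable assms by (intro borel_measurable_times) auto
  show "norm (Psi \<psi> \<nu> y * Psi \<psi> \<nu>' y) \<le> sup_Psi \<nu> * sup_Psi \<nu>'" if "y \<in> cube" for y
    unfolding real_norm_def abs_mult using Psi_bound[OF that] order.trans[OF zero_le_one sup_Psi_ge_1]
    by (intro mult_mono) auto
qed

lemma integrable_Psi_mult:
  fixes f :: "(nat \<Rightarrow> real) \<Rightarrow> complex"
  assumes "\<nu> \<in> multi_indices" "f \<in> borel_measurable ten" "\<And>y. y \<in> cube \<Longrightarrow> cmod (f y) \<le> B"
  shows "integrable ten (\<lambda>y. f y * complex_of_real (Psi \<psi> \<nu> y))"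
proof (rule ten_integrable_bounded)
  show "(\<lambda>y. f y * complex_of_real (Psi \<psi> \<nu> y)) \<in> borel_measurable ten"
    using Psi_measurable[OF assms(1)] assms(2) by (intro borel_measurable_times of_real_measurable)
  fix y assume y: "y \<in> cube"
  show "norm (f y * complex_of_real (Psi \<psi> \<nu> y)) \<le> B * sup_Psi \<nu>"
    unfolding norm_mult norm_of_real using assms(3)[OF y] Psi_bound[OF y]
    by (intro mult_mono) (auto intro: order.trans[OF norm_ge_zero])
qed

section \<open>Coefficient decay by projecting one variable after the other\<close>

definition coef :: "((nat \<Rightarrow> real) \<Rightarrow> complex) \<Rightarrow> (nat \<Rightarrow> nat) \<Rightarrow> complex" where
  "coef f \<nu> = (\<integral>y. f y * complex_of_real (Psi \<psi> \<nu> y) \<partial>ten)"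

abbreviation cx :: "(nat \<Rightarrow> real) \<Rightarrow> nat \<Rightarrow> complex" where
  "cx y \<equiv> (\<lambda>i. complex_of_real (y i))"

lemma cheb_node_in: "cheb_node N j \<in> {-1..1}"
  using abs_cheb_node[of N j] by (auto simp: abs_le_iff)

text \<open>Subtracting the projection in variable i removes a combination of polynomials in y_i of
  degree below \<nu> i, whose coefficients depend on the other variables. The coefficient at \<nu>
  does not notice this by orthogonality, while the sup bound gains the factor of
  \<open>cheb_projection_error\<close>. Variables in \<open>A\<close> are frozen at real values;
  holomorphy persists in the others, which lets the induction continue.\<close>

lemma project_all_variables:
  fixes F :: "(nat \<Rightarrow> complex) \<Rightarrow> complex"
  assumes \<nu>: "\<nu> \<in> multi_indices" and A: "finite A" "A \<subseteq> msupp \<nu>"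
    and \<rho>1: "\<And>i. 1 \<le> \<rho> i" and \<rho>: "\<And>i. i \<in> msupp \<nu> \<Longrightarrow> 1 < \<rho> i"
    and bd: "\<And>z. z \<in> bernstein_polyellipse \<rho> \<Longrightarrow> cmod (F z) \<le> 1"
    and hol: "separately_holomorphic_on F (bernstein_polyellipse \<rho>)"
    and meas: "(\<lambda>y. F (cx y)) \<in> borel_measurable ten"
  shows "\<exists>G. (\<forall>z\<in>bernstein_polyellipse \<rho>. (\<forall>i\<in>A. \<exists>x\<in>{-1..1}. z i = complex_of_real x) \<longrightarrow>
        cmod (G z) \<le> (\<Prod>i\<in>A. real (1 + 2 * \<nu> i) * (2 / (1 - 1 / \<rho> i)) / \<rho> i ^ \<nu> i) \<and>
        (\<forall>i. i \<notin> A \<longrightarrow> (\<lambda>w. G (z(i := w))) field_differentiable (at (z i))))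
      \<and> (\<lambda>y. G (cx y)) \<in> borel_measurable ten
      \<and> coef (\<lambda>y. G (cx y)) \<nu> = coef (\<lambda>y. F (cx y)) \<nu>"
  using A
proof (induction A)
  case empty
  have "cmod (F z) \<le> (\<Prod>i\<in>{}. real (1 + 2 * \<nu> i) * (2 / (1 - 1 / \<rho> i)) / \<rho> i ^ \<nu> i)" if "z \<in> bernstein_polyellipse \<rho>" for z
    using bd[OF that] by simp
  then show ?case using hol meas unfolding separately_holomorphic_on_def by blast
next
  case (insert i A)
  let ?n = "\<nu> i"
  have n: "0 < ?n" and \<rho>i: "1 < \<rho> i" using insert.prems \<rho> by (auto simp: msupp_def)
  define b where "b = (\<Prod>i\<in>A. real (1 + 2 * \<nu> i) * (2 / (1 - 1 / \<rho> i)) / \<rho> i ^ \<nu> i)"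
  have "A \<subseteq> msupp \<nu>" using insert.prems by simp
  from insert.IH[OF this] obtain G where G0: "\<forall>z\<in>bernstein_polyellipse \<rho>. (\<forall>i\<in>A. \<exists>x\<in>{-1..1}. z i = complex_of_real x) \<longrightarrow>
        cmod (G z) \<le> b \<and> (\<forall>i. i \<notin> A \<longrightarrow> (\<lambda>w. G (z(i := w))) field_differentiable (at (z i)))"
      and Gm: "(\<lambda>y. G (cx y)) \<in> borel_measurable ten" and Gc: "coef (\<lambda>y. G (cx y)) \<nu> = coef (\<lambda>y. F (cx y)) \<nu>"
    unfolding b_def[symmetric] by (elim exE conjE) (rule that)
  note G = G0[THEN bspec, THEN mp, THEN conjunct1] G0[THEN bspec, THEN mp, THEN conjunct2, THEN spec, THEN mp] Gm Gc
  define l where "l = cheb_lagrange ?n"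
  define x where "x = cheb_node (2 * ?n)"
  \<comment> \<open>\<open>Re (z i)\<close> allows evaluation at any z, while the claims about G'
    concern real z i only. Holomorphy in variable i is given up at this point, each variable being
    projected once.\<close>
  define G' where "G' = (\<lambda>z. G z - (\<Sum>j<2 * ?n. complex_of_real (poly (l j) (Re (z i))) * G (z(i := complex_of_real (x j)))))"
  have xin: "complex_of_real (x j) \<in> bernstein_ellipse (\<rho> i)" "x j \<in> {-1..1}" "\<bar>x j\<bar> \<le> 1" for j
    using real_in_bernstein_ellipse[OF \<rho>1 abs_cheb_node] cheb_node_in abs_cheb_node by (auto simp: x_def)
  have updE: "z(i := w) \<in> bernstein_polyellipse \<rho>" if "z \<in> bernstein_polyellipse \<rho>" "w \<in> bernstein_ellipse (\<rho> i)" for z w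
    using that by (auto simp: bernstein_polyellipse_def)
  have updA: "\<forall>k\<in>A. \<exists>x\<in>{-1..1}. (z(i := w)) k = complex_of_real x" if "\<forall>i\<in>A. \<exists>x\<in>{-1..1}. z i = complex_of_real x" for z w
    using that insert.hyps(2) by auto
  have cubeE: "cx y \<in> bernstein_polyellipse \<rho>" "\<forall>i\<in>A. \<exists>x\<in>{-1..1}. cx y i = complex_of_real x" if "y \<in> cube" for y
    using that real_in_bernstein_ellipse[OF \<rho>1] by (auto simp: cube_def bernstein_polyellipse_def abs_le_iff)
  have Gb: "cmod (G (cx y)) \<le> b" if "y \<in> cube" for y using G(1) cubeE[OF that] by blast
  have b0: "0 \<le> b" by (rule order.trans[OF norm_ge_zero Gb[of "\<lambda>_. 0"]]) (simp add: cube_def)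
  have ucube: "y(i := x j) \<in> cube" if "y \<in> cube" for y j using that xin(2)[of j] by (auto simp: cube_def)
  have 1: "cmod (G' z) \<le> (\<Prod>i\<in>insert i A. real (1 + 2 * \<nu> i) * (2 / (1 - 1 / \<rho> i)) / \<rho> i ^ \<nu> i)"
    if z: "z \<in> bernstein_polyellipse \<rho>" and zr: "\<forall>i\<in>insert i A. \<exists>x\<in>{-1..1}. z i = complex_of_real x" for z
  proof -
    obtain t where t: "t \<in> {-1..1}" "z i = complex_of_real t" using zr by blast
    have zA: "\<forall>i\<in>A. \<exists>x\<in>{-1..1}. z i = complex_of_real x" using zr by blast
    let ?f = "\<lambda>w. G (z(i := w))"
    have hf: "?f holomorphic_on bernstein_ellipse (\<rho> i)"
    proof (unfold holomorphic_on_def, intro ballI)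
      fix w assume w: "w \<in> bernstein_ellipse (\<rho> i)"
      have "(\<lambda>w'. G ((z(i := w))(i := w'))) field_differentiable (at ((z(i := w)) i))"
        using updE[OF z w] updA[OF zA] insert.hyps(2) by (intro G(2)) auto
      then show "?f field_differentiable (at w within bernstein_ellipse (\<rho> i))"
        by (simp add: field_differentiable_at_within)
    qed
    have "cmod (?f (complex_of_real t) - (\<Sum>j<2 * ?n. complex_of_real (poly (cheb_lagrange ?n j) t) * ?f (complex_of_real (cheb_node (2 * ?n) j))))
        \<le> real (1 + 2 * ?n) * b * (2 / (1 - 1 / \<rho> i)) / \<rho> i ^ ?n"
      using t n by (intro cheb_projection_error[OF \<rho>i hf] G(1) updE[OF z] updA[OF zA]) (auto simp: abs_le_iff)
    moreover have "z(i := complex_of_real t) = z" using t by auto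
    ultimately have "cmod (G' z) \<le> real (1 + 2 * ?n) * b * (2 / (1 - 1 / \<rho> i)) / \<rho> i ^ ?n"
      by (simp add: G'_def l_def x_def t(2))
    moreover have "(\<Prod>i\<in>insert i A. real (1 + 2 * \<nu> i) * (2 / (1 - 1 / \<rho> i)) / \<rho> i ^ \<nu> i)
        = real (1 + 2 * ?n) * (2 / (1 - 1 / \<rho> i)) / \<rho> i ^ ?n * b"
      unfolding b_def by (rule prod.insert[OF insert.hyps])
    moreover have "N * b * k / P = N * k / P * b" for N k P :: real by simp
    ultimately show ?thesis by (simp only:)
  qed
  have 2: "(\<lambda>w. G' (z(k := w))) field_differentiable (at (z k))"
    if z: "z \<in> bernstein_polyellipse \<rho>" and zr: "\<forall>i\<in>insert i A. \<exists>x\<in>{-1..1}. z i = complex_of_real x" and k: "k \<notin> insert i A" for z k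
  proof -
    have zA: "\<forall>i\<in>A. \<exists>x\<in>{-1..1}. z i = complex_of_real x" using zr by blast
    have e: "G' (z(k := w)) = G (z(k := w)) - (\<Sum>j<2 * ?n. complex_of_real (poly (l j) (Re (z i))) * G ((z(i := complex_of_real (x j)))(k := w)))" for w
      using k by (simp add: G'_def fun_upd_twist)
    have d: "(\<lambda>w. G ((z(i := complex_of_real (x j)))(k := w))) field_differentiable (at (z k))" for j
    proof -
      have "(\<lambda>w. G ((z(i := complex_of_real (x j)))(k := w))) field_differentiable (at ((z(i := complex_of_real (x j))) k))"
        using k by (intro G(2) updE[OF z xin(1)] updA[OF zA]) auto
      then show ?thesis using k by simp
    qed
    show ?thesis unfolding e using k
      by (intro field_differentiable_diff field_differentiable_sum field_differentiable_mult field_differentiable_const G(2) z zA d) auto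
  qed
  let ?h = "\<lambda>j y. complex_of_real (poly (l j) (y i)) * G (cx (y(i := x j)))"
  have hm: "?h j \<in> borel_measurable ten" for j
    by (intro borel_measurable_times of_real_measurable poly_coord_measurable
         measurable_compose[OF upd_const_measurable G(3)] xin(2))
  have hb: "cmod (?h j y) \<le> 1 * b" if "y \<in> cube" for j y
    unfolding norm_mult norm_of_real l_def using that n b0
    by (intro mult_mono cheb_lagrange_le_1 Gb ucube) (auto simp: cube_def abs_le_iff)
  \<comment> \<open>G is evaluated with coordinate i at a node, so only the polynomial
    \<open>l j\<close> and the factor of degree \<open>\<nu> i\<close> depend on that coordinate.
    Their product integrates to zero because \<open>l j\<close> has smaller degree.\<close>
  have hcoef: "coef (?h j) \<nu> = 0" for j
  proof -
    define rest where "rest = (\<lambda>y. \<Prod>k\<in>msupp \<nu> - {i}. poly (\<psi> (\<nu> k)) (y k))"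
    have Psiu: "Psi \<psi> \<nu> (y(i := t)) = poly (\<psi> ?n) t * rest y" for y t
    proof -
      have "Psi \<psi> \<nu> (y(i := t)) = (\<Prod>k\<in>insert i (msupp \<nu> - {i}). poly (\<psi> (\<nu> k)) ((y(i := t)) k))"
        unfolding Psi_def using insert.prems by (intro prod.cong) (auto simp: msupp_def)
      also have "\<dots> = poly (\<psi> ?n) t * (\<Prod>k\<in>msupp \<nu> - {i}. poly (\<psi> (\<nu> k)) ((y(i := t)) k))"
        using finite_msupp[OF \<nu>] by (subst prod.insert) auto
      also have "(\<Prod>k\<in>msupp \<nu> - {i}. poly (\<psi> (\<nu> k)) ((y(i := t)) k)) = rest y"
        unfolding rest_def by (intro prod.cong) auto
      finally show ?thesis .
    qed
    have "coef (?h j) \<nu> = (\<integral>y. (\<integral>t. ?h j (y(i := t)) * complex_of_real (Psi \<psi> \<nu> (y(i := t))) \<partial>\<mu>) \<partial>ten)"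
      unfolding coef_def
    proof (rule resample)
      show "(\<lambda>y. ?h j y * complex_of_real (Psi \<psi> \<nu> y)) \<in> borel_measurable ten"
        by (intro borel_measurable_times of_real_measurable hm Psi_measurable \<nu>)
      show "norm (?h j y * complex_of_real (Psi \<psi> \<nu> y)) \<le> (1 * b) * sup_Psi \<nu>" if "y \<in> cube" for y
        unfolding norm_mult[of "?h j y"] norm_of_real using that hb Psi_bound b0 by (intro mult_mono) auto
    qed
    also have "\<dots> = (\<integral>y. (\<integral>t. (G (cx (y(i := x j))) * complex_of_real (rest y)) * complex_of_real (poly (l j) t * poly (\<psi> ?n) t) \<partial>\<mu>) \<partial>ten)"
      by (simp add: Psiu mult_ac)
    also have "\<dots> = 0"
    proof -
      have "(\<integral>t. poly (l j) t * poly (\<psi> ?n) t \<partial>\<mu>) = 0"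
        unfolding l_def by (rule psi_orth_lower[OF degree_cheb_lagrange[OF n]])
      then have "(\<integral>t. c * complex_of_real (poly (l j) t * poly (\<psi> ?n) t) \<partial>\<mu>) = 0" for c
        by (simp only: integral_mult_right_zero integral_complex_of_real) simp
      then show ?thesis by simp
    qed
    finally show ?thesis .
  qed
  have e: "G' (cx y) = G (cx y) - (\<Sum>j<2 * ?n. ?h j y)" for y
    by (simp add: G'_def fun_upd_def if_distrib[of complex_of_real])
  have 3: "(\<lambda>y. G' (cx y)) \<in> borel_measurable ten"
    unfolding e by (intro borel_measurable_diff borel_measurable_sum hm G(3))
  have "coef (\<lambda>y. G' (cx y)) \<nu> = coef (\<lambda>y. G (cx y)) \<nu> - (\<Sum>j<2 * ?n. coef (?h j) \<nu>)"
  proof -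
    have "coef (\<lambda>y. G' (cx y)) \<nu> = (\<integral>y. G (cx y) * complex_of_real (Psi \<psi> \<nu> y) - (\<Sum>j<2 * ?n. ?h j y * complex_of_real (Psi \<psi> \<nu> y)) \<partial>ten)"
      unfolding coef_def e by (simp only: left_diff_distrib sum_distrib_right)
    also have "\<dots> = coef (\<lambda>y. G (cx y)) \<nu> - (\<Sum>j<2 * ?n. coef (?h j) \<nu>)"
      unfolding coef_def
      by (subst Bochner_Integration.integral_diff, intro integrable_Psi_mult[OF \<nu> G(3) Gb], assumption,
          intro Bochner_Integration.integrable_sum integrable_Psi_mult[OF \<nu> hm hb], assumption,
          subst Bochner_Integration.integral_sum, intro integrable_Psi_mult[OF \<nu> hm hb], assumption, rule refl)
    finally show ?thesis .
  qed
  then have 4: "coef (\<lambda>y. G' (cx y)) \<nu> = coef (\<lambda>y. F (cx y)) \<nu>" using hcoef G(4) by simp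
  show ?case using 1 2 3 4 by (intro exI[of _ G']) blast
qed

text \<open>After projection in the whole support the function is bounded by the product and has
  kept the coefficient of f. The inequality |x| \<le> (1 + x^2) / 2 together with the unit norm of
  \<open>Psi\<close> avoids a factor \<open>sup_Psi\<close>.\<close>

lemma coef_bound:
  assumes f: "f \<in> holo_class \<mu> b \<eta>" and \<nu>: "\<nu> \<in> multi_indices" and adm: "admissible b \<eta> \<rho>"
    and \<rho>: "\<And>i. i \<in> msupp \<nu> \<Longrightarrow> 1 < \<rho> i"
  shows "cmod (coef f \<nu>) \<le> (\<Prod>i\<in>msupp \<nu>. real (1 + 2 * \<nu> i) * (2 / (1 - 1 / \<rho> i)) / \<rho> i ^ \<nu> i)"
proof -
  obtain F where F: "\<And>y. y \<in> cube \<Longrightarrow> F (cx y) = f y" "separately_holomorphic_on F (bernstein_polyellipse \<rho>)"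
      "\<And>z. z \<in> holo_region b \<eta> \<Longrightarrow> cmod (F z) \<le> 1" and fm: "f \<in> borel_measurable ten"
    using f adm by (auto simp: holo_class_def)
  have \<rho>1: "1 \<le> \<rho> i" for i using adm by (simp add: admissible_def)
  have Fm: "(\<lambda>y. F (cx y)) \<in> borel_measurable ten"
    using fm by (rule measurable_cong[THEN iffD1, rotated]) (simp add: space_ten F(1))
  have "coef (\<lambda>y. F (cx y)) \<nu> = coef f \<nu>" unfolding coef_def
    by (rule Bochner_Integration.integral_cong) (auto simp: space_ten F(1))
  moreover have "cmod (F z) \<le> 1" if "z \<in> bernstein_polyellipse \<rho>" for z
    using that adm by (intro F(3)) (auto simp: holo_region_def)
  ultimately have coF: "coef (\<lambda>y. F (cx y)) \<nu> = coef f \<nu>" and bF: "\<And>z. z \<in> bernstein_polyellipse \<rho> \<Longrightarrow> cmod (F z) \<le> 1"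
    by blast+
  let ?B = "\<Prod>i\<in>msupp \<nu>. real (1 + 2 * \<nu> i) * (2 / (1 - 1 / \<rho> i)) / \<rho> i ^ \<nu> i"
  have "\<exists>G. (\<forall>z\<in>bernstein_polyellipse \<rho>. (\<forall>i\<in>msupp \<nu>. \<exists>x\<in>{-1..1}. z i = complex_of_real x) \<longrightarrow>
        cmod (G z) \<le> ?B \<and> (\<forall>i. i \<notin> msupp \<nu> \<longrightarrow> (\<lambda>w. G (z(i := w))) field_differentiable (at (z i))))
      \<and> (\<lambda>y. G (cx y)) \<in> borel_measurable ten \<and> coef (\<lambda>y. G (cx y)) \<nu> = coef (\<lambda>y. F (cx y)) \<nu>"
    by (rule project_all_variables[OF \<nu> finite_msupp[OF \<nu>] order_refl]) (fact \<rho>1 \<rho> bF F(2) Fm)+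
  then obtain G where G0: "\<forall>z\<in>bernstein_polyellipse \<rho>. (\<forall>i\<in>msupp \<nu>. \<exists>x\<in>{-1..1}. z i = complex_of_real x) \<longrightarrow>
        cmod (G z) \<le> ?B \<and> (\<forall>i. i \<notin> msupp \<nu> \<longrightarrow> (\<lambda>w. G (z(i := w))) field_differentiable (at (z i)))"
      and Gm: "(\<lambda>y. G (cx y)) \<in> borel_measurable ten" and Gc: "coef (\<lambda>y. G (cx y)) \<nu> = coef (\<lambda>y. F (cx y)) \<nu>"
    by (elim exE conjE) (rule that)
  note G = G0[THEN bspec, THEN mp, THEN conjunct1] Gm trans[OF Gc coF]
  have Gb: "cmod (G (cx y)) \<le> ?B" if "y \<in> cube" for y
    using that real_in_bernstein_ellipse[OF \<rho>1] by (intro G(1)) (auto simp: cube_def bernstein_polyellipse_def abs_le_iff)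
  have B0: "0 \<le> ?B" by (rule order.trans[OF norm_ge_zero Gb[of "\<lambda>_. 0"]]) (simp add: cube_def)
  have "cmod (coef f \<nu>) \<le> (\<integral>y. cmod (G (cx y) * complex_of_real (Psi \<psi> \<nu> y)) \<partial>ten)"
    unfolding G(3)[symmetric] unfolding coef_def by (rule integral_norm_bound)
  also have "\<dots> \<le> (\<integral>y. ?B * ((1 + Psi \<psi> \<nu> y * Psi \<psi> \<nu> y) / 2) \<partial>ten)"
  proof (rule integral_mono)
    show "integrable ten (\<lambda>y. cmod (G (cx y) * complex_of_real (Psi \<psi> \<nu> y)))"
      by (intro integrable_norm integrable_Psi_mult[OF \<nu> G(2) Gb])
    show "integrable ten (\<lambda>y. ?B * ((1 + Psi \<psi> \<nu> y * Psi \<psi> \<nu> y) / 2))"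
      using integrable_Psi_Psi[OF \<nu> \<nu>] by (intro integrable_mult_right integrable_divide Bochner_Integration.integrable_add ten.integrable_const)
    fix y assume "y \<in> space ten"
    then have y: "y \<in> cube" by (simp add: space_ten)
    have "\<bar>Psi \<psi> \<nu> y\<bar> \<le> (1 + Psi \<psi> \<nu> y * Psi \<psi> \<nu> y) / 2"
      using sum_squares_bound[of 1 "\<bar>Psi \<psi> \<nu> y\<bar>"] by (simp add: power2_eq_square)
    then show "cmod (G (cx y) * complex_of_real (Psi \<psi> \<nu> y)) \<le> ?B * ((1 + Psi \<psi> \<nu> y * Psi \<psi> \<nu> y) / 2)"
      unfolding norm_mult norm_of_real using Gb[OF y] B0 by (intro mult_mono) auto
  qed
  also have "\<dots> = ?B * ((1 + (\<integral>y. Psi \<psi> \<nu> y * Psi \<psi> \<nu> y \<partial>ten)) / 2)"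
    using integrable_Psi_Psi[OF \<nu> \<nu>] by (simp add: ten.prob_space)
  also have "\<dots> = ?B" by (simp add: Psi_ortho[OF \<nu> \<nu>])
  finally show ?thesis .
qed

text \<open>The constant radius 1 is admissible, and its polyellipse is the cube itself.\<close>

lemma holo_class_bounded:
  assumes f: "f \<in> holo_class \<mu> b \<eta>" and \<eta>: "0 < \<eta>" and y: "y \<in> cube"
  shows "cmod (f y) \<le> 1"
proof -
  obtain F where F: "\<And>y. y \<in> cube \<Longrightarrow> F (cx y) = f y" "\<And>z. z \<in> holo_region b \<eta> \<Longrightarrow> cmod (F z) \<le> 1"
    using f by (auto simp: holo_class_def)
  have "admissible b \<eta> (\<lambda>_. 1)" using \<eta> by (simp add: admissible_def)
  moreover have "cx y \<in> bernstein_polyellipse (\<lambda>_. 1)"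
    using y real_in_bernstein_ellipse[of 1] by (auto simp: bernstein_polyellipse_def cube_def abs_le_iff)
  ultimately have "cx y \<in> holo_region b \<eta>" by (auto simp: holo_region_def)
  then show ?thesis using F y by metis
qed

end

section \<open>Summability of the coefficient bounds\<close>

text \<open>Boxes stand in for the set of all multi-indices: sums over them are iterated sums over
  single entries, and every finite set of multi-indices lies in one.\<close>

definition mbox :: "nat set \<Rightarrow> nat \<Rightarrow> (nat \<Rightarrow> nat) set" where
  "mbox I N = {\<nu>. (\<forall>i\<in>I. \<nu> i \<le> N) \<and> (\<forall>i. i \<notin> I \<longrightarrow> \<nu> i = 0)}"

lemma mbox_empty: "mbox {} N = {\<lambda>_. 0}"
  by (auto simp: mbox_def)

lemma mbox_insert:
  assumes "i \<notin> I"
  shows "bij_betw (\<lambda>(n, \<nu>). \<nu>(i := n)) ({..N} \<times> mbox I N) (mbox (insert i I) N)"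
proof (rule bij_betwI')
  fix x y assume "x \<in> {..N} \<times> mbox I N" "y \<in> {..N} \<times> mbox I N"
  then obtain n \<nu> n' \<nu>' where xy: "x = (n, \<nu>)" "y = (n', \<nu>')" "\<nu> \<in> mbox I N" "\<nu>' \<in> mbox I N" by auto
  have "\<nu> = \<nu>'" if "\<nu>(i := n) = \<nu>'(i := n')"
  proof
    fix j show "\<nu> j = \<nu>' j"
      using fun_cong[OF that, of j] xy(3,4) assms by (cases "j = i") (auto simp: mbox_def)
  qed
  then show "((case x of (n, \<nu>) \<Rightarrow> \<nu>(i := n)) = (case y of (n, \<nu>) \<Rightarrow> \<nu>(i := n))) = (x = y)"
    using xy by (auto dest: fun_cong[of _ _ i])
next
  fix x assume "x \<in> {..N} \<times> mbox I N"
  then show "(case x of (n, \<nu>) \<Rightarrow> \<nu>(i := n)) \<in> mbox (insert i I) N" by (auto simp: mbox_def)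
next
  fix \<nu> assume \<nu>: "\<nu> \<in> mbox (insert i I) N"
  then have "(\<nu> i, \<nu>(i := 0)) \<in> {..N} \<times> mbox I N" by (auto simp: mbox_def)
  moreover have "\<nu> = (case (\<nu> i, \<nu>(i := 0)) of (n, \<nu>) \<Rightarrow> \<nu>(i := n))" by simp
  ultimately show "\<exists>x\<in>{..N} \<times> mbox I N. \<nu> = (case x of (n, \<nu>) \<Rightarrow> \<nu>(i := n))" by blast
qed

lemma sum_box_insert:
  assumes "i \<notin> I"
  shows "(\<Sum>\<nu>\<in>mbox (insert i I) N. g \<nu>) = (\<Sum>n\<le>N. \<Sum>\<nu>\<in>mbox I N. g (\<nu>(i := n)))"
  unfolding sum.cartesian_product
  by (subst sum.reindex_bij_betw[OF mbox_insert[OF assms], symmetric]) (simp add: split_beta)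

lemma finite_mbox: "finite I \<Longrightarrow> finite (mbox I N)"
proof (induction I rule: finite_induct)
  case (insert i I)
  then show ?case using bij_betw_finite[OF mbox_insert[OF insert.hyps(2), of N]] by simp
qed (simp add: mbox_empty)

text \<open>The term of index \<nu> in the multinomial expansion of the power of the sum of x whose
  exponent is the degree of \<nu> in \<open>I\<close>.\<close>

definition multinom :: "nat set \<Rightarrow> (nat \<Rightarrow> real) \<Rightarrow> (nat \<Rightarrow> nat) \<Rightarrow> real" where
  "multinom I x \<nu> = fact (\<Sum>i\<in>I. \<nu> i) * (\<Prod>i\<in>I. x i ^ \<nu> i / fact (\<nu> i))"

lemma multinom_nonneg: "(\<And>i. i \<in> I \<Longrightarrow> 0 \<le> x i) \<Longrightarrow> 0 \<le> multinom I x \<nu>"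
  unfolding multinom_def by (intro mult_nonneg_nonneg prod_nonneg) auto

text \<open>The multinomial theorem, by induction over the variables through the binomial theorem.
  It becomes an inequality because the box may cut off terms.\<close>

lemma sum_multinom_degree:
  assumes "finite I" "\<And>i. i \<in> I \<Longrightarrow> 0 \<le> x i"
  shows "(\<Sum>\<nu>\<in>mbox I N. if (\<Sum>i\<in>I. \<nu> i) = k then multinom I x \<nu> else 0) \<le> (\<Sum>i\<in>I. x i) ^ k"
  using assms
proof (induction I arbitrary: k rule: finite_induct)
  case empty
  show ?case unfolding mbox_empty by (simp add: multinom_def)
next
  case (insert i I)
  let ?s = "\<lambda>\<nu>. \<Sum>i\<in>I. \<nu> i"
  have x: "0 \<le> x i" "\<And>i. i \<in> I \<Longrightarrow> 0 \<le> x i" using insert.prems by auto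
  have u: "(\<Sum>j\<in>I. (\<nu>(i := n)) j) = ?s \<nu>" "(\<Prod>j\<in>I. x j ^ (\<nu>(i := n)) j / fact ((\<nu>(i := n)) j)) = (\<Prod>j\<in>I. x j ^ \<nu> j / fact (\<nu> j))" for \<nu> n
    using insert.hyps(2) by (auto intro!: sum.cong prod.cong)
  have e: "(if (\<Sum>j\<in>insert i I. (\<nu>(i := n)) j) = k then multinom (insert i I) x (\<nu>(i := n)) else 0)
     = (if n \<le> k then real (k choose n) * x i ^ n * (if ?s \<nu> = k - n then multinom I x \<nu> else 0) else 0)" for \<nu> n
  proof -
    have s: "(\<Sum>j\<in>insert i I. (\<nu>(i := n)) j) = n + ?s \<nu>" using insert.hyps u by simp
    have p: "(\<Prod>j\<in>insert i I. x j ^ (\<nu>(i := n)) j / fact ((\<nu>(i := n)) j)) = x i ^ n / fact n * (\<Prod>j\<in>I. x j ^ \<nu> j / fact (\<nu> j))"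
      using insert.hyps u by simp
    show ?thesis
    proof (cases "n \<le> k \<and> ?s \<nu> = k - n")
      case True
      then have "fact k / fact n = real (k choose n) * fact (?s \<nu>)" by (simp add: binomial_fact)
      then show ?thesis using True unfolding multinom_def s p by (simp add: field_simps)
    next
      case False
      then show ?thesis unfolding s by auto
    qed
  qed
  have "(\<Sum>\<nu>\<in>mbox (insert i I) N. if (\<Sum>j\<in>insert i I. \<nu> j) = k then multinom (insert i I) x \<nu> else 0)
     = (\<Sum>n\<le>N. if n \<le> k then real (k choose n) * x i ^ n * (\<Sum>\<nu>\<in>mbox I N. if ?s \<nu> = k - n then multinom I x \<nu> else 0) else 0)"
    unfolding sum_box_insert[OF insert.hyps(2)] e by (intro sum.cong refl) (simp add: sum_distrib_left)
  also have "\<dots> \<le> (\<Sum>n\<le>N. if n \<le> k then real (k choose n) * x i ^ n * (\<Sum>i\<in>I. x i) ^ (k - n) else 0)"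
    using insert.IH[OF x(2)] x by (intro sum_mono) (auto intro!: mult_left_mono)
  also have "\<dots> = (\<Sum>n\<in>{..N} \<inter> {..k}. real (k choose n) * x i ^ n * (\<Sum>i\<in>I. x i) ^ (k - n))"
    by (subst sum.inter_restrict) (auto intro!: sum.cong)
  also have "\<dots> \<le> (\<Sum>n\<le>k. real (k choose n) * x i ^ n * (\<Sum>i\<in>I. x i) ^ (k - n))"
    using x by (intro sum_mono2) (auto intro!: mult_nonneg_nonneg zero_le_power sum_nonneg)
  also have "\<dots> = (\<Sum>i\<in>insert i I. x i) ^ k" using insert.hyps by (simp add: binomial_ring)
  finally show ?case .
qed

lemma sum_multinom:
  assumes "finite I" "\<And>i. i \<in> I \<Longrightarrow> 0 \<le> x i" "(\<Sum>i\<in>I. x i) \<le> 1 / 2"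
  shows "(\<Sum>\<nu>\<in>mbox I N. multinom I x \<nu>) \<le> 2"
proof -
  let ?K = "card I * N"
  have "(\<Sum>\<nu>\<in>mbox I N. multinom I x \<nu>) = (\<Sum>\<nu>\<in>mbox I N. \<Sum>k\<le>?K. if (\<Sum>i\<in>I. \<nu> i) = k then multinom I x \<nu> else 0)"
  proof (intro sum.cong refl)
    fix \<nu> assume "\<nu> \<in> mbox I N"
    then have "(\<Sum>i\<in>I. \<nu> i) \<le> ?K" using sum_bounded_above[of I \<nu> N] by (simp add: mbox_def)
    then show "multinom I x \<nu> = (\<Sum>k\<le>?K. if (\<Sum>i\<in>I. \<nu> i) = k then multinom I x \<nu> else 0)" by simp
  qed
  also have "\<dots> \<le> (\<Sum>k\<le>?K. (\<Sum>i\<in>I. x i) ^ k)"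
    by (subst sum.swap) (intro sum_mono sum_multinom_degree assms)
  also have "\<dots> \<le> (\<Sum>k\<le>?K. (1 / 2) ^ k)" using assms by (intro sum_mono power_mono sum_nonneg)
  also have "\<dots> \<le> (\<Sum>k. (1 / 2) ^ k)" by (intro sum_le_suminf) auto
  also have "\<dots> = (2 :: real)" by (simp add: suminf_geometric)
  finally show ?thesis .
qed

text \<open>The sum factorizes over the variables in \<open>E\<close>, each contributing at most W.
  This is how the finitely many variables with large b are paid for by a constant.\<close>

lemma sum_box_weights:
  assumes "finite F" "\<And>i. i \<in> F \<Longrightarrow> 0 \<le> x i" "(\<Sum>i\<in>F. x i) \<le> 1 / 2"
    and "finite E" "E \<inter> F = {}" and w: "\<And>n. 0 \<le> w n" and W: "\<And>N. (\<Sum>n\<le>N. w n) \<le> W"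
  shows "(\<Sum>\<nu>\<in>mbox (E \<union> F) N. (\<Prod>i\<in>E. w (\<nu> i)) * multinom F x \<nu>) \<le> W ^ card E * 2"
  using assms(4,5)
proof (induction E rule: finite_induct)
  case empty
  then show ?case using sum_multinom[OF assms(1-3)] by simp
next
  case (insert i E)
  have i: "i \<notin> E \<union> F" using insert by auto
  have m: "multinom F x (\<nu>(i := n)) = multinom F x \<nu>" for \<nu> n
  proof -
    have "\<And>j. j \<in> F \<Longrightarrow> j \<noteq> i" using i by auto
    then show ?thesis unfolding multinom_def by (simp cong: sum.cong prod.cong)
  qed
  have p: "(\<Prod>j\<in>insert i E. w ((\<nu>(i := n)) j)) = w n * (\<Prod>j\<in>E. w (\<nu> j))" for \<nu> n
    using insert.hyps by (subst prod.insert) (auto intro!: prod.cong)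
  have "(\<Sum>\<nu>\<in>mbox (insert i E \<union> F) N. (\<Prod>i\<in>insert i E. w (\<nu> i)) * multinom F x \<nu>)
     = (\<Sum>n\<le>N. w n) * (\<Sum>\<nu>\<in>mbox (E \<union> F) N. (\<Prod>i\<in>E. w (\<nu> i)) * multinom F x \<nu>)"
    unfolding Un_insert_left sum_box_insert[OF i] m p
    by (simp add: sum_product mult.assoc)
  also have "\<dots> \<le> W * (W ^ card E * 2)"
  proof (intro mult_mono)
    show "0 \<le> W" using order.trans[OF sum_nonneg W[of 0]] w by auto
    show "0 \<le> (\<Sum>\<nu>\<in>mbox (E \<union> F) N. (\<Prod>i\<in>E. w (\<nu> i)) * multinom F x \<nu>)"
      using w assms(2) by (intro sum_nonneg mult_nonneg_nonneg prod_nonneg multinom_nonneg) auto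
  qed (use insert W in auto)
  finally show ?case using insert.hyps by simp
qed

lemma summable_poly5_geometric:
  assumes "0 < q" "q < 1" shows "summable (\<lambda>n. real (n + 1) ^ 5 * q ^ n)"
proof -
  \<comment> \<open>q^n is split into six equal factors: five tame the five factors n + 1, the last
    one ensures convergence.\<close>
  define r where "r = q powr (1 / 6)"
  have r: "0 < r" "r < 1" using assms powr_less_mono2[of "1/6" q 1] by (auto simp: r_def)
  have r6: "r ^ 6 = q" using assms by (simp add: r_def powr_power)
  have "(\<lambda>n. of_nat n * r ^ n + r ^ n) \<longlonglongrightarrow> 0 + 0"
    using r by (intro tendsto_add powser_times_n_limit_0 LIMSEQ_power_zero) auto
  then have "convergent (\<lambda>n. real (n + 1) * r ^ n)" by (auto simp: convergent_def algebra_simps)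
  then have "Bseq (\<lambda>n. real (n + 1) * r ^ n)" by (rule convergent_imp_Bseq)
  then obtain B where B: "\<And>n. norm (real (n + 1) * r ^ n) \<le> B" by (auto simp: Bseq_def)
  show ?thesis
  proof (rule summable_comparison_test')
    show "summable (\<lambda>n. B ^ 5 * r ^ n)" using r by (intro summable_mult summable_geometric) auto
    fix n
    have "real (n + 1) ^ 5 * q ^ n = (real (n + 1) * r ^ n) ^ 5 * r ^ n"
      unfolding r6[symmetric] by (simp add: power_mult_distrib power_mult[symmetric] power_add[symmetric])
    also have "\<dots> \<le> B ^ 5 * r ^ n" using B[of n] r by (intro mult_right_mono power_mono) (auto simp: abs_mult)
    finally show "norm (real (n + 1) ^ 5 * q ^ n) \<le> B ^ 5 * r ^ n" using assms by simp
  qed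
qed

text \<open>k^k / k! is one term of the exponential series at k.\<close>

lemma power_self_le_exp_fact: "real k ^ k \<le> exp (real k) * fact k"
proof -
  have s: "(\<lambda>n. real k ^ n / fact n) sums exp (real k)" using exp_converges[of "real k"] by (simp add: divide_inverse mult.commute)
  then have "(\<Sum>n\<in>{k}. real k ^ n / fact n) \<le> exp (real k)"
    using sum_le_suminf[of "\<lambda>n. real k ^ n / fact n" "{k}"] by (simp add: sums_iff)
  then show ?thesis by (simp add: field_simps)
qed

text \<open>The geometric constant is taken at the lower bound \<kappa> of the radii instead of at
  r, which leaves a pure power of r to be optimized.\<close>

definition coef_factor :: "real \<Rightarrow> nat \<Rightarrow> real \<Rightarrow> real" where
  "coef_factor \<kappa> n r = (2 / (1 - 1 / \<kappa>)) * real (1 + 2 * n) / r ^ n"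

text \<open>The infimum over all admissible radii depends neither on the function nor on the measure,
  so neither do the index sets selected by it.\<close>

definition coef_bd :: "(nat \<Rightarrow> real) \<Rightarrow> real \<Rightarrow> real \<Rightarrow> (nat \<Rightarrow> nat) \<Rightarrow> real" where
  "coef_bd b \<eta> \<kappa> \<nu> = Inf {(\<Prod>i\<in>msupp \<nu>. coef_factor \<kappa> (\<nu> i) (\<rho> i)) | \<rho>. admissible b \<eta> \<rho> \<and> (\<forall>i. \<kappa> \<le> \<rho> i)}"

lemma coef_factor_pos: "1 < \<kappa> \<Longrightarrow> 0 < r \<Longrightarrow> 0 < coef_factor \<kappa> n r"
  by (auto simp: coef_factor_def intro!: divide_pos_pos mult_pos_pos)

lemma prod_coef_factor_nonneg:
  assumes "1 < \<kappa>" "\<And>i. \<kappa> \<le> \<rho> i" shows "0 \<le> (\<Prod>i\<in>I. coef_factor \<kappa> (\<nu> i) (\<rho> i))"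
proof (rule prod_nonneg)
  fix i show "0 \<le> coef_factor \<kappa> (\<nu> i) (\<rho> i)" using coef_factor_pos[of \<kappa> "\<rho> i" "\<nu> i"] assms(1) assms(2)[of i] by simp
qed

lemma coef_bd_le:
  assumes "1 < \<kappa>" "admissible b \<eta> \<rho>" "\<And>i. \<kappa> \<le> \<rho> i"
  shows "coef_bd b \<eta> \<kappa> \<nu> \<le> (\<Prod>i\<in>msupp \<nu>. coef_factor \<kappa> (\<nu> i) (\<rho> i))"
  unfolding coef_bd_def
proof (rule cInf_lower)
  show "bdd_below {(\<Prod>i\<in>msupp \<nu>. coef_factor \<kappa> (\<nu> i) (\<rho> i)) | \<rho>. admissible b \<eta> \<rho> \<and> (\<forall>i. \<kappa> \<le> \<rho> i)}"
    using assms(1) by (intro bdd_belowI[of _ 0]) (auto intro!: prod_coef_factor_nonneg)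
qed (use assms in auto)

lemma coef_bd_greatest:
  assumes "1 < \<kappa>" "admissible b \<eta> (\<lambda>_. \<kappa>)"
    and "\<And>\<rho>. admissible b \<eta> \<rho> \<Longrightarrow> (\<And>i. \<kappa> \<le> \<rho> i) \<Longrightarrow> c \<le> (\<Prod>i\<in>msupp \<nu>. coef_factor \<kappa> (\<nu> i) (\<rho> i))"
  shows "c \<le> coef_bd b \<eta> \<kappa> \<nu>"
  unfolding coef_bd_def using assms by (intro cInf_greatest) auto

lemma coef_bd_nonneg:
  assumes "1 < \<kappa>" "admissible b \<eta> (\<lambda>_. \<kappa>)" shows "0 \<le> coef_bd b \<eta> \<kappa> \<nu>"
  by (rule coef_bd_greatest[OF assms]) (rule prod_coef_factor_nonneg[OF assms(1)])

text \<open>Enlarging a radius by x costs at most x / 2 in the budget of \<open>admissible\<close>,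
  since the reciprocal decreases.\<close>

lemma joukowski_growth: "1 \<le> (\<kappa> :: real) \<Longrightarrow> 0 \<le> x \<Longrightarrow> ((\<kappa> + x) + inverse (\<kappa> + x)) / 2 - 1 \<le> ((\<kappa> + inverse \<kappa>) / 2 - 1) + x / 2"
  using le_imp_inverse_le[of \<kappa> "\<kappa> + x"] by simp

lemma joukowski_ge_0: "1 \<le> r \<Longrightarrow> 0 \<le> (r + inverse r) / 2 - (1 :: real)"
proof -
  assume r: "1 \<le> r"
  have "0 \<le> (r - 1)\<^sup>2 / (2 * r)" using r by simp
  also have "\<dots> = (r + inverse r) / 2 - 1" using r by (simp add: field_simps power2_eq_square)
  finally show ?thesis .
qed

lemma exists_uniform_radius:
  fixes b :: "nat \<Rightarrow> real"
  assumes b: "\<And>i. 0 \<le> b i" "summable b" and \<eta>: "0 < \<eta>"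
  obtains \<kappa> where "1 < \<kappa>" "((\<kappa> + inverse \<kappa>) / 2 - 1) * (\<Sum>i. b i) \<le> \<eta> / 2"
proof -
  \<comment> \<open>The 1 added in the denominator covers the case b = 0.\<close>
  define x where "x = min 1 (\<eta> / (1 + (\<Sum>i. b i)))"
  have s: "0 \<le> (\<Sum>i. b i)" by (rule suminf_nonneg[OF b(2) b(1)])
  have x: "0 < x" "x \<le> \<eta> / (1 + (\<Sum>i. b i))" using s \<eta> by (auto simp: x_def)
  have "((1 + x) + inverse (1 + x)) / 2 - 1 \<le> x / 2" using joukowski_growth[of 1 x] x by simp
  then have "(((1 + x) + inverse (1 + x)) / 2 - 1) * (\<Sum>i. b i) \<le> x / 2 * (\<Sum>i. b i)" using s by (rule mult_right_mono)
  also have "\<dots> \<le> x / 2 * (1 + (\<Sum>i. b i))" using x by simp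
  also have "\<dots> \<le> \<eta> / 2" using x(2) s by (simp add: field_simps)
  finally show thesis using that[of "1 + x"] x by simp
qed

text \<open>The budget is halved: the uniform radius \<kappa> uses at most \<eta> / 2, and the
  shifts use at most half of the sum of \<open>x i * b i\<close>, which is again at most \<eta> /
  2.\<close>

lemma admissible_shift:
  assumes b: "\<And>i. 0 \<le> b i" "summable b" and \<kappa>: "1 < \<kappa>" "((\<kappa> + inverse \<kappa>) / 2 - 1) * (\<Sum>i. b i) \<le> \<eta> / 2"
    and fin: "finite I" and x: "\<And>i. 0 \<le> x i" "\<And>i. i \<notin> I \<Longrightarrow> x i = 0" "(\<Sum>i\<in>I. x i * b i) \<le> \<eta>"
  shows "admissible b \<eta> (\<lambda>i. \<kappa> + x i)"
proof -
  let ?g = "\<lambda>i. (((\<kappa> + x i) + inverse (\<kappa> + x i)) / 2 - 1) * b i"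
  let ?h = "\<lambda>i. ((\<kappa> + inverse \<kappa>) / 2 - 1) * b i + x i * b i / 2"
  have le: "?g i \<le> ?h i" for i
    using mult_right_mono[OF joukowski_growth[of \<kappa> "x i"] b(1)[of i]] \<kappa> x(1)[of i] by (simp add: algebra_simps)
  have nn: "0 \<le> ?g i" for i using joukowski_ge_0[of "\<kappa> + x i"] b(1)[of i] \<kappa> x(1)[of i] by (intro mult_nonneg_nonneg) auto
  have "(\<lambda>i. x i * b i / 2) sums (\<Sum>i\<in>I. x i * b i / 2)" using x(2) by (intro sums_finite[OF fin]) auto
  moreover have "(\<lambda>i. ((\<kappa> + inverse \<kappa>) / 2 - 1) * b i) sums (((\<kappa> + inverse \<kappa>) / 2 - 1) * (\<Sum>i. b i))"
    by (intro sums_mult summable_sums b)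
  ultimately have hs: "?h sums (((\<kappa> + inverse \<kappa>) / 2 - 1) * (\<Sum>i. b i) + (\<Sum>i\<in>I. x i * b i / 2))"
    by (intro sums_add)
  have gs: "summable ?g"
    by (rule summable_comparison_test'[where g = ?h]) (use hs le nn in \<open>auto simp: sums_iff\<close>)
  have "(\<Sum>i. ?g i) \<le> (\<Sum>i. ?h i)" by (rule suminf_le[OF le gs]) (use hs in \<open>auto simp: sums_iff\<close>)
  also have "\<dots> \<le> \<eta> / 2 + \<eta> / 2" using hs \<kappa>(2) x(3) by (simp add: sums_iff sum_divide_distrib[symmetric])
  finally show ?thesis using gs \<kappa> x(1) by (auto simp: admissible_def intro: add_increasing2)
qed


text \<open>The exponent 5 is 4 from the square of \<open>sup_psi\<close> plus 1 from 1 + 2 n \<le>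
  2 (n + 1), and 128 = 64 * 2. The polynomial part has a base of at least 1, so its power p \<le> 1
  may be dropped.\<close>

lemma factor_bound:
  assumes \<kappa>: "1 < \<kappa>" and p: "0 < p" "p \<le> 1" and r: "0 < r"
  shows "(sup_psi n)\<^sup>2 * coef_factor \<kappa> n r powr p \<le> (128 * (2 / (1 - 1 / \<kappa>))) * real (n + 1) ^ 5 * (1 / r ^ n) powr p"
proof -
  define K where "K = 2 / (1 - 1 / \<kappa>)"
  have K: "1 \<le> K" using \<kappa> by (simp add: K_def field_simps)
  have "1 * 1 \<le> K * real (1 + 2 * n)" using K by (intro mult_mono) auto
  then have c: "1 \<le> K * real (1 + 2 * n)" by simp
  have "coef_factor \<kappa> n r powr p = (K * real (1 + 2 * n)) powr p * (1 / r ^ n) powr p"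
    unfolding coef_factor_def K_def[symmetric] by (subst powr_mult[symmetric]) simp
  also have "(K * real (1 + 2 * n)) powr p \<le> (K * real (1 + 2 * n)) powr 1" using c p by (intro powr_mono) auto
  also have "(K * real (1 + 2 * n)) powr 1 \<le> K * (2 * real (n + 1))" using c K by (simp add: mult_left_mono)
  finally have t: "coef_factor \<kappa> n r powr p \<le> K * (2 * real (n + 1)) * (1 / r ^ n) powr p" by (simp add: mult_right_mono)
  have "(sup_psi n)\<^sup>2 \<le> 64 * real (n + 1) ^ 4" by (simp add: sup_psi_def power_mult_distrib power_mult[symmetric])
  then have "(sup_psi n)\<^sup>2 * coef_factor \<kappa> n r powr p \<le> (64 * real (n + 1) ^ 4) * (K * (2 * real (n + 1)) * (1 / r ^ n) powr p)"
    using t by (intro mult_mono) auto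
  also have "\<dots> = (128 * K) * real (n + 1) ^ 5 * (1 / r ^ n) powr p" by (simp add: power_numeral_reduce algebra_simps)
  finally show ?thesis unfolding K_def .
qed

text \<open>A constant per variable is too expensive for the variables with small b, as their number
  is unbounded. For n > 0 it can be charged to the n-th power and absorbed by the smallness of
  b.\<close>

lemma poly_weight_le_power:
  assumes "1 \<le> A" "0 < n" shows "A * real (n + 1) ^ 5 \<le> (32 * A) ^ n"
proof -
  have "Suc n \<le> 2 ^ n" by (induction n) auto
  then have "real (n + 1) \<le> 2 ^ n" by (metis Suc_eq_plus1 of_nat_le_iff of_nat_numeral of_nat_power)
  then have "real (n + 1) ^ 5 \<le> (2 ^ n) ^ 5" by (intro power_mono) auto
  also have "(2 ^ n) ^ 5 = (32 :: real) ^ n" by (simp add: power_mult[symmetric] mult.commute[of n]) (simp add: power_mult)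
  finally have "A * real (n + 1) ^ 5 \<le> A ^ n * 32 ^ n"
    using assms self_le_power[of A n] by (intro mult_mono) auto
  then show ?thesis by (simp add: power_mult_distrib mult.commute)
qed

text \<open>The product is at least 1, so p can be raised to 1. By n! \<le> n^n and k^k \<le> exp k
  * k! it turns into a multinomial coefficient times exp k, and exp k is again a power in each
  variable.\<close>

lemma multinomial_ratio_bound:
  assumes fin: "finite I" and pos: "\<And>i. i \<in> I \<Longrightarrow> 0 < \<nu> i" and p: "0 < p" "p \<le> 1"
  defines "k \<equiv> \<Sum>i\<in>I. \<nu> i"
  shows "(\<Prod>i\<in>I. (real k / real (\<nu> i)) ^ \<nu> i) powr p \<le> exp (real k) * fact k / (\<Prod>i\<in>I. fact (\<nu> i))"
proof -
  have le: "\<nu> i \<le> k" if "i \<in> I" for i unfolding k_def using that fin by (intro member_le_sum) auto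
  have "1 \<le> (\<Prod>i\<in>I. (real k / real (\<nu> i)) ^ \<nu> i)"
    using le pos by (intro prod_ge_1 one_le_power) auto
  then have "(\<Prod>i\<in>I. (real k / real (\<nu> i)) ^ \<nu> i) powr p \<le> (\<Prod>i\<in>I. (real k / real (\<nu> i)) ^ \<nu> i) powr 1"
    using p by (intro powr_mono) auto
  also have "\<dots> = (\<Prod>i\<in>I. (real k / real (\<nu> i)) ^ \<nu> i)" using \<open>1 \<le> _\<close> by simp
  also have "\<dots> \<le> (\<Prod>i\<in>I. real k ^ \<nu> i / fact (\<nu> i))"
  proof (intro prod_mono conjI)
    fix i assume i: "i \<in> I"
    have "fact (\<nu> i) \<le> real (\<nu> i ^ \<nu> i)" by (rule fact_le_power)
    then show "(real k / real (\<nu> i)) ^ \<nu> i \<le> real k ^ \<nu> i / fact (\<nu> i)"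
      using pos[OF i] by (simp add: power_divide divide_left_mono)
  qed auto
  also have "\<dots> = real k ^ k / (\<Prod>i\<in>I. fact (\<nu> i))" by (simp add: prod_dividef k_def power_sum)
  also have "\<dots> \<le> exp (real k) * fact k / (\<Prod>i\<in>I. fact (\<nu> i))"
    by (intro divide_right_mono power_self_le_exp_fact prod_nonneg) auto
  finally show ?thesis .
qed

text \<open>Particular radii are inserted into the infimum. For the variables in \<open>F\<close>
  the p-th power of the reciprocal radius splits into a power of bt / \<eta> and the ratios handled
  by \<open>multinomial_ratio_bound\<close>; the constant in \<open>x\<close> collects 32 A from the
  polynomial weights and exp 1 from the ratios. \<open>bt\<close> is a positive majorant of b, which
  makes the division possible.\<close>

lemma weighted_term_bound:
  assumes b: "\<And>i. 0 \<le> b i" "summable b" and bt: "\<And>i. b i \<le> bt i" "\<And>i. 0 < bt i" and \<eta>: "0 < \<eta>"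
    and \<kappa>: "1 < \<kappa>" "((\<kappa> + inverse \<kappa>) / 2 - 1) * (\<Sum>i. b i) \<le> \<eta> / 2"
    and p: "0 < p" "p \<le> 1" and \<nu>: "finite (msupp \<nu>)" "msupp \<nu> \<subseteq> {..<J} \<union> F" and F: "finite F" "{..<J} \<inter> F = {}"
  defines "A \<equiv> 128 * (2 / (1 - 1 / \<kappa>))"
  defines "w \<equiv> \<lambda>n. if n = 0 then 1 else A * real (n + 1) ^ 5 * ((1 / \<kappa>) powr p) ^ n"
    and "x \<equiv> \<lambda>i. 32 * A * exp 1 * (bt i / \<eta>) powr p"
  shows "(sup_Psi \<nu>)\<^sup>2 * coef_bd b \<eta> \<kappa> \<nu> powr p \<le> (\<Prod>i\<in>{..<J}. w (\<nu> i)) * multinom F x \<nu>"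
proof -
  define SE SF where "SE = msupp \<nu> \<inter> {..<J}" and "SF = msupp \<nu> \<inter> F"
  have fin: "finite SE" "finite SF" and un: "msupp \<nu> = SE \<union> SF" "SE \<inter> SF = {}" using \<nu> F by (auto simp: SE_def SF_def)
  have pos: "0 < \<nu> i" if "i \<in> SE \<union> SF" for i using that by (auto simp: SE_def SF_def msupp_def)
  define k where "k = (\<Sum>i\<in>SF. \<nu> i)"
  define s where "s = (\<lambda>i. if i \<in> SF then \<eta> * real (\<nu> i) / (real k * bt i) else 0)"
  define \<rho> where "\<rho> = (\<lambda>i. \<kappa> + s i)"
  have A1: "1 \<le> A" using \<kappa> by (simp add: A_def field_simps)
  have kpos: "0 < k" if "i \<in> SF" for i
  proof -
    have "\<nu> i \<le> k" unfolding k_def using that fin by (intro member_le_sum) auto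
    then show ?thesis using pos[of i] that by simp
  qed
  have s0: "0 \<le> s i" for i using \<eta> bt(2)[of i] by (auto simp: s_def)
  have \<rho>\<kappa>: "\<kappa> \<le> \<rho> i" for i using s0 by (simp add: \<rho>_def)
  have "admissible b \<eta> (\<lambda>i. \<kappa> + s i)"
  proof (rule admissible_shift[OF b \<kappa> fin(2) s0])
    show "i \<notin> SF \<Longrightarrow> s i = 0" for i by (simp add: s_def)
    have "(\<Sum>i\<in>SF. s i * b i) \<le> (\<Sum>i\<in>SF. \<eta> * real (\<nu> i) / real k)"
    proof (intro sum_mono)
      fix i assume i: "i \<in> SF"
      have "s i * b i \<le> s i * bt i" using s0 bt by (intro mult_left_mono)
      also have "\<dots> = \<eta> * real (\<nu> i) / real k" using i bt(2)[of i] by (simp add: s_def)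
      finally show "s i * b i \<le> \<eta> * real (\<nu> i) / real k" .
    qed
    also have "\<dots> = \<eta> * (real k / real k)" by (simp add: k_def sum_distrib_left[symmetric] sum_divide_distrib[symmetric])
    \<comment> \<open>If \<open>SF\<close> is empty, k = 0 and the quotient k / k is 0 by
      convention; hence an inequality.\<close>
    also have "\<dots> \<le> \<eta> * 1" using \<eta> by (intro mult_left_mono) auto
    finally show "(\<Sum>i\<in>SF. s i * b i) \<le> \<eta>" by simp
  qed
  then have adm: "admissible b \<eta> \<rho>" by (simp add: \<rho>_def)
  have kadm: "admissible b \<eta> (\<lambda>_. \<kappa>)"
    using admissible_shift[OF b \<kappa>, of "{}" "\<lambda>_. 0"] \<eta> by simp
  have \<rho>0: "0 < \<rho> i" for i using \<rho>\<kappa>[of i] \<kappa> by linarith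
  have "(sup_Psi \<nu>)\<^sup>2 * coef_bd b \<eta> \<kappa> \<nu> powr p \<le> (sup_Psi \<nu>)\<^sup>2 * (\<Prod>i\<in>msupp \<nu>. coef_factor \<kappa> (\<nu> i) (\<rho> i)) powr p"
    using p by (intro mult_left_mono powr_mono2 coef_bd_le coef_bd_nonneg \<kappa> adm kadm \<rho>\<kappa>) auto
  also have "\<dots> = (\<Prod>i\<in>msupp \<nu>. (sup_psi (\<nu> i))\<^sup>2 * coef_factor \<kappa> (\<nu> i) (\<rho> i) powr p)"
    by (simp add: sup_Psi_def prod_powr_distrib prod.distrib prod_power_distrib)
  also have "\<dots> \<le> (\<Prod>i\<in>msupp \<nu>. A * real (\<nu> i + 1) ^ 5 * (1 / \<rho> i ^ \<nu> i) powr p)"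
    unfolding A_def using \<kappa> p \<rho>0 by (intro prod_mono conjI factor_bound) auto
  also have "\<dots> = (\<Prod>i\<in>SE. A * real (\<nu> i + 1) ^ 5 * (1 / \<rho> i ^ \<nu> i) powr p) * (\<Prod>i\<in>SF. A * real (\<nu> i + 1) ^ 5 * (1 / \<rho> i ^ \<nu> i) powr p)"
    unfolding un(1) by (rule prod.union_disjoint[OF fin un(2)])
  also have "\<dots> \<le> (\<Prod>i\<in>{..<J}. w (\<nu> i)) * multinom F x \<nu>"
  proof (rule mult_mono)
    have "(\<Prod>i\<in>SE. A * real (\<nu> i + 1) ^ 5 * (1 / \<rho> i ^ \<nu> i) powr p) = (\<Prod>i\<in>SE. w (\<nu> i))"
    proof (intro prod.cong refl)
      fix i assume i: "i \<in> SE"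
      then have "\<rho> i = \<kappa>" using un(2) by (auto simp: \<rho>_def s_def)
      moreover have "(1 / \<kappa> ^ \<nu> i) powr p = ((1 / \<kappa>) powr p) ^ \<nu> i"
        using \<kappa> by (simp add: powr_power powr_realpow[symmetric] powr_divide powr_powr mult.commute)
      ultimately show "A * real (\<nu> i + 1) ^ 5 * (1 / \<rho> i ^ \<nu> i) powr p = w (\<nu> i)"
        using pos[of i] i by (simp add: w_def)
    qed
    also have "\<dots> = (\<Prod>i\<in>{..<J}. w (\<nu> i))"
      by (rule prod.mono_neutral_left) (auto simp: SE_def msupp_def w_def)
    finally show "(\<Prod>i\<in>SE. A * real (\<nu> i + 1) ^ 5 * (1 / \<rho> i ^ \<nu> i) powr p) \<le> (\<Prod>i\<in>{..<J}. w (\<nu> i))" by simp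
    have "(\<Prod>i\<in>SF. A * real (\<nu> i + 1) ^ 5 * (1 / \<rho> i ^ \<nu> i) powr p)
       \<le> (\<Prod>i\<in>SF. ((32 * A) ^ \<nu> i * ((bt i / \<eta>) powr p) ^ \<nu> i) * ((real k / real (\<nu> i)) ^ \<nu> i) powr p)"
    proof (intro prod_mono conjI)
      fix i assume i: "i \<in> SF"
      have \<nu>i: "0 < \<nu> i" and ki: "0 < k" using pos[of i] i kpos[OF i] by auto
      have sp: "0 < s i" using i \<eta> bt(2)[of i] \<nu>i ki by (simp add: s_def)
      have "1 / \<rho> i ^ \<nu> i \<le> 1 / s i ^ \<nu> i"
        using sp \<kappa> by (intro divide_left_mono power_mono mult_pos_pos) (auto simp: \<rho>_def)
      then have "(1 / \<rho> i ^ \<nu> i) powr p \<le> (1 / s i ^ \<nu> i) powr p" using p \<rho>0[of i] by (intro powr_mono2) auto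
      also have "1 / s i ^ \<nu> i = (bt i / \<eta>) ^ \<nu> i * (real k / real (\<nu> i)) ^ \<nu> i"
        using i by (simp add: s_def power_divide power_mult_distrib)
      also have "\<dots> powr p = ((bt i / \<eta>) ^ \<nu> i) powr p * ((real k / real (\<nu> i)) ^ \<nu> i) powr p" by (rule powr_mult)
      also have "((bt i / \<eta>) ^ \<nu> i) powr p = ((bt i / \<eta>) powr p) ^ \<nu> i"
        using bt(2)[of i] \<eta> by (simp add: powr_power powr_realpow[symmetric] powr_powr mult.commute)
      finally have "(1 / \<rho> i ^ \<nu> i) powr p \<le> ((bt i / \<eta>) powr p) ^ \<nu> i * ((real k / real (\<nu> i)) ^ \<nu> i) powr p" .
      from mult_mono[OF poly_weight_le_power[OF A1 \<nu>i] this]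
      show "A * real (\<nu> i + 1) ^ 5 * (1 / \<rho> i ^ \<nu> i) powr p
         \<le> ((32 * A) ^ \<nu> i * ((bt i / \<eta>) powr p) ^ \<nu> i) * ((real k / real (\<nu> i)) ^ \<nu> i) powr p"
        using A1 by (simp add: mult.assoc)
      show "0 \<le> A * real (\<nu> i + 1) ^ 5 * (1 / \<rho> i ^ \<nu> i) powr p" using A1 by simp
    qed
    also have "\<dots> = (\<Prod>i\<in>SF. (32 * A * (bt i / \<eta>) powr p) ^ \<nu> i) * (\<Prod>i\<in>SF. (real k / real (\<nu> i)) ^ \<nu> i) powr p"
      by (simp add: prod.distrib prod_powr_distrib power_mult_distrib)
    also have "\<dots> \<le> (\<Prod>i\<in>SF. (32 * A * (bt i / \<eta>) powr p) ^ \<nu> i) * (exp (real k) * fact k / (\<Prod>i\<in>SF. fact (\<nu> i)))"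
      unfolding k_def using A1 pos p by (intro mult_left_mono multinomial_ratio_bound[OF fin(2)] prod_nonneg) auto
    also have "exp (real k) = (\<Prod>i\<in>SF. exp 1 ^ \<nu> i)" unfolding k_def
      by (simp add: exp_of_nat_mult[symmetric] exp_sum[OF fin(2)])
    also have "(\<Prod>i\<in>SF. (32 * A * (bt i / \<eta>) powr p) ^ \<nu> i) * ((\<Prod>i\<in>SF. exp 1 ^ \<nu> i) * fact k / (\<Prod>i\<in>SF. fact (\<nu> i)))
       = fact k * (\<Prod>i\<in>SF. x i ^ \<nu> i / fact (\<nu> i))"
      by (simp add: x_def prod.distrib prod_dividef power_mult_distrib)
    also have "\<dots> = multinom F x \<nu>"
    proof -
      have "(\<Sum>i\<in>F. \<nu> i) = k" unfolding k_def SF_def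
        by (rule sum.mono_neutral_right) (auto simp: msupp_def F)
      moreover have "(\<Prod>i\<in>F. x i ^ \<nu> i / fact (\<nu> i)) = (\<Prod>i\<in>SF. x i ^ \<nu> i / fact (\<nu> i))" unfolding SF_def
      proof (rule prod.mono_neutral_right)
        show "\<forall>i\<in>F - msupp \<nu> \<inter> F. x i ^ \<nu> i / fact (\<nu> i) = 1"
        proof
          fix i assume "i \<in> F - msupp \<nu> \<inter> F"
          then have "\<nu> i = 0" by (auto simp: msupp_def)
          then show "x i ^ \<nu> i / fact (\<nu> i) = 1" by simp
        qed
      qed (use F in auto)
      ultimately show ?thesis by (simp add: multinom_def)
    qed
    finally show "(\<Prod>i\<in>SF. A * real (\<nu> i + 1) ^ 5 * (1 / \<rho> i ^ \<nu> i) powr p) \<le> multinom F x \<nu>" .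
    show "0 \<le> (\<Prod>i\<in>{..<J}. w (\<nu> i))" using A1 by (intro prod_nonneg) (auto simp: w_def)
    show "0 \<le> (\<Prod>i\<in>SF. A * real (\<nu> i + 1) ^ 5 * (1 / \<rho> i ^ \<nu> i) powr p)" using A1 by (intro prod_nonneg) auto
  qed
  finally show ?thesis .
qed

text \<open>The geometric floor makes every entry positive, so that it can be divided by, and costs
  only a convergent series.\<close>

lemma summable_powr_max_geometric:
  fixes p :: real
  assumes "0 < p" "summable (\<lambda>i. b i powr p)"
  shows "summable (\<lambda>i. (max (b i) ((1 / 2) ^ i)) powr p)"
proof (rule summable_comparison_test')
  have "summable (\<lambda>i. ((1 / 2) powr p) ^ i)" using powr_less_mono2[of p "1/2" 1] assms by (intro summable_geometric) auto
  moreover have "((1 / 2) powr p) ^ i = ((1 / 2) ^ i) powr p" for i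
    by (simp add: powr_power powr_realpow[symmetric] powr_powr mult.commute)
  ultimately show "summable (\<lambda>i. b i powr p + ((1 / 2) ^ i) powr p)" using assms by (intro summable_add) auto
  show "norm (max (b i) ((1 / 2) ^ i) powr p) \<le> b i powr p + ((1 / 2) ^ i) powr p" for i by (auto simp: max_def)
qed

text \<open>J is chosen so that the tail of \<open>x\<close> sums to less than 1/2, within reach of
  the multinomial estimate; the first J variables contribute the factor W^J. Neither J nor W depends
  on the finite set Z.\<close>

lemma weighted_coef_summable:
  assumes b: "\<And>i. 0 \<le> b i" "summable b" and \<eta>: "0 < \<eta>"
    and \<kappa>: "1 < \<kappa>" "((\<kappa> + inverse \<kappa>) / 2 - 1) * (\<Sum>i. b i) \<le> \<eta> / 2"
    and p: "0 < p" "p < 1" and bp: "summable (\<lambda>i. b i powr p)"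
  shows "\<exists>\<Sigma>>0. \<forall>Z\<subseteq>multi_indices. finite Z \<longrightarrow> (\<Sum>\<nu>\<in>Z. (sup_Psi \<nu>)\<^sup>2 * coef_bd b \<eta> \<kappa> \<nu> powr p) \<le> \<Sigma>"
proof -
  define bt where "bt = (\<lambda>i. max (b i) ((1 / 2) ^ i))"
  have bt: "b i \<le> bt i" "0 < bt i" for i by (auto simp: bt_def less_max_iff_disj)
  define A where "A = 128 * (2 / (1 - 1 / \<kappa>))"
  have A0: "0 < A" using \<kappa> by (simp add: A_def)
  define w where "w = (\<lambda>n. if n = 0 then 1 else A * real (n + 1) ^ 5 * ((1 / \<kappa>) powr p) ^ n)"
  define x where "x = (\<lambda>i. 32 * A * exp 1 * (bt i / \<eta>) powr p)"
  have w0: "0 \<le> w n" for n using A0 by (simp add: w_def)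
  have x0: "0 \<le> x i" for i using A0 by (simp add: x_def)
  have "summable (\<lambda>i. (32 * A * exp 1 / \<eta> powr p) * bt i powr p)"
    unfolding bt_def by (intro summable_mult summable_powr_max_geometric p bp)
  then have sx: "summable x" unfolding x_def by (simp add: powr_divide)
  obtain J where "norm (\<Sum>i. x (i + J)) < 1 / 2" using suminf_exist_split[OF _ sx, of "1 / 2"] by auto
  then have J: "(\<Sum>i. x (i + J)) < 1 / 2" using abs_ge_self[of "\<Sum>i. x (i + J)"] by (simp only: real_norm_def)
  have q: "0 < (1 / \<kappa>) powr p" "(1 / \<kappa>) powr p < 1" using \<kappa> p powr_less_mono2[of p "1 / \<kappa>" 1] by auto
  \<comment> \<open>The correction at n = 0 accounts for the value w 0 = 1 in place of A.\<close>
  have "summable (\<lambda>n. A * (real (n + 1) ^ 5 * ((1 / \<kappa>) powr p) ^ n) + (if n = 0 then 1 - A else 0))"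
    by (intro summable_add summable_mult summable_poly5_geometric q) (rule summable_finite[of "{0}"], auto)
  also have "(\<lambda>n. A * (real (n + 1) ^ 5 * ((1 / \<kappa>) powr p) ^ n) + (if n = 0 then 1 - A else 0)) = w"
    by (auto simp: w_def fun_eq_iff)
  finally have sw: "summable w" .
  define W where "W = (\<Sum>n. w n)"
  have W: "(\<Sum>n\<le>N. w n) \<le> W" for N unfolding W_def using sw w0 by (intro sum_le_suminf) auto
  have W0: "0 \<le> W" using order.trans[OF sum_nonneg W[of 0]] w0 by auto
  have "(\<Sum>\<nu>\<in>Z. (sup_Psi \<nu>)\<^sup>2 * coef_bd b \<eta> \<kappa> \<nu> powr p) \<le> W ^ J * 2 + 1" if Z: "Z \<subseteq> multi_indices" "finite Z" for Z
  proof -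
    have fs: "finite (\<Union>\<nu>\<in>Z. msupp \<nu>)" using Z finite_msupp by auto
    then obtain N0 where N0: "(\<Union>\<nu>\<in>Z. msupp \<nu>) \<subseteq> {..<N0}" using finite_nat_iff_bounded by blast
    define N where "N = max N0 J"
    define F where "F = {J..<N}"
    have "finite (\<Union>\<nu>\<in>Z. \<nu> ` msupp \<nu>)" using Z finite_msupp by auto
    then obtain D where D: "(\<Union>\<nu>\<in>Z. \<nu> ` msupp \<nu>) \<subseteq> {..<D}" using finite_nat_iff_bounded by blast
    have EF: "{..<J} \<union> F = {..<N}" "{..<J} \<inter> F = {}" "finite F" by (auto simp: F_def N_def)
    have sub: "msupp \<nu> \<subseteq> {..<J} \<union> F" if "\<nu> \<in> Z" for \<nu> using N0 that unfolding EF N_def by fastforce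
    have Zb: "Z \<subseteq> mbox ({..<J} \<union> F) D"
    proof
      fix \<nu> assume \<nu>: "\<nu> \<in> Z"
      have "\<nu> i \<le> D" for i using D \<nu> by (cases "\<nu> i = 0") (force simp: msupp_def)+
      moreover have "\<nu> i = 0" if "i \<notin> {..<J} \<union> F" for i using sub[OF \<nu>] that by (auto simp: msupp_def)
      ultimately show "\<nu> \<in> mbox ({..<J} \<union> F) D" by (simp add: mbox_def)
    qed
    have sF: "(\<Sum>i\<in>F. x i) \<le> 1 / 2"
    proof -
      have "(\<Sum>i\<in>F. x i) = (\<Sum>i\<in>{0..<N - J}. x (i + J))"
        unfolding F_def by (rule sum.reindex_bij_witness[of _ "\<lambda>i. i + J" "\<lambda>i. i - J"]) auto
      also have "\<dots> \<le> (\<Sum>i. x (i + J))" using sx x0 by (intro sum_le_suminf) (auto simp: summable_iff_shift)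
      finally show ?thesis using J by simp
    qed
    have "(\<Sum>\<nu>\<in>Z. (sup_Psi \<nu>)\<^sup>2 * coef_bd b \<eta> \<kappa> \<nu> powr p) \<le> (\<Sum>\<nu>\<in>Z. (\<Prod>i\<in>{..<J}. w (\<nu> i)) * multinom F x \<nu>)"
      unfolding w_def x_def A_def
      using Z finite_msupp p by (intro sum_mono weighted_term_bound[OF b bt \<eta> \<kappa> p(1) _ _ sub EF(3,2)]) auto
    also have "\<dots> \<le> (\<Sum>\<nu>\<in>mbox ({..<J} \<union> F) D. (\<Prod>i\<in>{..<J}. w (\<nu> i)) * multinom F x \<nu>)"
      using w0 x0 EF by (intro sum_mono2 Zb finite_mbox mult_nonneg_nonneg prod_nonneg multinom_nonneg) auto
    also have "\<dots> \<le> W ^ card {..<J} * 2"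
      by (rule sum_box_weights[OF EF(3) x0 sF _ EF(2) w0 W]) simp
    finally show ?thesis by simp
  qed
  then show ?thesis using W0 by (intro exI[of _ "W ^ J * 2 + 1"]) (auto simp: add_nonneg_pos)
qed

section \<open>Index sets and expansions\<close>

text \<open>The threshold is the infimum of the admissible ones, so that one set serves all exponents \<open>p\<close> at once.\<close>

lemma threshold_set:
  fixes B u :: "'x \<Rightarrow> real"
  assumes B: "\<And>\<nu>. 0 \<le> B \<nu>" and u: "\<And>\<nu>. 1 \<le> u \<nu>" and k: "0 \<le> k"
    and P: "\<And>p \<Sigma>. P p \<Sigma> \<longleftrightarrow> 0 < p \<and> p < 1 \<and> 0 < \<Sigma> \<and> (\<forall>Z\<subseteq>X. finite Z \<longrightarrow> (\<Sum>\<nu>\<in>Z. (u \<nu>)\<^sup>2 * B \<nu> powr p) \<le> \<Sigma>)"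
    and ex: "P p0 \<Sigma>0"
  shows "\<exists>T\<subseteq>X. finite T \<and> (\<Sum>\<nu>\<in>T. (u \<nu>)\<^sup>2) \<le> k \<and>
    (\<forall>p \<Sigma>. P p \<Sigma> \<longrightarrow> (\<forall>Z\<subseteq>X - T. finite Z \<longrightarrow>
       (\<Sum>\<nu>\<in>Z. (B \<nu>)\<^sup>2) \<le> (\<Sigma> powr (1 / p))\<^sup>2 * (max 1 k) powr (1 - 2 / p) \<and>
       (\<Sum>\<nu>\<in>Z. u \<nu> * B \<nu>) \<le> \<Sigma> powr (1 / p) * (max 1 k) powr (1 - 1 / p)))"
proof -
  define T where "T = (\<lambda>t. {\<nu>\<in>X. t * u \<nu> < B \<nu>})"
  define good where "good = {t. 0 \<le> t \<and> (\<forall>Z\<subseteq>T t. finite Z \<longrightarrow> (\<Sum>\<nu>\<in>Z. (u \<nu>)\<^sup>2) \<le> k)}"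
  define K where "K = max 1 k"
  have K: "1 \<le> K" "0 < K" by (auto simp: K_def)
  \<comment> \<open>The threshold at which a Markov-type estimate of the weighted p-sum yields total
    weight K.\<close>
  define tp where "tp = (\<lambda>p \<Sigma>. (\<Sigma> / K) powr (1 / p))"
  have u0: "0 < u \<nu>" for \<nu> using u[of \<nu>] by linarith
  have anti: "T t' \<subseteq> T t" if "t \<le> t'" for t t'
  proof
    fix \<nu> assume "\<nu> \<in> T t'"
    moreover have "t * u \<nu> \<le> t' * u \<nu>" using that u0[of \<nu>] by (intro mult_right_mono) auto
    ultimately show "\<nu> \<in> T t" by (auto simp: T_def)
  qed
  have tpgood: "tp p \<Sigma> \<in> good" if "P p \<Sigma>" for p \<Sigma>
  proof -
    have p: "0 < p" "p < 1" "0 < \<Sigma>" and S: "\<And>Z. Z \<subseteq> X \<Longrightarrow> finite Z \<Longrightarrow> (\<Sum>\<nu>\<in>Z. (u \<nu>)\<^sup>2 * B \<nu> powr p) \<le> \<Sigma>"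
      using that P by auto
    let ?t = "tp p \<Sigma>"
    have t: "0 < ?t" "?t powr p = \<Sigma> / K" using p K by (auto simp: tp_def powr_powr)
    have B_large: "\<Sigma> / K \<le> B \<nu> powr p" if "\<nu> \<in> T ?t" for \<nu>
    proof -
      have "?t \<le> ?t * u \<nu>" using t(1) u[of \<nu>] by simp
      then have "?t \<le> B \<nu>" using that by (simp add: T_def)
      then have "?t powr p \<le> B \<nu> powr p" using p t(1) by (intro powr_mono2) auto
      then show ?thesis using t by simp
    qed
    have "(\<Sum>\<nu>\<in>Z. (u \<nu>)\<^sup>2) \<le> k" if Z: "Z \<subseteq> T ?t" "finite Z" for Z
    proof (cases "1 \<le> k")
      case True
      have "(\<Sum>\<nu>\<in>Z. (u \<nu>)\<^sup>2) * (\<Sigma> / K) \<le> (\<Sum>\<nu>\<in>Z. (u \<nu>)\<^sup>2 * B \<nu> powr p)"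
        unfolding sum_distrib_right using Z B_large by (intro sum_mono mult_left_mono) auto
      also have "\<dots> \<le> \<Sigma>" using Z by (intro S) (auto simp: T_def)
      finally have "(\<Sum>\<nu>\<in>Z. (u \<nu>)\<^sup>2) \<le> K" using p K by (simp add: field_simps)
      then show ?thesis using True by (simp add: K_def)
    next
      case False
      then have K1: "K = 1" by (simp add: K_def)
      \<comment> \<open>For k < 1 no index may be selected at all. The strict inequality in T
        excludes indices whose bound just meets the threshold.\<close>
      have "T ?t = {}"
      proof (rule ccontr)
        assume "T ?t \<noteq> {}"
        then obtain \<nu> where \<nu>: "\<nu> \<in> T ?t" by blast
        have "?t \<le> ?t * u \<nu>" using t(1) u[of \<nu>] by simp
        then have "?t < B \<nu>" using \<nu> by (simp add: T_def)
        then have "?t powr p < B \<nu> powr p" using p t(1) by (intro powr_less_mono2) auto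
        then have "\<Sigma> < 1 * B \<nu> powr p" using t K1 by simp
        also have "\<dots> \<le> (u \<nu>)\<^sup>2 * B \<nu> powr p" using u[of \<nu>] by (intro mult_right_mono) auto
        also have "\<dots> \<le> \<Sigma>" using S[of "{\<nu>}"] \<nu> by (auto simp: T_def)
        finally show False by simp
      qed
      then show ?thesis using Z k by auto
    qed
    then show ?thesis using t(1) by (simp add: good_def)
  qed
  define t0 where "t0 = Inf good"
  have bdd: "bdd_below good" by (auto simp: good_def bdd_below_def)
  have ne: "good \<noteq> {}" using tpgood[OF ex] by auto
  have t0: "0 \<le> t0" unfolding t0_def using ne by (intro cInf_greatest) (auto simp: good_def)
  \<comment> \<open>The infimum is itself good: a finite set above the threshold t0 is still above a
    slightly larger one, and good thresholds exist arbitrarily close to t0.\<close>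
  have sumT: "(\<Sum>\<nu>\<in>Z. (u \<nu>)\<^sup>2) \<le> k" if Z: "Z \<subseteq> T t0" "finite Z" for Z
  proof (cases "Z = {}")
    case False
    define t1 where "t1 = Min ((\<lambda>\<nu>. B \<nu> / u \<nu>) ` Z)"
    have "t0 < t1" unfolding t1_def using Z False u0 by (subst Min_gr_iff) (auto simp: T_def pos_less_divide_eq)
    then obtain s where s: "s \<in> good" "s < (t0 + t1) / 2"
      using cInf_lessD[OF ne, of "(t0 + t1) / 2"] by (auto simp: t0_def)
    have "Z \<subseteq> T ((t0 + t1) / 2)"
    proof
      fix \<nu> assume \<nu>: "\<nu> \<in> Z"
      have "t1 \<le> B \<nu> / u \<nu>" unfolding t1_def using \<nu> Z by (intro Min_le) auto
      moreover have "(t0 + t1) / 2 < t1" using \<open>t0 < t1\<close> by simp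
      ultimately have "(t0 + t1) / 2 < B \<nu> / u \<nu>" by (rule order.strict_trans2[rotated])
      then show "\<nu> \<in> T ((t0 + t1) / 2)" using \<nu> Z u0[of \<nu>] by (auto simp: T_def pos_less_divide_eq)
    qed
    also have "\<dots> \<subseteq> T s" using s by (intro anti) auto
    finally show ?thesis using s(1) Z by (simp add: good_def)
  qed (use k in simp)
  have finT: "finite (T t0)"
  proof (rule ccontr)
    assume "infinite (T t0)"
    then obtain Z where Z: "Z \<subseteq> T t0" "finite Z" "card Z = nat \<lceil>k\<rceil> + 1" using infinite_arbitrarily_large by metis
    have "(\<Sum>\<nu>\<in>Z. 1) \<le> (\<Sum>\<nu>\<in>Z. (u \<nu>)\<^sup>2)" by (intro sum_mono one_le_power u)
    then have "real (card Z) \<le> (\<Sum>\<nu>\<in>Z. (u \<nu>)\<^sup>2)" by simp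
    also have "\<dots> \<le> k" by (rule sumT[OF Z(1,2)])
    finally show False using Z(3) by (auto simp: field_simps) linarith
  qed
  have tail: "(\<Sum>\<nu>\<in>Z. (B \<nu>)\<^sup>2) \<le> (\<Sigma> powr (1 / p))\<^sup>2 * K powr (1 - 2 / p) \<and>
       (\<Sum>\<nu>\<in>Z. u \<nu> * B \<nu>) \<le> \<Sigma> powr (1 / p) * K powr (1 - 1 / p)"
    if Pp: "P p \<Sigma>" and Z: "Z \<subseteq> X - T t0" "finite Z" for p \<Sigma> Z
  proof -
    have p: "0 < p" "p < 1" "0 < \<Sigma>" and S: "\<And>Z. Z \<subseteq> X \<Longrightarrow> finite Z \<Longrightarrow> (\<Sum>\<nu>\<in>Z. (u \<nu>)\<^sup>2 * B \<nu> powr p) \<le> \<Sigma>"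
      using Pp P by auto
    let ?t = "tp p \<Sigma>"
    have t: "0 < ?t" using p K by (auto simp: tp_def)
    have "t0 \<le> ?t" unfolding t0_def by (rule cInf_lower[OF tpgood[OF Pp] bdd])
    have Bt: "B \<nu> \<le> ?t * u \<nu>" if "\<nu> \<in> Z" for \<nu>
    proof -
      have "B \<nu> \<le> t0 * u \<nu>" using that Z by (auto simp: T_def)
      also have "\<dots> \<le> ?t * u \<nu>" using \<open>t0 \<le> ?t\<close> u0[of \<nu>] by (intro mult_right_mono) auto
      finally show ?thesis .
    qed
    \<comment> \<open>Stechkin's step: off T the factor B^c is at most (t u)^c, which leaves the
      p-th power of B for the summable series. In both tails the exponents of u total 2 - p, hence
      the weight u^2 in the hypothesis suffices.\<close>
    have split: "B \<nu> powr c * B \<nu> powr p \<le> ?t powr c * ((u \<nu>) powr c * B \<nu> powr p)" if "\<nu> \<in> Z" "0 \<le> c" for \<nu> c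
    proof -
      have "B \<nu> powr c \<le> (?t * u \<nu>) powr c" using Bt that B by (intro powr_mono2) auto
      then show ?thesis by (simp add: powr_mult mult.assoc[symmetric] mult_right_mono)
    qed
    have pw: "x powr (c - p) * x powr p = x powr c" for x c :: real by (simp add: powr_add[symmetric])
    have tv: "?t powr c * \<Sigma> = \<Sigma> powr ((c + p) / p) * K powr (- c / p)" for c
    proof -
      have "?t powr c = \<Sigma> powr (c / p) / K powr (c / p)" using p K by (simp add: tp_def powr_powr powr_divide)
      moreover have "\<Sigma> powr ((c + p) / p) = \<Sigma> powr (c / p) * \<Sigma>" using p by (simp add: add_divide_distrib powr_add)
      ultimately show ?thesis by (simp add: powr_minus_divide)
    qed
    have le2: "(B \<nu>)\<^sup>2 \<le> ?t powr (2 - p) * ((u \<nu>)\<^sup>2 * B \<nu> powr p)" if "\<nu> \<in> Z" for \<nu>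
    proof -
      have "(B \<nu>)\<^sup>2 = B \<nu> powr (2 - p) * B \<nu> powr p"
        unfolding pw using B[of \<nu>] by (cases "B \<nu> = 0") (auto simp: powr_numeral)
      also have "\<dots> \<le> ?t powr (2 - p) * ((u \<nu>) powr (2 - p) * B \<nu> powr p)" using that p by (intro split) auto
      also have "\<dots> \<le> ?t powr (2 - p) * ((u \<nu>) powr 2 * B \<nu> powr p)"
        using u[of \<nu>] p by (intro mult_left_mono mult_right_mono powr_mono) auto
      finally show ?thesis using u0[of \<nu>] by (simp add: powr_numeral)
    qed
    have le1: "u \<nu> * B \<nu> \<le> ?t powr (1 - p) * ((u \<nu>)\<^sup>2 * B \<nu> powr p)" if "\<nu> \<in> Z" for \<nu>
    proof -
      have "B \<nu> = B \<nu> powr (1 - p) * B \<nu> powr p" unfolding pw using B[of \<nu>] by auto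
      also have "\<dots> \<le> ?t powr (1 - p) * ((u \<nu>) powr (1 - p) * B \<nu> powr p)" using that p by (intro split) auto
      also have "\<dots> \<le> ?t powr (1 - p) * ((u \<nu>) powr 1 * B \<nu> powr p)"
        using u[of \<nu>] p by (intro mult_left_mono mult_right_mono powr_mono) auto
      finally have "u \<nu> * B \<nu> \<le> u \<nu> * (?t powr (1 - p) * (u \<nu> * B \<nu> powr p))" using u0[of \<nu>] by (simp add: mult_left_mono)
      then show ?thesis by (simp add: power2_eq_square mult_ac)
    qed
    have ZX: "(\<Sum>\<nu>\<in>Z. (u \<nu>)\<^sup>2 * B \<nu> powr p) \<le> \<Sigma>" using Z by (intro S) auto
    have "(\<Sum>\<nu>\<in>Z. (B \<nu>)\<^sup>2) \<le> ?t powr (2 - p) * (\<Sum>\<nu>\<in>Z. (u \<nu>)\<^sup>2 * B \<nu> powr p)"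
      unfolding sum_distrib_left by (intro sum_mono le2)
    also have "\<dots> \<le> ?t powr (2 - p) * \<Sigma>" using ZX by (intro mult_left_mono) auto
    also have "\<dots> = \<Sigma> powr (2 / p) * K powr (1 - 2 / p)" unfolding tv using p by (simp add: field_simps)
    also have "\<Sigma> powr (2 / p) = (\<Sigma> powr (1 / p))\<^sup>2" using p by (simp add: powr_power)
    finally have 2: "(\<Sum>\<nu>\<in>Z. (B \<nu>)\<^sup>2) \<le> (\<Sigma> powr (1 / p))\<^sup>2 * K powr (1 - 2 / p)" .
    have "(\<Sum>\<nu>\<in>Z. u \<nu> * B \<nu>) \<le> ?t powr (1 - p) * (\<Sum>\<nu>\<in>Z. (u \<nu>)\<^sup>2 * B \<nu> powr p)"
      unfolding sum_distrib_left by (intro sum_mono le1)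
    also have "\<dots> \<le> ?t powr (1 - p) * \<Sigma>" using ZX by (intro mult_left_mono) auto
    also have "\<dots> = \<Sigma> powr (1 / p) * K powr (1 - 1 / p)" unfolding tv using p by (simp add: field_simps)
    finally show ?thesis using 2 by blast
  qed
  show ?thesis
    using finT sumT[OF order_refl finT] tail unfolding K_def
    by (intro exI[of _ "T t0"] conjI allI impI) (auto simp: T_def)
qed

section \<open>Completeness of the tensor product polynomials\<close>

context ortho_polys
begin

text \<open>The laws of the \<open>i\<close>-th coordinate under the densities \<open>1 + g / B\<close> and \<open>1\<close> have the same moments,
  hence, having bounded support, the same characteristic function.\<close>

lemma moment_zero_imp_event_zero:
  fixes g :: "(nat \<Rightarrow> real) \<Rightarrow> real"
  assumes g: "g \<in> borel_measurable ten" and B: "\<And>y. y \<in> cube \<Longrightarrow> \<bar>g y\<bar> \<le> B" "0 < B"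
    and z: "\<And>q. (\<integral>y. g y * poly q (y i) \<partial>ten) = 0" and A: "A \<in> sets \<mu>"
  shows "(\<integral>y. g y * indicator A (y i) \<partial>ten) = 0"
proof -
  \<comment> \<open>Shifting by B makes f a density with values in [0,2]; its total mass is 1 by the
    hypothesis for q = 1.\<close>
  define f where "f = (\<lambda>y. (g y + B) / B)"
  have fm: "f \<in> borel_measurable ten" unfolding f_def using g by measurable
  have f0: "0 \<le> f y" and f2: "f y \<le> 2" if "y \<in> cube" for y using B(1)[OF that] B(2) by (auto simp: f_def field_simps abs_le_iff)
  have Xm: "(\<lambda>y. y i) \<in> borel_measurable ten" using poly_coord_measurable[of "[:0, 1:]" i] by simp
  define P where "P = distr (density ten f) borel (\<lambda>y. y i)"
  define Q where "Q = distr ten borel (\<lambda>y. y i)"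
  have Xmd: "(\<lambda>y. y i) \<in> borel_measurable (density ten f)" using Xm by simp
  have PI: "(\<integral>x. k x \<partial>P) = (\<integral>y. f y *\<^sub>R k (y i) \<partial>ten)" if "k \<in> borel_measurable borel" for k :: "real \<Rightarrow> 'b :: {banach, second_countable_topology}"
  proof -
    have "(\<integral>x. k x \<partial>P) = (\<integral>y. k (y i) \<partial>density ten f)" unfolding P_def by (rule integral_distr[OF Xmd that])
    also have "\<dots> = (\<integral>y. f y *\<^sub>R k (y i) \<partial>ten)"
      by (rule integral_density[OF measurable_compose[OF Xm that] fm]) (auto intro!: AE_I2 simp: f0 space_ten)
    finally show ?thesis .
  qed
  have QI: "(\<integral>x. k x \<partial>Q) = (\<integral>y. k (y i) \<partial>ten)" if "k \<in> borel_measurable borel" for k :: "real \<Rightarrow> 'b :: {banach, second_countable_topology}"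
    unfolding Q_def using that by (rule integral_distr[OF Xm])
  have diff: "(\<integral>x. k x \<partial>P) = (\<integral>x. k x \<partial>Q) + (\<integral>y. (g y / B) *\<^sub>R k (y i) \<partial>ten)"
    if k: "k \<in> borel_measurable borel" "\<And>x. norm (k x) \<le> 1" for k :: "real \<Rightarrow> 'b :: {banach, second_countable_topology}"
  proof -
    have km: "(\<lambda>y. k (y i)) \<in> borel_measurable ten" by (rule measurable_compose[OF Xm k(1)])
    have i1: "integrable ten (\<lambda>y. k (y i))" by (rule ten_integrable_bounded[OF km, of 1]) (use k in auto)
    have i2: "integrable ten (\<lambda>y. (g y / B) *\<^sub>R k (y i))"
    proof (rule ten_integrable_bounded)
      show "(\<lambda>y. (g y / B) *\<^sub>R k (y i)) \<in> borel_measurable ten" using g km by measurable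
      show "norm ((g y / B) *\<^sub>R k (y i)) \<le> 1 * 1" if "y \<in> cube" for y
        unfolding norm_scaleR using B(1)[OF that] B(2) k(2) by (intro mult_mono) auto
    qed
    have "(\<integral>x. k x \<partial>P) = (\<integral>y. k (y i) + (g y / B) *\<^sub>R k (y i) \<partial>ten)"
      unfolding PI[OF k(1)] using B(2) by (intro Bochner_Integration.integral_cong) (auto simp: f_def add_divide_distrib scaleR_add_left add.commute)
    then show ?thesis unfolding QI[OF k(1)] by (simp add: Bochner_Integration.integral_add[OF i1 i2])
  qed
  have "prob_space Q" unfolding Q_def by (rule ten.prob_space_distr[OF Xm])
  have "prob_space P"
  proof
    have em: "emeasure P (space P) = (\<integral>\<^sup>+y. f y \<partial>ten)"
      unfolding P_def using fm by (simp add: emeasure_distr[OF Xmd] emeasure_density[OF _ sets.top] cong: nn_integral_cong_simp)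
    also have "\<dots> = ennreal (\<integral>y. f y \<partial>ten)"
      by (rule nn_integral_eq_integral) (use f0 f2 in \<open>auto intro!: ten_integrable_bounded[OF fm, of 2] AE_I2 simp: space_ten\<close>)
    also have "(\<integral>y. f y \<partial>ten) = 1"
    proof -
      have ig: "integrable ten g" by (rule ten_integrable_bounded[OF g, of B]) (use B in auto)
      have "(\<integral>y. f y \<partial>ten) = ((\<integral>y. g y \<partial>ten) + B) / B" unfolding f_def using ig by (simp add: ten.prob_space)
      then show ?thesis using z[of 1] B(2) by simp
    qed
    finally show "emeasure P (space P) = 1" by simp
  qed
  interpret P: real_distribution P
    by (intro real_distribution.intro real_distribution_axioms.intro \<open>prob_space P\<close>) (simp_all add: P_def)
  interpret Q: real_distribution Q
    by (intro real_distribution.intro real_distribution_axioms.intro \<open>prob_space Q\<close>) (simp_all add: Q_def)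
  have "char P = char Q"
  proof
    fix t
    let ?e = "\<lambda>x. iexp (t * x)"
    have "(\<integral>y. (g y / B) *\<^sub>R ?e (y i) \<partial>ten) = 0"
    proof -
      let ?a = "\<lambda>k y. complex_of_real (g y / B) * ((\<i> * complex_of_real (t * y i)) ^ k / fact k)"
      have a: "?a k y = (\<i> ^ k * complex_of_real (t ^ k / (B * fact k))) * complex_of_real (g y * poly (Polynomial.monom 1 k) (y i))" for k y
        by (simp add: poly_monom power_mult_distrib field_simps)
      have gm: "(\<lambda>y. g y * poly (Polynomial.monom 1 k) (y i)) \<in> borel_measurable ten" for k
        using g poly_coord_measurable by (intro borel_measurable_times) auto
      have bd: "\<bar>g y * poly (Polynomial.monom 1 k) (y i)\<bar> \<le> B" if "y \<in> cube" for y k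
      proof -
        have "\<bar>g y\<bar> * \<bar>y i\<bar> ^ k \<le> B * 1" using B(1)[OF that] that by (intro mult_mono power_le_one) (auto simp: cube_def abs_le_iff)
        then show ?thesis by (simp add: poly_monom abs_mult power_abs)
      qed
      have ai: "integrable ten (?a k)" for k
        unfolding a by (intro integrable_mult_right integrable_of_real ten_integrable_bounded[OF gm, of _ B]) (use bd in auto)
      have an: "norm (?a k y) \<le> \<bar>t\<bar> ^ k / fact k" if "y \<in> cube" for k y
      proof -
        have "norm (?a k y) = \<bar>t\<bar> ^ k / (B * fact k) * \<bar>g y * poly (Polynomial.monom 1 k) (y i)\<bar>"
          unfolding a using B(2) by (simp add: norm_mult norm_power norm_divide abs_mult)
        also have "\<dots> \<le> \<bar>t\<bar> ^ k / (B * fact k) * B" using bd[OF that] B(2) by (intro mult_left_mono) auto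
        finally show ?thesis using B(2) by simp
      qed
      have st: "summable (\<lambda>k. \<bar>t\<bar> ^ k / fact k)" using summable_exp[of "\<bar>t\<bar>"] by (simp add: divide_inverse mult.commute)
      have s1: "AE y in ten. summable (\<lambda>k. norm (?a k y))"
        by (intro AE_I2 summable_comparison_test'[OF st]) (use an in \<open>auto simp: space_ten\<close>)
      have s2: "summable (\<lambda>k. \<integral>y. norm (?a k y) \<partial>ten)"
      proof (rule summable_comparison_test'[OF st])
        fix k
        have "(\<integral>y. norm (?a k y) \<partial>ten) \<le> (\<integral>y. \<bar>t\<bar> ^ k / fact k \<partial>ten)"
          using ai an by (intro integral_mono) (auto simp: space_ten)
        then show "norm (\<integral>y. norm (?a k y) \<partial>ten) \<le> \<bar>t\<bar> ^ k / fact k"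
          by (simp add: ten.prob_space)
      qed
      \<comment> \<open>Boundedness of the coordinate permits termwise integration of the
        exponential series, and every term is a vanishing moment of g.\<close>
      have "(\<integral>y. (\<Sum>k. ?a k y) \<partial>ten) = (\<Sum>k. \<integral>y. ?a k y \<partial>ten)" by (rule integral_suminf[OF ai s1 s2])
      also have "\<dots> = 0"
      proof -
        have a0: "(\<integral>y. ?a k y \<partial>ten) = 0" for k
          unfolding a integral_mult_right_zero integral_complex_of_real z by simp
        show ?thesis by (simp only: a0 suminf_zero)
      qed
      also have "(\<integral>y. (\<Sum>k. ?a k y) \<partial>ten) = (\<integral>y. (g y / B) *\<^sub>R ?e (y i) \<partial>ten)"
      proof (intro Bochner_Integration.integral_cong refl)
        fix y
        have "(\<lambda>k. (\<i> * complex_of_real (t * y i)) ^ k /\<^sub>R fact k) sums ?e (y i)" by (rule exp_converges)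
        then have "(\<lambda>k. ?a k y) sums (complex_of_real (g y / B) * ?e (y i))"
          by (intro sums_mult) (simp add: scaleR_conv_of_real divide_inverse mult.commute)
        then show "(\<Sum>k. ?a k y) = (g y / B) *\<^sub>R ?e (y i)" by (simp add: sums_iff scaleR_conv_of_real)
      qed
      finally show ?thesis .
    qed
    then show "char P t = char Q t" unfolding char_def by (subst diff) auto
  qed
  then have "P = Q" by (rule Levy_uniqueness[OF P.real_distribution_axioms Q.real_distribution_axioms])
  moreover have Ab: "A \<in> sets borel" using A unfolding sets_mu by (auto simp: sets_restrict_space)
  ultimately have "(\<integral>y. (g y / B) *\<^sub>R (indicator A (y i) :: real) \<partial>ten) = 0"
    using diff[of "indicator A :: real \<Rightarrow> real"] by (auto simp: indicator_def)
  then have "(1 / B) * (\<integral>y. g y * indicator A (y i) \<partial>ten) = 0"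
    by (subst integral_mult_right_zero[symmetric]) simp
  then show ?thesis using B(2) by simp
qed

text \<open>Vanishing coefficients give vanishing integrals against products of arbitrary
  polynomials; then the polynomial factors are traded for indicators one coordinate at a time. So h
  + c and c are densities of measures that agree on cylinders, hence everywhere. The constant c
  makes them nonnegative.\<close>

lemma complete_real:
  fixes h :: "(nat \<Rightarrow> real) \<Rightarrow> real"
  assumes h: "h \<in> borel_measurable ten" and B: "\<And>y. y \<in> cube \<Longrightarrow> \<bar>h y\<bar> \<le> B"
    and z: "\<And>\<nu>. \<nu> \<in> multi_indices \<Longrightarrow> (\<integral>y. h y * Psi \<psi> \<nu> y \<partial>ten) = 0"
  shows "AE y in ten. h y = 0"
proof -
  have int: "integrable ten (\<lambda>y. h y * G y)" if "G \<in> borel_measurable ten" "\<And>y. y \<in> cube \<Longrightarrow> \<bar>G y\<bar> \<le> C" for G C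
  proof (rule ten_integrable_bounded)
    show "(\<lambda>y. h y * G y) \<in> borel_measurable ten" using h that by measurable
    show "norm (h y * G y) \<le> B * C" if "y \<in> cube" for y
      unfolding real_norm_def abs_mult using B[OF that] \<open>\<And>y. y \<in> cube \<Longrightarrow> \<bar>G y\<bar> \<le> C\<close>[OF that]
      by (intro mult_mono) (auto intro: order.trans[OF abs_ge_zero])
  qed
  have chi_deg: "degree (unit_psi n) = n" "unit_psi n \<noteq> 0" for n
  proof -
    show "degree (unit_psi n) = n" by (simp add: unit_psi_def degree_psi)
    show "unit_psi n \<noteq> 0" using unit_psi_ortho[of n n] by auto
  qed
  have polys: "(\<integral>y. h y * ((\<Prod>i\<in>I. poly (q i) (y i)) * (\<Prod>j\<in>J. poly (unit_psi (n j)) (y j))) \<partial>ten) = 0"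
    if "finite I" "finite J" "I \<inter> J = {}" for I J q n
    using that
  proof (induction I arbitrary: J n rule: finite_induct)
    case empty
    define \<nu> where "\<nu> = (\<lambda>j. if j \<in> J then n j else 0)"
    have s: "msupp \<nu> \<subseteq> J" by (auto simp: msupp_def \<nu>_def)
    then have \<nu>: "\<nu> \<in> multi_indices" using empty finite_subset by (auto simp: multi_indices_def msupp_def)
    have "(\<Prod>j\<in>J. poly (unit_psi (n j)) (y j)) = Psi \<psi> \<nu> y" for y
      using Psi_unit_psi[OF empty(1) s] by (auto simp: \<nu>_def)
    then show ?case using z[OF \<nu>] by simp
  next
    case (insert i I)
    obtain a where a: "q i = (\<Sum>k\<le>degree (q i). Polynomial.smult (a k) (unit_psi k))"
      using poly_basis_degree[of "degree (q i)" unit_psi "q i"] chi_deg by blast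
    let ?R = "\<lambda>k y. (\<Prod>i\<in>I. poly (q i) (y i)) * (\<Prod>j\<in>insert i J. poly (unit_psi ((n(i := k)) j)) (y j))"
    have ij: "i \<notin> J" using insert by auto
    have e: "(\<Prod>i\<in>insert i I. poly (q i) (y i)) * (\<Prod>j\<in>J. poly (unit_psi (n j)) (y j)) = (\<Sum>k\<le>degree (q i). a k * ?R k y)" for y
    proof -
      have r: "?R k y = poly (unit_psi k) (y i) * ((\<Prod>i\<in>I. poly (q i) (y i)) * (\<Prod>j\<in>J. poly (unit_psi (n j)) (y j)))" for k
      proof -
        have "(\<Prod>j\<in>J. poly (unit_psi ((n(i := k)) j)) (y j)) = (\<Prod>j\<in>J. poly (unit_psi (n j)) (y j))"
          using ij by (intro prod.cong) auto
        then show ?thesis using insert.prems ij by (simp add: mult_ac)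
      qed
      have "poly (q i) (y i) = (\<Sum>k\<le>degree (q i). a k * poly (unit_psi k) (y i))" by (subst a) (simp add: poly_sum)
      then show ?thesis unfolding r using insert.hyps by (simp add: sum_distrib_left sum_distrib_right mult_ac)
    qed
    have zk: "(\<integral>y. h y * ?R k y \<partial>ten) = 0" for k using insert.prems ij insert.hyps by (intro insert.IH) auto
    have ik: "integrable ten (\<lambda>y. h y * ?R k y)" for k
    proof -
      obtain C1 C2 where "\<And>y. y \<in> cube \<Longrightarrow> \<bar>\<Prod>i\<in>I. poly (q i) (y i)\<bar> \<le> C1" "0 \<le> C1"
        "\<And>y. y \<in> cube \<Longrightarrow> \<bar>\<Prod>j\<in>insert i J. poly (unit_psi ((n(i := k)) j)) (y j)\<bar> \<le> C2"
        using prod_poly_bounded[OF insert.hyps(1), of q] prod_poly_bounded[of "insert i J" "\<lambda>j. unit_psi ((n(i := k)) j)"] insert.prems by (metis finite_insert)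
      then show ?thesis
        by (intro int[of _ "C1 * C2"] borel_measurable_times prod_poly_measurable) (auto simp: abs_mult simp del: fun_upd_apply intro!: mult_mono)
    qed
    have "(\<integral>y. h y * ((\<Prod>i\<in>insert i I. poly (q i) (y i)) * (\<Prod>j\<in>J. poly (unit_psi (n j)) (y j))) \<partial>ten)
       = (\<integral>y. (\<Sum>k\<le>degree (q i). a k * (h y * ?R k y)) \<partial>ten)"
      unfolding e by (simp only: sum_distrib_left mult.left_commute[of "h _"])
    also have "\<dots> = (\<Sum>k\<le>degree (q i). a k * (\<integral>y. h y * ?R k y \<partial>ten))"
      by (subst Bochner_Integration.integral_sum) (use ik in auto)
    finally show ?case unfolding zk by simp
  qed
  \<comment> \<open>Arbitrary polynomial factors on J are kept in the statement: the induction
    hypothesis then supplies all moments in the coordinate that is traded next.\<close>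
  have cyl: "(\<integral>y. h y * ((\<Prod>i\<in>I. indicator (A i) (y i)) * (\<Prod>j\<in>J. poly (q j) (y j))) \<partial>ten) = 0"
    if "finite I" "finite J" "I \<inter> J = {}" "\<And>i. i \<in> I \<Longrightarrow> A i \<in> sets \<mu>" for I J q and A :: "nat \<Rightarrow> real set"
    using that
  proof (induction I arbitrary: J q rule: finite_induct)
    case empty
    then show ?case using polys[of J "{}" q] by simp
  next
    case (insert i I)
    have ij: "i \<notin> J" using insert by auto
    obtain C where C: "0 \<le> C" "\<And>y. y \<in> cube \<Longrightarrow> \<bar>\<Prod>j\<in>J. poly (q j) (y j)\<bar> \<le> C"
      using prod_poly_bounded[OF insert.prems(1), of q] by auto
    let ?g = "\<lambda>y. h y * ((\<Prod>i\<in>I. indicator (A i) (y i)) * (\<Prod>j\<in>J. poly (q j) (y j)))"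
    have im: "(\<lambda>y. indicator (A k) (y k) :: real) \<in> borel_measurable ten" if "k \<in> I" for k
      using measurable_compose[OF coord_measurable borel_measurable_indicator[OF insert.prems(3)], of k] that by simp
    have ib: "\<bar>\<Prod>i\<in>I. indicator (A i) (y i) :: real\<bar> \<le> 1" for y
      unfolding abs_prod by (intro prod_le_1) (auto simp: indicator_def)
    have "(\<integral>y. ?g y * indicator (A i) (y i) \<partial>ten) = 0"
    proof (rule moment_zero_imp_event_zero)
      show "?g \<in> borel_measurable ten"
        by (intro borel_measurable_times h borel_measurable_prod prod_poly_measurable im)
      show "\<bar>?g y\<bar> \<le> B * (1 * C) + 1" if "y \<in> cube" for y
        using mult_mono[OF B[OF that] mult_mono[OF ib[of y] C(2)[OF that]]] C(1) order.trans[OF abs_ge_zero B[OF that]]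
        by (simp add: abs_mult)
      have "0 \<le> B" using B[of "\<lambda>_. 0"] by (simp add: cube_def)
      then show "0 < B * (1 * C) + 1" using C(1) by (simp add: add_nonneg_pos)
      show "(\<integral>y. ?g y * poly r (y i) \<partial>ten) = 0" for r
      proof -
        have "?g y * poly r (y i) = h y * ((\<Prod>i\<in>I. indicator (A i) (y i)) * (\<Prod>j\<in>insert i J. poly ((q(i := r)) j) (y j)))" for y
        proof -
          have "(\<Prod>j\<in>J. poly ((q(i := r)) j) (y j)) = (\<Prod>j\<in>J. poly (q j) (y j))" using ij by (intro prod.cong) auto
          then show ?thesis using insert.prems(1) ij by (simp add: mult_ac)
        qed
        then show ?thesis using insert.IH[of "insert i J" "q(i := r)"] insert.prems insert.hyps ij by (simp only:) auto
      qed
      show "A i \<in> sets \<mu>" using insert.prems by simp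
    qed
    then show ?case using insert.hyps by (simp add: mult_ac)
  qed
  define c where "c = \<bar>B\<bar>"
  have hb: "0 \<le> h y + c" if "y \<in> cube" for y using B[OF that] by (auto simp: c_def)
  have hm: "(\<lambda>y. ennreal (h y + c)) \<in> borel_measurable ten" using h by measurable
  have "density ten (\<lambda>y. ennreal (h y + c)) = density ten (\<lambda>y. ennreal c)"
  proof (rule measure_eqI_PiM_infinite[where I = UNIV and M = "\<lambda>_. \<mu>"])
    show "sets (density ten (\<lambda>y. ennreal (h y + c))) = sets (\<Pi>\<^sub>M i\<in>UNIV. \<mu>)" "sets (density ten (\<lambda>y. ennreal c)) = sets (\<Pi>\<^sub>M i\<in>UNIV. \<mu>)"
      by (simp_all add: tensor_measure_def)
    have nn: "(\<integral>\<^sup>+y. ennreal (h y + c) * indicator E y \<partial>ten) = ennreal (\<integral>y. (h y + c) * indicator E y \<partial>ten)" if "E \<in> sets ten" for E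
    proof -
      have "(\<integral>\<^sup>+y. ennreal (h y + c) * indicator E y \<partial>ten) = (\<integral>\<^sup>+y. ennreal ((h y + c) * indicator E y) \<partial>ten)"
        by (intro nn_integral_cong) (auto simp: indicator_def)
      also have "\<dots> = ennreal (\<integral>y. (h y + c) * indicator E y \<partial>ten)"
      proof (rule nn_integral_eq_integral)
        show "integrable ten (\<lambda>y. (h y + c) * indicator E y)"
        proof (rule ten_integrable_bounded)
          show "(\<lambda>y. (h y + c) * indicator E y) \<in> borel_measurable ten" using h that by measurable
          show "norm ((h y + c) * indicator E y) \<le> B + c" if "y \<in> cube" for y
            using B[OF that] by (auto simp: indicator_def c_def abs_le_iff)
        qed
        show "AE y in ten. 0 \<le> (h y + c) * indicator E y" using hb by (intro AE_I2) (simp add: space_ten)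
      qed
      finally show ?thesis .
    qed
    show "finite_measure (density ten (\<lambda>y. ennreal (h y + c)))"
    proof
      have "emeasure (density ten (\<lambda>y. ennreal (h y + c))) (space ten) = ennreal (\<integral>y. (h y + c) * indicator (space ten) y \<partial>ten)"
        using hm nn[OF sets.top] by (simp add: emeasure_density)
      then show "emeasure (density ten (\<lambda>y. ennreal (h y + c))) (space (density ten (\<lambda>y. ennreal (h y + c)))) \<noteq> \<infinity>"
        by (simp add: space_density)
    qed
    fix A :: "nat \<Rightarrow> real set" and J
    assume J: "finite J" "\<And>i. i \<in> J \<Longrightarrow> A i \<in> sets \<mu>"
    define E where "E = prod_emb UNIV (\<lambda>_. \<mu>) J (Pi\<^sub>E J A)"
    have Es: "E \<in> sets ten" unfolding E_def tensor_measure_def using J by (intro sets_PiM_I) auto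
    have ind: "indicator E y = (\<Prod>i\<in>J. indicator (A i) (y i) :: real)" if "y \<in> cube" for y
    proof -
      have yE: "y \<in> E \<longleftrightarrow> (\<forall>i\<in>J. y i \<in> A i)"
        using that by (auto simp: E_def prod_emb_def space_mu cube_def PiE_def Pi_def restrict_def extensional_def)
      show ?thesis
      proof (cases "\<forall>i\<in>J. y i \<in> A i")
        case False
        then have "(\<Prod>i\<in>J. indicator (A i) (y i) :: real) = 0" using J(1) by (auto simp: prod_zero_iff indicator_def)
        then show ?thesis using yE False by simp
      qed (use yE in simp)
    qed
    have iE: "integrable ten (\<lambda>y. h y * indicator E y)" by (rule int[of _ 1]) (use Es in \<open>auto simp: indicator_def\<close>)
    have iE1: "integrable ten (indicator E :: _ \<Rightarrow> real)" using Es by (intro integrable_real_indicator) (auto simp: ten.emeasure_eq_measure)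
    have "(\<integral>y. h y * indicator E y \<partial>ten) = (\<integral>y. h y * ((\<Prod>i\<in>J. indicator (A i) (y i)) * (\<Prod>j\<in>{}. poly ((\<lambda>_. 0) j) (y j))) \<partial>ten)"
      by (intro Bochner_Integration.integral_cong) (auto simp: space_ten ind)
    also have "\<dots> = 0" using J by (intro cyl) auto
    finally have "(\<integral>y. (h y + c) * indicator E y \<partial>ten) = (\<integral>y. c * indicator E y \<partial>ten)"
      using iE iE1 by (simp add: distrib_right)
    then have "(\<integral>\<^sup>+y. ennreal (h y + c) * indicator E y \<partial>ten) = ennreal (c * measure ten E)"
      using nn[OF Es] Es by simp
    moreover have "(\<integral>\<^sup>+y. ennreal c * indicator E y \<partial>ten) = ennreal (c * measure ten E)"
      using Es by (simp add: nn_integral_cmult_indicator ten.emeasure_eq_measure ennreal_mult c_def)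
    ultimately show "emeasure (density ten (\<lambda>y. ennreal (h y + c))) (prod_emb UNIV (\<lambda>_. \<mu>) J (Pi\<^sub>E J A)) = emeasure (density ten (\<lambda>y. ennreal c)) (prod_emb UNIV (\<lambda>_. \<mu>) J (Pi\<^sub>E J A))"
      unfolding E_def[symmetric] using hm Es by (simp add: emeasure_density)
  qed
  then have "AE y in ten. ennreal (h y + c) = ennreal c"
    using hm by (subst (asm) ten.density_unique_iff) auto
  then show ?thesis
  proof (rule AE_mp, intro AE_I2 impI)
    fix y assume y: "y \<in> space ten" "ennreal (h y + c) = ennreal c"
    then have "h y + c = c" using hb[of y] by (subst (asm) ennreal_inj) (auto simp: space_ten c_def)
    then show "h y = 0" by simp
  qed
qed

end

lemma cmod_sum_power2:
  "(cmod (\<Sum>\<nu>\<in>Z. c \<nu> * complex_of_real (g \<nu>)))\<^sup>2 = (\<Sum>\<nu>\<in>Z. \<Sum>\<nu>'\<in>Z. Re (c \<nu> * cnj (c \<nu>')) * (g \<nu> * g \<nu>'))"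
proof -
  have "complex_of_real ((cmod (\<Sum>\<nu>\<in>Z. c \<nu> * complex_of_real (g \<nu>)))\<^sup>2)
     = (\<Sum>\<nu>\<in>Z. c \<nu> * complex_of_real (g \<nu>)) * cnj (\<Sum>\<nu>\<in>Z. c \<nu> * complex_of_real (g \<nu>))"
    by (simp only: complex_norm_square)
  also have "\<dots> = (\<Sum>\<nu>\<in>Z. \<Sum>\<nu>'\<in>Z. (c \<nu> * cnj (c \<nu>')) * complex_of_real (g \<nu> * g \<nu>'))"
    by (simp add: sum_product mult_ac)
  finally have "Re (complex_of_real ((cmod (\<Sum>\<nu>\<in>Z. c \<nu> * complex_of_real (g \<nu>)))\<^sup>2))
     = Re (\<Sum>\<nu>\<in>Z. \<Sum>\<nu>'\<in>Z. (c \<nu> * cnj (c \<nu>')) * complex_of_real (g \<nu> * g \<nu>'))" by (rule arg_cong)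
  then show ?thesis by (simp only: Re_complex_of_real Re_sum mult.commute[of _ "complex_of_real _"] Re_complex_of_real)
     (simp add: mult.commute)
qed

section \<open>Orthogonal expansions in L2 and in the sup norm\<close>

context ortho_polys
begin

definition psum :: "(nat \<Rightarrow> nat) set \<Rightarrow> ((nat \<Rightarrow> nat) \<Rightarrow> complex) \<Rightarrow> (nat \<Rightarrow> real) \<Rightarrow> complex" where
  "psum Z c y = (\<Sum>\<nu>\<in>Z. c \<nu> * complex_of_real (Psi \<psi> \<nu> y))"

lemma psum_measurable: "Z \<subseteq> multi_indices \<Longrightarrow> psum Z c \<in> borel_measurable ten"
  unfolding psum_def[abs_def]
  by (intro borel_measurable_sum borel_measurable_times borel_measurable_const of_real_measurable Psi_measurable) auto

lemma psum_bound: "y \<in> cube \<Longrightarrow> cmod (psum Z c y) \<le> (\<Sum>\<nu>\<in>Z. sup_Psi \<nu> * cmod (c \<nu>))"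
  unfolding psum_def using Psi_bound
  by (intro sum_norm_le) (simp add: norm_mult mult.commute[of "sup_Psi _"] mult_left_mono)

lemma parseval:
  assumes Z: "finite Z" "Z \<subseteq> multi_indices"
  shows "(\<integral>y. (cmod (psum Z c y))\<^sup>2 \<partial>ten) = (\<Sum>\<nu>\<in>Z. (cmod (c \<nu>))\<^sup>2)"
proof -
  have i: "integrable ten (\<lambda>y. Psi \<psi> \<nu> y * Psi \<psi> \<nu>' y)" if "\<nu> \<in> Z" "\<nu>' \<in> Z" for \<nu> \<nu>'
    using integrable_Psi_Psi that Z by blast
  have "(\<integral>y. (cmod (psum Z c y))\<^sup>2 \<partial>ten) = (\<Sum>\<nu>\<in>Z. \<Sum>\<nu>'\<in>Z. Re (c \<nu> * cnj (c \<nu>')) * (\<integral>y. Psi \<psi> \<nu> y * Psi \<psi> \<nu>' y \<partial>ten))"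
    unfolding psum_def cmod_sum_power2 using i by (simp add: Bochner_Integration.integral_sum)
  also have "\<dots> = (\<Sum>\<nu>\<in>Z. \<Sum>\<nu>'\<in>Z. Re (c \<nu> * cnj (c \<nu>')) * of_bool (\<nu> = \<nu>'))"
    using Z by (intro sum.cong refl) (auto simp: Psi_ortho subset_iff)
  also have "\<dots> = (\<Sum>\<nu>\<in>Z. (cmod (c \<nu>))\<^sup>2)"
  proof (intro sum.cong refl)
    fix \<nu> assume "\<nu> \<in> Z"
    then have "(\<Sum>\<nu>'\<in>Z. Re (c \<nu> * cnj (c \<nu>')) * of_bool (\<nu> = \<nu>')) = Re (c \<nu> * cnj (c \<nu>))"
      using Z(1) by (subst sum.remove[of _ \<nu>]) (auto intro!: sum.neutral)
    then show "(\<Sum>\<nu>'\<in>Z. Re (c \<nu> * cnj (c \<nu>')) * of_bool (\<nu> = \<nu>')) = (cmod (c \<nu>))\<^sup>2"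
      by (simp add: complex_mult_cnj cmod_power2)
  qed
  finally show ?thesis .
qed

lemma coef_psum:
  assumes Z: "finite Z" "Z \<subseteq> multi_indices" and \<nu>: "\<nu> \<in> multi_indices"
  shows "coef (psum Z c) \<nu> = (if \<nu> \<in> Z then c \<nu> else 0)"
proof -
  have "coef (psum Z c) \<nu> = (\<integral>y. (\<Sum>\<nu>'\<in>Z. c \<nu>' * complex_of_real (Psi \<psi> \<nu>' y * Psi \<psi> \<nu> y)) \<partial>ten)"
    by (simp add: coef_def psum_def sum_distrib_right mult.assoc)
  also have "\<dots> = (\<Sum>\<nu>'\<in>Z. c \<nu>' * complex_of_real (\<integral>y. Psi \<psi> \<nu>' y * Psi \<psi> \<nu> y \<partial>ten))"
    using integrable_Psi_Psi Z \<nu>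
    by (subst Bochner_Integration.integral_sum)
       (auto simp: integral_mult_right_zero integral_complex_of_real subset_iff simp del: of_real_mult intro!: integrable_mult_right integrable_of_real)
  also have "\<dots> = (\<Sum>\<nu>'\<in>Z. c \<nu>' * of_bool (\<nu>' = \<nu>))"
    using Z \<nu> by (intro sum.cong refl) (auto simp: Psi_ortho subset_iff)
  also have "\<dots> = (if \<nu> \<in> Z then c \<nu> else 0)"
  proof (cases "\<nu> \<in> Z")
    case True
    then show ?thesis using Z(1) by (subst sum.remove[of _ \<nu>]) (auto intro!: sum.neutral)
  qed (auto intro!: sum.neutral)
  finally show ?thesis .
qed

lemma complete_complex:
  fixes h :: "(nat \<Rightarrow> real) \<Rightarrow> complex"
  assumes h: "h \<in> borel_measurable ten" and B: "\<And>y. y \<in> cube \<Longrightarrow> cmod (h y) \<le> B"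
    and z: "\<And>\<nu>. \<nu> \<in> multi_indices \<Longrightarrow> coef h \<nu> = 0"
  shows "AE y in ten. h y = 0"
proof -
  have i: "integrable ten (\<lambda>y. h y * complex_of_real (Psi \<psi> \<nu> y))" if "\<nu> \<in> multi_indices" for \<nu>
    by (rule integrable_Psi_mult[OF that h B])
  have "(\<integral>y. Re (h y) * Psi \<psi> \<nu> y \<partial>ten) = 0" if "\<nu> \<in> multi_indices" for \<nu>
    using integral_Re[OF i[OF that]] z[OF that] by (simp add: coef_def)
  then have r: "AE y in ten. Re (h y) = 0"
    using h B by (intro complete_real[of _ B]) (auto intro: order.trans[OF abs_Re_le_cmod])
  have "(\<integral>y. Im (h y) * Psi \<psi> \<nu> y \<partial>ten) = 0" if "\<nu> \<in> multi_indices" for \<nu>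
    using integral_Im[OF i[OF that]] z[OF that] by (simp add: coef_def)
  then have "AE y in ten. Im (h y) = 0"
    using h B by (intro complete_real[of _ B]) (auto intro: order.trans[OF abs_Im_le_cmod])
  with r show ?thesis by eventually_elim (simp add: complex_eq_iff)
qed

lemma coef_diff:
  assumes \<nu>: "\<nu> \<in> multi_indices" and f: "f \<in> borel_measurable ten" "\<And>y. y \<in> cube \<Longrightarrow> cmod (f y) \<le> B"
    and g: "g \<in> borel_measurable ten" "\<And>y. y \<in> cube \<Longrightarrow> cmod (g y) \<le> B'"
  shows "coef (\<lambda>y. f y - g y) \<nu> = coef f \<nu> - coef g \<nu>"
  unfolding coef_def left_diff_distrib
  by (rule Bochner_Integration.integral_diff[OF integrable_Psi_mult[OF \<nu> f] integrable_Psi_mult[OF \<nu> g]])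

lemma coef_le:
  assumes \<nu>: "\<nu> \<in> multi_indices" and f: "f \<in> borel_measurable ten" "\<And>y. y \<in> cube \<Longrightarrow> cmod (f y) \<le> B"
  shows "cmod (coef f \<nu>) \<le> B * sup_Psi \<nu>"
proof -
  have "cmod (coef f \<nu>) \<le> (\<integral>y. cmod (f y * complex_of_real (Psi \<psi> \<nu> y)) \<partial>ten)"
    unfolding coef_def by (rule integral_norm_bound)
  also have "\<dots> \<le> (\<integral>y. B * sup_Psi \<nu> \<partial>ten)"
    using f(2) Psi_bound
    by (intro integral_mono integrable_norm integrable_Psi_mult[OF \<nu> f] ten.integrable_const)
       (auto simp: norm_mult space_ten intro!: mult_mono intro: order.trans[OF norm_ge_zero])
  finally show ?thesis by (simp add: ten.prob_space)
qed

text \<open>Partial sums converge uniformly by the weighted l1 bound. Their limit G has the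
  coefficients of f, so f = G almost everywhere by completeness, and both tail bounds pass from
  finite partial sums to G. The sup bound is asserted almost everywhere because f = G is.\<close>

lemma expansion_tail:
  assumes f: "f \<in> borel_measurable ten" "\<And>y. y \<in> cube \<Longrightarrow> cmod (f y) \<le> 1"
    and B: "\<And>\<nu>. \<nu> \<in> multi_indices \<Longrightarrow> cmod (coef f \<nu>) \<le> B \<nu>"
    and S: "finite S" "S \<subseteq> multi_indices"
    and \<tau>: "\<And>Z. Z \<subseteq> multi_indices - S \<Longrightarrow> finite Z \<Longrightarrow> (\<Sum>\<nu>\<in>Z. (B \<nu>)\<^sup>2) \<le> \<tau>2 \<and> (\<Sum>\<nu>\<in>Z. sup_Psi \<nu> * B \<nu>) \<le> \<tau>1"
  shows "(AE y in ten. cmod (f y - psum S (coef f) y) \<le> \<tau>1)"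
    and "(\<integral>y. (cmod (f y - psum S (coef f) y))\<^sup>2 \<partial>ten) \<le> \<tau>2"
proof -
  let ?c = "coef f"
  let ?X = "multi_indices - S"
  have B0: "0 \<le> B \<nu>" if "\<nu> \<in> multi_indices" for \<nu> using order.trans[OF norm_ge_zero B[OF that]] .
  have u0: "0 < sup_Psi \<nu>" for \<nu> using sup_Psi_ge_1[of \<nu>] by linarith
  \<comment> \<open>Instead of enumerating multi-indices, finite sets are picked whose weighted sums
    come within (1/2)^j of the supremum; any finite set of further indices then weighs at most
    (1/2)^j.\<close>
  define s where "s = Sup {(\<Sum>\<nu>\<in>Z. sup_Psi \<nu> * B \<nu>) | Z. Z \<subseteq> ?X \<and> finite Z}"
  have bdd: "bdd_above {(\<Sum>\<nu>\<in>Z. sup_Psi \<nu> * B \<nu>) | Z. Z \<subseteq> ?X \<and> finite Z}" using \<tau> by (intro bdd_aboveI[of _ \<tau>1]) auto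
  have ne: "{(\<Sum>\<nu>\<in>Z. sup_Psi \<nu> * B \<nu>) | Z. Z \<subseteq> ?X \<and> finite Z} \<noteq> {}" by blast
  have "\<exists>Z\<subseteq>?X. finite Z \<and> s - (1 / 2) ^ j < (\<Sum>\<nu>\<in>Z. sup_Psi \<nu> * B \<nu>)" for j
    using less_cSupD[OF ne, of "s - (1 / 2) ^ j"] unfolding s_def[symmetric] by auto
  then obtain Z0 where Z0: "\<And>j. Z0 j \<subseteq> ?X" "\<And>j. finite (Z0 j)" "\<And>j. s - (1 / 2) ^ j < (\<Sum>\<nu>\<in>Z0 j. sup_Psi \<nu> * B \<nu>)" by metis
  define Z where "Z = (\<lambda>j. \<Union>i\<le>j. Z0 i)"
  have Z: "Z j \<subseteq> ?X" "finite (Z j)" for j using Z0 by (auto simp: Z_def)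
  have Zmono: "Z i \<subseteq> Z j" if "i \<le> j" for i j using that by (auto simp: Z_def intro: order.trans)
  have small: "(\<Sum>\<nu>\<in>W. sup_Psi \<nu> * B \<nu>) \<le> (1 / 2) ^ j" if W: "W \<subseteq> ?X - Z j" "finite W" for W j
  proof -
    have "(\<Sum>\<nu>\<in>Z0 j. sup_Psi \<nu> * B \<nu>) \<le> (\<Sum>\<nu>\<in>Z j. sup_Psi \<nu> * B \<nu>)"
      using Z(1,2)[of j] B0 u0 by (intro sum_mono2) (auto simp: Z_def less_imp_le intro!: mult_nonneg_nonneg)
    moreover have "(\<Sum>\<nu>\<in>Z j. sup_Psi \<nu> * B \<nu>) + (\<Sum>\<nu>\<in>W. sup_Psi \<nu> * B \<nu>) = (\<Sum>\<nu>\<in>Z j \<union> W. sup_Psi \<nu> * B \<nu>)"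
      using W Z(2)[of j] by (intro sum.union_disjoint[symmetric]) auto
    moreover have "(\<Sum>\<nu>\<in>Z j \<union> W. sup_Psi \<nu> * B \<nu>) \<le> s"
      unfolding s_def using W Z[of j] by (intro cSup_upper[OF _ bdd]) auto
    ultimately show ?thesis using Z0(3)[of j] by linarith
  qed
  define g where "g = (\<lambda>j. psum (S \<union> Z j) ?c)"
  have ZS: "finite (S \<union> Z j)" "S \<union> Z j \<subseteq> multi_indices" for j using Z S by auto
  have gm: "g j \<in> borel_measurable ten" for j unfolding g_def by (rule psum_measurable[OF ZS(2)])
  have pd: "psum V ?c y - psum W ?c y = psum (V - W) ?c y" if "W \<subseteq> V" "finite V" for V W y
    unfolding psum_def using that by (simp add: sum_diff)
  have pb: "cmod (psum W ?c y) \<le> (\<Sum>\<nu>\<in>W. sup_Psi \<nu> * B \<nu>)" if "y \<in> cube" "W \<subseteq> multi_indices" for W y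
    using that B u0 by (intro order.trans[OF psum_bound] sum_mono mult_left_mono) (auto simp: less_imp_le)
  have gd: "cmod (g k y - g j y) \<le> (1 / 2) ^ j" if "y \<in> cube" "j \<le> k" for j k y
  proof -
    have "cmod (g k y - g j y) = cmod (psum ((S \<union> Z k) - (S \<union> Z j)) ?c y)"
      unfolding g_def using Zmono[OF that(2)] ZS by (subst pd) auto
    also have "\<dots> \<le> (\<Sum>\<nu>\<in>(S \<union> Z k) - (S \<union> Z j). sup_Psi \<nu> * B \<nu>)" using that ZS(2)[of k] by (intro pb) auto
    also have "\<dots> \<le> (1 / 2) ^ j" using Z[of k] S by (intro small) auto
    finally show ?thesis .
  qed
  have half0: "(\<lambda>j. (1 / 2) ^ j :: real) \<longlonglongrightarrow> 0" by (rule LIMSEQ_power_zero) simp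
  have "Cauchy (\<lambda>j. g j y)" if y: "y \<in> cube" for y
  proof (rule CauchyI)
    fix e :: real assume e: "0 < e"
    obtain M where M: "(1 / 2) ^ M < e / 2"
      using LIMSEQ_D[OF half0, of "e / 2"] e by (auto simp del: power_divide)
    have "cmod (g m y - g n y) < e" if "M \<le> m" "M \<le> n" for m n
      using gd[OF y that(1)] gd[OF y that(2)] M norm_triangle_ineq4[of "g m y - g M y" "g n y - g M y"] by simp
    then show "\<exists>M. \<forall>m\<ge>M. \<forall>n\<ge>M. norm (g m y - g n y) < e" by blast
  qed
  then have conv: "(\<lambda>j. g j y) \<longlonglongrightarrow> lim (\<lambda>j. g j y)" if "y \<in> cube" for y
    using that by (simp add: Cauchy_convergent_iff convergent_LIMSEQ_iff)
  define G where "G = (\<lambda>y. lim (\<lambda>j. g j y))"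
  have Gm: "G \<in> borel_measurable ten" unfolding G_def by (intro borel_measurable_lim_metric gm)
  have GG: "(\<lambda>j. g j y) \<longlonglongrightarrow> G y" if "y \<in> cube" for y using conv[OF that] by (simp add: G_def)
  have Gg: "cmod (G y - g j y) \<le> (1 / 2) ^ j" if "y \<in> cube" for y j
  proof (rule LIMSEQ_le_const2)
    show "(\<lambda>k. cmod (g k y - g j y)) \<longlonglongrightarrow> cmod (G y - g j y)" using GG[OF that] by (intro tendsto_intros)
    show "\<exists>N. \<forall>k\<ge>N. cmod (g k y - g j y) \<le> (1 / 2) ^ j" using gd[OF that] by blast
  qed
  have gb: "cmod (g j y) \<le> (\<Sum>\<nu>\<in>S \<union> Z j. sup_Psi \<nu> * B \<nu>)" if "y \<in> cube" for j y
    unfolding g_def by (rule pb[OF that ZS(2)])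
  have Gb: "cmod (G y) \<le> 1 + (\<Sum>\<nu>\<in>S \<union> Z 0. sup_Psi \<nu> * B \<nu>)" if "y \<in> cube" for y
    using norm_triangle_sub[of "G y" "g 0 y"] Gg[OF that, of 0] gb[OF that, of 0] by simp
  have coefG: "coef G \<nu> = ?c \<nu>" if \<nu>: "\<nu> \<in> multi_indices" for \<nu>
  proof -
    have "cmod (coef G \<nu> - ?c \<nu>) \<le> (1 / 2) ^ j * (sup_Psi \<nu> + 1)" for j
    proof -
      have "cmod (coef G \<nu> - coef (g j) \<nu>) \<le> (1 / 2) ^ j * sup_Psi \<nu>"
      proof -
        have "coef (\<lambda>y. G y - g j y) \<nu> = coef G \<nu> - coef (g j) \<nu>" by (rule coef_diff[OF \<nu> Gm Gb gm gb])
        moreover have "(\<lambda>y. G y - g j y) \<in> borel_measurable ten" using Gm gm[of j] by measurable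
        ultimately show ?thesis using coef_le[OF \<nu>, of "\<lambda>y. G y - g j y" "(1 / 2) ^ j"] Gg by simp
      qed
      moreover have "cmod (coef (g j) \<nu> - ?c \<nu>) \<le> (1 / 2) ^ j"
      proof (cases "\<nu> \<in> S \<union> Z j")
        case True
        then show ?thesis unfolding g_def coef_psum[OF ZS \<nu>] by simp
      next
        \<comment> \<open>The partial sum has coefficient 0 at an index it misses, and the true
          coefficient there is at most (1/2)^j by \<open>small\<close>.\<close>
        case False
        have "cmod (?c \<nu>) \<le> 1 * B \<nu>" using B[OF \<nu>] by simp
        also have "\<dots> \<le> sup_Psi \<nu> * B \<nu>" using B0[OF \<nu>] sup_Psi_ge_1 by (intro mult_right_mono) auto
        also have "\<dots> \<le> (1 / 2) ^ j" using small[of "{\<nu>}" j] False \<nu> by simp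
        finally show ?thesis using False unfolding g_def coef_psum[OF ZS \<nu>] by simp
      qed
      ultimately show ?thesis using norm_triangle_ineq[of "coef G \<nu> - coef (g j) \<nu>" "coef (g j) \<nu> - ?c \<nu>"]
        by (simp add: distrib_left)
    qed
    moreover have "(\<lambda>j. (1 / 2) ^ j * (sup_Psi \<nu> + 1)) \<longlonglongrightarrow> 0 * (sup_Psi \<nu> + 1)" by (intro tendsto_mult half0 tendsto_const)
    ultimately have "cmod (coef G \<nu> - ?c \<nu>) \<le> 0" by (intro LIMSEQ_le_const[of _ 0]) auto
    then show ?thesis by simp
  qed
  have fG: "AE y in ten. f y = G y"
  proof -
    have "AE y in ten. f y - G y = 0"
    proof (rule complete_complex)
      show "(\<lambda>y. f y - G y) \<in> borel_measurable ten" using f Gm by measurable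
      show "cmod (f y - G y) \<le> 1 + (1 + (\<Sum>\<nu>\<in>S \<union> Z 0. sup_Psi \<nu> * B \<nu>))" if "y \<in> cube" for y
        using norm_triangle_ineq4[of "f y" "G y"] f(2)[OF that] Gb[OF that] by linarith
      show "coef (\<lambda>y. f y - G y) \<nu> = 0" if "\<nu> \<in> multi_indices" for \<nu>
      proof -
        have "coef (\<lambda>y. f y - G y) \<nu> = coef f \<nu> - coef G \<nu>" by (rule coef_diff[OF that f Gm Gb])
        then show ?thesis by (simp add: coefG[OF that])
      qed
    qed
    then show ?thesis by simp
  qed
  have gS: "g j y - psum S ?c y = psum (Z j) ?c y" for j y
  proof -
    have "g j y - psum S ?c y = psum (S \<union> Z j - S) ?c y" unfolding g_def using ZS by (intro pd) auto
    moreover have "S \<union> Z j - S = Z j" using Z(1)[of j] by auto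
    ultimately show ?thesis by simp
  qed
  have Zb: "cmod (g j y - psum S ?c y) \<le> \<tau>1" if "y \<in> cube" for j y
  proof -
    have "cmod (psum (Z j) ?c y) \<le> (\<Sum>\<nu>\<in>Z j. sup_Psi \<nu> * B \<nu>)" using Z(1)[of j] by (intro pb that) auto
    then show ?thesis using \<tau>[OF Z] unfolding gS by (meson order.trans)
  qed
  have lim1: "(\<lambda>j. cmod (g j y - psum S ?c y)) \<longlonglongrightarrow> cmod (G y - psum S ?c y)" if "y \<in> cube" for y
    using GG[OF that] by (intro tendsto_intros)
  have GS: "cmod (G y - psum S ?c y) \<le> \<tau>1" if "y \<in> cube" for y
    by (rule LIMSEQ_le_const2[OF lim1[OF that]]) (use Zb[OF that] in blast)
  show "AE y in ten. cmod (f y - psum S ?c y) \<le> \<tau>1"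
    using fG by (rule AE_mp) (auto intro!: AE_I2 GS simp: space_ten)
  have Sm: "psum S ?c \<in> borel_measurable ten" by (rule psum_measurable[OF S(2)])
  have "(\<integral>y. (cmod (f y - psum S ?c y))\<^sup>2 \<partial>ten) = (\<integral>y. (cmod (G y - psum S ?c y))\<^sup>2 \<partial>ten)"
  proof (rule integral_cong_AE)
    show "(\<lambda>y. (cmod (f y - psum S ?c y))\<^sup>2) \<in> borel_measurable ten" using f Sm by measurable
    show "(\<lambda>y. (cmod (G y - psum S ?c y))\<^sup>2) \<in> borel_measurable ten" using Gm Sm by measurable
    show "AE y in ten. (cmod (f y - psum S ?c y))\<^sup>2 = (cmod (G y - psum S ?c y))\<^sup>2" using fG by (rule AE_mp) auto
  qed
  also have "\<dots> \<le> \<tau>2"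
  proof (rule LIMSEQ_le_const2)
    show "(\<lambda>j. \<integral>y. (cmod (g j y - psum S ?c y))\<^sup>2 \<partial>ten) \<longlonglongrightarrow> (\<integral>y. (cmod (G y - psum S ?c y))\<^sup>2 \<partial>ten)"
    proof (rule integral_dominated_convergence[where w = "\<lambda>_. \<tau>1\<^sup>2"])
      show "(\<lambda>y. (cmod (G y - psum S ?c y))\<^sup>2) \<in> borel_measurable ten" using Gm Sm by measurable
      show "(\<lambda>y. (cmod (g j y - psum S ?c y))\<^sup>2) \<in> borel_measurable ten" for j using gm[of j] Sm by measurable
      show "AE y in ten. (\<lambda>j. (cmod (g j y - psum S ?c y))\<^sup>2) \<longlonglongrightarrow> (cmod (G y - psum S ?c y))\<^sup>2"
        by (intro AE_I2 tendsto_power lim1) (simp add: space_ten)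
      show "AE y in ten. norm ((cmod (g j y - psum S ?c y))\<^sup>2) \<le> \<tau>1\<^sup>2" for j
        using Zb by (intro AE_I2) (auto simp: space_ten intro!: power_mono)
    qed simp
    have "(\<integral>y. (cmod (g j y - psum S ?c y))\<^sup>2 \<partial>ten) \<le> \<tau>2" for j
    proof -
      have "(\<integral>y. (cmod (g j y - psum S ?c y))\<^sup>2 \<partial>ten) = (\<Sum>\<nu>\<in>Z j. (cmod (?c \<nu>))\<^sup>2)"
        unfolding gS using Z[of j] by (intro parseval) auto
      also have "\<dots> \<le> (\<Sum>\<nu>\<in>Z j. (B \<nu>)\<^sup>2)" using Z(1)[of j] B by (intro sum_mono power_mono) auto
      also have "\<dots> \<le> \<tau>2" using \<tau>[OF Z] by blast
      finally show ?thesis .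
    qed
    then show "\<exists>N. \<forall>j\<ge>N. (\<integral>y. (cmod (g j y - psum S ?c y))\<^sup>2 \<partial>ten) \<le> \<tau>2" by blast
  qed
  finally show "(\<integral>y. (cmod (f y - psum S ?c y))\<^sup>2 \<partial>ten) \<le> \<tau>2" .
qed

end

section \<open>Least squares\<close>

text \<open>The normal equations are solvable for any finite family of vectors, independent or not.
  This is Gram-Schmidt: the new vector is reduced modulo the old ones, and the residual is corrected
  along the reduced vector. If that vector vanishes on the samples, the factor t = 0 serves.\<close>

lemma projection_exists:
  fixes a :: "'x \<Rightarrow> nat \<Rightarrow> complex"
  assumes "finite S"
  shows "\<exists>c. \<forall>\<nu>\<in>S. (\<Sum>i<m. (w i - (\<Sum>\<nu>'\<in>S. c \<nu>' * a \<nu>' i)) * cnj (a \<nu> i)) = 0"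
  using assms
proof (induction S arbitrary: w rule: finite_induct)
  case (insert \<nu>0 S)
  let ?ip = "\<lambda>u v :: nat \<Rightarrow> complex. \<Sum>i<m. u i * cnj (v i)"
  obtain c where c: "\<And>\<nu>. \<nu> \<in> S \<Longrightarrow> ?ip (\<lambda>i. w i - (\<Sum>\<nu>'\<in>S. c \<nu>' * a \<nu>' i)) (a \<nu>) = 0" using insert.IH[of w] by blast
  obtain d where d: "\<And>\<nu>. \<nu> \<in> S \<Longrightarrow> ?ip (\<lambda>i. a \<nu>0 i - (\<Sum>\<nu>'\<in>S. d \<nu>' * a \<nu>' i)) (a \<nu>) = 0" using insert.IH[of "a \<nu>0"] by blast
  define w' where "w' = (\<lambda>i. w i - (\<Sum>\<nu>'\<in>S. c \<nu>' * a \<nu>' i))"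
  define a' where "a' = (\<lambda>i. a \<nu>0 i - (\<Sum>\<nu>'\<in>S. d \<nu>' * a \<nu>' i))"
  have sub: "?ip (\<lambda>i. u i - t * v i) z = ?ip u z - t * ?ip v z" for u v z t
    by (simp add: left_diff_distrib sum_subtractf sum_distrib_left mult.assoc)
  have perp: "?ip u (a \<nu>0) = ?ip u a'" if "\<And>\<nu>. \<nu> \<in> S \<Longrightarrow> ?ip u (a \<nu>) = 0" for u
  proof -
    have "?ip u a' = ?ip u (a \<nu>0) - (\<Sum>i<m. \<Sum>\<nu>\<in>S. cnj (d \<nu>) * (u i * cnj (a \<nu> i)))"
      by (simp add: a'_def right_diff_distrib sum_subtractf sum_distrib_left mult_ac)
    also have "(\<Sum>i<m. \<Sum>\<nu>\<in>S. cnj (d \<nu>) * (u i * cnj (a \<nu> i))) = (\<Sum>\<nu>\<in>S. cnj (d \<nu>) * ?ip u (a \<nu>))"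
      by (subst sum.swap) (simp add: sum_distrib_left)
    also have "\<dots> = 0" using that by simp
    finally show ?thesis by simp
  qed
  obtain t where t: "?ip w' a' = t * ?ip a' a'"
  proof (cases "?ip a' a' = 0")
    case True
    have "complex_of_real (\<Sum>i<m. (cmod (a' i))\<^sup>2) = 0" using True by (simp only: of_real_sum complex_norm_square)
    then have "(\<Sum>i<m. (cmod (a' i))\<^sup>2) = 0" by (simp only: of_real_eq_0_iff)
    then have "\<forall>i\<in>{..<m}. (cmod (a' i))\<^sup>2 = 0" by (subst (asm) sum_nonneg_eq_0_iff) auto
    then show ?thesis using that[of 0] by simp
  next
    case False
    then show ?thesis using that[of "?ip w' a' / ?ip a' a'"] by simp
  qed
  define e where "e = (\<lambda>\<nu>. if \<nu> = \<nu>0 then t else c \<nu> - t * d \<nu>)"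
  have res: "w i - (\<Sum>\<nu>'\<in>insert \<nu>0 S. e \<nu>' * a \<nu>' i) = w' i - t * a' i" for i
  proof -
    have "(\<Sum>\<nu>'\<in>S. e \<nu>' * a \<nu>' i) = (\<Sum>\<nu>'\<in>S. (c \<nu>' - t * d \<nu>') * a \<nu>' i)"
      using insert.hyps by (intro sum.cong) (auto simp: e_def)
    then show ?thesis using insert.hyps
      by (simp add: w'_def a'_def e_def left_diff_distrib sum_subtractf sum_distrib_left algebra_simps)
  qed
  have S: "?ip (\<lambda>i. w' i - t * a' i) (a \<nu>) = 0" if "\<nu> \<in> S" for \<nu>
    unfolding sub using c[OF that] d[OF that] by (simp add: w'_def a'_def)
  have "?ip (\<lambda>i. w' i - t * a' i) (a \<nu>0) = ?ip (\<lambda>i. w' i - t * a' i) a'" by (rule perp[OF S])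
  also have "\<dots> = 0" unfolding sub t by simp
  finally have "?ip (\<lambda>i. w' i - t * a' i) (a \<nu>0) = 0" .
  then have "\<forall>\<nu>\<in>insert \<nu>0 S. (\<Sum>i<m. (w i - (\<Sum>\<nu>'\<in>insert \<nu>0 S. e \<nu>' * a \<nu>' i)) * cnj (a \<nu> i)) = 0"
    unfolding res using S by auto
  then show ?case by blast
qed simp

lemma pythagoras_sum:
  fixes r v :: "nat \<Rightarrow> complex"
  assumes "(\<Sum>i<m. r i * cnj (v i)) = 0"
  shows "(\<Sum>i<m. (cmod (r i + v i))\<^sup>2) = (\<Sum>i<m. (cmod (r i))\<^sup>2) + (\<Sum>i<m. (cmod (v i))\<^sup>2)"
proof -
  have "(cmod (r i + v i))\<^sup>2 = (cmod (r i))\<^sup>2 + (cmod (v i))\<^sup>2 + 2 * Re (r i * cnj (v i))" for i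
    unfolding cmod_power2 by (simp add: power2_eq_square algebra_simps)
  moreover have "(\<Sum>i<m. Re (r i * cnj (v i))) = 0" using arg_cong[OF assms, of Re] by simp
  ultimately show ?thesis by (simp add: sum.distrib sum_distrib_left[symmetric])
qed

context ortho_polys
begin

text \<open>Up to the factor m, the spectrum of the Gram matrix of the samples lies in [1/2, 3/2];
  the real form is the one that \<open>concentration\<close> delivers.\<close>

definition stable :: "(nat \<Rightarrow> nat) set \<Rightarrow> nat \<Rightarrow> (nat \<Rightarrow> nat \<Rightarrow> real) \<Rightarrow> bool" where
  "stable S m y \<longleftrightarrow> (\<forall>v. real m / 2 * ip S v v \<le> (\<Sum>r<m. (ip S (\<lambda>\<nu>. Psi \<psi> \<nu> (y r)) v)\<^sup>2)
          \<and> (\<Sum>r<m. (ip S (\<lambda>\<nu>. Psi \<psi> \<nu> (y r)) v)\<^sup>2) \<le> 3 / 2 * real m * ip S v v)"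

text \<open>\<open>Psi\<close> is real, so the real and imaginary parts of the coefficients
  separate.\<close>

lemma stable_complex:
  assumes "stable S m y"
  shows "real m / 2 * (\<Sum>\<nu>\<in>S. (cmod (c \<nu>))\<^sup>2) \<le> (\<Sum>i<m. (cmod (psum S c (y i)))\<^sup>2)"
    and "(\<Sum>i<m. (cmod (psum S c (y i)))\<^sup>2) \<le> 3 / 2 * real m * (\<Sum>\<nu>\<in>S. (cmod (c \<nu>))\<^sup>2)"
proof -
  have "(cmod (psum S c (y i)))\<^sup>2 = (ip S (\<lambda>\<nu>. Psi \<psi> \<nu> (y i)) (\<lambda>\<nu>. Re (c \<nu>)))\<^sup>2 + (ip S (\<lambda>\<nu>. Psi \<psi> \<nu> (y i)) (\<lambda>\<nu>. Im (c \<nu>)))\<^sup>2" for i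
    unfolding cmod_power2 by (simp add: psum_def ip_def mult.commute)
  then have s: "(\<Sum>i<m. (cmod (psum S c (y i)))\<^sup>2) = (\<Sum>i<m. (ip S (\<lambda>\<nu>. Psi \<psi> \<nu> (y i)) (\<lambda>\<nu>. Re (c \<nu>)))\<^sup>2)
     + (\<Sum>i<m. (ip S (\<lambda>\<nu>. Psi \<psi> \<nu> (y i)) (\<lambda>\<nu>. Im (c \<nu>)))\<^sup>2)" by (simp add: sum.distrib)
  have n: "(\<Sum>\<nu>\<in>S. (cmod (c \<nu>))\<^sup>2) = ip S (\<lambda>\<nu>. Re (c \<nu>)) (\<lambda>\<nu>. Re (c \<nu>)) + ip S (\<lambda>\<nu>. Im (c \<nu>)) (\<lambda>\<nu>. Im (c \<nu>))"
    unfolding cmod_power2 by (simp add: ip_def sum.distrib power2_eq_square)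
  note st = assms[unfolded stable_def, rule_format]
  show "real m / 2 * (\<Sum>\<nu>\<in>S. (cmod (c \<nu>))\<^sup>2) \<le> (\<Sum>i<m. (cmod (psum S c (y i)))\<^sup>2)"
    "(\<Sum>i<m. (cmod (psum S c (y i)))\<^sup>2) \<le> 3 / 2 * real m * (\<Sum>\<nu>\<in>S. (cmod (c \<nu>))\<^sup>2)"
    unfolding s n distrib_left
    by (rule add_mono[OF conjunct1[OF st] conjunct1[OF st]], rule add_mono[OF conjunct2[OF st] conjunct2[OF st]])
qed

lemma psum_diff: "psum S c x - psum S d x = psum S (\<lambda>\<nu>. c \<nu> - d \<nu>) x"
  by (simp add: psum_def left_diff_distrib sum_subtractf)

lemma poly_space_psum: "poly_space \<psi> S = range (psum S)"
  by (auto simp: poly_space_def psum_def[abs_def])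

text \<open>The residual of a solution of the normal equations is orthogonal to the space. By
  Pythagoras the objective at d exceeds the minimum by a multiple of the squared discrete norm of c
  - d, which \<open>stable\<close> bounds from below. The same identity gives uniqueness and the
  distance to any competitor d.\<close>

lemma least_squares:
  assumes S: "finite S" and m: "0 < m" and st: "stable S m y"
  shows "\<exists>c. (\<forall>q. is_least_squares \<psi> S m y f e q \<longleftrightarrow> q = psum S c) \<and>
    (\<forall>d. (\<Sum>\<nu>\<in>S. (cmod (c \<nu> - d \<nu>))\<^sup>2) \<le> 2 / real m * (\<Sum>i<m. (cmod (f (y i) + e i - psum S d (y i)))\<^sup>2))"
proof -
  define w where "w = (\<lambda>i. f (y i) + e i)"
  obtain c where c: "\<And>\<nu>. \<nu> \<in> S \<Longrightarrow> (\<Sum>i<m. (w i - psum S c (y i)) * cnj (complex_of_real (Psi \<psi> \<nu> (y i)))) = 0"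
    using projection_exists[OF S, where m = m and w = w and a = "\<lambda>\<nu> i. complex_of_real (Psi \<psi> \<nu> (y i))"] unfolding psum_def by auto
  have py: "(\<Sum>i<m. (cmod (w i - psum S d (y i)))\<^sup>2) = (\<Sum>i<m. (cmod (w i - psum S c (y i)))\<^sup>2) + (\<Sum>i<m. (cmod (psum S (\<lambda>\<nu>. c \<nu> - d \<nu>) (y i)))\<^sup>2)" for d
  proof -
    have "(\<Sum>i<m. (w i - psum S c (y i)) * cnj (psum S (\<lambda>\<nu>. c \<nu> - d \<nu>) (y i)))
      = (\<Sum>i<m. \<Sum>\<nu>\<in>S. cnj (c \<nu> - d \<nu>) * ((w i - psum S c (y i)) * cnj (complex_of_real (Psi \<psi> \<nu> (y i)))))"
      unfolding psum_def[of S "\<lambda>\<nu>. c \<nu> - d \<nu>"] by (simp add: sum_distrib_left mult_ac)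
    also have "\<dots> = (\<Sum>\<nu>\<in>S. cnj (c \<nu> - d \<nu>) * (\<Sum>i<m. (w i - psum S c (y i)) * cnj (complex_of_real (Psi \<psi> \<nu> (y i)))))"
      by (subst sum.swap) (simp only: sum_distrib_left)
    also have "\<dots> = 0" using c by simp
    finally have "(\<Sum>i<m. (w i - psum S c (y i)) * cnj (psum S (\<lambda>\<nu>. c \<nu> - d \<nu>) (y i))) = 0" .
    from pythagoras_sum[OF this] show ?thesis by (simp add: psum_diff[symmetric])
  qed
  have low: "real m / 2 * (\<Sum>\<nu>\<in>S. (cmod (c \<nu> - d \<nu>))\<^sup>2) \<le> (\<Sum>i<m. (cmod (psum S (\<lambda>\<nu>. c \<nu> - d \<nu>) (y i)))\<^sup>2)" for d
    by (rule stable_complex(1)[OF st])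
  let ?J = "\<lambda>q. 1 / real m * (\<Sum>i<m. (cmod (f (y i) + e i - q (y i)))\<^sup>2)"
  have J: "?J (psum S d) = 1 / real m * (\<Sum>i<m. (cmod (w i - psum S d (y i)))\<^sup>2)" for d by (simp add: w_def)
  have Jle: "?J (psum S c) \<le> ?J (psum S d)" for d
    unfolding J py[of d] by (intro mult_left_mono) (auto intro!: sum_nonneg)
  have uniq: "psum S d = psum S c" if "?J (psum S d) \<le> ?J (psum S c)" for d
  proof -
    have "(\<Sum>i<m. (cmod (psum S (\<lambda>\<nu>. c \<nu> - d \<nu>) (y i)))\<^sup>2) \<le> 0"
      using that m unfolding J py[of d] by (simp add: divide_le_cancel)
    then have "real m / 2 * (\<Sum>\<nu>\<in>S. (cmod (c \<nu> - d \<nu>))\<^sup>2) \<le> 0" using low[of d] by simp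
    then have "(\<Sum>\<nu>\<in>S. (cmod (c \<nu> - d \<nu>))\<^sup>2) \<le> 0" using m by (simp add: mult_le_0_iff)
    then have "(\<Sum>\<nu>\<in>S. (cmod (c \<nu> - d \<nu>))\<^sup>2) = 0" by (intro antisym sum_nonneg) auto
    then have "\<forall>\<nu>\<in>S. c \<nu> = d \<nu>" using S by (subst (asm) sum_nonneg_eq_0_iff) auto
    then show ?thesis unfolding psum_def[abs_def] by (intro ext sum.cong) auto
  qed
  have "is_least_squares \<psi> S m y f e q \<longleftrightarrow> q = psum S c" for q
  proof
    assume "is_least_squares \<psi> S m y f e q"
    then have "q \<in> range (psum S)" and "\<not> ?J (psum S c) < ?J q"
      unfolding is_least_squares_def is_arg_min_def poly_space_psum by blast+
    then show "q = psum S c" using uniq by fastforce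
  next
    assume "q = psum S c"
    then show "is_least_squares \<psi> S m y f e q"
      unfolding is_least_squares_def is_arg_min_def poly_space_psum using Jle by (auto simp: not_less)
  qed
  moreover have "(\<Sum>\<nu>\<in>S. (cmod (c \<nu> - d \<nu>))\<^sup>2) \<le> 2 / real m * (\<Sum>i<m. (cmod (f (y i) + e i - psum S d (y i)))\<^sup>2)" for d
  proof -
    have "0 \<le> (\<Sum>i<m. (cmod (w i - psum S c (y i)))\<^sup>2)" by (intro sum_nonneg) auto
    then have "real m / 2 * (\<Sum>\<nu>\<in>S. (cmod (c \<nu> - d \<nu>))\<^sup>2) \<le> (\<Sum>i<m. (cmod (w i - psum S d (y i)))\<^sup>2)"
      using low[of d] py[of d] by linarith
    then show ?thesis using m by (simp add: w_def field_simps)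
  qed
  ultimately show ?thesis by blast
qed

text \<open>The approximation is compared with a reference d. The noise constant is 2 = sqrt 2 *
  sqrt 2: one factor from |a + b|^2 \<le> 2 |a|^2 + 2 |b|^2, the other from the lower spectral bound
  1/2. \<open>disc\<close> and \<open>st\<close> are what probability has to supply.\<close>

lemma least_squares_error:
  assumes S: "finite S" "S \<subseteq> multi_indices" and m: "0 < m" and st: "stable S m y"
    and f: "f \<in> borel_measurable ten" "\<And>y. y \<in> cube \<Longrightarrow> cmod (f y) \<le> 1"
    and t2: "(\<integral>x. (cmod (f x - psum S d x))\<^sup>2 \<partial>ten) \<le> \<tau>2" "0 \<le> \<tau>2"
    and disc: "(\<Sum>i<m. (cmod (f (y i) - psum S d (y i)))\<^sup>2) \<le> real m * \<sigma>" "0 \<le> \<sigma>"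
  shows "(\<exists>!q. is_least_squares \<psi> S m y f e q) \<and> (\<forall>q. is_least_squares \<psi> S m y f e q \<longrightarrow>
    L2_norm ten (\<lambda>x. f x - q x) \<le> sqrt 2 * sqrt \<tau>2 + 2 * sqrt \<sigma> + 2 * (MAX i\<in>{..<m}. cmod (e i)))"
proof -
  obtain c where c0: "\<forall>q. is_least_squares \<psi> S m y f e q \<longleftrightarrow> q = psum S c"
    and cd0: "\<forall>d. (\<Sum>\<nu>\<in>S. (cmod (c \<nu> - d \<nu>))\<^sup>2) \<le> 2 / real m * (\<Sum>i<m. (cmod (f (y i) + e i - psum S d (y i)))\<^sup>2)"
    using least_squares[OF S(1) m st, of f e] by (elim exE conjE) (rule that)
  note c = c0[rule_format] and cd = cd0[rule_format, of d]
  define E where "E = (MAX i\<in>{..<m}. cmod (e i))"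
  have eE: "cmod (e i) \<le> E" if "i < m" for i unfolding E_def using that by (intro Max_ge) auto
  have E0: "0 \<le> E" using order.trans[OF norm_ge_zero eE[OF m]] .
  have "sqrt (\<Sum>i<m. (cmod (f (y i) + e i - psum S d (y i)))\<^sup>2) \<le> sqrt (\<Sum>i<m. (cmod (f (y i) - psum S d (y i)) + cmod (e i))\<^sup>2)"
  proof (intro real_sqrt_le_mono sum_mono power_mono)
    fix i show "cmod (f (y i) + e i - psum S d (y i)) \<le> cmod (f (y i) - psum S d (y i)) + cmod (e i)"
      using norm_triangle_ineq[of "f (y i) - psum S d (y i)" "e i"] by (simp add: algebra_simps)
  qed auto
  also have "\<dots> \<le> sqrt (\<Sum>i<m. (cmod (f (y i) - psum S d (y i)))\<^sup>2) + sqrt (\<Sum>i<m. (cmod (e i))\<^sup>2)"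
    using L2_set_triangle_ineq[of "\<lambda>i. cmod (f (y i) - psum S d (y i))" "\<lambda>i. cmod (e i)" "{..<m}"] by (simp add: L2_set_def)
  also have "\<dots> \<le> sqrt (real m * \<sigma>) + sqrt (\<Sum>i<m. E\<^sup>2)"
    using disc eE by (intro add_mono real_sqrt_le_mono sum_mono power_mono) auto
  also have "\<dots> = sqrt (real m) * (sqrt \<sigma> + E)" using E0 by (simp add: real_sqrt_mult distrib_left)
  finally have q: "sqrt (\<Sum>i<m. (cmod (f (y i) + e i - psum S d (y i)))\<^sup>2) \<le> sqrt (real m) * (sqrt \<sigma> + E)" .
  have sc: "sqrt (\<Sum>\<nu>\<in>S. (cmod (c \<nu> - d \<nu>))\<^sup>2) \<le> sqrt 2 * (sqrt \<sigma> + E)"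
  proof -
    have "sqrt (\<Sum>\<nu>\<in>S. (cmod (c \<nu> - d \<nu>))\<^sup>2) \<le> sqrt (2 / real m * (\<Sum>i<m. (cmod (f (y i) + e i - psum S d (y i)))\<^sup>2))"
      by (rule real_sqrt_le_mono[OF cd])
    also have "\<dots> = sqrt 2 / sqrt (real m) * sqrt (\<Sum>i<m. (cmod (f (y i) + e i - psum S d (y i)))\<^sup>2)"
      by (simp only: real_sqrt_mult real_sqrt_divide)
    also have "\<dots> \<le> sqrt 2 / sqrt (real m) * (sqrt (real m) * (sqrt \<sigma> + E))" by (rule mult_left_mono[OF q]) simp
    also have "\<dots> = sqrt 2 * (sqrt \<sigma> + E)" using m by simp
    finally show ?thesis .
  qed
  have "L2_norm ten (\<lambda>x. f x - psum S c x) \<le> sqrt 2 * sqrt \<tau>2 + 2 * sqrt \<sigma> + 2 * E"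
  proof -
    have pm: "psum S c' \<in> borel_measurable ten" for c' by (rule psum_measurable[OF S(2)])
    have bd: "cmod (psum S c' x) \<le> (\<Sum>\<nu>\<in>S. sup_Psi \<nu> * cmod (c' \<nu>))" if "x \<in> cube" for c' x by (rule psum_bound[OF that])
    have i1: "integrable ten (\<lambda>x. (cmod (f x - psum S c' x))\<^sup>2)" for c'
    proof (rule ten_integrable_bounded)
      show "(\<lambda>x. (cmod (f x - psum S c' x))\<^sup>2) \<in> borel_measurable ten" using f(1) pm[of c'] by measurable
      show "norm ((cmod (f x - psum S c' x))\<^sup>2) \<le> (1 + (\<Sum>\<nu>\<in>S. sup_Psi \<nu> * cmod (c' \<nu>)))\<^sup>2" if "x \<in> cube" for x
        using norm_triangle_ineq4[of "f x" "psum S c' x"] f(2)[OF that] bd[OF that, of c'] by (simp add: power_mono)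
    qed
    have i2: "integrable ten (\<lambda>x. (cmod (psum S c' x))\<^sup>2)" for c'
    proof (rule ten_integrable_bounded)
      show "(\<lambda>x. (cmod (psum S c' x))\<^sup>2) \<in> borel_measurable ten" using pm[of c'] by measurable
      show "norm ((cmod (psum S c' x))\<^sup>2) \<le> (\<Sum>\<nu>\<in>S. sup_Psi \<nu> * cmod (c' \<nu>))\<^sup>2" if "x \<in> cube" for x
        using bd[OF that, of c'] by (simp add: power_mono)
    qed
    have "(\<integral>x. (cmod (f x - psum S c x))\<^sup>2 \<partial>ten) \<le> (\<integral>x. 2 * (cmod (f x - psum S d x))\<^sup>2 + 2 * (cmod (psum S (\<lambda>\<nu>. c \<nu> - d \<nu>) x))\<^sup>2 \<partial>ten)"
    proof (rule integral_mono)
      show "integrable ten (\<lambda>x. 2 * (cmod (f x - psum S d x))\<^sup>2 + 2 * (cmod (psum S (\<lambda>\<nu>. c \<nu> - d \<nu>) x))\<^sup>2)"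
        by (intro Bochner_Integration.integrable_add integrable_mult_right i1 i2)
      fix x
      let ?a = "cmod (f x - psum S d x)" and ?b = "cmod (psum S (\<lambda>\<nu>. c \<nu> - d \<nu>) x)"
      have "cmod (f x - psum S c x) \<le> ?a + ?b"
        unfolding psum_diff[symmetric] using norm_triangle_ineq4[of "f x - psum S d x" "psum S c x - psum S d x"] by simp
      then have "(cmod (f x - psum S c x))\<^sup>2 \<le> (?a + ?b)\<^sup>2" by (intro power_mono) auto
      also have "\<dots> \<le> 2 * ?a\<^sup>2 + 2 * ?b\<^sup>2" using sum_squares_bound[of ?a ?b] by (simp add: power2_sum)
      finally show "(cmod (f x - psum S c x))\<^sup>2 \<le> 2 * ?a\<^sup>2 + 2 * ?b\<^sup>2" .
    qed (rule i1)
    also have "\<dots> = 2 * (\<integral>x. (cmod (f x - psum S d x))\<^sup>2 \<partial>ten) + 2 * (\<Sum>\<nu>\<in>S. (cmod (c \<nu> - d \<nu>))\<^sup>2)"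
      using i1 i2 by (simp add: parseval[OF S])
    also have "\<dots> \<le> 2 * \<tau>2 + 2 * (\<Sum>\<nu>\<in>S. (cmod (c \<nu> - d \<nu>))\<^sup>2)" using t2 by simp
    finally have "L2_norm ten (\<lambda>x. f x - psum S c x) \<le> sqrt (2 * \<tau>2 + 2 * (\<Sum>\<nu>\<in>S. (cmod (c \<nu> - d \<nu>))\<^sup>2))"
      unfolding L2_norm_def by (rule real_sqrt_le_mono)
    also have "\<dots> \<le> sqrt (2 * \<tau>2) + sqrt (2 * (\<Sum>\<nu>\<in>S. (cmod (c \<nu> - d \<nu>))\<^sup>2))"
      using t2 by (intro sqrt_add_le_add_sqrt mult_nonneg_nonneg sum_nonneg) auto
    also have "\<dots> = sqrt 2 * sqrt \<tau>2 + sqrt 2 * sqrt (\<Sum>\<nu>\<in>S. (cmod (c \<nu> - d \<nu>))\<^sup>2)" by (simp only: real_sqrt_mult)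
    also have "\<dots> \<le> sqrt 2 * sqrt \<tau>2 + sqrt 2 * (sqrt 2 * (sqrt \<sigma> + E))" using sc by (intro add_mono mult_left_mono) auto
    also have "sqrt 2 * (sqrt 2 * (sqrt \<sigma> + E)) = 2 * sqrt \<sigma> + 2 * E"
      unfolding mult.assoc[symmetric] by (simp add: distrib_left)
    finally show ?thesis by simp
  qed
  then show ?thesis unfolding c E_def by auto
qed

text \<open>For an eigenvector v with eigenvalue k one has k |v|^2 = |A v|^2, so k is real and
  between 1/2 and 3/2 by stability. The singular values lie between sqrt (1/2) and sqrt (3/2), whose
  quotient is sqrt 3.\<close>

lemma cond_le_2:
  assumes S: "finite S" "S \<noteq> {}" and m: "0 < m" and st: "stable S m y" and \<nu>: "bij_betw \<nu> {..<card S} S"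
  shows "cond (ls_matrix \<psi> m (card S) \<nu> y) \<le> 2"
proof -
  define n where "n = card S"
  define A where "A = ls_matrix \<psi> m n \<nu> y"
  have n: "0 < n" using S by (simp add: n_def card_gt_0_iff)
  have Ac: "A \<in> carrier_mat m n" by (simp add: A_def ls_matrix_def)
  have Hc: "mat_adjoint A \<in> carrier_mat n m" using Ac by (auto simp: mat_adjoint_def)
  have H: "mat_adjoint A $$ (k, i) = cnj (A $$ (i, k))" if "k < n" "i < m" for k i
    using that Ac by (simp add: mat_adjoint_def mat_of_rows_index)
  have AAc: "mat_adjoint A * A \<in> carrier_mat n n" using Ac Hc by simp
  \<comment> \<open>The inverse enumeration carries an eigenvector, indexed by positions, to
    coefficients indexed by S.\<close>
  define \<nu>' where "\<nu>' = the_inv_into {..<n} \<nu>"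
  have ev: "\<exists>x. k = complex_of_real x \<and> 1 / 2 \<le> x \<and> x \<le> 3 / 2" if k: "eigenvalue (mat_adjoint A * A) k" for k
  proof -
    obtain v where v: "v \<in> carrier_vec n" "v \<noteq> 0\<^sub>v n" "(mat_adjoint A * A) *\<^sub>v v = k \<cdot>\<^sub>v v"
      using k AAc unfolding eigenvalue_def eigenvector_def by auto
    define c where "c = (\<lambda>\<mu>. v $ (\<nu>' \<mu>))"
    have inv: "\<nu>' (\<nu> l) = l" if "l < n" for l
      using \<nu> that by (auto simp: \<nu>'_def n_def bij_betw_def the_inv_into_f_f)
    have re: "(\<Sum>\<mu>\<in>S. h \<mu>) = (\<Sum>l<n. h (\<nu> l))" for h :: "_ \<Rightarrow> 'z :: comm_monoid_add"
      using sum.reindex_bij_betw[OF \<nu>, of h] by (simp add: n_def)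
    define Av where "Av = (\<lambda>i. \<Sum>l<n. A $$ (i, l) * v $ l)"
    have Avp: "Av i = psum S c (y i) / sqrt (real m)" if "i < m" for i
    proof -
      have "Av i = (\<Sum>l<n. c (\<nu> l) * complex_of_real (Psi \<psi> (\<nu> l) (y i)) / sqrt (real m))"
        unfolding Av_def using that by (intro sum.cong) (auto simp: A_def ls_matrix_def c_def inv)
      then show ?thesis unfolding psum_def re by (simp add: sum_divide_distrib)
    qed
    have row: "(\<Sum>i<m. cnj (A $$ (i, l)) * Av i) = k * v $ l" if l: "l < n" for l
    proof -
      have "k * v $ l = ((mat_adjoint A * A) *\<^sub>v v) $ l" unfolding v(3) using v(1) l by simp
      also have "\<dots> = (mat_adjoint A *\<^sub>v (A *\<^sub>v v)) $ l" using Hc Ac v(1) by simp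
      also have "\<dots> = (\<Sum>i<m. mat_adjoint A $$ (l, i) * (A *\<^sub>v v) $ i)"
        using l Hc Ac by (auto simp: scalar_prod_def lessThan_atLeast0)
      also have "\<dots> = (\<Sum>i<m. cnj (A $$ (i, l)) * Av i)"
        using l Ac v(1) by (intro sum.cong) (auto simp: H Av_def scalar_prod_def lessThan_atLeast0)
      finally show ?thesis by simp
    qed
    have "k * complex_of_real (\<Sum>l<n. (cmod (v $ l))\<^sup>2) = (\<Sum>l<n. (k * v $ l) * cnj (v $ l))"
      by (simp only: of_real_sum complex_norm_square sum_distrib_left mult.assoc)
    also have "\<dots> = (\<Sum>l<n. \<Sum>i<m. cnj (A $$ (i, l)) * Av i * cnj (v $ l))"
      by (intro sum.cong refl) (simp add: row[symmetric] sum_distrib_right)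
    also have "\<dots> = (\<Sum>i<m. Av i * cnj (Av i))"
      by (subst sum.swap) (simp add: Av_def sum_distrib_left mult_ac)
    also have "\<dots> = complex_of_real (\<Sum>i<m. (cmod (Av i))\<^sup>2)" by (simp only: of_real_sum complex_norm_square)
    also have "(\<Sum>i<m. (cmod (Av i))\<^sup>2) = (\<Sum>i<m. (cmod (psum S c (y i)))\<^sup>2) / real m"
      unfolding sum_divide_distrib by (intro sum.cong) (auto simp: Avp norm_divide power_divide)
    finally have kk: "k * complex_of_real (\<Sum>l<n. (cmod (v $ l))\<^sup>2) = complex_of_real ((\<Sum>i<m. (cmod (psum S c (y i)))\<^sup>2) / real m)" .
    define V where "V = (\<Sum>l<n. (cmod (v $ l))\<^sup>2)"
    have cV: "(\<Sum>\<mu>\<in>S. (cmod (c \<mu>))\<^sup>2) = V" unfolding re V_def by (intro sum.cong) (auto simp: c_def inv)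
    have "0 < V"
    proof -
      obtain l where l: "l < n" "v $ l \<noteq> 0" using v(1,2) by (metis carrier_vecD eq_vecI index_zero_vec(1,2))
      have "0 < (cmod (v $ l))\<^sup>2" using l by simp
      also have "\<dots> \<le> V" unfolding V_def using l by (intro member_le_sum) auto
      finally show ?thesis .
    qed
    define x where "x = (\<Sum>i<m. (cmod (psum S c (y i)))\<^sup>2) / real m / V"
    have "k = complex_of_real (R / V)" if "k * complex_of_real V = complex_of_real R" for R
      using that \<open>0 < V\<close> by (simp add: field_simps)
    from this[OF kk[folded V_def]] have "k = complex_of_real x" unfolding x_def .
    moreover have "1 / 2 \<le> x" "x \<le> 3 / 2"
      using stable_complex[OF st, of c] \<open>0 < V\<close> m unfolding cV x_def by (simp_all add: field_simps)
    ultimately show ?thesis by blast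
  qed
  let ?SV = "singular_values A"
  have sv: "sqrt (1 / 2) \<le> s \<and> s \<le> sqrt (3 / 2)" if "s \<in> ?SV" for s
  proof -
    have s: "0 \<le> s" "eigenvalue (mat_adjoint A * A) (complex_of_real (s\<^sup>2))" using that by (auto simp: singular_values_def)
    then have "1 / 2 \<le> s\<^sup>2" "s\<^sup>2 \<le> 3 / 2" using ev[OF s(2)] by (auto simp del: of_real_power)
    then show ?thesis using s(1) by (auto intro: real_le_lsqrt real_le_rsqrt)
  qed
  \<comment> \<open>\<open>Min\<close> and \<open>Max\<close> in \<open>cond\<close> are informative
    for a finite nonempty set only; nonemptiness rests on the existence of a complex
    eigenvalue.\<close>
  have "finite ?SV"
  proof (rule finite_subset)
    show "?SV \<subseteq> (\<lambda>k. sqrt (Re k)) ` spectrum (mat_adjoint A * A)"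
    proof
      fix s assume s: "s \<in> ?SV"
      then have "s = sqrt (Re (complex_of_real (s\<^sup>2)))" by (simp add: singular_values_def)
      moreover have "complex_of_real (s\<^sup>2) \<in> spectrum (mat_adjoint A * A)" using s by (auto simp: singular_values_def spectrum_def)
      ultimately show "s \<in> (\<lambda>k. sqrt (Re k)) ` spectrum (mat_adjoint A * A)" by (rule image_eqI)
    qed
    show "finite ((\<lambda>k. sqrt (Re k)) ` spectrum (mat_adjoint A * A))" using card_finite_spectrum(1)[OF AAc] by simp
  qed
  moreover have "?SV \<noteq> {}"
  proof -
    obtain k where "eigenvalue (mat_adjoint A * A) k" using spectrum_non_empty[OF AAc n] by (auto simp: spectrum_def)
    moreover from ev[OF this] obtain x where "k = complex_of_real x" "1 / 2 \<le> x" by blast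
    ultimately have "sqrt x \<in> ?SV" by (simp add: singular_values_def flip: of_real_power)
    then show ?thesis by blast
  qed
  ultimately have "Min ?SV \<in> ?SV" "Max ?SV \<in> ?SV" by simp_all
  then have mm: "sqrt (1 / 2) \<le> Min ?SV" "Max ?SV \<le> sqrt (3 / 2)" using sv by blast+
  have pos: "0 < sqrt (1 / 2)" by simp
  have "Max ?SV \<le> 2 * Min ?SV"
  proof -
    have "sqrt (3 / 2) \<le> sqrt (4 * (1 / 2))" by (intro real_sqrt_le_mono) simp
    also have "\<dots> = 2 * sqrt (1 / 2)" by (subst real_sqrt_mult) simp
    finally show ?thesis using mm by linarith
  qed
  moreover have "0 < Min ?SV" using mm(1) pos by linarith
  ultimately have "Max ?SV / Min ?SV \<le> 2" by (simp add: pos_divide_le_eq)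
  moreover have "Min ?SV \<noteq> 0" using mm(1) pos by linarith
  ultimately show ?thesis unfolding A_def[symmetric] n_def[symmetric] cond_def by simp
qed

end

section \<open>The probabilistic error bound\<close>

text \<open>On [0,1], exp x \<le> 1 + x + x^2 \<le> 1 + 2 x, so the mean of exp (X / M) is at most
  exp (2 t / M), and Markov's inequality applies to the product over the samples. Allowing twice the
  mean leaves a deviation term M * l that is linear in the sup bound.\<close>

lemma chernoff_bounded_sum:
  fixes X :: "'a \<Rightarrow> real"
  assumes N: "prob_space N" and X: "X \<in> borel_measurable N" and M: "0 < M"
    and bd: "AE x in N. 0 \<le> X x \<and> X x \<le> M" and t: "(\<integral>x. X x \<partial>N) \<le> t"
  shows "measure (\<Pi>\<^sub>M i\<in>{..<m}. N) {y \<in> space (\<Pi>\<^sub>M i\<in>{..<m}. N). 2 * real m * t + M * l \<le> (\<Sum>i<m. X (y i))} \<le> exp (- l)"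
proof -
  interpret N: prob_space N by fact
  interpret pf: product_sigma_finite "\<lambda>_::nat. N" by standard
  let ?P = "\<Pi>\<^sub>M i\<in>{..<m}. N"
  interpret P: prob_space ?P by (intro prob_space_PiM N)
  have em: "(\<lambda>x. exp (X x / M)) \<in> borel_measurable N" using X by measurable
  have ei: "integrable N (\<lambda>x. exp (X x / M))"
  proof (rule N.integrable_const_bound[OF _ em])
    show "AE x in N. norm (exp (X x / M)) \<le> exp 1"
      using bd by (rule AE_mp) (use M in \<open>auto intro!: AE_I2\<close>)
  qed
  have Xi: "integrable N X"
  proof (rule N.integrable_const_bound[OF _ X])
    show "AE x in N. norm (X x) \<le> M" using bd by (rule AE_mp) (auto intro!: AE_I2)
  qed
  have "(\<integral>x. exp (X x / M) \<partial>N) \<le> (\<integral>x. 1 + 2 / M * X x \<partial>N)"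
  proof (rule integral_mono_AE[OF ei])
    show "integrable N (\<lambda>x. 1 + 2 / M * X x)" using Xi by simp
    show "AE x in N. exp (X x / M) \<le> 1 + 2 / M * X x"
      using bd
    proof (rule AE_mp, intro AE_I2 impI)
      fix x assume x: "0 \<le> X x \<and> X x \<le> M"
      then have q: "0 \<le> X x / M" "X x / M \<le> 1" using M by auto
      have "exp (X x / M) \<le> 1 + X x / M + (X x / M)\<^sup>2" by (rule exp_bound[OF q])
      also have "(X x / M)\<^sup>2 \<le> X x / M" using q mult_left_le[of "X x / M" "X x / M"] unfolding power2_eq_square by simp
      finally show "exp (X x / M) \<le> 1 + 2 / M * X x" by simp
    qed
  qed
  also have "\<dots> = 1 + 2 / M * (\<integral>x. X x \<partial>N)" using Xi by (simp add: N.prob_space)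
  also have "\<dots> \<le> 1 + 2 / M * t" using t M by (intro add_left_mono mult_left_mono) auto
  also have "\<dots> \<le> exp (2 / M * t)" by (rule exp_ge_add_one_self)
  finally have e1: "(\<integral>x. exp (X x / M) \<partial>N) \<le> exp (2 / M * t)" .
  have e0: "0 \<le> (\<integral>x. exp (X x / M) \<partial>N)" by (rule integral_nonneg_AE) simp
  have ex: "exp ((\<Sum>i<m. X (y i)) / M) = (\<Prod>i<m. exp (X (y i) / M))" for y :: "nat \<Rightarrow> 'a"
    by (simp add: exp_sum sum_divide_distrib)
  have Pi: "integrable ?P (\<lambda>y. \<Prod>i<m. exp (X (y i) / M))"
    by (rule pf.product_integrable_prod) (use ei in auto)
  have "(\<integral>y. (\<Prod>i<m. exp (X (y i) / M)) \<partial>?P) = (\<Prod>i<m. \<integral>x. exp (X x / M) \<partial>N)"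
    by (rule pf.product_integral_prod) (use ei in auto)
  also have "\<dots> \<le> exp (2 / M * t) ^ m" using e0 e1 by (simp add: power_mono)
  also have "\<dots> = exp (real m * (2 / M * t))" by (rule exp_of_nat_mult[symmetric])
  finally have I: "(\<integral>y. (\<Prod>i<m. exp (X (y i) / M)) \<partial>?P) \<le> exp (real m * (2 / M * t))" .
  let ?thr = "exp ((2 * real m * t + M * l) / M)"
  have "{y \<in> space ?P. 2 * real m * t + M * l \<le> (\<Sum>i<m. X (y i))} = {y \<in> space ?P. (\<Prod>i<m. exp (X (y i) / M)) \<ge> ?thr}"
    using M by (auto simp: ex[symmetric] divide_le_cancel)
  also have "measure ?P \<dots> \<le> (\<integral>y. (\<Prod>i<m. exp (X (y i) / M)) \<partial>?P) / ?thr"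
    by (rule integral_Markov_inequality_measure[OF Pi sets.empty_sets]) (auto intro!: AE_I2 prod_nonneg)
  also have "\<dots> \<le> exp (real m * (2 / M * t)) / ?thr" using I by (intro divide_right_mono) auto
  also have "\<dots> = exp (- l)"
    unfolding exp_diff[symmetric] using M by (simp add: field_simps)
  finally show ?thesis .
qed

context ortho_polys
begin

text \<open>For radii of at least \<kappa> the constant 2 / (1 - 1 / \<rho> i) is largest at
  \<kappa>. So each admissible choice gives a product above the coefficient, and the infimum
  inherits this.\<close>

lemma coef_le_coef_bd:
  assumes f: "f \<in> holo_class \<mu> b \<eta>" and \<nu>: "\<nu> \<in> multi_indices" and \<kappa>: "1 < \<kappa>" "admissible b \<eta> (\<lambda>_. \<kappa>)"
  shows "cmod (coef f \<nu>) \<le> coef_bd b \<eta> \<kappa> \<nu>"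
proof (rule coef_bd_greatest[OF \<kappa>])
  fix \<rho> assume adm: "admissible b \<eta> \<rho>" and \<rho>: "\<And>i. \<kappa> \<le> \<rho> i"
  have \<rho>1: "1 < \<rho> i" for i using \<rho>[of i] \<kappa>(1) by linarith
  have "cmod (coef f \<nu>) \<le> (\<Prod>i\<in>msupp \<nu>. real (1 + 2 * \<nu> i) * (2 / (1 - 1 / \<rho> i)) / \<rho> i ^ \<nu> i)"
    by (rule coef_bound[OF f \<nu> adm \<rho>1])
  also have "\<dots> \<le> (\<Prod>i\<in>msupp \<nu>. coef_factor \<kappa> (\<nu> i) (\<rho> i))"
  proof (intro prod_mono conjI)
    fix i
    have "2 / (1 - 1 / \<rho> i) \<le> 2 / (1 - 1 / \<kappa>)"
      using \<rho>[of i] \<rho>1[of i] \<kappa>(1) by (intro divide_left_mono mult_pos_pos diff_left_mono) auto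
    then have "real (1 + 2 * \<nu> i) * (2 / (1 - 1 / \<rho> i)) \<le> (2 / (1 - 1 / \<kappa>)) * real (1 + 2 * \<nu> i)"
      by (subst mult.commute) (intro mult_right_mono, auto)
    then show "real (1 + 2 * \<nu> i) * (2 / (1 - 1 / \<rho> i)) / \<rho> i ^ \<nu> i \<le> coef_factor \<kappa> (\<nu> i) (\<rho> i)"
      unfolding coef_factor_def using \<rho>1[of i] by (intro divide_right_mono) auto
    show "0 \<le> real (1 + 2 * \<nu> i) * (2 / (1 - 1 / \<rho> i)) / \<rho> i ^ \<nu> i" using \<rho>1[of i] by simp
  qed
  finally show "cmod (coef f \<nu>) \<le> (\<Prod>i\<in>msupp \<nu>. coef_factor \<kappa> (\<nu> i) (\<rho> i))" .
qed

text \<open>\<open>Psi\<close> at the zero index is the empty product 1, so the quadratic form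
  equals m times the squared norm for every sample.\<close>

lemma stable_constant: "stable {\<lambda>_. 0} m y"
  by (simp add: stable_def ip_def Psi_def power2_eq_square)

text \<open>The dimension factor of \<open>concentration\<close> is replaced by \<kappa>, as the
  cardinality of S is at most the sum of the squared sup norms.\<close>

lemma stable_event:
  assumes S: "finite S" "S \<subseteq> multi_indices" and \<kappa>: "(\<Sum>\<nu>\<in>S. (sup_Psi \<nu>)\<^sup>2) \<le> \<kappa>" "0 < \<kappa>"
  shows "\<exists>E\<in>sets (\<Pi>\<^sub>M i\<in>{..<m}. ten). measure (\<Pi>\<^sub>M i\<in>{..<m}. ten) (space (\<Pi>\<^sub>M i\<in>{..<m}. ten) - E) \<le> 4 * \<kappa> * exp (- (real m / (16 * \<kappa>)))
     \<and> (\<forall>y\<in>E. stable S m y)"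
proof -
  interpret iso: isotropic ten S "\<lambda>y \<nu>. Psi \<psi> \<nu> y" \<kappa>
  proof
    show "finite S" "0 < \<kappa>" by fact+
    show "(\<lambda>y. Psi \<psi> \<nu> y) \<in> borel_measurable ten" if "\<nu> \<in> S" for \<nu> using Psi_measurable[of \<nu>] S that by auto
    show "ip S (\<lambda>\<nu>. Psi \<psi> \<nu> y) (\<lambda>\<nu>. Psi \<psi> \<nu> y) \<le> \<kappa>" if "y \<in> space ten" for y
    proof -
      have "ip S (\<lambda>\<nu>. Psi \<psi> \<nu> y) (\<lambda>\<nu>. Psi \<psi> \<nu> y) \<le> (\<Sum>\<nu>\<in>S. (sup_Psi \<nu>)\<^sup>2)"
        unfolding ip_def power2_eq_square[symmetric]
      proof (intro sum_mono abs_le_square_iff[THEN iffD1])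
        fix \<nu> assume "\<nu> \<in> S"
        then have "\<nu> \<in> multi_indices" using S(2) by blast
        moreover have "y \<in> cube" using that by (simp add: space_ten)
        ultimately show "\<bar>Psi \<psi> \<nu> y\<bar> \<le> \<bar>sup_Psi \<nu>\<bar>" by (intro order.trans[OF Psi_bound abs_ge_self])
      qed
      then show ?thesis using \<kappa> by simp
    qed
    show "(\<integral>y. Psi \<psi> \<nu> y * Psi \<psi> \<nu>' y \<partial>ten) = of_bool (\<nu> = \<nu>')" if "\<nu> \<in> S" "\<nu>' \<in> S" for \<nu> \<nu>'
      using Psi_ortho that S by blast
  qed
  obtain E where E: "E \<in> sets (\<Pi>\<^sub>M i\<in>{..<m}. ten)"
     "measure (\<Pi>\<^sub>M i\<in>{..<m}. ten) (space (\<Pi>\<^sub>M i\<in>{..<m}. ten) - E) \<le> 4 * real (card S) * exp (- (real m / (16 * \<kappa>)))"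
     "\<forall>y\<in>E. stable S m y"
    using iso.concentration[of m] unfolding stable_def[symmetric] by (elim bexE conjE) (rule that)
  have "(\<Sum>\<nu>\<in>S. 1) \<le> (\<Sum>\<nu>\<in>S. (sup_Psi \<nu>)\<^sup>2)" by (intro sum_mono one_le_power sup_Psi_ge_1)
  then have "real (card S) \<le> \<kappa>" using \<kappa> by simp
  then have "4 * real (card S) * exp (- (real m / (16 * \<kappa>))) \<le> 4 * \<kappa> * exp (- (real m / (16 * \<kappa>)))" by (intro mult_right_mono) auto
  then show ?thesis using E(2) by (intro bexI[OF _ E(1)] conjI E(3)) linarith
qed

text \<open>Two events of failure probability at most \<epsilon> / 2 are intersected: stability of
  the samples, and a bound on the discrete norm of the remainder of f. Adjoining the zero index
  keeps S nonempty; its weight 1 is compensated by the -1 in k.\<close>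

lemma least_squares_with_probability:
  fixes \<epsilon> p D :: real and m n :: nat
  assumes \<eta>: "0 < \<eta>" and \<kappa>: "1 < \<kappa>" "admissible b \<eta> (\<lambda>_. \<kappa>)" and f: "f \<in> holo_class \<mu> b \<eta>"
    and p: "0 < p" "p < 1" and \<epsilon>: "0 < \<epsilon>" "\<epsilon> < 1" and m: "3 \<le> m"
    and n: "n = nat \<lceil>real m / ln (real m / \<epsilon>)\<rceil>"
    and k: "k = max 0 (real n / 96 - 1)"
    and T: "T \<subseteq> multi_indices" "finite T" "(\<Sum>\<nu>\<in>T. (sup_Psi \<nu>)\<^sup>2) \<le> k"
    and D: "0 < D" and tail: "\<And>Z. Z \<subseteq> multi_indices - T \<Longrightarrow> finite Z \<Longrightarrow>
      (\<Sum>\<nu>\<in>Z. (coef_bd b \<eta> \<kappa> \<nu>)\<^sup>2) \<le> D\<^sup>2 * (max 1 k) powr (1 - 2 / p) \<and>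
      (\<Sum>\<nu>\<in>Z. sup_Psi \<nu> * coef_bd b \<eta> \<kappa> \<nu>) \<le> D * (max 1 k) powr (1 - 1 / p)"
  defines "S \<equiv> insert (\<lambda>_. 0) T"
  shows "S \<subseteq> multi_indices \<and> finite S \<and> card S \<le> n \<and>
    (\<exists>E\<in>sets (\<Pi>\<^sub>M i\<in>{..<m}. ten). 1 - \<epsilon> \<le> measure (\<Pi>\<^sub>M i\<in>{..<m}. ten) E \<and>
      (\<forall>y\<in>E. stable S m y \<and> (\<forall>e. (\<exists>!q. is_least_squares \<psi> S m y f e q) \<and>
        (\<forall>q. is_least_squares \<psi> S m y f e q \<longrightarrow> L2_norm ten (\<lambda>x. f x - q x)
           \<le> 6 * D * 192 powr (1 / p) * (real m / ln (real m / \<epsilon>)) powr (1 / 2 - 1 / p) + 2 * (MAX i\<in>{..<m}. cmod (e i))))))"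
proof -
  let ?P = "\<Pi>\<^sub>M i\<in>{..<m}. ten"
  interpret P: prob_space ?P by (intro prob_space_PiM prob_ten)
  define L where "L = ln (real m / \<epsilon>)"
  define R where "R = real m / L"
  have m3: "3 \<le> real m" using m by simp
  have me: "3 < real m / \<epsilon>" using m3 \<epsilon> by (simp add: pos_less_divide_eq)
  then have "exp 1 < real m / \<epsilon>" using exp_le by linarith
  then have "ln (exp 1) < L" unfolding L_def using me by (subst ln_less_cancel_iff) auto
  then have L1: "1 < L" by simp
  have R0: "0 < R" using L1 m3 by (simp add: R_def)
  have Rm: "R \<le> real m" using L1 m3 by (simp add: R_def divide_le_eq mult_left_le_one_le)
  have n_R: "R \<le> real n" "real n < R + 1" "1 \<le> n"
    using R0 ceiling_correct[of R] unfolding n R_def[unfolded L_def, symmetric] by (simp_all add: Suc_le_eq)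
  have S: "S \<subseteq> multi_indices" "finite S" using T by (auto simp: S_def multi_indices_def)
  define u2 where "u2 = (\<Sum>\<nu>\<in>S. (sup_Psi \<nu>)\<^sup>2)"
  have u2: "u2 \<le> 1 + k"
  proof -
    have "u2 \<le> (sup_Psi (\<lambda>_. 0))\<^sup>2 + (\<Sum>\<nu>\<in>T. (sup_Psi \<nu>)\<^sup>2)"
      unfolding u2_def S_def using T(2) by (cases "(\<lambda>_. 0) \<in> T") (auto simp: insert_absorb)
    then show ?thesis using T(3) by (simp add: sup_Psi_def msupp_def)
  qed
  have "(\<Sum>\<nu>\<in>S. 1) \<le> u2" unfolding u2_def by (intro sum_mono one_le_power sup_Psi_ge_1)
  then have cardS: "real (card S) \<le> u2" by simp
  have card: "card S \<le> n"
  proof -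
    have "real (card S) \<le> real n" using cardS u2 n_R by (auto simp: k max_def split: if_splits)
    then show ?thesis by simp
  qed
  \<comment> \<open>For n \<le> 96 the budget k is 0, so S is the zero index alone and stable for
    every sample. Otherwise 1 + k = n / 96 \<le> R / 48, because n < R + 1.\<close>
  obtain E1 where E1: "E1 \<in> sets ?P" "measure ?P (space ?P - E1) \<le> \<epsilon> / 2" "\<And>y. y \<in> E1 \<Longrightarrow> stable S m y"
  proof (cases "real n / 96 \<le> 1")
    case True
    then have "(\<Sum>\<nu>\<in>T. (sup_Psi \<nu>)\<^sup>2) \<le> 0" using T(3) by (simp add: k)
    moreover have "(\<Sum>\<nu>\<in>T. 1) \<le> (\<Sum>\<nu>\<in>T. (sup_Psi \<nu>)\<^sup>2)" by (intro sum_mono one_le_power sup_Psi_ge_1)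
    ultimately have "real (card T) \<le> 0" by simp
    then have "T = {}" using T(2) by simp
    then show thesis using that[of "space ?P"] stable_constant \<epsilon> by (simp add: S_def)
  next
    case False
    define \<kappa>' where "\<kappa>' = R / 48"
    have "u2 \<le> \<kappa>'" using u2 False n_R by (simp add: k \<kappa>'_def)
    then obtain E where E: "E \<in> sets ?P" "measure ?P (space ?P - E) \<le> 4 * \<kappa>' * exp (- (real m / (16 * \<kappa>')))" "\<forall>y\<in>E. stable S m y"
      using stable_event[OF S(2,1), of \<kappa>' m] R0 unfolding u2_def \<kappa>'_def by auto
    have "real m / (16 * \<kappa>') = 3 * L" using m3 L1 by (simp add: \<kappa>'_def R_def)
    moreover have "exp (- (3 * L)) = (\<epsilon> / real m) ^ 3"
    proof -
      have "exp L = real m / \<epsilon>" unfolding L_def using me by simp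
      then have "exp (- L) = \<epsilon> / real m" by (simp add: exp_minus)
      moreover have "exp (- (3 * L)) = exp (- L) ^ 3" using exp_of_nat_mult[of 3 "- L"] by simp
      ultimately show ?thesis by simp
    qed
    moreover have "4 * \<kappa>' * (\<epsilon> / real m) ^ 3 \<le> \<epsilon> / 2"
    proof -
      have "\<kappa>' \<le> real m / 48" using Rm by (simp add: \<kappa>'_def)
      then have "4 * \<kappa>' * (\<epsilon> / real m) ^ 3 \<le> (real m / 12) * (\<epsilon> / real m) ^ 3"
        using \<epsilon> m3 by (intro mult_right_mono) auto
      also have "\<dots> = (\<epsilon> / 12) * (\<epsilon> / real m)\<^sup>2" using m3 by (simp add: power2_eq_square power3_eq_cube)
      also have "\<dots> \<le> (\<epsilon> / 12) * 1"
        using \<epsilon> m3 by (intro mult_left_mono power_le_one) auto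
      finally show ?thesis using \<epsilon> by simp
    qed
    ultimately show thesis using that[OF E(1) _ bspec[OF E(3)]] E(2) by simp
  qed
  define D' where "D' = D * 192 powr (1 / p)"
  have D': "0 < D'" using D by (simp add: D'_def)
  \<comment> \<open>For n \<le> 192 the left side is at most 1; otherwise k = n / 96 - 1 \<ge> n /
    192. Passing from k to R in this way is the origin of the factor 192 powr (1 / p).\<close>
  have K: "R / 192 \<le> max 1 k" using n_R by (auto simp: k max_def field_simps split: if_splits)
  have Kp: "(max 1 k) powr c \<le> 192 powr (- c) * R powr c" if "c \<le> 0" for c
  proof -
    have "(max 1 k) powr c \<le> (R / 192) powr c" using that R0 K by (intro powr_mono2') auto
    also have "\<dots> = 192 powr (- c) * R powr c" using R0 by (simp add: powr_divide powr_minus_divide)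
    finally show ?thesis .
  qed
  have pc: "1 - 2 / p \<le> 0" "1 - 1 / p \<le> 0" using p by (simp_all add: field_simps)
  have t2: "D\<^sup>2 * (max 1 k) powr (1 - 2 / p) \<le> D'\<^sup>2 * R powr (1 - 2 / p)"
  proof -
    have "D\<^sup>2 * (max 1 k) powr (1 - 2 / p) \<le> D\<^sup>2 * (192 powr (2 / p - 1) * R powr (1 - 2 / p))"
      using Kp[OF pc(1)] by (intro mult_left_mono) auto
    also have "\<dots> \<le> D\<^sup>2 * (192 powr (2 / p) * R powr (1 - 2 / p))"
      by (intro mult_left_mono mult_right_mono powr_mono) auto
    also have "192 powr (2 / p) = (192 powr (1 / p))\<^sup>2" by (simp add: powr_power)
    finally show ?thesis by (simp add: D'_def power_mult_distrib mult_ac)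
  qed
  have t1: "D * (max 1 k) powr (1 - 1 / p) \<le> D' * R powr (1 - 1 / p)"
  proof -
    have "D * (max 1 k) powr (1 - 1 / p) \<le> D * (192 powr (1 / p - 1) * R powr (1 - 1 / p))"
      using Kp[OF pc(2)] D by (intro mult_left_mono) auto
    also have "\<dots> \<le> D * (192 powr (1 / p) * R powr (1 - 1 / p))"
      using D by (intro mult_left_mono mult_right_mono powr_mono) auto
    finally show ?thesis by (simp add: D'_def mult_ac)
  qed
  have fm: "f \<in> borel_measurable ten" using f by (simp add: holo_class_def)
  have fb: "cmod (f y) \<le> 1" if "y \<in> cube" for y by (rule holo_class_bounded[OF f \<eta> that])
  let ?r = "\<lambda>y. f y - psum S (coef f) y"
  have tail': "(\<Sum>\<nu>\<in>Z. (coef_bd b \<eta> \<kappa> \<nu>)\<^sup>2) \<le> D'\<^sup>2 * R powr (1 - 2 / p) \<and>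
      (\<Sum>\<nu>\<in>Z. sup_Psi \<nu> * coef_bd b \<eta> \<kappa> \<nu>) \<le> D' * R powr (1 - 1 / p)" if "Z \<subseteq> multi_indices - S" "finite Z" for Z
  proof -
    have "Z \<subseteq> multi_indices - T" using that(1) by (auto simp: S_def)
    from tail[OF this that(2)] show ?thesis using t1 t2 by auto
  qed
  note et = expansion_tail[OF fm fb coef_le_coef_bd[OF f _ \<kappa>] S(2,1) tail']
  have r1: "AE y in ten. cmod (?r y) \<le> D' * R powr (1 - 1 / p)" by (rule et(1))
  have r2: "(\<integral>y. (cmod (?r y))\<^sup>2 \<partial>ten) \<le> D'\<^sup>2 * R powr (1 - 2 / p)" by (rule et(2))
  define M where "M = (D' * R powr (1 - 1 / p))\<^sup>2"
  have M0: "0 < M" using D' R0 by (simp add: M_def)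
  have rm: "?r \<in> borel_measurable ten" using fm psum_measurable[OF S(1)] by (intro borel_measurable_diff) auto
  have Xm: "(\<lambda>y. (cmod (?r y))\<^sup>2) \<in> borel_measurable ten" using rm by measurable
  define thr where "thr = 2 * real m * (D'\<^sup>2 * R powr (1 - 2 / p)) + M * ln (2 / \<epsilon>)"
  have ch: "measure ?P {y \<in> space ?P. thr \<le> (\<Sum>i<m. (cmod (?r (y i)))\<^sup>2)} \<le> exp (- ln (2 / \<epsilon>))"
    unfolding thr_def
  proof (rule chernoff_bounded_sum[OF prob_ten Xm M0 _ r2])
    show "AE y in ten. 0 \<le> (cmod (?r y))\<^sup>2 \<and> (cmod (?r y))\<^sup>2 \<le> M"
      using r1 unfolding M_def by (rule AE_mp) (auto intro!: AE_I2 power_mono)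
  qed
  have "exp (- ln (2 / \<epsilon>)) = \<epsilon> / 2" using \<epsilon> by (simp add: exp_minus)
  note ch = ch[unfolded this]
  have Sm: "(\<lambda>y. \<Sum>i<m. (cmod (?r (y i)))\<^sup>2) \<in> borel_measurable ?P"
    by (intro borel_measurable_sum measurable_compose[where f = "\<lambda>y. y _" and g = "\<lambda>x. (cmod (?r x))\<^sup>2", OF _ Xm] measurable_component_singleton) auto
  define E2 where "E2 = {y \<in> space ?P. (\<Sum>i<m. (cmod (?r (y i)))\<^sup>2) < thr}"
  have E2: "E2 \<in> sets ?P" unfolding E2_def using Sm by measurable
  have cE2: "space ?P - E2 = {y \<in> space ?P. thr \<le> (\<Sum>i<m. (cmod (?r (y i)))\<^sup>2)}" by (auto simp: E2_def)
  \<comment> \<open>The 3 is 2 from twice the mean plus 1 from the deviation term.\<close>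
  define \<sigma> where "\<sigma> = 3 * (D'\<^sup>2 * R powr (1 - 2 / p))"
  have thr: "thr \<le> real m * \<sigma>"
  proof -
    have "ln (2 / \<epsilon>) \<le> L" unfolding L_def using \<epsilon> m3 by (subst ln_le_cancel_iff) (auto simp: divide_right_mono)
    then have "M * ln (2 / \<epsilon>) \<le> M * L" using M0 by (intro mult_left_mono) auto
    \<comment> \<open>M is R times the mean-square bound and R * L = m, so the deviation term equals
      m times that bound.\<close>
    also have "M * L = real m * (D'\<^sup>2 * R powr (1 - 2 / p))"
    proof -
      have "M = D'\<^sup>2 * R powr (2 * (1 - 1 / p))" using R0 by (simp add: M_def power_mult_distrib powr_power)
      also have "R powr (2 * (1 - 1 / p)) = R powr (1 - 2 / p) * R"
      proof -
        have "2 * (1 - 1 / p) = (1 - 2 / p) + 1" by simp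
        then show ?thesis using R0 by (simp only: powr_add) simp
      qed
      finally have "M * L = D'\<^sup>2 * R powr (1 - 2 / p) * (R * L)" by simp
      moreover have "R * L = real m" using L1 by (simp add: R_def)
      ultimately show ?thesis by simp
    qed
    finally show ?thesis by (simp add: thr_def \<sigma>_def)
  qed
  have sq: "sqrt (D'\<^sup>2 * R powr (1 - 2 / p)) = D' * R powr (1 / 2 - 1 / p)"
  proof -
    have "sqrt (R powr (1 - 2 / p)) = R powr ((1 - 2 / p) * (1 / 2))"
      using R0 by (simp add: powr_half_sqrt[symmetric] powr_powr)
    also have "(1 - 2 / p) * (1 / 2) = 1 / 2 - 1 / p" by (simp add: field_simps)
    finally show ?thesis using D' by (simp add: real_sqrt_mult)
  qed
  have s3: "sqrt 3 \<le> 2" "sqrt 2 \<le> 2" by (auto intro: real_le_lsqrt)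
  have err: "sqrt 2 * sqrt (D'\<^sup>2 * R powr (1 - 2 / p)) + 2 * sqrt \<sigma> \<le> 6 * D * 192 powr (1 / p) * R powr (1 / 2 - 1 / p)"
  proof -
    let ?x = "D' * R powr (1 / 2 - 1 / p)"
    have x0: "0 \<le> ?x" using D' by simp
    have "sqrt \<sigma> = sqrt 3 * ?x" unfolding \<sigma>_def real_sqrt_mult[of 3] sq ..
    then have "sqrt 2 * sqrt (D'\<^sup>2 * R powr (1 - 2 / p)) + 2 * sqrt \<sigma> = sqrt 2 * ?x + 2 * (sqrt 3 * ?x)" unfolding sq by simp
    also have "\<dots> \<le> 2 * ?x + 2 * (2 * ?x)" using s3 x0 by (intro add_mono mult_left_mono mult_right_mono) auto
    also have "\<dots> = 6 * D * 192 powr (1 / p) * R powr (1 / 2 - 1 / p)" by (simp add: D'_def)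
    finally show ?thesis .
  qed
  have "measure ?P (space ?P - (E1 \<inter> E2)) \<le> measure ?P (space ?P - E1) + measure ?P (space ?P - E2)"
  proof -
    have "space ?P - (E1 \<inter> E2) = (space ?P - E1) \<union> (space ?P - E2)" by auto
    then show ?thesis using E1(1) E2 measure_Un_le[of "space ?P - E1" ?P "space ?P - E2"] by auto
  qed
  also have "\<dots> \<le> \<epsilon> / 2 + \<epsilon> / 2" using E1(2) ch unfolding cE2 by (intro add_mono)
  finally have pr: "1 - \<epsilon> \<le> measure ?P (E1 \<inter> E2)"
    using P.prob_compl[of "E1 \<inter> E2"] E1(1) E2 by auto
  have good: "stable S m y \<and> (\<forall>e. (\<exists>!q. is_least_squares \<psi> S m y f e q) \<and>
        (\<forall>q. is_least_squares \<psi> S m y f e q \<longrightarrow> L2_norm ten (\<lambda>x. f x - q x)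
           \<le> 6 * D * 192 powr (1 / p) * R powr (1 / 2 - 1 / p) + 2 * (MAX i\<in>{..<m}. cmod (e i))))"
    if y: "y \<in> E1 \<inter> E2" for y
  proof -
    have st: "stable S m y" using E1(3) y by blast
    have disc: "(\<Sum>i<m. (cmod (?r (y i)))\<^sup>2) \<le> real m * \<sigma>" using y thr by (auto simp: E2_def)
    have m0: "0 < m" using m by simp
    have "0 \<le> D'\<^sup>2 * R powr (1 - 2 / p)" "0 \<le> \<sigma>" by (simp_all add: \<sigma>_def)
    note ls = least_squares_error[OF S(2,1) m0 st fm fb r2 this(1) disc this(2)]
    show ?thesis
    proof (intro conjI allI impI st)
      fix e :: "nat \<Rightarrow> complex"
      show "\<exists>!q. is_least_squares \<psi> S m y f e q" using ls[of e] by simp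
      fix q assume "is_least_squares \<psi> S m y f e q"
      then have "L2_norm ten (\<lambda>x. f x - q x) \<le> sqrt 2 * sqrt (D'\<^sup>2 * R powr (1 - 2 / p)) + 2 * sqrt \<sigma> + 2 * (MAX i\<in>{..<m}. cmod (e i))"
        using ls[of e] by simp
      then show "L2_norm ten (\<lambda>x. f x - q x) \<le> 6 * D * 192 powr (1 / p) * R powr (1 / 2 - 1 / p) + 2 * (MAX i\<in>{..<m}. cmod (e i))"
        using err by linarith
    qed
  qed
  have "E1 \<inter> E2 \<in> sets ?P" using E1(1) E2 by (rule sets.Int)
  then show ?thesis unfolding R_def[unfolded L_def, symmetric]
    by (intro conjI S card bexI[of _ "E1 \<inter> E2"] pr ballI good)
qed

end

text \<open>Summability of the p-th powers forces b i \<le> 1 eventually, and then b i \<le> b i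
  powr p.\<close>

lemma summable_of_summable_powr:
  fixes b :: "nat \<Rightarrow> real"
  assumes b: "\<And>i. 0 \<le> b i" and p: "0 < p" "p < 1" and s: "summable (\<lambda>i. b i powr p)"
  shows "summable b"
proof (rule summable_comparison_test_ev[OF _ s])
  have "(\<lambda>i. b i powr p) \<longlonglongrightarrow> 0" by (rule summable_LIMSEQ_zero[OF s])
  then have "\<forall>\<^sub>F i in sequentially. b i powr p < 1" by (rule order_tendstoD) simp
  then show "\<forall>\<^sub>F i in sequentially. norm (b i) \<le> b i powr p"
  proof eventually_elim
    case (elim i)
    have "b i \<le> 1"
    proof (rule ccontr)
      assume "\<not> b i \<le> 1"
      then have "1 \<le> b i powr p" using p by (intro ge_one_powr_ge_zero) auto
      then show False using elim by simp
    qed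
    then have "b i powr 1 \<le> b i powr p" using b[of i] p by (intro powr_mono') auto
    then show ?case using b[of i] by simp
  qed
qed

text \<open>Indexing the sets by n alone expresses that m and \<epsilon> enter only through the
  allowed cardinality; the sets precede p, the measure and the basis. The event follows f but
  precedes the noise, so that one event serves all e.\<close>

theorem theorem6p1:
  fixes b :: "nat \<Rightarrow> real" and \<eta> :: real
  assumes "\<And>i. 0 \<le> b i" and "0 < \<eta>"
  shows "\<exists>(S :: nat \<Rightarrow> (nat \<Rightarrow> nat) set) (C :: real \<Rightarrow> real).
    \<forall>(p :: real) (\<epsilon> :: real) (m :: nat) (\<mu> :: real measure) (\<psi> :: nat \<Rightarrow> real poly) (n :: nat).
      0 < p \<longrightarrow> p < 1 \<longrightarrow> summable (\<lambda>i. b i powr p) \<longrightarrow>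
      0 < \<epsilon> \<longrightarrow> \<epsilon> < 1 \<longrightarrow> 3 \<le> m \<longrightarrow>
      \<mu> \<in> {uniform1, chebyshev1} \<longrightarrow> orthonormal_polys \<mu> \<psi> \<longrightarrow>
      n = nat \<lceil>real m / ln (real m / \<epsilon>)\<rceil> \<longrightarrow>
        S n \<subseteq> multi_indices \<and> finite (S n) \<and> card (S n) \<le> n \<and>
        (\<forall>f\<in>holo_class \<mu> b \<eta>.
          \<exists>E\<in>sets (\<Pi>\<^sub>M i\<in>{..<m}. tensor_measure \<mu>).
            1 - \<epsilon> \<le> measure (\<Pi>\<^sub>M i\<in>{..<m}. tensor_measure \<mu>) E \<and>
            (\<forall>y\<in>E.
              (\<forall>e :: nat \<Rightarrow> complex.
                (\<exists>!q. is_least_squares \<psi> (S n) m y f e q) \<and>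
                (\<forall>q. is_least_squares \<psi> (S n) m y f e q \<longrightarrow>
                  L2_norm (tensor_measure \<mu>) (\<lambda>x. f x - q x)
                    \<le> C p * (real m / ln (real m / \<epsilon>)) powr (1 / 2 - 1 / p)
                      + 2 * (MAX i\<in>{..<m}. cmod (e i)))) \<and>
              (\<forall>\<nu>. bij_betw \<nu> {..<card (S n)} (S n) \<longrightarrow>
                cond (ls_matrix \<psi> m (card (S n)) \<nu> y) \<le> 2)))"
proof (cases "\<exists>p. 0 < p \<and> p < 1 \<and> summable (\<lambda>i. b i powr p)")
  \<comment> \<open>Without an exponent p the premises are never met, and any S and C will
    do.\<close>
  case False
  then show ?thesis by blast
next
  case True
  \<comment> \<open>\<open>p0\<close> shows that b is summable and that some threshold exists; the
    selection of the index sets refers to all pairs (p, \<Sigma>) at once.\<close>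
  then obtain p0 where p0: "0 < p0" "p0 < 1" "summable (\<lambda>i. b i powr p0)" by blast
  note b = assms(1) and \<eta> = assms(2)
  have sb: "summable b" by (rule summable_of_summable_powr[OF b p0])
  obtain \<kappa> where \<kappa>: "1 < \<kappa>" "((\<kappa> + inverse \<kappa>) / 2 - 1) * (\<Sum>i. b i) \<le> \<eta> / 2"
    using exists_uniform_radius[OF b sb \<eta>] by blast
  have adm: "admissible b \<eta> (\<lambda>_. \<kappa>)"
    using admissible_shift[OF b sb \<kappa>, of "{}" "\<lambda>_. 0"] \<eta> by simp
  define P where "P = (\<lambda>p \<Sigma>. 0 < p \<and> p < 1 \<and> 0 < \<Sigma> \<and>
    (\<forall>Z\<subseteq>multi_indices. finite Z \<longrightarrow> (\<Sum>\<nu>\<in>Z. (sup_Psi \<nu>)\<^sup>2 * coef_bd b \<eta> \<kappa> \<nu> powr p) \<le> \<Sigma>))"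
  have exP: "\<exists>\<Sigma>. P p \<Sigma>" if "0 < p" "p < 1" "summable (\<lambda>i. b i powr p)" for p
    using weighted_coef_summable[OF b sb \<eta> \<kappa> that] that by (auto simp: P_def)
  define Sg where "Sg = (\<lambda>p. SOME \<Sigma>. P p \<Sigma>)"
  have Sg: "P p (Sg p)" if "0 < p" "p < 1" "summable (\<lambda>i. b i powr p)" for p
    unfolding Sg_def by (rule someI_ex[OF exP[OF that]])
  define Tail where "Tail = (\<lambda>k T. T \<subseteq> multi_indices \<and> finite T \<and> (\<Sum>\<nu>\<in>T. (sup_Psi \<nu>)\<^sup>2) \<le> k \<and>
    (\<forall>p \<Sigma>. P p \<Sigma> \<longrightarrow> (\<forall>Z\<subseteq>multi_indices - T. finite Z \<longrightarrow>
       (\<Sum>\<nu>\<in>Z. (coef_bd b \<eta> \<kappa> \<nu>)\<^sup>2) \<le> (\<Sigma> powr (1 / p))\<^sup>2 * (max 1 k) powr (1 - 2 / p) \<and>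
       (\<Sum>\<nu>\<in>Z. sup_Psi \<nu> * coef_bd b \<eta> \<kappa> \<nu>) \<le> \<Sigma> powr (1 / p) * (max 1 k) powr (1 - 1 / p))))"
  have exT: "\<exists>T. Tail k T" if k: "0 \<le> k" for k
  proof -
    have "\<exists>T\<subseteq>multi_indices. finite T \<and> (\<Sum>\<nu>\<in>T. (sup_Psi \<nu>)\<^sup>2) \<le> k \<and>
      (\<forall>p \<Sigma>. P p \<Sigma> \<longrightarrow> (\<forall>Z\<subseteq>multi_indices - T. finite Z \<longrightarrow>
         (\<Sum>\<nu>\<in>Z. (coef_bd b \<eta> \<kappa> \<nu>)\<^sup>2) \<le> (\<Sigma> powr (1 / p))\<^sup>2 * (max 1 k) powr (1 - 2 / p) \<and>
         (\<Sum>\<nu>\<in>Z. sup_Psi \<nu> * coef_bd b \<eta> \<kappa> \<nu>) \<le> \<Sigma> powr (1 / p) * (max 1 k) powr (1 - 1 / p)))"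
      by (rule threshold_set[where B = "coef_bd b \<eta> \<kappa>" and u = sup_Psi and P = P and ?p0.0 = p0 and ?\<Sigma>0.0 = "Sg p0", OF coef_bd_nonneg[OF \<kappa>(1) adm] sup_Psi_ge_1 k]) (simp_all add: P_def Sg[OF p0, unfolded P_def])
    then show ?thesis unfolding Tail_def .
  qed
  \<comment> \<open>The factor 96 keeps the sum of squared sup norms below \<open>R / 48\<close> for \<open>R = m / ln (m / \<epsilon>)\<close>, so that
    the failure probability of the matrix Chernoff bound is of order \<open>(\<epsilon> / m) ^ 3\<close>.\<close>
  define kk where "kk = (\<lambda>n::nat. max 0 (real n / 96 - 1))"
  define T where "T = (\<lambda>n. SOME T. Tail (kk n) T)"
  have T: "Tail (kk n) (T n)" for n
    unfolding T_def by (rule someI_ex[OF exT]) (simp add: kk_def)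
  define S where "S = (\<lambda>n. insert (\<lambda>_. 0) (T n))"
  define C where "C = (\<lambda>p. 6 * Sg p powr (1 / p) * 192 powr (1 / p))"
  show ?thesis
  proof (intro exI[of _ S] exI[of _ C] allI impI)
    fix p \<epsilon> :: real and m n :: nat and \<mu> :: "real measure" and \<psi> :: "nat \<Rightarrow> real poly"
    assume p: "0 < p" "p < 1" "summable (\<lambda>i. b i powr p)" and \<epsilon>: "0 < \<epsilon>" "\<epsilon> < 1" and m: "3 \<le> m"
      and \<mu>: "\<mu> \<in> {uniform1, chebyshev1}" and \<psi>: "orthonormal_polys \<mu> \<psi>" and n: "n = nat \<lceil>real m / ln (real m / \<epsilon>)\<rceil>"
    interpret ortho_polys \<mu> \<psi> by standard fact+
    have D: "0 < Sg p powr (1 / p)" using Sg[OF p] by (simp add: P_def)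
    have Tn: "T n \<subseteq> multi_indices" "finite (T n)" "(\<Sum>\<nu>\<in>T n. (sup_Psi \<nu>)\<^sup>2) \<le> kk n"
      using T[of n] by (auto simp: Tail_def)
    have tail: "(\<Sum>\<nu>\<in>Z. (coef_bd b \<eta> \<kappa> \<nu>)\<^sup>2) \<le> (Sg p powr (1 / p))\<^sup>2 * (max 1 (kk n)) powr (1 - 2 / p) \<and>
       (\<Sum>\<nu>\<in>Z. sup_Psi \<nu> * coef_bd b \<eta> \<kappa> \<nu>) \<le> Sg p powr (1 / p) * (max 1 (kk n)) powr (1 - 1 / p)"
      if "Z \<subseteq> multi_indices - T n" "finite Z" for Z
      using T[of n] Sg[OF p] that unfolding Tail_def by blast
    have main: "S n \<subseteq> multi_indices \<and> finite (S n) \<and> card (S n) \<le> n \<and>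
      (\<exists>E\<in>sets (\<Pi>\<^sub>M i\<in>{..<m}. ten). 1 - \<epsilon> \<le> measure (\<Pi>\<^sub>M i\<in>{..<m}. ten) E \<and>
        (\<forall>y\<in>E. stable (S n) m y \<and> (\<forall>e. (\<exists>!q. is_least_squares \<psi> (S n) m y f e q) \<and>
          (\<forall>q. is_least_squares \<psi> (S n) m y f e q \<longrightarrow> L2_norm ten (\<lambda>x. f x - q x)
             \<le> C p * (real m / ln (real m / \<epsilon>)) powr (1 / 2 - 1 / p) + 2 * (MAX i\<in>{..<m}. cmod (e i))))))"
      if f: "f \<in> holo_class \<mu> b \<eta>" for f
      unfolding S_def C_def
      by (rule least_squares_with_probability[OF \<eta> \<kappa>(1) adm f p(1,2) \<epsilon> m n _ Tn D tail]) (simp_all add: kk_def)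
    \<comment> \<open>\<open>main\<close> proves the claims about \<open>S n\<close> alone together
      with those for a given f; the constant 1 witnesses that the class is nonempty.\<close>
    have one: "(\<lambda>_. 1) \<in> holo_class \<mu> b \<eta>"
    proof -
      have "integrable ten (\<lambda>y. (cmod 1)\<^sup>2)" by simp
      then show ?thesis unfolding holo_class_def
        by (auto intro!: exI[of _ "\<lambda>_. 1"] simp: separately_holomorphic_on_def)
    qed
    note S = main[OF one, THEN conjunct1] main[OF one, THEN conjunct2, THEN conjunct1]
      main[OF one, THEN conjunct2, THEN conjunct2, THEN conjunct1]
    have ne: "S n \<noteq> {}" by (simp add: S_def)
    have m0: "0 < m" using m by simp
    show "S n \<subseteq> multi_indices \<and> finite (S n) \<and> card (S n) \<le> n \<and>
        (\<forall>f\<in>holo_class \<mu> b \<eta>.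
          \<exists>E\<in>sets (\<Pi>\<^sub>M i\<in>{..<m}. tensor_measure \<mu>).
            1 - \<epsilon> \<le> measure (\<Pi>\<^sub>M i\<in>{..<m}. tensor_measure \<mu>) E \<and>
            (\<forall>y\<in>E.
              (\<forall>e :: nat \<Rightarrow> complex.
                (\<exists>!q. is_least_squares \<psi> (S n) m y f e q) \<and>
                (\<forall>q. is_least_squares \<psi> (S n) m y f e q \<longrightarrow>
                  L2_norm (tensor_measure \<mu>) (\<lambda>x. f x - q x)
                    \<le> C p * (real m / ln (real m / \<epsilon>)) powr (1 / 2 - 1 / p)
                      + 2 * (MAX i\<in>{..<m}. cmod (e i)))) \<and>
              (\<forall>\<nu>. bij_betw \<nu> {..<card (S n)} (S n) \<longrightarrow>
                cond (ls_matrix \<psi> m (card (S n)) \<nu> y) \<le> 2)))"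
    proof (intro conjI S ballI)
      fix f assume f: "f \<in> holo_class \<mu> b \<eta>"
      from main[OF f] obtain E where E: "E \<in> sets (\<Pi>\<^sub>M i\<in>{..<m}. ten)" "1 - \<epsilon> \<le> measure (\<Pi>\<^sub>M i\<in>{..<m}. ten) E"
        and Ey: "\<forall>y\<in>E. stable (S n) m y \<and> (\<forall>e. (\<exists>!q. is_least_squares \<psi> (S n) m y f e q) \<and>
        (\<forall>q. is_least_squares \<psi> (S n) m y f e q \<longrightarrow> L2_norm ten (\<lambda>x. f x - q x)
           \<le> C p * (real m / ln (real m / \<epsilon>)) powr (1 / 2 - 1 / p) + 2 * (MAX i\<in>{..<m}. cmod (e i))))"
        by (elim conjE bexE) (rule that)
      show "\<exists>E\<in>sets (\<Pi>\<^sub>M i\<in>{..<m}. tensor_measure \<mu>).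
            1 - \<epsilon> \<le> measure (\<Pi>\<^sub>M i\<in>{..<m}. tensor_measure \<mu>) E \<and>
            (\<forall>y\<in>E.
              (\<forall>e :: nat \<Rightarrow> complex.
                (\<exists>!q. is_least_squares \<psi> (S n) m y f e q) \<and>
                (\<forall>q. is_least_squares \<psi> (S n) m y f e q \<longrightarrow>
                  L2_norm (tensor_measure \<mu>) (\<lambda>x. f x - q x)
                    \<le> C p * (real m / ln (real m / \<epsilon>)) powr (1 / 2 - 1 / p)
                      + 2 * (MAX i\<in>{..<m}. cmod (e i)))) \<and>
              (\<forall>\<nu>. bij_betw \<nu> {..<card (S n)} (S n) \<longrightarrow>
                cond (ls_matrix \<psi> m (card (S n)) \<nu> y) \<le> 2))"
      proof (intro bexI[OF _ E(1)] conjI E(2) ballI)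
        fix y assume y: "y \<in> E"
        show "\<forall>e. (\<exists>!q. is_least_squares \<psi> (S n) m y f e q) \<and>
        (\<forall>q. is_least_squares \<psi> (S n) m y f e q \<longrightarrow> L2_norm ten (\<lambda>x. f x - q x)
           \<le> C p * (real m / ln (real m / \<epsilon>)) powr (1 / 2 - 1 / p) + 2 * (MAX i\<in>{..<m}. cmod (e i)))"
          using bspec[OF Ey y] by (rule conjunct2)
        show "\<forall>\<nu>. bij_betw \<nu> {..<card (S n)} (S n) \<longrightarrow> cond (ls_matrix \<psi> m (card (S n)) \<nu> y) \<le> 2"
          using bspec[OF Ey y, THEN conjunct1] by (intro allI impI cond_le_2 S ne m0)
      qed
    qed
  qed
qed

end
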